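(* Let $n\ge2$, let $D\subset\mathbf{C}^n$ be a $C^\infty$-smoothly bounded domain and let $\psi$ be a $C^\infty$-smooth defining function for $D$ defined on all of $\mathbf{C}^n$. Let $\{D_\nu\}$ be a sequence of $C^\infty$-smoothly bounded domains in $\mathbf{C}^n$ with $C^\infty$-smooth defining functions $\psi_\nu$ (defined on $\mathbf{C}^n$) that converge in the $C^\infty$-topology on compact subsets of $\mathbf{C}^n$ to $\psi$. Let $p_\nu\in D_\nu$ be such that $\{p_\nu\}$ converges to $p_0\in\partial D$. Define the half space $$\mathcal{H}=\Big\{w\in\mathbf{C}^n:\ 2\,\mathrm{Re}\Big(\sum_{\alpha=1}^n\psi_\alpha(p_0)w_\alpha\Big)-1<0\Big\},$$ and let $\Lambda_\nu$ and $\Lambda_{\mathcal{H}}$ denote the Robin functions for $D_\nu$ and $\mathcal{H}$ respectively. Then for all multi-indices $A,B\in\mathbf{N}^n$, $$(-1)^{|A|+|B|}\,D^{A\overline B}\Lambda_\nu(p_\nu)\,\big(\psi_\nu(p_\nu)\big)^{2n-2+|A|+|B|}\longrightarrow D^{A\overline B}\Lambda_{\mathcal{H}}(0)\qquad\text{as }\nu\to\infty.$$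
   Context: A $C^\infty$-smoothly bounded domain is a bounded domain with $C^\infty$-smooth boundary. A $C^\infty$-smooth defining function for $D$ on $\mathbf{C}^n$ is a real-valued $C^\infty$ function $\psi$ with $D=\{\psi<0\}$, $\partial D=\{\psi=0\}$ and nonvanishing gradient on $\partial D$. Convergence in the $C^\infty$-topology on compact sets means uniform convergence on compact sets of all partial derivatives of all orders. $\psi_\alpha=\partial\psi/\partial z_\alpha$. For $A=(\alpha_1,\dots,\alpha_n)$, $B=(\beta_1,\dots,\beta_n)$ in $\mathbf{N}^n$ (entries $\geq 0$), $|A|=\sum\alpha_i$, $|B|=\sum\beta_i$ and $$D^{A\overline B}=\frac{\partial^{|A|+|B|}}{\partial z_1^{\alpha_1}\cdots\partial z_n^{\alpha_n}\,\partial\overline z_1^{\beta_1}\cdots\partial\overline z_n^{\beta_n}}.$$ For a domain $\Omega\subset\mathbf{C}^n$ and $p\in\Omega$, the Green function $G(z,p)$ with pole $p$ (for the standard Laplacian $\Delta=4\sum\partial^2/\partial z_i\partial\overline z_i$) is the function harmonic in $z\in\Omega\setminus\{p\}$, tending to $0$ as $z\to\partial\Omega$ (and as $|z|\to\infty$ if $\Omega$ is unbounded), with $G(z,p)-|z-p|^{-2n+2}$ harmonic near $p$; the Robin function of $\Omega$ is $p\mapsto\lim_{z\to p}\big(G(z,p)-|z-p|^{-2n+2}\big)$. For the half space $\mathcal{H}$ it is given explicitly by $\Lambda_{\mathcal{H}}(w)=-\Big(\dfrac{|\partial\psi(p_0)|}{2\,\mathrm{Re}\sum_\alpha\psi_\alpha(p_0)w_\alpha-1}\Big)^{2n-2}$,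 where $|\partial\psi|^2=\sum_\alpha|\psi_\alpha|^2$. *)

theory Defs
  imports "HOL-Analysis.Analysis"
begin

section \<open>Partial derivatives and smoothness\<close>

definition partial_deriv ::
    "'a::euclidean_space \<Rightarrow> ('a \<Rightarrow> 'b::real_normed_vector) \<Rightarrow> 'a \<Rightarrow> 'b" where
  "partial_deriv b f x = frechet_derivative f (at x) b"

text \<open>The list gives the directions; its last entry is the derivative taken first.\<close>

definition partial_derivs ::
    "'a::euclidean_space list \<Rightarrow> ('a \<Rightarrow> 'b::real_normed_vector) \<Rightarrow> 'a \<Rightarrow> 'b" where
  "partial_derivs bs f = foldr partial_deriv bs f"

text \<open>
  \<open>C\<^sup>k\<close> on an open set. Partial derivatives of order below \<open>k\<close> of a \<open>C\<^sup>k\<close> function are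
  \<open>C\<^sup>1\<close>, hence Frechet differentiable; requiring this makes \<^const>\<open>frechet_derivative\<close>
  meaningful at every step.
\<close>

definition Ck_on :: "nat \<Rightarrow> 'a::euclidean_space set \<Rightarrow> ('a \<Rightarrow> 'b::real_normed_vector) \<Rightarrow> bool" where
  "Ck_on k S f \<longleftrightarrow>
     (\<forall>bs. set bs \<subseteq> Basis \<longrightarrow>
        (length bs < k \<longrightarrow> (\<forall>x\<in>S. partial_derivs bs f differentiable (at x))) \<and>
        (length bs \<le> k \<longrightarrow> continuous_on S (partial_derivs bs f)))"

definition smooth_on :: "'a::euclidean_space set \<Rightarrow> ('a \<Rightarrow> 'b::real_normed_vector) \<Rightarrow> bool" where
  "smooth_on S f \<longleftrightarrow> (\<forall>k. Ck_on k S f)"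

definition converges_smoothly ::
    "(nat \<Rightarrow> 'a::euclidean_space \<Rightarrow> 'b::real_normed_vector) \<Rightarrow> ('a \<Rightarrow> 'b) \<Rightarrow> bool" where
  "converges_smoothly f g \<longleftrightarrow>
     (\<forall>K bs. compact K \<longrightarrow> set bs \<subseteq> Basis \<longrightarrow>
        uniform_limit K (\<lambda>\<nu>. partial_derivs bs (f \<nu>)) (partial_derivs bs g) sequentially)"

section \<open>Wirtinger derivatives\<close>

text \<open>
  In the real vector space \<open>complex ^ 'n\<close>, the direction \<open>axis i 1\<close> is \<open>x\<^sub>i\<close> and
  \<open>axis i \<i>\<close> is \<open>y\<^sub>i\<close>, where \<open>z\<^sub>i = x\<^sub>i + \<i> y\<^sub>i\<close>.
\<close>

definition dz :: "'n::finite \<Rightarrow> (complex ^ 'n \<Rightarrow> complex) \<Rightarrow> complex ^ 'n \<Rightarrow> complex" where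
  "dz i f z = (partial_deriv (axis i 1) f z - \<i> * partial_deriv (axis i \<i>) f z) / 2"

definition dzbar :: "'n::finite \<Rightarrow> (complex ^ 'n \<Rightarrow> complex) \<Rightarrow> complex ^ 'n \<Rightarrow> complex" where
  "dzbar i f z = (partial_deriv (axis i 1) f z + \<i> * partial_deriv (axis i \<i>) f z) / 2"

text \<open>
  The linear order on the index type fixes the order of differentiation to be
  \<open>\<partial>z\<^sub>1 \<dots> \<partial>z\<^sub>n \<partial>zbar\<^sub>1 \<dots> \<partial>zbar\<^sub>n\<close>, the rightmost derivative being taken first;
  the order is immaterial for smooth functions.
\<close>

definition wirtinger_deriv ::
    "('n::{finite,linorder} \<Rightarrow> nat) \<Rightarrow> ('n \<Rightarrow> nat) \<Rightarrow>
     ((complex, 'n) vec \<Rightarrow> complex) \<Rightarrow> (complex, 'n) vec \<Rightarrow> complex" where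
  "wirtinger_deriv A B f =
     foldr (\<lambda>i. dz i ^^ A i) (sorted_list_of_set UNIV)
       (foldr (\<lambda>i. dzbar i ^^ B i) (sorted_list_of_set UNIV) f)"

definition multi_order :: "('n::finite \<Rightarrow> nat) \<Rightarrow> nat" where
  "multi_order A = (\<Sum>i\<in>UNIV. A i)"

section \<open>Smoothly bounded domains and defining functions\<close>

definition is_domain :: "'a::euclidean_space set \<Rightarrow> bool" where
  "is_domain \<Omega> \<longleftrightarrow> open \<Omega> \<and> connected \<Omega> \<and> \<Omega> \<noteq> {}"

definition smooth_boundary :: "'a::euclidean_space set \<Rightarrow> bool" where
  "smooth_boundary \<Omega> \<longleftrightarrow>
     (\<forall>q\<in>frontier \<Omega>. \<exists>U (\<rho>::'a \<Rightarrow> real). open U \<and> q \<in> U \<and> smooth_on U \<rho> \<and>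
        (\<forall>x\<in>U. \<exists>b\<in>Basis. partial_deriv b \<rho> x \<noteq> 0) \<and>
        \<Omega> \<inter> U = {x\<in>U. \<rho> x < 0} \<and> frontier \<Omega> \<inter> U = {x\<in>U. \<rho> x = 0})"

definition smoothly_bounded_domain :: "'a::euclidean_space set \<Rightarrow> bool" where
  "smoothly_bounded_domain \<Omega> \<longleftrightarrow> is_domain \<Omega> \<and> bounded \<Omega> \<and> smooth_boundary \<Omega>"

definition smooth_defining_function :: "'a::euclidean_space set \<Rightarrow> ('a \<Rightarrow> real) \<Rightarrow> bool" where
  "smooth_defining_function \<Omega> \<psi> \<longleftrightarrow>
     smooth_on UNIV \<psi> \<and> \<Omega> = {x. \<psi> x < 0} \<and> frontier \<Omega> = {x. \<psi> x = 0} \<and>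
     (\<forall>x\<in>frontier \<Omega>. \<exists>b\<in>Basis. partial_deriv b \<psi> x \<noteq> 0)"

section \<open>Green function and Robin function\<close>

definition laplacian :: "(complex ^ 'n::finite \<Rightarrow> complex) \<Rightarrow> complex ^ 'n \<Rightarrow> complex" where
  "laplacian f z = 4 * (\<Sum>i\<in>UNIV. dz i (dzbar i f) z)"

definition harmonic_on :: "(complex ^ 'n::finite) set \<Rightarrow> (complex ^ 'n \<Rightarrow> real) \<Rightarrow> bool" where
  "harmonic_on S u \<longleftrightarrow> open S \<and> Ck_on 2 S u \<and>
     (\<forall>z\<in>S. laplacian (\<lambda>z. complex_of_real (u z)) z = 0)"

text \<open>
  The difference of \<open>G\<close> and the singular part is defined off \<open>p\<close> only; it is required to
  extend harmonically across \<open>p\<close>. If \<open>\<Omega>\<close> is bounded, the filter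
  \<open>inf at_infinity (principal \<Omega>)\<close> is \<open>bot\<close> and the condition at infinity is vacuous.
\<close>

definition is_green_function ::
    "(complex ^ 'n::finite) set \<Rightarrow> complex ^ 'n \<Rightarrow> (complex ^ 'n \<Rightarrow> real) \<Rightarrow> bool" where
  "is_green_function \<Omega> p G \<longleftrightarrow>
     harmonic_on (\<Omega> - {p}) G \<and>
     (\<forall>q\<in>frontier \<Omega>. (G \<longlongrightarrow> 0) (at q within \<Omega>)) \<and>
     (G \<longlongrightarrow> 0) (inf at_infinity (principal \<Omega>)) \<and>
     (\<exists>r>0. \<exists>h. ball p r \<subseteq> \<Omega> \<and> harmonic_on (ball p r) h \<and>
        (\<forall>z\<in>ball p r - {p}. h z = G z - norm (z - p) powi (2 - 2 * int CARD('n))))"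

text \<open>
  A function as above is determined by \<open>\<Omega>\<close> and \<open>p\<close> on \<open>\<Omega> - {p}\<close> (maximum principle),
  so the choice only affects irrelevant values outside this set.
\<close>

definition green_function ::
    "(complex ^ 'n::finite) set \<Rightarrow> complex ^ 'n \<Rightarrow> complex ^ 'n \<Rightarrow> real" where
  "green_function \<Omega> p = (SOME G. is_green_function \<Omega> p G)"

definition robin_function :: "(complex ^ 'n::finite) set \<Rightarrow> complex ^ 'n \<Rightarrow> real" where
  "robin_function \<Omega> p =
     Lim (at p) (\<lambda>z. green_function \<Omega> p z - norm (z - p) powi (2 - 2 * int CARD('n)))"

section \<open>The limiting half space\<close>

definition half_space_at ::
    "(complex ^ 'n::finite \<Rightarrow> real) \<Rightarrow> complex ^ 'n \<Rightarrow> (complex ^ 'n) set" where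
  "half_space_at \<psi> p =
     {w. 2 * Re (\<Sum>i\<in>UNIV. dz i (\<lambda>z. complex_of_real (\<psi> z)) p * w $ i) - 1 < 0}"

end

theory Submission
  imports Defs
begin

text \<open>
  Write the Robin function as the diagonal of the regular part \<open>h(z, p) = G(z, p) - \<bar>z - p\<bar>\<^bsup>2-N\<^esup>\<close>
  with \<open>N = 2 n\<close>. It exists by sweeping out the capped Newton kernel, exterior balls serving as barriers,
  and it is harmonic in each variable separately.

  Put \<open>t\<^sub>\<nu> = - \<psi>\<^sub>\<nu>(p\<^sub>\<nu>)\<close> and blow up at \<open>p\<^sub>\<nu>\<close> by the factor \<open>1 / t\<^sub>\<nu>\<close>. The rescaled defining functions
  converge locally uniformly to \<open>g \<bullet> w - 1\<close>, where \<open>g\<close> is the real gradient of \<open>\<psi>\<close> at \<open>p\<^sub>0\<close>, and the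
  maximum principle shows that the rescaled regular parts converge uniformly near \<open>(0, 0)\<close> to
  that of the half space, which is minus the reflected Newton kernel. A function that is harmonic in each variable
  equals its convolution with a product kernel, so all derivatives of its diagonal are controlled
  by its supremum; hence the derivatives at \<open>0\<close> converge too. By the chain rule, the
  rescaling multiplies them by \<open>t\<^sub>\<nu>\<close> to the power \<open>N - 2 + \<bar>A\<bar> + \<bar>B\<bar>\<close>.
\<close>

section \<open>Calculus of iterated partial derivatives\<close>

text \<open>The obstacle is that the Robin function is in general not harmonic, so convergence of
  its values says nothing about its derivatives; this is why h(z, p) is kept as a function of two
  variables until the end. Harmonicity in the pole is inherited from the boundary data by
  uniqueness.

  Harmonicity is handled through solid averages with the weights (1 - |y|^2)^m, cut off at the unit
  sphere, in place of spherical means. They are Lebesgue integrals, the radial derivative of one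
  average is an average of the Laplacian with the next weight, and the weight of exponent k + 1 is
  C^k. Letting m vary supplies a reproducing kernel for each order of differentiation separately.

  Barriers serve for the existence of h on one domain at a time. The blow-up compares boundary
  values only: far from the origin the kernel and its reflection are both small, and near the
  limiting hyperplane they almost agree because they agree on it. This is why local convergence of
  the defining functions is enough.\<close>

lemma partial_derivs_simps [simp]:
  "partial_derivs [] f = f"
  "partial_derivs (b # bs) f = partial_deriv b (partial_derivs bs f)"
  by (simp_all add: partial_derivs_def)

lemma partial_derivs_snoc: "partial_derivs (bs @ [b]) f = partial_derivs bs (partial_deriv b f)"
  by (simp add: partial_derivs_def)

lemma Ck_on_0: "Ck_on 0 S f \<longleftrightarrow> continuous_on S f"
  by (auto simp: Ck_on_def)

text \<open>The definition quantifies over lists of directions, whose last entry acts first.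
  Splitting off that entry turns it into a recursion on \<open>k\<close>, through which the later
  closure properties are proved by induction.\<close>

lemma Ck_on_Suc:
  "Ck_on (Suc k) S f \<longleftrightarrow> continuous_on S f \<and> (\<forall>x\<in>S. f differentiable (at x)) \<and>
     (\<forall>b\<in>Basis. Ck_on k S (partial_deriv b f))"
proof
  assume L: "Ck_on (Suc k) S f"
  have "Ck_on k S (partial_deriv b f)" if "b \<in> Basis" for b
    unfolding Ck_on_def
  proof (intro allI impI)
    fix bs :: "'a list" assume "set bs \<subseteq> Basis"
    then have "set (bs @ [b]) \<subseteq> Basis" using that by auto
    with L show "(length bs < k \<longrightarrow> (\<forall>x\<in>S. partial_derivs bs (partial_deriv b f) differentiable at x)) \<and>
         (length bs \<le> k \<longrightarrow> continuous_on S (partial_derivs bs (partial_deriv b f)))"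
      unfolding Ck_on_def partial_derivs_snoc[symmetric] by (metis Suc_le_mono Suc_less_eq length_append_singleton)
  qed
  moreover have "continuous_on S f" "\<forall>x\<in>S. f differentiable (at x)"
    using L unfolding Ck_on_def by (auto dest: spec[of _ "[]"])
  ultimately show "continuous_on S f \<and> (\<forall>x\<in>S. f differentiable (at x)) \<and>
     (\<forall>b\<in>Basis. Ck_on k S (partial_deriv b f))" by blast
next
  assume R: "continuous_on S f \<and> (\<forall>x\<in>S. f differentiable (at x)) \<and>
     (\<forall>b\<in>Basis. Ck_on k S (partial_deriv b f))"
  show "Ck_on (Suc k) S f"
    unfolding Ck_on_def
  proof (intro allI impI)
    fix bs :: "'a list" assume bs: "set bs \<subseteq> Basis"
    show "(length bs < Suc k \<longrightarrow> (\<forall>x\<in>S. partial_derivs bs f differentiable at x)) \<and>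
         (length bs \<le> Suc k \<longrightarrow> continuous_on S (partial_derivs bs f))"
    proof (cases bs rule: rev_exhaust)
      case Nil
      with R show ?thesis by simp
    next
      case (snoc cs b)
      then have "b \<in> Basis" "set cs \<subseteq> Basis" using bs by auto
      then show ?thesis using R unfolding snoc partial_derivs_snoc by (auto simp: Ck_on_def)
    qed
  qed
qed

lemma Ck_on_imp_continuous: "Ck_on k S f \<Longrightarrow> continuous_on S f"
  by (cases k) (auto simp: Ck_on_0 Ck_on_Suc)

lemma Ck_on_le: "Ck_on k S f \<Longrightarrow> j \<le> k \<Longrightarrow> Ck_on j S f"
  unfolding Ck_on_def by fastforce

lemma Ck_on_subset: "Ck_on k S f \<Longrightarrow> T \<subseteq> S \<Longrightarrow> Ck_on k T f"
  unfolding Ck_on_def by (meson continuous_on_subset subsetD)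

lemma Ck_on_differentiable: "Ck_on k S f \<Longrightarrow> 1 \<le> k \<Longrightarrow> x \<in> S \<Longrightarrow> f differentiable (at x)"
  by (cases k) (auto simp: Ck_on_Suc)

lemma Ck_on_partial_deriv: "Ck_on (Suc k) S f \<Longrightarrow> b \<in> Basis \<Longrightarrow> Ck_on k S (partial_deriv b f)"
  by (simp add: Ck_on_Suc)

lemma partial_deriv_cong:
  assumes "open S" "x \<in> S" "\<And>y. y \<in> S \<Longrightarrow> f y = g y"
  shows "partial_deriv b f x = partial_deriv b g x"
proof -
  \<comment> \<open>\<open>frechet_derivative\<close> is a choice operator, so it is enough that
    both functions have the same derivatives at \<open>x\<close>; this also covers points where
    there is none.\<close>
  have "(f has_derivative f') (at x) \<longleftrightarrow> (g has_derivative f') (at x)" for f'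
    using assms has_derivative_transform_within_open[of f f' x UNIV S g]
      has_derivative_transform_within_open[of g f' x UNIV S f] by auto
  then show ?thesis unfolding partial_deriv_def frechet_derivative_def by simp
qed

lemma partial_derivs_cong:
  assumes "open S" "x \<in> S" "\<And>y. y \<in> S \<Longrightarrow> f y = g y"
  shows "partial_derivs bs f x = partial_derivs bs g x"
  using assms(2)
proof (induction bs arbitrary: x)
  case Nil
  then show ?case using assms by simp
next
  case (Cons b bs)
  then show ?case by (auto intro!: partial_deriv_cong[OF assms(1)])
qed

lemma differentiable_cong_open:
  assumes "open S" "x \<in> S" "\<And>y. y \<in> S \<Longrightarrow> f y = g y" "f differentiable (at x)"
  shows "g differentiable (at x)"
  using assms has_derivative_transform_within_open[of f _ x UNIV S g]
  unfolding differentiable_def by auto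

lemma Ck_on_cong:
  assumes "open S" "\<And>y. y \<in> S \<Longrightarrow> f y = g y" "Ck_on k S f"
  shows "Ck_on k S g"
  using assms(2,3)
proof (induction k arbitrary: f g)
  case 0
  then show ?case by (simp add: Ck_on_0 cong: continuous_on_cong)
next
  case (Suc k)
  have "Ck_on k S (partial_deriv b g)" if "b \<in> Basis" for b
    using Suc.IH[of "partial_deriv b f" "partial_deriv b g"] partial_deriv_cong[OF assms(1) _ Suc.prems(1)] Suc.prems that
    by (auto simp: Ck_on_Suc)
  moreover have "continuous_on S g" 
    using Suc.prems by (auto simp: Ck_on_Suc cong: continuous_on_cong)
  moreover have "g differentiable (at x)" if "x \<in> S" for x
    using differentiable_cong_open[OF assms(1) that Suc.prems(1)] Suc.prems(2) that by (auto simp: Ck_on_Suc)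
  ultimately show ?case by (auto simp: Ck_on_Suc)
qed

lemma Ck_on_local:
  assumes "\<And>x. x \<in> S \<Longrightarrow> \<exists>U. open U \<and> x \<in> U \<and> Ck_on k U f"
  shows "Ck_on k S f"
  unfolding Ck_on_def
proof (intro allI impI conjI ballI)
  fix bs :: "'a list" and x assume bs: "set bs \<subseteq> Basis" "length bs < k" "x \<in> S"
  then show "partial_derivs bs f differentiable (at x)"
    using assms[of x] unfolding Ck_on_def by blast
next
  fix bs :: "'a list" assume bs: "set bs \<subseteq> Basis" "length bs \<le> k"
  have "continuous (at x) (partial_derivs bs f)" if "x \<in> S" for x
    using assms[OF that] bs unfolding Ck_on_def by (meson continuous_on_eq_continuous_at)
  then show "continuous_on S (partial_derivs bs f)"
    by (simp add: continuous_at_imp_continuous_on)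
qed

lemma partial_deriv_eq: "(f has_derivative f') (at x) \<Longrightarrow> partial_deriv b f x = f' b"
  by (metis frechet_derivative_at partial_deriv_def)

lemma has_derivative_partial:
  fixes f :: "'a::euclidean_space \<Rightarrow> 'b::real_normed_vector"
  assumes "f differentiable (at x)"
  shows "(f has_derivative (\<lambda>v. \<Sum>b\<in>Basis. (v \<bullet> b) *\<^sub>R partial_deriv b f x)) (at x)"
proof -
  let ?D = "frechet_derivative f (at x)"
  have D: "(f has_derivative ?D) (at x)"
    using assms frechet_derivative_works by blast
  interpret linear ?D by (rule linear_frechet_derivative[OF assms])
  have "?D v = (\<Sum>b\<in>Basis. (v \<bullet> b) *\<^sub>R ?D b)" for v
    by (subst (1) euclidean_representation[of v, symmetric]) (simp add: sum scale)
  then have "?D = (\<lambda>v. \<Sum>b\<in>Basis. (v \<bullet> b) *\<^sub>R partial_deriv b f x)"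
    unfolding partial_deriv_def by blast
  with D show ?thesis by metis
qed

lemma Ck_on_SucI:
  assumes "\<And>x. x \<in> S \<Longrightarrow> (f has_derivative f' x) (at x)"
    and "\<And>b. b \<in> Basis \<Longrightarrow> Ck_on k S (\<lambda>x. f' x b)" and "open S"
  shows "Ck_on (Suc k) S f"
proof -
  have "Ck_on k S (partial_deriv b f)" if "b \<in> Basis" for b
    by (rule Ck_on_cong[OF assms(3) _ assms(2)[OF that]]) (simp add: partial_deriv_eq[OF assms(1)])
  moreover have "continuous_on S f"
    by (meson assms(1) continuous_at_imp_continuous_on has_derivative_continuous)
  ultimately show ?thesis unfolding Ck_on_Suc using assms(1) differentiable_def by blast
qed

section \<open>Closure of C^k under linear maps, sums, products and affine substitutions\<close>

lemma partial_deriv_const: "partial_deriv b (\<lambda>x. c) = (\<lambda>x. 0)"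
  by (rule ext) (simp add: partial_deriv_def)

lemma Ck_on_const: "Ck_on k S (\<lambda>x. c)"
  by (induction k arbitrary: c) (auto simp: Ck_on_0 Ck_on_Suc partial_deriv_const)

lemma Ck_on_bounded_linear_comp:
  fixes f :: "'a::euclidean_space \<Rightarrow> 'b::real_normed_vector"
  assumes "bounded_linear L" "open S"
  shows "Ck_on k S f \<Longrightarrow> Ck_on k S (\<lambda>x. L (f x))"
proof (induction k arbitrary: f)
  case 0
  then show ?case unfolding Ck_on_0
    using bounded_linear.continuous_on[OF assms(1)] by blast
next
  case (Suc k)
  show ?case
  proof (rule Ck_on_SucI[OF _ _ assms(2)])
    fix x assume "x \<in> S"
    then have "f differentiable (at x)" using Suc.prems by (simp add: Ck_on_Suc)
    then show "((\<lambda>x. L (f x)) has_derivative (\<lambda>v. L (frechet_derivative f (at x) v))) (at x)"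
      using bounded_linear.has_derivative[OF assms(1)] frechet_derivative_works by blast
  next
    fix b :: 'a assume "b \<in> Basis"
    then show "Ck_on k S (\<lambda>x. L (frechet_derivative f (at x) b))"
      using Suc.IH[OF Ck_on_partial_deriv[OF Suc.prems]] by (simp add: partial_deriv_def)
  qed
qed

lemma partial_deriv_bounded_linear_comp:
  assumes "bounded_linear L" "f differentiable (at x)"
  shows "partial_deriv b (\<lambda>x. L (f x)) x = L (partial_deriv b f x)"
  by (metis (full_types) assms bounded_linear.has_derivative frechet_derivative_works partial_deriv_def partial_deriv_eq)

lemma Ck_on_bounded_linear:
  fixes L :: "'a::euclidean_space \<Rightarrow> 'b::real_normed_vector"
  assumes "bounded_linear L" shows "Ck_on k S L"
proof (rule Ck_on_subset)
  show "Ck_on k UNIV L"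
  proof (cases k)
    case 0
    then show ?thesis using assms by (simp add: Ck_on_0 linear_continuous_on)
  next
    case (Suc j)
    have "(L has_derivative L) (at x)" for x
      using assms bounded_linear_imp_has_derivative by blast
    then show ?thesis unfolding Suc by (intro Ck_on_SucI[where f'="\<lambda>x. L"] Ck_on_const) auto
  qed
qed auto

lemma partial_deriv_bounded_linear: "bounded_linear L \<Longrightarrow> partial_deriv b L x = L b"
  by (simp add: bounded_linear_imp_has_derivative partial_deriv_eq)

lemma partial_deriv_add:
  fixes f g :: "'a::euclidean_space \<Rightarrow> 'b::real_normed_vector"
  assumes "f differentiable (at x)" "g differentiable (at x)"
  shows "partial_deriv b (\<lambda>x. f x + g x) x = partial_deriv b f x + partial_deriv b g x"
proof -
  have "((\<lambda>x. f x + g x) has_derivative (\<lambda>v. frechet_derivative f (at x) v + frechet_derivative g (at x) v)) (at x)"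
    using assms by (intro has_derivative_add) (simp_all add: frechet_derivative_works[symmetric])
  then show ?thesis by (simp add: partial_deriv_def frechet_derivative_at[symmetric])
qed

lemma Ck_on_add:
  fixes f g :: "'a::euclidean_space \<Rightarrow> 'b::real_normed_vector"
  assumes "open S"
  shows "Ck_on k S f \<Longrightarrow> Ck_on k S g \<Longrightarrow> Ck_on k S (\<lambda>x. f x + g x)"
proof (induction k arbitrary: f g)
  case 0
  then show ?case unfolding Ck_on_0 by (intro continuous_intros)
next
  case (Suc k)
  have d: "f differentiable (at x)" "g differentiable (at x)" if "x \<in> S" for x
    using Suc.prems that by (auto simp: Ck_on_Suc)
  have "Ck_on k S (partial_deriv b (\<lambda>x. f x + g x))" if "b \<in> Basis" for b
  proof -
    have "Ck_on k S (\<lambda>x. partial_deriv b f x + partial_deriv b g x)"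
      using Suc.prems that by (intro Suc.IH) (auto simp: Ck_on_Suc)
    then show ?thesis
      by (rule Ck_on_cong[OF assms, rotated]) (simp add: partial_deriv_add d)
  qed
  moreover have "continuous_on S (\<lambda>x. f x + g x)"
    using Suc.prems by (intro continuous_intros) (auto simp: Ck_on_Suc)
  ultimately show ?case using d by (simp add: Ck_on_Suc)
qed

lemma Ck_on_sum:
  fixes f :: "'i \<Rightarrow> 'a::euclidean_space \<Rightarrow> 'b::real_normed_vector"
  assumes "open S"
  shows "(\<And>i. i \<in> I \<Longrightarrow> Ck_on k S (f i)) \<Longrightarrow> Ck_on k S (\<lambda>x. \<Sum>i\<in>I. f i x)"
  by (induction I rule: infinite_finite_induct) (auto intro!: Ck_on_const Ck_on_add assms)

lemma partial_deriv_mult: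
  fixes f g :: "'a::euclidean_space \<Rightarrow> real"
  assumes "f differentiable (at x)" "g differentiable (at x)"
  shows "partial_deriv b (\<lambda>x. f x * g x) x = f x * partial_deriv b g x + partial_deriv b f x * g x"
proof -
  have "((\<lambda>x. f x * g x) has_derivative (\<lambda>v. f x * frechet_derivative g (at x) v + frechet_derivative f (at x) v * g x)) (at x)"
    using assms by (intro has_derivative_mult) (simp_all add: frechet_derivative_works[symmetric])
  then show ?thesis by (simp add: partial_deriv_def frechet_derivative_at[symmetric])
qed

lemma Ck_on_mult:
  fixes f g :: "'a::euclidean_space \<Rightarrow> real"
  assumes "open S"
  shows "Ck_on k S f \<Longrightarrow> Ck_on k S g \<Longrightarrow> Ck_on k S (\<lambda>x. f x * g x)"
proof (induction k arbitrary: f g)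
  case 0
  then show ?case unfolding Ck_on_0 by (intro continuous_intros)
next
  case (Suc k)
  have d: "f differentiable (at x)" "g differentiable (at x)" if "x \<in> S" for x
    using Suc.prems that by (auto simp: Ck_on_Suc)
  have fg: "Ck_on k S f" "Ck_on k S g" using Suc.prems by (auto intro: Ck_on_le)
  have "Ck_on k S (partial_deriv b (\<lambda>x. f x * g x))" if "b \<in> Basis" for b
  proof -
    have "Ck_on k S (\<lambda>x. f x * partial_deriv b g x + partial_deriv b f x * g x)"
      using Suc.prems that fg by (intro Ck_on_add assms Suc.IH) (auto simp: Ck_on_Suc)
    then show ?thesis
      by (rule Ck_on_cong[OF assms, rotated]) (simp add: partial_deriv_mult d)
  qed
  moreover have "continuous_on S (\<lambda>x. f x * g x)"
    using Suc.prems by (intro continuous_intros) (auto simp: Ck_on_Suc)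
  ultimately show ?case using d by (simp add: Ck_on_Suc)
qed

lemma Ck_on_cmult:
  fixes f :: "'a::euclidean_space \<Rightarrow> real"
  shows "open S \<Longrightarrow> Ck_on k S f \<Longrightarrow> Ck_on k S (\<lambda>x. c * f x)"
  by (intro Ck_on_mult Ck_on_const)

lemma Ck_on_diff:
  fixes f g :: "'a::euclidean_space \<Rightarrow> real"
  assumes "open S" "Ck_on k S f" "Ck_on k S g" 
  shows "Ck_on k S (\<lambda>x. f x - g x)"
  using Ck_on_add[OF assms(1,2) Ck_on_cmult[OF assms(1,3), of "-1"]] by simp

lemma Ck_on_inner_self: "Ck_on k UNIV (\<lambda>x::'a::euclidean_space. x \<bullet> x)"
proof -
  have "Ck_on k UNIV (\<lambda>x::'a. \<Sum>b\<in>Basis. (x \<bullet> b) * (x \<bullet> b))"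
    by (intro Ck_on_sum Ck_on_mult Ck_on_bounded_linear bounded_linear_inner_left) auto
  then show ?thesis by (simp add: euclidean_inner[symmetric])
qed

lemma partial_deriv_affine:
  assumes "f differentiable (at (c + r *\<^sub>R x))"
  shows "partial_deriv b (\<lambda>x. f (c + r *\<^sub>R x)) x = r *\<^sub>R partial_deriv b f (c + r *\<^sub>R x)"
proof -
  let ?D = "frechet_derivative f (at (c + r *\<^sub>R x))"
  have 1: "((\<lambda>x. c + r *\<^sub>R x) has_derivative (\<lambda>v. r *\<^sub>R v)) (at x)"
    by (auto intro!: derivative_eq_intros)
  have "((\<lambda>x. f (c + r *\<^sub>R x)) has_derivative (\<lambda>v. ?D (r *\<^sub>R v))) (at x)"
    using has_derivative_compose[OF 1] assms frechet_derivative_works by blast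
  then show ?thesis
    using linear_frechet_derivative[OF assms] by (simp add: partial_deriv_eq linear_scale) (simp add: partial_deriv_def)
qed

lemma Ck_on_affine:
  fixes f :: "'a::euclidean_space \<Rightarrow> 'b::real_normed_vector"
  assumes "open S"
  shows "Ck_on k S f \<Longrightarrow> Ck_on k ((\<lambda>x. c + r *\<^sub>R x) -` S) (\<lambda>x. f (c + r *\<^sub>R x))"
proof (induction k arbitrary: f)
  case 0
  show ?case unfolding Ck_on_0
    by (rule continuous_on_compose2[OF 0[unfolded Ck_on_0]]) (auto intro!: continuous_intros)
next
  case (Suc k)
  let ?T = "(\<lambda>x. c + r *\<^sub>R x) -` S"
  have oT: "open ?T" by (intro open_vimage assms) (auto intro!: continuous_intros)
  have d: "f differentiable (at (c + r *\<^sub>R x))" if "x \<in> ?T" for x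
    using Suc.prems that by (auto simp: Ck_on_Suc)
  have "Ck_on k ?T (partial_deriv b (\<lambda>x. f (c + r *\<^sub>R x)))" if "b \<in> Basis" for b
    by (rule Ck_on_cong[OF oT _ Ck_on_bounded_linear_comp[OF bounded_linear_scaleR_right[of r] oT Suc.IH[OF Ck_on_partial_deriv[OF Suc.prems that]]]])
      (use d partial_deriv_affine in \<open>simp add: partial_deriv_affine\<close>)
  moreover have "continuous_on ?T (\<lambda>x. f (c + r *\<^sub>R x))"
    by (rule continuous_on_compose2[OF Ck_on_imp_continuous[OF Suc.prems]]) (auto intro!: continuous_intros)
  moreover have "(\<lambda>x. f (c + r *\<^sub>R x)) differentiable (at x)" if "x \<in> ?T" for x
    by (rule differentiable_compose[of f "\<lambda>x. c + r *\<^sub>R x"]) (use d[OF that] in \<open>auto intro!: derivative_intros\<close>)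
  ultimately show ?case by (simp add: Ck_on_Suc)
qed

section \<open>Derivatives along lines and the symmetry of second derivatives\<close>

lemma has_real_derivative_line:
  fixes f :: "'a::euclidean_space \<Rightarrow> real"
  assumes "f differentiable (at (x + t *\<^sub>R b))"
  shows "((\<lambda>t. f (x + t *\<^sub>R b)) has_real_derivative partial_deriv b f (x + t *\<^sub>R b)) (at t)"
proof -
  let ?D = "frechet_derivative f (at (x + t *\<^sub>R b))"
  have 1: "((\<lambda>t. x + t *\<^sub>R b) has_derivative (\<lambda>v. v *\<^sub>R b)) (at t)"
    by (auto intro!: derivative_eq_intros)
  have "((\<lambda>t. f (x + t *\<^sub>R b)) has_derivative (\<lambda>v. ?D (v *\<^sub>R b))) (at t)"
    using has_derivative_compose[OF 1] assms frechet_derivative_works by blast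
  moreover have "(\<lambda>v. ?D (v *\<^sub>R b)) = (*) (partial_deriv b f (x + t *\<^sub>R b))"
    using linear_frechet_derivative[OF assms] by (auto simp: linear_scale partial_deriv_def mult.commute)
  ultimately show ?thesis by (simp add: has_field_derivative_def)
qed

text \<open>The mean value theorem, applied first along \<open>a\<close> and then along
  \<open>b\<close>. The left side is symmetric in the two directions and the right side is not,
  which is what yields the interchange of derivatives.\<close>

lemma second_difference:
  fixes f :: "'a::euclidean_space \<Rightarrow> real"
  assumes C: "Ck_on 2 S f" and S: "cball x (2 * t) \<subseteq> S" "0 < t" and ab: "a \<in> Basis" "b \<in> Basis"
  shows "\<exists>p\<in>cball x (2 * t). f (x + t *\<^sub>R a + t *\<^sub>R b) - f (x + t *\<^sub>R a) - f (x + t *\<^sub>R b) + f x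
     = t * t * partial_deriv b (partial_deriv a f) p"
proof -
  have C1: "Ck_on (Suc 1) S f" using C by (simp add: numeral_2_eq_2)
  have Ca: "Ck_on (Suc 0) S (partial_deriv a f)" using Ck_on_partial_deriv[OF C1 ab(1)] by simp
  have inS: "x + s *\<^sub>R a + s' *\<^sub>R b \<in> cball x (2 * t)" if "0 \<le> s" "s \<le> t" "0 \<le> s'" "s' \<le> t" for s s'
  proof -
    have "norm (s *\<^sub>R a + s' *\<^sub>R b) \<le> s + s'" 
      using norm_triangle_ineq[of "s *\<^sub>R a" "s' *\<^sub>R b"] ab that by simp
    then have "norm (s *\<^sub>R a + s' *\<^sub>R b) \<le> 2 * t" using that by simp
    moreover have "dist x (x + s *\<^sub>R a + s' *\<^sub>R b) = norm (s *\<^sub>R a + s' *\<^sub>R b)"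
      by (metis add.assoc add_diff_cancel_left' dist_commute dist_norm)
    ultimately show ?thesis by simp
  qed
  have d: "f differentiable (at (x + s *\<^sub>R a + s' *\<^sub>R b))" "partial_deriv a f differentiable (at (x + s *\<^sub>R a + s' *\<^sub>R b))"
    if "0 \<le> s" "s \<le> t" "0 \<le> s'" "s' \<le> t" for s s'
    using inS[OF that] S C1 Ca by (auto simp: Ck_on_Suc)
  \<comment> \<open>The difference in direction \<open>b\<close>, seen as a function of the position
    along \<open>a\<close>; thus \<open>g t - g 0\<close> is the second difference.\<close>
  define g where "g s = f (x + s *\<^sub>R a + t *\<^sub>R b) - f (x + s *\<^sub>R a)" for s
  have "\<exists>z>0. z < t \<and> g t - g 0 = (t - 0) * (partial_deriv a f (x + z *\<^sub>R a + t *\<^sub>R b) - partial_deriv a f (x + z *\<^sub>R a))"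
  proof (rule MVT2[OF S(2)])
    fix s assume s: "0 \<le> s" "s \<le> t"
    have 1: "((\<lambda>s. f ((x + t *\<^sub>R b) + s *\<^sub>R a)) has_real_derivative partial_deriv a f ((x + t *\<^sub>R b) + s *\<^sub>R a)) (at s)"
      by (rule has_real_derivative_line) (use d(1)[OF s, of t] S(2) in \<open>simp add: algebra_simps\<close>)
    have 2: "((\<lambda>s. f (x + s *\<^sub>R a)) has_real_derivative partial_deriv a f (x + s *\<^sub>R a)) (at s)"
      by (rule has_real_derivative_line) (use d(1)[OF s, of 0] S(2) in \<open>simp add: algebra_simps\<close>)
    show "(g has_real_derivative partial_deriv a f (x + s *\<^sub>R a + t *\<^sub>R b) - partial_deriv a f (x + s *\<^sub>R a)) (at s)"
      unfolding g_def using DERIV_diff[OF 1 2] by (simp add: algebra_simps)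
  qed
  then obtain z where z: "0 < z" "z < t"
    "g t - g 0 = t * (partial_deriv a f (x + z *\<^sub>R a + t *\<^sub>R b) - partial_deriv a f (x + z *\<^sub>R a))" by auto
  have "\<exists>w>0. w < t \<and> partial_deriv a f ((x + z *\<^sub>R a) + t *\<^sub>R b) - partial_deriv a f ((x + z *\<^sub>R a) + 0 *\<^sub>R b)
     = (t - 0) * partial_deriv b (partial_deriv a f) ((x + z *\<^sub>R a) + w *\<^sub>R b)"
    by (rule MVT2[OF S(2)], rule has_real_derivative_line, rule d(2)) (use z in auto)
  then obtain w where w: "0 < w" "w < t" 
    "partial_deriv a f (x + z *\<^sub>R a + t *\<^sub>R b) - partial_deriv a f (x + z *\<^sub>R a)
     = t * partial_deriv b (partial_deriv a f) (x + z *\<^sub>R a + w *\<^sub>R b)" by auto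
  have "x + z *\<^sub>R a + w *\<^sub>R b \<in> cball x (2 * t)" using inS z w by simp
  moreover have "f (x + t *\<^sub>R a + t *\<^sub>R b) - f (x + t *\<^sub>R a) - f (x + t *\<^sub>R b) + f x = g t - g 0"
    by (simp add: g_def)
  ultimately show ?thesis using z(3) w(3) by (metis mult.assoc)
qed

text \<open>Evaluating the same second difference in both orders gives points near \<open>x\<close>
  at which the two mixed derivatives take equal values; these points tend to \<open>x\<close>, and
  both derivatives are continuous there.\<close>

lemma partial_deriv_commute:
  fixes f :: "'a::euclidean_space \<Rightarrow> real"
  assumes C: "Ck_on 2 S f" and S: "open S" "x \<in> S" and ab: "a \<in> Basis" "b \<in> Basis"
  shows "partial_deriv a (partial_deriv b f) x = partial_deriv b (partial_deriv a f) x"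
proof -
  let ?A = "partial_deriv a (partial_deriv b f)" and ?B = "partial_deriv b (partial_deriv a f)"
  obtain r where r: "0 < r" "cball x r \<subseteq> S" using S open_contains_cball by blast
  \<comment> \<open>The division by 2 keeps the balls of radius \<open>2 * t n\<close>, which
    contain the evaluation points, inside \<open>S\<close>.\<close>
  define t where "t n = r / 2 / real (Suc n)" for n
  have t: "0 < t n" "2 * t n \<le> r" for n
    using r unfolding t_def by (auto simp: field_simps)
  have tl: "t \<longlonglongrightarrow> 0" unfolding t_def
    using tendsto_mult_right_zero[OF LIMSEQ_inverse_real_of_nat, of "r/2"] by (simp add: field_simps)
  have sub: "cball x (2 * t n) \<subseteq> S" for n using t(2)[of n] r(2) by auto
  have "\<exists>p q. p \<in> cball x (2 * t n) \<and> q \<in> cball x (2 * t n) \<and> ?A q = ?B p" for n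
  proof -
    obtain p q where pq: "p \<in> cball x (2 * t n)" "q \<in> cball x (2 * t n)"
      "f (x + t n *\<^sub>R a + t n *\<^sub>R b) - f (x + t n *\<^sub>R a) - f (x + t n *\<^sub>R b) + f x = t n * t n * ?B p"
      "f (x + t n *\<^sub>R b + t n *\<^sub>R a) - f (x + t n *\<^sub>R b) - f (x + t n *\<^sub>R a) + f x = t n * t n * ?A q"
      using second_difference[OF C sub t(1) ab] second_difference[OF C sub t(1) ab(2,1)] by blast
    moreover have "x + t n *\<^sub>R b + t n *\<^sub>R a = x + t n *\<^sub>R a + t n *\<^sub>R b" by (simp add: add_ac)
    ultimately have "t n * t n * ?A q = t n * t n * ?B p" by (smt (verit))
    then have "?A q = ?B p" using t(1)[of n] by (metis mult_cancel_left mult_eq_0_iff order_less_irrefl)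
    then show ?thesis using pq by blast
  qed
  then obtain p q where pq: "\<And>n. p n \<in> cball x (2 * t n)" "\<And>n. q n \<in> cball x (2 * t n)" "\<And>n. ?A (q n) = ?B (p n)"
    by metis
  have lim: "u \<longlonglongrightarrow> x" if "\<And>n. u n \<in> cball x (2 * t n)" for u :: "nat \<Rightarrow> 'a"
  proof (rule metric_tendsto_imp_tendsto[of "\<lambda>n. 2 * t n" 0])
    show "(\<lambda>n. 2 * t n) \<longlonglongrightarrow> 0" using tendsto_mult_right_zero[OF tl] by simp
    show "\<forall>\<^sub>F n in sequentially. dist (u n) x \<le> dist (2 * t n) 0"
      using that t by (intro always_eventually allI) (metis abs_ge_self dist_0_norm dist_commute mem_cball order_trans real_norm_def)
  qed
  have C1: "Ck_on (Suc (Suc 0)) S f" using C by (simp add: numeral_2_eq_2)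
  have cont: "continuous (at x) ?A" "continuous (at x) ?B"
    using C1 ab S by (auto simp: Ck_on_Suc Ck_on_0 continuous_on_eq_continuous_at)
  have "(\<lambda>n. ?A (q n)) \<longlonglongrightarrow> ?A x" "(\<lambda>n. ?B (p n)) \<longlonglongrightarrow> ?B x"
    using lim[OF pq(1)] lim[OF pq(2)] cont by (auto simp: isCont_def intro: tendsto_compose[OF _ _] dest: continuous_at_sequentiallyI isCont_tendsto_compose)
  then show ?thesis using pq(3) LIMSEQ_unique by simp
qed

section \<open>Convolution with compactly supported kernels\<close>

lemma lborel_integral_affine:
  fixes f :: "'a::euclidean_space \<Rightarrow> real"
  assumes "c \<noteq> 0" "f \<in> borel_measurable borel"
  shows "(\<integral>x. f x \<partial>lborel) = \<bar>c\<bar> ^ DIM('a) * (\<integral>x. f (t + c *\<^sub>R x) \<partial>lborel)"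
proof -
  have "(\<integral>x. f x \<partial>lborel) = (\<integral>x. f x \<partial>density (distr lborel borel (\<lambda>x. t + c *\<^sub>R x)) (\<lambda>_. ennreal (\<bar>c\<bar> ^ DIM('a))))"
    using lborel_affine[OF assms(1), of t] by (simp add: ennreal_power)
  also have "\<dots> = (\<integral>x. \<bar>c\<bar> ^ DIM('a) *\<^sub>R f x \<partial>distr lborel borel (\<lambda>x. t + c *\<^sub>R x))"
    using assms(2) by (subst integral_density) auto
  also have "\<dots> = (\<integral>x. \<bar>c\<bar> ^ DIM('a) *\<^sub>R f (t + c *\<^sub>R x) \<partial>lborel)"
    using assms(2) by (subst integral_distr) auto
  finally show ?thesis by simp
qed

lemma integrable_indicator_cball:
  "integrable lborel (indicator (cball x r) :: 'a::euclidean_space \<Rightarrow> real)"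
  by (rule integrable_real_indicator) (use emeasure_lborel_cball_finite[of x r] in auto)

definition conv :: "('a::euclidean_space \<Rightarrow> real) \<Rightarrow> ('a \<Rightarrow> real) \<Rightarrow> 'a \<Rightarrow> real" where
  "conv h \<kappa> x = (\<integral>y. h y * \<kappa> (x - y) \<partial>lborel)"

lemma compact_support_bounded:
  fixes f :: "'a::euclidean_space \<Rightarrow> real"
  assumes "continuous_on UNIV f" "\<And>y. R < norm y \<Longrightarrow> f y = 0"
  shows "\<exists>C>0. \<forall>y. \<bar>f y\<bar> \<le> C"
proof -
  have "compact (f ` cball 0 R)"
    using assms(1) by (meson compact_cball compact_continuous_image continuous_on_subset subset_UNIV)
  then obtain C where "C > 0" "\<forall>z\<in>f ` cball 0 R. norm z \<le> C"
    using compact_imp_bounded bounded_pos by metis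
  then have "\<bar>f y\<bar> \<le> C" for y
    using assms(2)[of y] by (cases "norm y \<le> R") auto
  with \<open>C > 0\<close> show ?thesis by blast
qed

lemma compact_support_uniformly_continuous:
  fixes f :: "'a::euclidean_space \<Rightarrow> real"
  assumes "continuous_on UNIV f" "\<And>y. R < norm y \<Longrightarrow> f y = 0" "0 < e"
  shows "\<exists>d>0. \<forall>x y. dist x y < d \<longrightarrow> \<bar>f x - f y\<bar> < e"
proof -
  have "uniformly_continuous_on (cball 0 (R + 1)) f"
    using assms(1) by (meson compact_cball compact_uniformly_continuous continuous_on_subset subset_UNIV)
  then obtain d where d: "d > 0" "\<And>x y. x \<in> cball 0 (R + 1) \<Longrightarrow> y \<in> cball 0 (R + 1) \<Longrightarrow> dist y x < d \<Longrightarrow> dist (f y) (f x) < e"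
    using \<open>0 < e\<close> unfolding uniformly_continuous_on_def by metis
  have "\<bar>f x - f y\<bar> < e" if xy: "dist x y < min d 1" for x y
  proof (cases "norm x \<le> R \<or> norm y \<le> R")
    case True
    have "norm x \<le> norm y + 1" "norm y \<le> norm x + 1"
      using xy norm_triangle_ineq2[of x y] norm_triangle_ineq2[of y x] by (auto simp: dist_norm norm_minus_commute)
    then have "norm x \<le> R + 1" "norm y \<le> R + 1" using True by auto
    then show ?thesis using d(2)[of y x] xy by (simp add: dist_norm)
  next
    case False
    then show ?thesis using assms by auto
  qed
  then show ?thesis using d(1) by (intro exI[of _ "min d 1"]) auto
qed

lemma integrable_conv:
  fixes h g :: "'a::euclidean_space \<Rightarrow> real"
  assumes "integrable lborel h" "continuous_on UNIV g" "\<And>y. R < norm y \<Longrightarrow> g y = 0"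
  shows "integrable lborel (\<lambda>y. h y * g (x - y))"
proof -
  obtain C where C: "\<And>y. \<bar>g y\<bar> \<le> C" using compact_support_bounded[OF assms(2,3)] by blast
  have [measurable]: "h \<in> borel_measurable borel" "g \<in> borel_measurable borel"
    using assms(1) borel_measurable_integrable assms(2) borel_measurable_continuous_onI by auto
  show ?thesis
  proof (rule Bochner_Integration.integrable_bound[where f="\<lambda>y. C * h y"])
    show "AE y in lborel. norm (h y * g (x - y)) \<le> norm (C * h y)"
    proof (intro AE_I2)
      fix y
      have "\<bar>h y\<bar> * \<bar>g (x - y)\<bar> \<le> \<bar>h y\<bar> * \<bar>C\<bar>"
        using C[of "x - y"] by (intro mult_left_mono) auto
      then show "norm (h y * g (x - y)) \<le> norm (C * h y)" by (simp add: abs_mult mult.commute)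
    qed
  qed (use assms(1) in auto)
qed

lemma conv_diff_bound:
  fixes h g :: "'a::euclidean_space \<Rightarrow> real"
  assumes "integrable lborel h" "integrable lborel (\<lambda>y. h y * g y)" "\<And>y. \<bar>g y\<bar> \<le> e"
  shows "\<bar>\<integral>y. h y * g y \<partial>lborel\<bar> \<le> e * (\<integral>y. \<bar>h y\<bar> \<partial>lborel)"
proof -
  have "\<bar>\<integral>y. h y * g y \<partial>lborel\<bar> \<le> (\<integral>y. \<bar>h y * g y\<bar> \<partial>lborel)"
    using integral_norm_bound[of lborel "\<lambda>y. h y * g y"] by simp
  also have "\<dots> \<le> (\<integral>y. e * \<bar>h y\<bar> \<partial>lborel)"
  proof (rule integral_mono)
    show "integrable lborel (\<lambda>y. \<bar>h y * g y\<bar>)" "integrable lborel (\<lambda>y. e * \<bar>h y\<bar>)"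
      using assms(1,2) by (auto intro: integrable_abs)
    show "\<bar>h y * g y\<bar> \<le> e * \<bar>h y\<bar>" for y
      using mult_right_mono[OF assms(3)[of y], of "\<bar>h y\<bar>"] by (simp add: abs_mult mult.commute)
  qed
  finally show ?thesis by simp
qed

lemma continuous_conv:
  assumes h: "integrable lborel h" and g: "continuous_on UNIV g" "\<And>y. R < norm y \<Longrightarrow> g y = 0"
  shows "continuous_on UNIV (conv h g)"
  unfolding continuous_on_iff
proof (intro ballI allI impI)
  fix x :: 'a and e :: real assume e: "0 < e"
  define I where "I = (\<integral>y. \<bar>h y\<bar> \<partial>lborel)"
  have I: "0 \<le> I" unfolding I_def by simp
  \<comment> \<open>Dividing by \<open>I + 1\<close> rather than \<open>I\<close> keeps the quotient
    meaningful when \<open>I = 0\<close>.\<close>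
  obtain d where d: "d > 0" "\<And>x y. dist x y < d \<Longrightarrow> \<bar>g x - g y\<bar> < e / (I + 1)"
  proof -
    have "\<exists>d>0. \<forall>x y. dist x y < d \<longrightarrow> \<bar>g x - g y\<bar> < e / (I + 1)"
      by (rule compact_support_uniformly_continuous[where R=R]) (use g e I in auto)
    then show ?thesis using that by auto
  qed
  have "dist (conv h g x') (conv h g x) < e" if x': "dist x' x < d" for x'
  proof -
    have "conv h g x' - conv h g x = (\<integral>y. h y * (g (x' - y) - g (x - y)) \<partial>lborel)"
      unfolding conv_def right_diff_distrib
      by (rule Bochner_Integration.integral_diff[symmetric]) (auto intro!: integrable_conv[where R=R] h g)
    also have "\<bar>\<dots>\<bar> \<le> e / (I + 1) * I"
      unfolding I_def
    proof (rule conv_diff_bound[OF h])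
      show "integrable lborel (\<lambda>y. h y * (g (x' - y) - g (x - y)))"
        unfolding right_diff_distrib by (auto intro!: integrable_conv[where R=R] h g)
      show "\<bar>g (x' - y) - g (x - y)\<bar> \<le> e / ((\<integral>y. \<bar>h y\<bar> \<partial>lborel) + 1)" for y
        using d(2)[of "x' - y" "x - y"] x' unfolding I_def by (simp add: dist_norm)
    qed
    also have "\<dots> < e" using e I by (simp add: field_simps)
    finally show ?thesis by (simp add: dist_norm)
  qed
  then show "\<exists>d>0. \<forall>x'\<in>UNIV. dist x' x < d \<longrightarrow> dist (conv h g x') (conv h g x) < e"
    using d(1) by blast
qed

text \<open>The remainder is uniform in the base point \<open>a\<close>, because the partial
  derivatives are continuous with compact support and hence uniformly continuous. This uniformity
  lets the estimate pass under the integral in \<open>conv_has_derivative\<close>.\<close>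

lemma compact_support_taylor:
  fixes \<kappa> :: "'a::euclidean_space \<Rightarrow> real"
  assumes \<kappa>: "Ck_on (Suc 0) UNIV \<kappa>" "\<And>y. R < norm y \<Longrightarrow> \<kappa> y = 0" and e: "0 < e"
  shows "\<exists>d>0. \<forall>a v. norm v < d \<longrightarrow> \<bar>\<kappa> (a + v) - \<kappa> a - (\<Sum>b\<in>Basis. (v \<bullet> b) * partial_deriv b \<kappa> a)\<bar> \<le> e * norm v"
proof -
  have z: "partial_deriv b \<kappa> y = 0" if "R < norm y" for b y
    using partial_deriv_cong[of "{y. R < norm y}" y \<kappa> "\<lambda>_. 0" b] that \<kappa>(2)
    by (simp add: open_Collect_less continuous_on_norm partial_deriv_const)
  define N where "N = real DIM('a)"
  have N: "0 < N" by (simp add: N_def)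
  have "\<forall>b\<in>Basis. \<exists>d>0. \<forall>x y. dist x y < d \<longrightarrow> \<bar>partial_deriv b \<kappa> x - partial_deriv b \<kappa> y\<bar> < e / N"
  proof
    fix b :: 'a assume b: "b \<in> Basis"
    have c: "continuous_on UNIV (partial_deriv b \<kappa>)" using \<kappa>(1) b by (simp add: Ck_on_Suc Ck_on_0)
    show "\<exists>d>0. \<forall>x y. dist x y < d \<longrightarrow> \<bar>partial_deriv b \<kappa> x - partial_deriv b \<kappa> y\<bar> < e / N"
      by (rule compact_support_uniformly_continuous[where R=R]) (use c z e N in auto)
  qed
  then obtain D where D: "\<And>b. b \<in> Basis \<Longrightarrow> D b > 0"
    "\<And>b x y. b \<in> Basis \<Longrightarrow> dist x y < D b \<Longrightarrow> \<bar>partial_deriv b \<kappa> x - partial_deriv b \<kappa> y\<bar> < e / N"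
    by metis
  define d where "d = Min (D ` Basis)"
  have d: "d > 0" "\<And>b. b \<in> Basis \<Longrightarrow> d \<le> D b" using D(1) by (auto simp: d_def)
  have "\<bar>\<kappa> (a + v) - \<kappa> a - (\<Sum>b\<in>Basis. (v \<bullet> b) * partial_deriv b \<kappa> a)\<bar> \<le> e * norm v" if v: "norm v < d" for a v
  proof -
    have diff: "\<kappa> differentiable (at x)" for x using \<kappa>(1) by (simp add: Ck_on_Suc)
    have pv: "partial_deriv v \<kappa> x = (\<Sum>b\<in>Basis. (v \<bullet> b) * partial_deriv b \<kappa> x)" for x
      using partial_deriv_eq[OF has_derivative_partial[OF diff[of x]], of v] by simp
    have "\<exists>t>0. t < 1 \<and> \<kappa> (a + 1 *\<^sub>R v) - \<kappa> (a + 0 *\<^sub>R v) = (1 - 0) * partial_deriv v \<kappa> (a + t *\<^sub>R v)"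
      by (rule MVT2) (auto intro: has_real_derivative_line diff)
    then obtain t where t: "0 < t" "t < 1" "\<kappa> (a + v) - \<kappa> a = partial_deriv v \<kappa> (a + t *\<^sub>R v)" by auto
    have "\<bar>\<kappa> (a + v) - \<kappa> a - (\<Sum>b\<in>Basis. (v \<bullet> b) * partial_deriv b \<kappa> a)\<bar>
      = \<bar>\<Sum>b\<in>Basis. (v \<bullet> b) * (partial_deriv b \<kappa> (a + t *\<^sub>R v) - partial_deriv b \<kappa> a)\<bar>"
      using t(3) pv by (simp add: right_diff_distrib sum_subtractf)
    also have "\<dots> \<le> (\<Sum>b\<in>Basis. \<bar>v \<bullet> b\<bar> * \<bar>partial_deriv b \<kappa> (a + t *\<^sub>R v) - partial_deriv b \<kappa> a\<bar>)"
      by (rule order_trans[OF sum_abs]) (simp add: abs_mult)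
    also have "\<dots> \<le> (\<Sum>b\<in>(Basis::'a set). norm v * (e / N))"
    proof (intro sum_mono mult_mono)
      fix b :: 'a assume b: "b \<in> Basis"
      show "\<bar>v \<bullet> b\<bar> \<le> norm v" using b by (rule Basis_le_norm)
      have "norm (t *\<^sub>R v) \<le> norm v" using t by (simp add: mult_left_le_one_le)
      then have "dist (a + t *\<^sub>R v) a < D b" using v d(2)[OF b] by (simp add: dist_norm)
      then show "\<bar>partial_deriv b \<kappa> (a + t *\<^sub>R v) - partial_deriv b \<kappa> a\<bar> \<le> e / N" using D(2)[OF b] by fastforce
    qed auto
    also have "\<dots> = e * norm v" using N by (simp add: N_def)
    finally show ?thesis .
  qed
  then show ?thesis using d(1) by blast
qed

lemma partial_derivs_support:
  assumes "\<And>y. R < norm y \<Longrightarrow> \<kappa> y = 0" "R < norm (y::'a::euclidean_space)"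
  shows "partial_derivs bs \<kappa> y = (0::'b::real_normed_vector)"
proof -
  have "partial_derivs bs (\<lambda>_. 0::'b) = (\<lambda>_::'a. 0)" by (induction bs) (auto simp: partial_deriv_const)
  then show ?thesis using partial_derivs_cong[of "{y. R < norm y}" y \<kappa> "\<lambda>_. 0" bs] assms 
    by (simp add: open_Collect_less continuous_on_norm)
qed

text \<open>Integrating the uniform Taylor remainder of the kernel against the absolute value of
  \<open>h\<close> leaves an error of the same form. All regularity comes from the kernel;
  \<open>h\<close> is merely integrable.\<close>

lemma conv_has_derivative:
  fixes h \<kappa> :: "'a::euclidean_space \<Rightarrow> real"
  assumes h: "integrable lborel h" and \<kappa>: "Ck_on (Suc 0) UNIV \<kappa>" "\<And>y. R < norm y \<Longrightarrow> \<kappa> y = 0"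
  shows "(conv h \<kappa> has_derivative (\<lambda>v. \<Sum>b\<in>Basis. (v \<bullet> b) * conv h (partial_deriv b \<kappa>) x)) (at x)"
  unfolding has_derivative_at_alt
proof (intro conjI allI impI)
  show "bounded_linear (\<lambda>v. \<Sum>b\<in>Basis. (v \<bullet> b) * conv h (partial_deriv b \<kappa>) x)"
    by (intro bounded_linear_sum bounded_linear_mult_const bounded_linear_inner_left)
  fix e :: real assume e: "0 < e"
  define I where "I = (\<integral>y. \<bar>h y\<bar> \<partial>lborel)"
  have I: "0 \<le> I" unfolding I_def by simp
  have z: "partial_deriv b \<kappa> y = 0" if "R < norm y" for b y
    using partial_derivs_support[of R \<kappa> y "[b]"] that \<kappa>(2) by simp
  have c: "continuous_on UNIV \<kappa>" "\<And>b. b \<in> Basis \<Longrightarrow> continuous_on UNIV (partial_deriv b \<kappa>)"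
    using \<kappa>(1) by (auto simp: Ck_on_Suc Ck_on_0)
  obtain d where d: "d > 0" "\<And>a v. norm v < d \<Longrightarrow>
      \<bar>\<kappa> (a + v) - \<kappa> a - (\<Sum>b\<in>Basis. (v \<bullet> b) * partial_deriv b \<kappa> a)\<bar> \<le> e / (I + 1) * norm v"
  proof -
    have "\<exists>d>0. \<forall>a v. norm v < d \<longrightarrow>
      \<bar>\<kappa> (a + v) - \<kappa> a - (\<Sum>b\<in>Basis. (v \<bullet> b) * partial_deriv b \<kappa> a)\<bar> \<le> e / (I + 1) * norm v"
      by (rule compact_support_taylor[where R=R]) (use \<kappa> e I in auto)
    then show ?thesis using that by auto
  qed
  have "norm (conv h \<kappa> x' - conv h \<kappa> x - (\<Sum>b\<in>Basis. ((x' - x) \<bullet> b) * conv h (partial_deriv b \<kappa>) x)) \<le> e * norm (x' - x)"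
    if x': "norm (x' - x) < d" for x'
  proof -
    let ?v = "x' - x"
    let ?g = "\<lambda>y. \<kappa> (x' - y) - \<kappa> (x - y) - (\<Sum>b\<in>Basis. (?v \<bullet> b) * partial_deriv b \<kappa> (x - y))"
    have i1: "integrable lborel (\<lambda>y. h y * \<kappa> (x - y))" for x by (intro integrable_conv[where R=R] h c(1) \<kappa>(2))
    have i2: "integrable lborel (\<lambda>y. h y * partial_deriv b \<kappa> (x - y))" if "b \<in> Basis" for b
      by (intro integrable_conv[where R=R] h c(2) z that)
    have g: "h y * ?g y = h y * \<kappa> (x' - y) - h y * \<kappa> (x - y) - (\<Sum>b\<in>Basis. (?v \<bullet> b) * (h y * partial_deriv b \<kappa> (x - y)))" for y
      by (simp add: algebra_simps sum_distrib_left)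
    have ig: "integrable lborel (\<lambda>y. h y * ?g y)"
      unfolding g by (intro Bochner_Integration.integrable_diff Bochner_Integration.integrable_sum i1 integrable_mult_right i2)
    have "conv h \<kappa> x' - conv h \<kappa> x - (\<Sum>b\<in>Basis. (?v \<bullet> b) * conv h (partial_deriv b \<kappa>) x) = (\<integral>y. h y * ?g y \<partial>lborel)"
      unfolding g conv_def
      by (subst Bochner_Integration.integral_diff, intro Bochner_Integration.integrable_diff i1, 
          intro Bochner_Integration.integrable_sum integrable_mult_right i2, assumption,
          subst Bochner_Integration.integral_diff, rule i1, rule i1, 
          subst Bochner_Integration.integral_sum, intro integrable_mult_right i2, assumption)
        simp
    also have "\<bar>\<dots>\<bar> \<le> (e / (I + 1) * norm ?v) * I"
      unfolding I_def
    proof (rule conv_diff_bound[OF h ig])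
      show "\<bar>?g y\<bar> \<le> e / ((\<integral>y. \<bar>h y\<bar> \<partial>lborel) + 1) * norm ?v" for y
        using d(2)[OF x', of "x - y"] by (simp add: I_def algebra_simps)
    qed
    also have "\<dots> \<le> e * norm ?v" using e I by (simp add: field_simps mult_left_mono)
    finally show ?thesis by simp
  qed
  then show "\<exists>d>0. \<forall>x'. norm (x' - x) < d \<longrightarrow> norm (conv h \<kappa> x' - conv h \<kappa> x 
      - (\<Sum>b\<in>Basis. ((x' - x) \<bullet> b) * conv h (partial_deriv b \<kappa>) x)) \<le> e * norm (x' - x)"
    using d(1) by blast
qed

lemma partial_deriv_conv:
  fixes h \<kappa> :: "'a::euclidean_space \<Rightarrow> real"
  assumes "integrable lborel h" "Ck_on (Suc 0) UNIV \<kappa>" "\<And>y. R < norm y \<Longrightarrow> \<kappa> y = 0" "b \<in> Basis"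
  shows "partial_deriv b (conv h \<kappa>) = conv h (partial_deriv b \<kappa>)"
proof
  fix x
  show "partial_deriv b (conv h \<kappa>) x = conv h (partial_deriv b \<kappa>) x"
    using partial_deriv_eq[OF conv_has_derivative[of h \<kappa> R x], where b=b] assms(1-3) assms(4)
    by (simp add: inner_Basis if_distrib[of "\<lambda>z. z * _"] cong: if_cong)
qed

lemma Ck_on_conv:
  fixes h \<kappa> :: "'a::euclidean_space \<Rightarrow> real"
  assumes h: "integrable lborel h" 
  shows "Ck_on k UNIV \<kappa> \<Longrightarrow> (\<And>y. R < norm y \<Longrightarrow> \<kappa> y = 0) \<Longrightarrow> Ck_on k UNIV (conv h \<kappa>)"
proof (induction k arbitrary: \<kappa>)
  case 0
  then show ?case using continuous_conv[OF h, of \<kappa> R] by (simp add: Ck_on_0)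
next
  case (Suc k)
  have 1: "Ck_on (Suc 0) UNIV \<kappa>" using Suc.prems(1) by (rule Ck_on_le) simp
  have "Ck_on k UNIV (partial_deriv b (conv h \<kappa>))" if "b \<in> Basis" for b
  proof -
    have "Ck_on k UNIV (conv h (partial_deriv b \<kappa>))"
      by (rule Suc.IH[OF Ck_on_partial_deriv[OF Suc.prems(1) that]])
        (use partial_derivs_support[of R \<kappa> _ "[b]"] Suc.prems(2) in auto)
    then show ?thesis using partial_deriv_conv[of h \<kappa> R b] h 1 Suc.prems(2) that by simp
  qed
  moreover have "continuous_on UNIV (conv h \<kappa>)"
    by (rule continuous_conv[OF h Ck_on_imp_continuous[OF 1] Suc.prems(2)])
  ultimately show ?case
    using conv_has_derivative[of h \<kappa> R] h 1 Suc.prems(2) by (auto simp: Ck_on_Suc differentiable_def)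
qed

text \<open>Convolution with the indicator of a ball larger than the support is constant near
  \<open>0\<close>, equal to the integral of \<open>F\<close>. Differentiating this constant and
  moving the derivative onto \<open>F\<close> gives the claim.\<close>

lemma integral_partial_deriv_eq_0:
  fixes F :: "'a::euclidean_space \<Rightarrow> real"
  assumes F: "Ck_on (Suc 0) UNIV F" "\<And>y. R < norm y \<Longrightarrow> F y = 0" and b: "b \<in> Basis"
  shows "(\<integral>y. partial_deriv b F y \<partial>lborel) = 0"
proof -
  \<comment> \<open>The margin 1 in the radius absorbs translations by points of the unit ball; the
    absolute value covers negative \<open>R\<close>.\<close>
  let ?h = "indicator (cball 0 (\<bar>R\<bar> + 1)) :: 'a \<Rightarrow> real"
  have h: "integrable lborel ?h" by (rule integrable_indicator_cball)
  have [measurable]: "F \<in> borel_measurable borel" "partial_deriv b F \<in> borel_measurable borel"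
    using F(1) b by (auto intro!: borel_measurable_continuous_onI simp: Ck_on_Suc Ck_on_0)
  have z: "partial_deriv b F y = 0" if "R < norm y" for y
    using partial_derivs_support[of R F y "[b]"] that F(2) by simp
  have c: "conv ?h G x = (\<integral>y. G y \<partial>lborel)" 
    if "x \<in> ball 0 1" "\<And>y. R < norm y \<Longrightarrow> G y = 0" "G \<in> borel_measurable borel" for x and G :: "'a \<Rightarrow> real"
  proof -
    have "?h y * G (x - y) = G (x - y)" for y
    proof (cases "norm (x - y) \<le> R")
      case True
      then have "norm y \<le> \<bar>R\<bar> + 1" using norm_triangle_ineq2[of y x] that(1) by (simp add: norm_minus_commute)
      then show ?thesis by simp
    qed (use that(2) in simp)
    then have "conv ?h G x = (\<integral>y. G (x - y) \<partial>lborel)" 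
      unfolding conv_def by (intro Bochner_Integration.integral_cong refl)
    also have "\<dots> = (\<integral>y. G y \<partial>lborel)"
      using lborel_integral_affine[of "-1" G x] that(3) by simp
    finally show ?thesis .
  qed
  have "partial_deriv b (conv ?h F) 0 = partial_deriv b (\<lambda>x. \<integral>y. F y \<partial>lborel) 0"
    by (rule partial_deriv_cong[of "ball 0 1"]) (use c F(2) in auto)
  then have "conv ?h (partial_deriv b F) 0 = 0"
    using partial_deriv_conv[of ?h F R b] h F b by (simp add: partial_deriv_const)
  then show ?thesis using c[of 0 "partial_deriv b F"] z by simp
qed

text \<open>By the mean value theorem every difference quotient is a value of \<open>f'\<close>,
  hence bounded by \<open>g\<close>, and dominated convergence applies along sequences.
  Measurability of \<open>f' r\<close> comes with it, as a limit of measurable quotients.\<close>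

lemma DERIV_integral_dominated:
  fixes f f' :: "real \<Rightarrow> 'a \<Rightarrow> real"
  assumes r: "r \<in> {a<..<b}" and int: "\<And>s. s \<in> {a<..<b} \<Longrightarrow> integrable M (f s)" and g: "integrable M g"
    and der: "\<And>s y. s \<in> {a<..<b} \<Longrightarrow> y \<in> space M \<Longrightarrow> ((\<lambda>s. f s y) has_real_derivative f' s y) (at s)"
    and bnd: "\<And>s y. s \<in> {a<..<b} \<Longrightarrow> y \<in> space M \<Longrightarrow> \<bar>f' s y\<bar> \<le> g y"
  shows "((\<lambda>s. \<integral>y. f s y \<partial>M) has_real_derivative (\<integral>y. f' r y \<partial>M)) (at r)"
proof -
  have "((\<lambda>s. ((\<integral>y. f s y \<partial>M) - (\<integral>y. f r y \<partial>M)) / (s - r)) \<longlongrightarrow> (\<integral>y. f' r y \<partial>M)) (at r within {a<..<b})"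
    unfolding tendsto_at_iff_sequentially
  proof (intro allI impI)
    fix X :: "nat \<Rightarrow> real" assume X: "\<forall>i. X i \<in> {a<..<b} - {r}" "X \<longlonglongrightarrow> r"
    let ?q = "\<lambda>i y. (f (X i) y - f r y) / (X i - r)"
    have ql: "(\<lambda>i. ?q i y) \<longlonglongrightarrow> f' r y" if y: "y \<in> space M" for y
    proof -
      have "((\<lambda>s. (f s y - f r y) / (s - r)) \<longlongrightarrow> f' r y) (at r)"
        using der[OF r y] by (simp add: has_field_derivative_iff)
      then have "((\<lambda>s. (f s y - f r y) / (s - r)) \<circ> X) \<longlonglongrightarrow> f' r y"
        unfolding tendsto_at_iff_sequentially using X by blast
      then show ?thesis by (simp add: o_def)
    qed
    have qb: "\<bar>?q i y\<bar> \<le> g y" if y: "y \<in> space M" for i y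
    proof -
      have Xi: "a < X i" "X i < b" "X i \<noteq> r" using X(1) by auto
      have "\<exists>z. min r (X i) < z \<and> z < max r (X i) \<and> f (max r (X i)) y - f (min r (X i)) y = (max r (X i) - min r (X i)) * f' z y"
      proof (rule MVT2)
        show "min r (X i) < max r (X i)" using Xi by auto
        fix t assume "min r (X i) \<le> t" "t \<le> max r (X i)"
        then have "t \<in> {a<..<b}" using Xi r by auto
        then show "((\<lambda>s. f s y) has_real_derivative f' t y) (at t)" using der y by blast
      qed
      then obtain z where z: "min r (X i) < z" "z < max r (X i)" 
        "f (max r (X i)) y - f (min r (X i)) y = (max r (X i) - min r (X i)) * f' z y" by blast
      have "z \<in> {a<..<b}" using z Xi r by auto
      moreover have "?q i y = f' z y"
        using z X(1)[rule_format, of i] by (cases "r < X i") (auto simp: min_def max_def field_simps split: if_splits)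
      ultimately show ?thesis using bnd[OF _ y] by simp
    qed
    have "(\<lambda>i. \<integral>y. ?q i y \<partial>M) \<longlonglongrightarrow> (\<integral>y. f' r y \<partial>M)"
    proof (rule integral_dominated_convergence[where w=g])
      show mq: "?q i \<in> borel_measurable M" for i
        using int[OF r] int[of "X i"] X(1) by (auto intro!: borel_measurable_divide borel_measurable_diff dest: borel_measurable_integrable)
      show "f' r \<in> borel_measurable M"
        by (rule borel_measurable_LIMSEQ_real[OF ql mq])
    qed (use ql qb g in auto)
    moreover have "(\<integral>y. ?q i y \<partial>M) = ((\<integral>y. f (X i) y \<partial>M) - (\<integral>y. f r y \<partial>M)) / (X i - r)" for i
      using int[OF r] int[of "X i"] X(1) by (subst Bochner_Integration.integral_divide_zero, subst Bochner_Integration.integral_diff) auto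
    ultimately show "((\<lambda>s. ((\<integral>y. f s y \<partial>M) - (\<integral>y. f r y \<partial>M)) / (s - r)) \<circ> X) \<longlonglongrightarrow> (\<integral>y. f' r y \<partial>M)"
      unfolding o_def by (simp only:)
  qed
  moreover have "at r within {a<..<b} = at r" using r by (intro at_within_open) auto
  ultimately show ?thesis by (simp add: has_field_derivative_iff)
qed

section \<open>Harmonic functions and weighted mean values\<close>

text \<open>Powers of the positive part take the place of a smooth cut-off: their smoothness is
  finite but of any prescribed order, and their derivatives are multiples of members of the same
  family.\<close>

definition pos_power :: "nat \<Rightarrow> real \<Rightarrow> real" where
  "pos_power m s = max 0 s ^ m"

lemma has_real_derivative_pos_power:
  "(pos_power (Suc (Suc m)) has_real_derivative real (m + 2) * pos_power (Suc m) s) (at s)"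
proof -
  consider "s > 0" | "s < 0" | "s = 0" by linarith
  then show ?thesis
  proof cases
    case 1
    have "((\<lambda>s. s ^ Suc (Suc m)) has_real_derivative real (m + 2) * pos_power (Suc m) s) (at s)"
      using 1 DERIV_pow[of "Suc (Suc m)" s] by (simp add: pos_power_def)
    then show ?thesis
      by (rule has_field_derivative_transform_within_open[of _ _ _ "{0<..}"]) (use 1 in \<open>auto simp: pos_power_def\<close>)
  next
    case 2
    have "((\<lambda>s. 0) has_real_derivative real (m + 2) * pos_power (Suc m) s) (at s)"
      using 2 by (auto simp: pos_power_def)
    then show ?thesis
      by (rule has_field_derivative_transform_within_open[of _ _ _ "{..<0}"]) (use 2 in \<open>auto simp: pos_power_def\<close>)
  next
    case 3
    \<comment> \<open>One power is lost to the division by \<open>h\<close> and at least one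
      remains; this is why the exponent starts at 2.\<close>
    have "((\<lambda>h. (pos_power (Suc (Suc m)) h - pos_power (Suc (Suc m)) 0) / (h - 0)) \<longlongrightarrow> 0) (at 0)"
    proof (rule tendsto_0_le[where K=1])
      show "((\<lambda>h::real. h ^ Suc m) \<longlongrightarrow> 0) (at 0)"
        by (rule tendsto_eq_intros refl)+ simp
      have "norm ((pos_power (Suc (Suc m)) h - pos_power (Suc (Suc m)) 0) / (h - 0)) \<le> norm (h ^ Suc m) * 1" for h
        by (cases "h > 0") (auto simp: pos_power_def)
      then show "\<forall>\<^sub>F h in at 0. norm ((pos_power (Suc (Suc m)) h - pos_power (Suc (Suc m)) 0) / (h - 0)) \<le> norm (h ^ Suc m) * 1"
        by (intro always_eventually allI)
    qed
    then show ?thesis using 3 by (simp add: has_field_derivative_iff pos_power_def)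
  qed
qed

lemma continuous_pos_power: "continuous_on S (pos_power m)"
  unfolding pos_power_def by (intro continuous_intros)

text \<open>Each derivative lowers the exponent by one, and exponent 1 is still continuous; so
  \<open>k\<close> continuous derivatives are paid for by the exponent \<open>k + 1\<close>.\<close>

lemma Ck_on_pos_power:
  fixes q :: "'a::euclidean_space \<Rightarrow> real"
  shows "Ck_on k UNIV q \<Longrightarrow> Ck_on k UNIV (\<lambda>y. pos_power (Suc k) (q y))"
proof (induction k)
  case 0
  then show ?case unfolding Ck_on_0 by (intro continuous_on_compose2[OF continuous_pos_power]) auto
next
  case (Suc k)
  let ?D = "\<lambda>y v. real (k + 2) * pos_power (Suc k) (q y) * frechet_derivative q (at y) v"
  show ?case
  proof (rule Ck_on_SucI[where f'="?D"])
    fix y :: 'a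
    have "(q has_derivative frechet_derivative q (at y)) (at y)"
      using Suc.prems frechet_derivative_works by (auto simp: Ck_on_Suc)
    from has_derivative_compose[OF this, of "pos_power (Suc (Suc k))" "(*) (real (k + 2) * pos_power (Suc k) (q y))"]
    show "((\<lambda>y. pos_power (Suc (Suc k)) (q y)) has_derivative ?D y) (at y)"
      using has_real_derivative_pos_power[of k "q y"] by (simp add: has_field_derivative_def mult.commute)
  next
    fix b :: 'a assume b: "b \<in> Basis"
    have "Ck_on k UNIV (\<lambda>y. pos_power (Suc k) (q y))" "Ck_on k UNIV (partial_deriv b q)"
      using Suc.IH[OF Ck_on_le[OF Suc.prems]] Ck_on_partial_deriv[OF Suc.prems b] by auto
    then show "Ck_on k UNIV (\<lambda>y. ?D y b)"
      unfolding partial_deriv_def[abs_def] by (intro Ck_on_mult Ck_on_const) auto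
  qed auto
qed

definition bump :: "nat \<Rightarrow> 'a::euclidean_space \<Rightarrow> real" where
  "bump m y = pos_power m (1 - y \<bullet> y)"

definition bump_mass :: "'a::euclidean_space itself \<Rightarrow> nat \<Rightarrow> real" where
  "bump_mass _ m = (\<integral>y. bump m (y::'a) \<partial>lborel)"

lemma Ck_on_bump: "Ck_on k UNIV (bump (Suc k) :: 'a::euclidean_space \<Rightarrow> real)"
  unfolding bump_def[abs_def] 
  by (intro Ck_on_pos_power Ck_on_diff Ck_on_const Ck_on_inner_self) auto

text \<open>The ladder relation behind the mean value formulas: up to a constant factor, the vector
  \<open>y\<close> times one weight is the gradient of the next weight.\<close>

lemma partial_deriv_bump:
  "partial_deriv b (bump (Suc (Suc m))) y = - 2 * real (m + 2) * (y \<bullet> b) * bump (Suc m) y"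
proof -
  have 1: "((\<lambda>y. 1 - y \<bullet> y) has_derivative (\<lambda>v. - (2 * (y \<bullet> v)))) (at y)"
    by (auto intro!: derivative_eq_intros simp: inner_commute)
  have "((\<lambda>y. pos_power (Suc (Suc m)) (1 - y \<bullet> y)) has_derivative 
      (\<lambda>v. (real (m + 2) * pos_power (Suc m) (1 - y \<bullet> y)) * (- (2 * (y \<bullet> v))))) (at y)"
    by (rule has_derivative_compose[OF 1, of "pos_power (Suc (Suc m))"])
      (use has_real_derivative_pos_power[of m "1 - y \<bullet> y"] in \<open>simp add: has_field_derivative_def\<close>)
  from partial_deriv_eq[OF this, of b] show ?thesis
    unfolding bump_def[abs_def] by (simp add: algebra_simps)
qed

lemma bump_0: "1 \<le> norm y \<Longrightarrow> bump (Suc m) y = 0"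
proof -
  assume "1 \<le> norm y"
  then have "1 \<le> y \<bullet> y" using power_mono[of 1 "norm y" 2] by (simp add: power2_norm_eq_inner)
  then show ?thesis by (simp add: bump_def pos_power_def)
qed

lemma bump_nonneg: "0 \<le> bump m y" by (simp add: bump_def pos_power_def)

lemma continuous_on_bump: "continuous_on S (bump m)"
  unfolding bump_def[abs_def] by (intro continuous_on_compose2[OF continuous_pos_power] continuous_intros) auto

lemma borel_measurable_bump [measurable]: "bump m \<in> borel_measurable borel"
  by (intro borel_measurable_continuous_onI continuous_on_bump)

lemma bump_minus: "bump m (- y) = bump m y"
  by (simp add: bump_def)

lemma integrable_mult_bump:
  assumes "continuous_on (cball 0 1) f"
  shows "integrable lborel (\<lambda>y. f y * bump (Suc m) y)"
proof -
  have "integrable lborel (\<lambda>y. indicator (cball 0 1) y *\<^sub>R (f y * bump (Suc m) y))"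
    by (intro borel_integrable_compact continuous_intros assms continuous_on_bump) auto
  moreover have "(\<lambda>y. indicator (cball 0 1) y *\<^sub>R (f y * bump (Suc m) y)) = (\<lambda>y. f y * bump (Suc m) y)"
    by (rule ext) (auto simp: indicator_def bump_0)
  ultimately show ?thesis by simp
qed

lemma integrable_bump: "integrable lborel (bump (Suc m))"
  using integrable_mult_bump[of "\<lambda>_. 1" m] by simp

lemma bump_mass_pos: "0 < bump_mass TYPE('a::euclidean_space) (Suc m)"
proof -
  \<comment> \<open>On the ball of radius 1/2 the base \<open>1 - y \<bullet> y\<close> is at least
    3/4.\<close>
  have b: "(3/4) ^ Suc m * indicator (ball 0 (1/2)) y \<le> bump (Suc m) y" for y :: 'a
  proof (cases "norm y < 1/2")
    case True
    then have "y \<bullet> y \<le> 1/4" using power_mono[of "norm y" "1/2" 2] by (simp add: power2_norm_eq_inner[symmetric] power2_eq_square)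
    then have "3/4 \<le> max 0 (1 - y \<bullet> y)" by simp
    then have "(3/4) ^ Suc m \<le> max 0 (1 - y \<bullet> y) ^ Suc m" by (rule power_mono) simp
    then show ?thesis using True unfolding bump_def pos_power_def by simp
  qed (simp add: bump_nonneg)
  have "0 < (3/4::real) ^ Suc m * measure lborel (ball (0::'a) (1/2))"
    using content_ball_pos[of "1/2" "0::'a"] by (simp only: zero_less_mult_iff) simp
  also have "\<dots> = (\<integral>y. (3/4) ^ Suc m * indicator (ball (0::'a) (1/2)) y \<partial>lborel)"
    by simp
  also have "\<dots> \<le> bump_mass TYPE('a) (Suc m)"
    unfolding bump_mass_def
    by (intro integral_mono b integrable_bump integrable_mult_right integrable_real_indicator)
      (use emeasure_lborel_ball_finite[of "0::'a" "1/2"] in auto)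
  finally show ?thesis .
qed

text \<open>Counterparts of \<open>laplacian\<close> and \<open>harmonic_on\<close> on arbitrary
  Euclidean spaces, so that the potential theory is free of complex coordinates;
  \<open>harmonic_on_iff_harm\<close> makes the connection.\<close>

definition lap :: "('a::euclidean_space \<Rightarrow> real) \<Rightarrow> 'a \<Rightarrow> real" where
  "lap f x = (\<Sum>b\<in>Basis. partial_deriv b (partial_deriv b f) x)"

definition harm :: "'a::euclidean_space set \<Rightarrow> ('a \<Rightarrow> real) \<Rightarrow> bool" where
  "harm S u \<longleftrightarrow> open S \<and> Ck_on 2 S u \<and> (\<forall>x\<in>S. lap u x = 0)"

lemma lap_cong:
  assumes "open S" "x \<in> S" "\<And>y. y \<in> S \<Longrightarrow> f y = g y"
  shows "lap f x = lap g x"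
proof -
  have "partial_derivs [b, b] f x = partial_derivs [b, b] g x" for b
    using assms by (rule partial_derivs_cong)
  then show ?thesis by (simp add: lap_def)
qed

lemma harm_cong: "harm S u \<Longrightarrow> (\<And>x. x \<in> S \<Longrightarrow> u x = v x) \<Longrightarrow> harm S v"
  unfolding harm_def using Ck_on_cong[of S u v] lap_cong[of S _ u v] by metis

lemma harm_subset: "harm S u \<Longrightarrow> open T \<Longrightarrow> T \<subseteq> S \<Longrightarrow> harm T u"
  unfolding harm_def by (auto intro: Ck_on_subset)

lemma harm_local:
  assumes "\<And>x. x \<in> S \<Longrightarrow> \<exists>U. x \<in> U \<and> harm U u" "open S"
  shows "harm S u"
  unfolding harm_def
proof (intro conjI ballI Ck_on_local assms(2))
  fix x assume "x \<in> S"
  then show "\<exists>U. open U \<and> x \<in> U \<and> Ck_on 2 U u" "lap u x = 0" using assms(1) unfolding harm_def by blast+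
qed

lemma harm_imp_continuous: "harm S u \<Longrightarrow> continuous_on S u"
  unfolding harm_def using Ck_on_imp_continuous by blast

lemma Ck_2_iff: "Ck_on 2 S f \<longleftrightarrow> Ck_on (Suc (Suc 0)) S f"
  by (simp add: numeral_2_eq_2)

lemma Ck_2_differentiable:
  assumes "Ck_on 2 S f" "x \<in> S" "b \<in> Basis"
  shows "f differentiable (at x)" "partial_deriv b f differentiable (at x)"
  using assms by (auto simp: Ck_2_iff Ck_on_Suc)

lemma lap_add:
  assumes "open S" "x \<in> S" "Ck_on 2 S f" "Ck_on 2 S g"
  shows "lap (\<lambda>x. f x + g x) x = lap f x + lap g x"
proof -
  have "partial_deriv b (partial_deriv b (\<lambda>x. f x + g x)) x 
    = partial_deriv b (partial_deriv b f) x + partial_deriv b (partial_deriv b g) x" if b: "b \<in> Basis" for b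
  proof -
    have "partial_deriv b (partial_deriv b (\<lambda>x. f x + g x)) x = partial_deriv b (\<lambda>x. partial_deriv b f x + partial_deriv b g x) x"
      by (rule partial_deriv_cong[OF assms(1,2)]) (rule partial_deriv_add; use assms b Ck_2_differentiable in blast)
    also have "\<dots> = partial_deriv b (partial_deriv b f) x + partial_deriv b (partial_deriv b g) x"
      by (rule partial_deriv_add) (use assms b Ck_2_differentiable in blast)+
    finally show ?thesis .
  qed
  then show ?thesis by (simp add: lap_def sum.distrib)
qed

lemma partial_deriv_cmult:
  fixes f :: "'a::euclidean_space \<Rightarrow> real"
  shows "f differentiable (at x) \<Longrightarrow> partial_deriv b (\<lambda>x. c * f x) x = c * partial_deriv b f x"
  using partial_deriv_bounded_linear_comp[OF bounded_linear_mult_right[of c]] by blast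

lemma lap_cmult:
  assumes "open S" "x \<in> S" "Ck_on 2 S f"
  shows "lap (\<lambda>x. c * f x) x = c * lap f x"
proof -
  have "partial_deriv b (partial_deriv b (\<lambda>x. c * f x)) x = c * partial_deriv b (partial_deriv b f) x" if b: "b \<in> Basis" for b
  proof -
    have "partial_deriv b (partial_deriv b (\<lambda>x. c * f x)) x = partial_deriv b (\<lambda>x. c * partial_deriv b f x) x"
      by (rule partial_deriv_cong[OF assms(1,2)]) (rule partial_deriv_cmult; use assms b Ck_2_differentiable in blast)
    also have "\<dots> = c * partial_deriv b (partial_deriv b f) x"
      by (rule partial_deriv_cmult) (use assms b Ck_2_differentiable in blast)+
    finally show ?thesis .
  qed
  then show ?thesis by (simp add: lap_def sum_distrib_left)
qed

lemma harm_add: "harm S f \<Longrightarrow> harm S g \<Longrightarrow> harm S (\<lambda>x. f x + g x)"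
  unfolding harm_def by (auto intro: Ck_on_add simp: lap_add)

lemma harm_cmult: "harm S f \<Longrightarrow> harm S (\<lambda>x. c * f x)"
  unfolding harm_def by (auto intro: Ck_on_cmult simp: lap_cmult)

lemma harm_diff: "harm S f \<Longrightarrow> harm S g \<Longrightarrow> harm S (\<lambda>x. f x - g x)"
  using harm_add[of S f "\<lambda>x. (-1) * g x"] harm_cmult[of S g "-1"] by simp

lemma harm_uminus: "harm S f \<Longrightarrow> harm S (\<lambda>x. - f x)"
  using harm_cmult[of S f "-1"] by simp

lemma harm_const: "open S \<Longrightarrow> harm S (\<lambda>x. c)"
  unfolding harm_def lap_def by (simp add: Ck_on_const partial_deriv_const)

text \<open>The open sets \<open>S\<close> and \<open>{y. 1 < norm y}\<close> cover the space, and
  on the second one the product is identically zero; thus it is regular everywhere although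
  \<open>f\<close> is controlled on \<open>S\<close> only.\<close>

lemma Ck_on_mult_bump:
  assumes S: "open S" "cball 0 1 \<subseteq> S" and f: "Ck_on k S f" "k \<le> m"
  shows "Ck_on k UNIV (\<lambda>y. f y * bump (Suc m) y)"
proof (rule Ck_on_local)
  fix x :: 'a
  have b: "Ck_on k UNIV (bump (Suc m) :: 'a \<Rightarrow> real)" using Ck_on_bump f(2) by (rule Ck_on_le)
  show "\<exists>U. open U \<and> x \<in> U \<and> Ck_on k U (\<lambda>y. f y * bump (Suc m) y)"
  proof (cases "x \<in> S")
    case True
    then show ?thesis using S f b by (intro exI[of _ S]) (auto intro: Ck_on_mult Ck_on_subset)
  next
    case False
    let ?U = "{y::'a. 1 < norm y}"
    have "Ck_on k ?U (\<lambda>y. f y * bump (Suc m) y)"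
      by (rule Ck_on_cong[OF _ _ Ck_on_const[of k _ 0]]) (auto simp: bump_0 open_Collect_less continuous_on_norm)
    moreover have "1 < norm x" using False S(2) by (meson linorder_not_le mem_cball_0 subsetD)
    ultimately show ?thesis by (intro exI[of _ ?U]) (auto simp: open_Collect_less continuous_on_norm)
  qed
qed

text \<open>Integration by parts against the higher weight, whose derivative is a multiple of
  \<open>y \<bullet> b\<close> times the lower one; compact support removes the boundary
  terms.\<close>

lemma integral_bump_parts:
  fixes f :: "'a::euclidean_space \<Rightarrow> real"
  assumes S: "open S" "cball 0 1 \<subseteq> S" and f: "Ck_on (Suc 0) S f" and b: "b \<in> Basis"
  shows "2 * real (m + 2) * (\<integral>y. (y \<bullet> b) * f y * bump (Suc m) y \<partial>lborel) 
       = (\<integral>y. partial_deriv b f y * bump (Suc (Suc m)) y \<partial>lborel)"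
proof -
  let ?F = "\<lambda>y. f y * bump (Suc (Suc m)) y"
  have pd: "partial_deriv b ?F y = partial_deriv b f y * bump (Suc (Suc m)) y - 2 * real (m + 2) * ((y \<bullet> b) * f y * bump (Suc m) y)" for y
  proof (cases "y \<in> S")
    case True
    have "bump (Suc (Suc m)) differentiable (at y)"
      using Ck_on_differentiable[OF Ck_on_bump[of "Suc m"]] by simp
    then show ?thesis using f True by (subst partial_deriv_mult) (auto simp: Ck_on_Suc partial_deriv_bump algebra_simps)
  next
    case False
    have "partial_deriv b ?F y = partial_deriv b (\<lambda>_. 0) y"
    proof (rule partial_deriv_cong[of "{y. 1 < norm y}"])
      show "y \<in> {y. 1 < norm y}" using False S(2) by (metis linorder_not_le mem_Collect_eq mem_cball_0 subsetD)
    qed (auto simp: bump_0 open_Collect_less continuous_on_norm)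
    moreover have "1 \<le> norm y" using False S(2) by force
    ultimately show ?thesis by (simp add: bump_0 partial_deriv_const)
  qed
  have "continuous_on (cball 0 1) f" "continuous_on (cball 0 1) (partial_deriv b f)"
    using f b S(2) by (auto simp: Ck_on_Suc Ck_on_0 intro: continuous_on_subset)
  then have i: "integrable lborel (\<lambda>y. partial_deriv b f y * bump (Suc (Suc m)) y)"
    "integrable lborel (\<lambda>y. (y \<bullet> b) * f y * bump (Suc m) y)"
    by (auto intro!: integrable_mult_bump continuous_intros)
  have "(\<integral>y. partial_deriv b ?F y \<partial>lborel) = 0"
    by (rule integral_partial_deriv_eq_0[where R=1, OF Ck_on_mult_bump[OF S f] _ b]) (auto simp: bump_0)
  then show ?thesis unfolding pd using i
    by (subst (asm) Bochner_Integration.integral_diff) auto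
qed

section \<open>Weighted means over balls and harmonicity\<close>

lemma cball_enlarge:
  fixes x :: "'a::euclidean_space"
  assumes "open S" "cball x r \<subseteq> S" "0 \<le> r"
  obtains R where "r < R" "cball x R \<subseteq> S"
proof -
  obtain e where e: "e > 0" "(\<Union>y\<in>cball x r. cball y e) \<subseteq> S"
    using compact_subset_open_imp_cball_epsilon_subset[OF compact_cball assms(1,2)] by metis
  have "cball x (r + e) \<subseteq> S"
  proof
    fix z assume z: "z \<in> cball x (r + e)"
    show "z \<in> S"
    proof (cases "dist x z \<le> r")
      case False
      \<comment> \<open>The radial projection of \<open>z\<close> onto the sphere of radius
        \<open>r\<close>.\<close>
      let ?y = "x + (r / dist x z) *\<^sub>R (z - x)"
      have d: "dist x z > 0" using False assms(3) by linarith
      have yr: "norm (?y - x) = r" using d assms(3) by (simp add: dist_norm norm_minus_commute)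
      have "z - ?y = (1 - r / dist x z) *\<^sub>R (z - x)" by (simp add: algebra_simps)
      then have "norm (z - ?y) = \<bar>1 - r / dist x z\<bar> * dist x z" by (simp add: dist_norm norm_minus_commute)
      also have "\<dots> = dist x z - r" using d False by (simp add: abs_if field_simps)
      finally have "z \<in> cball ?y e" using z by (simp add: dist_norm norm_minus_commute)
      moreover have "?y \<in> cball x r" using yr by (simp add: dist_norm norm_minus_commute)
      ultimately show ?thesis using e(2) by blast
    qed (use assms(2) in auto)
  qed
  with e(1) that show thesis by (metis less_add_same_cancel1)
qed

text \<open>Differentiation in the radius produces the inner product of \<open>y\<close> with the
  gradient of \<open>u\<close>. By the ladder relation, integration by parts trades the factor
  \<open>y\<close> for a further derivative and the next weight, which yields the Laplacian. The
  range of \<open>r\<close> is symmetric about 0, so that the mean can be followed down to the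
  centre.\<close>

lemma weighted_mean_has_derivative:
  fixes u :: "'a::euclidean_space \<Rightarrow> real"
  assumes S: "open S" "cball x R \<subseteq> S" and u: "Ck_on 2 S u" and r: "\<bar>r\<bar> < R"
  shows "((\<lambda>r. \<integral>y. u (x + r *\<^sub>R y) * bump (Suc m) y \<partial>lborel) has_real_derivative
     r / (2 * real (m + 2)) * (\<integral>y. lap u (x + r *\<^sub>R y) * bump (Suc (Suc m)) y \<partial>lborel)) (at r)"
proof -
  let ?f' = "\<lambda>s y. (\<Sum>b\<in>Basis. (y \<bullet> b) * partial_deriv b u (x + s *\<^sub>R y)) * bump (Suc m) y"
  have inS: "x + s *\<^sub>R y \<in> cball x R" if "\<bar>s\<bar> < R" "norm y \<le> 1" for s y
  proof -
    have "norm (s *\<^sub>R y) \<le> R * 1" unfolding norm_scaleR using that by (intro mult_mono) auto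
    then show ?thesis by (simp add: dist_norm)
  qed
  have C1: "Ck_on (Suc (Suc 0)) S u" using u by (simp add: Ck_2_iff)
  have cu: "continuous_on S u" "\<And>b. b \<in> Basis \<Longrightarrow> continuous_on S (partial_deriv b u)"
    using C1 by (auto simp: Ck_on_Suc)
  have "\<forall>b\<in>Basis. \<exists>C>0. \<forall>z\<in>cball x R. \<bar>partial_deriv b u z\<bar> \<le> C"
  proof
    fix b :: 'a assume "b \<in> Basis"
    then have "compact (partial_deriv b u ` cball x R)"
      using cu(2) S(2) by (meson compact_cball compact_continuous_image continuous_on_subset)
    then obtain C where "C > 0" "\<forall>z\<in>partial_deriv b u ` cball x R. norm z \<le> C"
      using compact_imp_bounded bounded_pos by metis
    then show "\<exists>C>0. \<forall>z\<in>cball x R. \<bar>partial_deriv b u z\<bar> \<le> C" by auto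
  qed
  then obtain C where C: "\<And>b. b \<in> Basis \<Longrightarrow> C b > 0" "\<And>b z. b \<in> Basis \<Longrightarrow> z \<in> cball x R \<Longrightarrow> \<bar>partial_deriv b u z\<bar> \<le> C b"
    by metis
  have D: "((\<lambda>r. \<integral>y. u (x + r *\<^sub>R y) * bump (Suc m) y \<partial>lborel) has_real_derivative (\<integral>y. ?f' r y \<partial>lborel)) (at r)"
  proof (rule DERIV_integral_dominated[where a="-R" and b=R and g="\<lambda>y. (\<Sum>b\<in>Basis. C b) * bump (Suc m) y"])
    show "r \<in> {-R<..<R}" using r by auto
    show "integrable lborel (\<lambda>y. (\<Sum>b\<in>Basis. C b) * bump (Suc m) y)"
      by (intro integrable_mult_right integrable_bump)
    fix s assume s: "s \<in> {-R<..<R}"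
    then have s': "\<bar>s\<bar> < R" by auto
    show "integrable lborel (\<lambda>y. u (x + s *\<^sub>R y) * bump (Suc m) y)"
      by (intro integrable_mult_bump continuous_on_compose2[OF cu(1)] continuous_intros)
        (use inS[OF s'] S(2) in auto)
    fix y :: 'a
    show "((\<lambda>s. u (x + s *\<^sub>R y) * bump (Suc m) y) has_real_derivative ?f' s y) (at s)"
    proof (cases "norm y < 1")
      case True
      have d: "u differentiable (at (x + s *\<^sub>R y))" 
        using C1 inS[OF s', of y] True S(2) by (auto simp: Ck_on_Suc)
      have "partial_deriv y u (x + s *\<^sub>R y) = (\<Sum>b\<in>Basis. (y \<bullet> b) * partial_deriv b u (x + s *\<^sub>R y))"
        using partial_deriv_eq[OF has_derivative_partial[OF d], of y] by simp
      then show ?thesis using has_real_derivative_line[OF d] by (simp add: DERIV_cmult_right)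
    qed (simp add: bump_0)
    show "\<bar>?f' s y\<bar> \<le> (\<Sum>b\<in>Basis. C b) * bump (Suc m) y"
    proof (cases "norm y < 1")
      case True
      have "\<bar>\<Sum>b\<in>Basis. (y \<bullet> b) * partial_deriv b u (x + s *\<^sub>R y)\<bar> \<le> (\<Sum>b\<in>Basis. C b)"
      proof (rule order_trans[OF sum_abs sum_mono])
        fix b :: 'a assume b: "b \<in> Basis"
        have "\<bar>y \<bullet> b\<bar> * \<bar>partial_deriv b u (x + s *\<^sub>R y)\<bar> \<le> 1 * C b"
          using Basis_le_norm[OF b, of y] True C(2)[OF b inS[OF s', of y]] by (intro mult_mono) auto
        then show "\<bar>(y \<bullet> b) * partial_deriv b u (x + s *\<^sub>R y)\<bar> \<le> C b" by (simp add: abs_mult)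
      qed
      then show ?thesis unfolding abs_mult using bump_nonneg[of "Suc m" y] by (simp add: mult_right_mono)
    qed (simp add: bump_0)
  qed
  \<comment> \<open>Integration by parts takes place in the variable \<open>y\<close>, hence on the
    preimage of \<open>S\<close>, which contains the closed unit ball.\<close>
  define T where "T = (\<lambda>y. x + r *\<^sub>R y) -` S"
  have T: "open T" "cball 0 1 \<subseteq> T"
    unfolding T_def using inS[OF r] S by (auto intro!: open_vimage continuous_intros simp del: mem_cball) (meson mem_cball_0 subsetD)
  let ?g = "\<lambda>b y. partial_deriv b u (x + r *\<^sub>R y)"
  have gC: "Ck_on (Suc 0) T (?g b)" if "b \<in> Basis" for b
    unfolding T_def by (intro Ck_on_affine S Ck_on_partial_deriv C1 that)
  have ig: "integrable lborel (\<lambda>y. (y \<bullet> b) * ?g b y * bump (Suc m) y)" if "b \<in> Basis" for b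
    using gC[OF that] T(2) by (intro integrable_mult_bump continuous_intros) (auto dest!: Ck_on_imp_continuous intro: continuous_on_subset)
  have ig2: "integrable lborel (\<lambda>y. partial_deriv b (partial_deriv b u) (x + r *\<^sub>R y) * bump (Suc (Suc m)) y)" if "b \<in> Basis" for b
  proof (intro integrable_mult_bump)
    have "continuous_on S (partial_deriv b (partial_deriv b u))" using C1 that by (auto simp: Ck_on_Suc Ck_on_0)
    then show "continuous_on (cball 0 1) (\<lambda>y. partial_deriv b (partial_deriv b u) (x + r *\<^sub>R y))"
      by (rule continuous_on_compose2) (use inS[OF r] S(2) in \<open>auto intro!: continuous_intros\<close>)
  qed
  have parts: "2 * real (m + 2) * (\<integral>y. (y \<bullet> b) * ?g b y * bump (Suc m) y \<partial>lborel)
     = r * (\<integral>y. partial_deriv b (partial_deriv b u) (x + r *\<^sub>R y) * bump (Suc (Suc m)) y \<partial>lborel)" if b: "b \<in> Basis" for b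
  proof -
    have e: "partial_deriv b (?g b) y * bump (Suc (Suc m)) y = r * (partial_deriv b (partial_deriv b u) (x + r *\<^sub>R y) * bump (Suc (Suc m)) y)" for y
    proof (cases "norm y < 1")
      case True
      then have "partial_deriv b u differentiable (at (x + r *\<^sub>R y))"
        using Ck_2_differentiable[OF u _ b] inS[OF r, of y] S(2) by auto
      then show ?thesis by (simp add: partial_deriv_affine)
    qed (simp add: bump_0)
    show ?thesis using integral_bump_parts[OF T gC[OF b] b, of m] unfolding e by simp
  qed
  have "(\<integral>y. ?f' r y \<partial>lborel) = (\<Sum>b\<in>Basis. \<integral>y. (y \<bullet> b) * ?g b y * bump (Suc m) y \<partial>lborel)"
    unfolding sum_distrib_right using ig by (rule Bochner_Integration.integral_sum)
  also have "\<dots> = (\<Sum>b\<in>Basis. r / (2 * real (m + 2)) * (\<integral>y. partial_deriv b (partial_deriv b u) (x + r *\<^sub>R y) * bump (Suc (Suc m)) y \<partial>lborel))"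
    using parts by (intro sum.cong refl) (simp add: field_simps)
  also have "\<dots> = r / (2 * real (m + 2)) * (\<integral>y. lap u (x + r *\<^sub>R y) * bump (Suc (Suc m)) y \<partial>lborel)"
    unfolding lap_def sum_distrib_right sum_distrib_left[symmetric]
    using ig2 by (subst Bochner_Integration.integral_sum) auto
  finally show ?thesis using D by simp
qed

text \<open>Solid averages for all weights at once, so that kernels of every order of smoothness
  reproduce \<open>u\<close>. Only closed balls inside \<open>S\<close> are tested, so the notion
  makes sense for closed \<open>S\<close> too.\<close>

definition mean_property :: "'a::euclidean_space set \<Rightarrow> ('a \<Rightarrow> real) \<Rightarrow> bool" where
  "mean_property S u \<longleftrightarrow> (\<forall>m x r. 0 < r \<longrightarrow> cball x r \<subseteq> S \<longrightarrow>
      (\<integral>y. u (x + r *\<^sub>R y) * bump (Suc m) y \<partial>lborel) = u x * bump_mass TYPE('a) (Suc m))"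

text \<open>The weighted mean has derivative zero on an interval of radii around 0, and at radius 0
  it is the value at the centre times the mass.\<close>

lemma harm_imp_mean_property:
  assumes "harm S u" shows "mean_property S u"
  unfolding mean_property_def
proof (intro allI impI)
  fix m x and r :: real assume r: "0 < r" "cball x r \<subseteq> S"
  have S: "open S" "Ck_on 2 S u" "\<And>x. x \<in> S \<Longrightarrow> lap u x = 0" using assms by (auto simp: harm_def)
  \<comment> \<open>Room beyond \<open>r\<close> makes \<open>r\<close> an interior point of the
    interval of radii.\<close>
  obtain R where R: "r < R" "cball x R \<subseteq> S" using cball_enlarge[OF S(1) r(2)] r(1) by auto
  let ?J = "\<lambda>r. \<integral>y. u (x + r *\<^sub>R y) * bump (Suc m) y \<partial>lborel"
  have "(?J has_real_derivative 0) (at s)" if s: "\<bar>s\<bar> < R" for s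
  proof -
    have "lap u (x + s *\<^sub>R y) * bump (Suc (Suc m)) y = 0" for y :: 'a
    proof (cases "norm y < 1")
      case True
      have "norm (s *\<^sub>R y) \<le> R * 1" unfolding norm_scaleR using s True by (intro mult_mono) auto
      then have "x + s *\<^sub>R y \<in> cball x R" by (simp add: dist_norm)
      then show ?thesis using S(3) R(2) by auto
    qed (simp add: bump_0)
    then have "(\<integral>y. lap u (x + s *\<^sub>R y) * bump (Suc (Suc m)) y \<partial>lborel) = 0"
      by (simp only: integral_zero)
    then show ?thesis using weighted_mean_has_derivative[OF S(1) R(2) S(2) s, of m] by simp
  qed
  then have "?J r = ?J 0"
    using R r(1) by (intro DERIV_isconst3[of "-R" R r 0 ?J]) auto
  then show "?J r = u x * bump_mass TYPE('a) (Suc m)" by (simp add: bump_mass_def)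
qed

text \<open>Rescaling the mean value formula writes \<open>u\<close> near \<open>x0\<close> as a
  multiple of the convolution of its cut-off with a bump of radius \<open>\<rho>\<close>, whose
  exponent is chosen to match the order \<open>k\<close>.\<close>

lemma mean_property_imp_Ck_on:
  fixes u :: "'a::euclidean_space \<Rightarrow> real"
  assumes S: "open S" and int: "\<And>x r. cball x r \<subseteq> S \<Longrightarrow> integrable lborel (\<lambda>y. indicator (cball x r) y * u y)"
    and mp: "mean_property S u"
  shows "Ck_on k S u"
proof (rule Ck_on_local)
  fix x0 assume "x0 \<in> S"
  then obtain R where R: "0 < R" "cball x0 R \<subseteq> S" using S open_contains_cball by blast
  \<comment> \<open>Half of \<open>R\<close>, so that balls of radius \<open>\<rho>\<close> around
    points of \<open>ball x0 \<rho>\<close> stay where the cut-off factor is 1.\<close>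
  define \<rho> where "\<rho> = R / 2"
  have \<rho>: "0 < \<rho>" "\<rho> + \<rho> \<le> R" using R by (auto simp: \<rho>_def)
  let ?h = "\<lambda>y. indicator (cball x0 R) y * u y"
  let ?\<kappa> = "\<lambda>y::'a. bump (Suc k) (0 + (1/\<rho>) *\<^sub>R y)"
  let ?c = "\<rho> ^ DIM('a) * bump_mass TYPE('a) (Suc k)"
  have h: "integrable lborel ?h" by (rule int[OF R(2)])
  then have [measurable]: "?h \<in> borel_measurable borel" using borel_measurable_integrable by auto
  have c: "0 < ?c" using \<rho> bump_mass_pos by (intro mult_pos_pos) auto
  have \<kappa>: "Ck_on k UNIV ?\<kappa>" using Ck_on_affine[OF open_UNIV Ck_on_bump, of k 0 "1/\<rho>"] by simp
  have \<kappa>0: "?\<kappa> y = 0" if "\<rho> < norm y" for y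
    using that \<rho> by (intro bump_0) (simp add: field_simps)
  have u: "u x = (1 / ?c) * conv ?h ?\<kappa> x" if x: "x \<in> ball x0 \<rho>" for x
  proof -
    have sub: "cball x \<rho> \<subseteq> cball x0 R" 
      using x \<rho> by (auto simp: subset_iff) (smt (verit) dist_triangle)
    have "u x * bump_mass TYPE('a) (Suc k) = (\<integral>y. u (x + \<rho> *\<^sub>R y) * bump (Suc k) y \<partial>lborel)"
      using mp \<rho>(1) order_trans[OF sub R(2)] unfolding mean_property_def by simp
    also have "\<dots> = (\<integral>y. ?h (x + \<rho> *\<^sub>R y) * bump (Suc k) y \<partial>lborel)"
    proof (rule Bochner_Integration.integral_cong[OF refl])
      fix y :: 'a
      show "u (x + \<rho> *\<^sub>R y) * bump (Suc k) y = ?h (x + \<rho> *\<^sub>R y) * bump (Suc k) y"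
      proof (cases "norm y < 1")
        case True
        then have "x + \<rho> *\<^sub>R y \<in> cball x \<rho>" using \<rho>(1) by (simp add: dist_norm)
        then show ?thesis using sub by (auto simp: indicator_def)
      qed (simp add: bump_0)
    qed
    also have "\<rho> ^ DIM('a) * \<dots> = (\<integral>z. ?h z * bump (Suc k) ((1/\<rho>) *\<^sub>R (z - x)) \<partial>lborel)"
      using lborel_integral_affine[of \<rho> "\<lambda>z. ?h z * bump (Suc k) ((1/\<rho>) *\<^sub>R (z - x))" x] \<rho>(1) by simp
    also have "\<dots> = conv ?h ?\<kappa> x"
      unfolding conv_def by (subst bump_minus[symmetric]) (simp add: scaleR_minus_right[symmetric] del: scaleR_minus_right)
    finally have "conv ?h ?\<kappa> x = ?c * u x" by (simp only: mult_ac)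
    moreover have "?c \<noteq> 0" using c by linarith
    ultimately show ?thesis by (metis nonzero_mult_div_cancel_left times_divide_eq_left mult_1_left)
  qed
  have "Ck_on k UNIV (\<lambda>x. (1 / ?c) * conv ?h ?\<kappa> x)"
    by (intro Ck_on_cmult Ck_on_conv[OF h \<kappa> \<kappa>0]) auto
  then have "Ck_on k (ball x0 \<rho>) (\<lambda>x. (1 / ?c) * conv ?h ?\<kappa> x)" by (rule Ck_on_subset) auto
  then have "Ck_on k (ball x0 \<rho>) u" 
    by (rule Ck_on_cong[rotated 2]) (use u in auto)
  then show "\<exists>U. open U \<and> x0 \<in> U \<and> Ck_on k U u" using \<rho> by (intro exI[of _ "ball x0 \<rho>"]) auto
qed

text \<open>If the Laplacian had a sign at \<open>x\<close>, it would keep it on a small ball, and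
  the radial derivative of the weighted mean would be nonzero although the mean is constant. The
  factor \<open>s\<close> treats both signs.\<close>

lemma mean_property_imp_harm:
  fixes u :: "'a::euclidean_space \<Rightarrow> real"
  assumes S: "open S" and int: "\<And>x r. cball x r \<subseteq> S \<Longrightarrow> integrable lborel (\<lambda>y. indicator (cball x r) y * u y)"
    and mp: "mean_property S u"
  shows "harm S u"
proof -
  have C: "Ck_on 2 S u" by (rule mean_property_imp_Ck_on[OF assms])
  have L: "\<not> 0 < s * lap u x" if x: "x \<in> S" and s: "s \<noteq> 0" for x s
  proof
    assume pos: "0 < s * lap u x"
    have "continuous_on S (lap u)" unfolding lap_def[abs_def]
      using C by (intro continuous_on_sum) (auto simp: Ck_2_iff Ck_on_Suc Ck_on_0)
    then have "continuous_on S (\<lambda>x. s * lap u x)" by (intro continuous_intros)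
    then have "isCont (\<lambda>x. s * lap u x) x" using x S by (simp add: continuous_on_eq_continuous_at)
    then have "\<forall>\<^sub>F z in at x. s * lap u x / 2 < s * lap u z"
      using pos by (intro order_tendstoD(1)[OF isContD]) auto
    then obtain e where e: "e > 0" "\<And>z. z \<noteq> x \<Longrightarrow> dist z x < e \<Longrightarrow> s * lap u x / 2 < s * lap u z"
      unfolding eventually_at by auto
    obtain R where R: "0 < R" "cball x R \<subseteq> S" using S x open_contains_cball by blast
    define r where "r = min e R / 2"
    have r: "0 < r" "r < e" "r < R" using e R by (auto simp: r_def)
    let ?I = "\<integral>y. lap u (x + r *\<^sub>R y) * bump (Suc (Suc 0)) y \<partial>lborel"
    have 1: "((\<lambda>r. \<integral>y. u (x + r *\<^sub>R y) * bump (Suc 0) y \<partial>lborel) has_real_derivative r / (2 * real (0 + 2)) * ?I) (at r)"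
      by (rule weighted_mean_has_derivative[OF S R(2) C]) (use r in auto)
    have "((\<lambda>r. \<integral>y. u (x + r *\<^sub>R y) * bump (Suc 0) y \<partial>lborel) has_real_derivative 0) (at r)"
    proof (rule has_field_derivative_transform_within_open[where S="{0<..<R}"])
      show "((\<lambda>r. u x * bump_mass TYPE('a) (Suc 0)) has_real_derivative 0) (at r)" by simp
      fix t assume "t \<in> {0<..<R}"
      then have "cball x t \<subseteq> S" using R(2) by auto
      then show "u x * bump_mass TYPE('a) (Suc 0) = (\<integral>y. u (x + t *\<^sub>R y) * bump (Suc 0) y \<partial>lborel)"
        using mp \<open>t \<in> {0<..<R}\<close> unfolding mean_property_def by simp
    qed (use r in auto)
    with 1 have "r / (2 * real (0 + 2)) * ?I = 0" by (rule DERIV_unique)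
    then have I0: "?I = 0" using r by simp
    have inS: "x + r *\<^sub>R y \<in> cball x R" if "norm y \<le> 1" for y
    proof -
      have "norm (r *\<^sub>R y) \<le> r * 1" unfolding norm_scaleR using that r by (intro mult_mono) auto
      moreover have "dist x (x + r *\<^sub>R y) = norm (r *\<^sub>R y)" by (simp add: dist_norm)
      ultimately show ?thesis using r by (simp only: mem_cball)
    qed
    have "continuous_on (cball 0 1) (\<lambda>y. lap u (x + r *\<^sub>R y))"
      by (rule continuous_on_compose2[OF \<open>continuous_on S (lap u)\<close>]) (use inS R(2) in \<open>auto intro!: continuous_intros\<close>)
    then have i: "integrable lborel (\<lambda>y. lap u (x + r *\<^sub>R y) * bump (Suc (Suc 0)) y)" by (rule integrable_mult_bump)
    have "s * lap u x / 2 * bump_mass TYPE('a) (Suc (Suc 0)) = (\<integral>y. s * lap u x / 2 * bump (Suc (Suc 0)) (y::'a) \<partial>lborel)"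
      by (simp add: bump_mass_def)
    also have "\<dots> \<le> (\<integral>y. s * (lap u (x + r *\<^sub>R y) * bump (Suc (Suc 0)) y) \<partial>lborel)"
    proof (rule integral_mono)
      show "integrable lborel (\<lambda>y::'a. s * lap u x / 2 * bump (Suc (Suc 0)) y)"
        by (intro integrable_mult_right integrable_bump)
      show "integrable lborel (\<lambda>y. s * (lap u (x + r *\<^sub>R y) * bump (Suc (Suc 0)) y))"
        by (intro integrable_mult_right i)
      fix y :: 'a
      show "s * lap u x / 2 * bump (Suc (Suc 0)) y \<le> s * (lap u (x + r *\<^sub>R y) * bump (Suc (Suc 0)) y)"
      proof (cases "norm y < 1")
        case True
        have "s * lap u x / 2 \<le> s * lap u (x + r *\<^sub>R y)"
        proof (cases "y = 0")
          case False
          have "norm (r *\<^sub>R y) \<le> r * 1" unfolding norm_scaleR using True r by (intro mult_mono) auto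
          moreover have "dist (x + r *\<^sub>R y) x = norm (r *\<^sub>R y)" by (simp add: dist_norm)
          ultimately have "dist (x + r *\<^sub>R y) x < e" using r by linarith
          then show ?thesis using e(2)[of "x + r *\<^sub>R y"] False r by simp
        qed (use pos in auto)
        then show ?thesis unfolding mult.assoc[symmetric] by (rule mult_right_mono) (rule bump_nonneg)
      qed (simp add: bump_0)
    qed
    also have "\<dots> = 0" using I0 by simp
    finally have "s * lap u x / 2 * bump_mass TYPE('a) (Suc (Suc 0)) \<le> 0" .
    moreover have "0 < s * lap u x / 2 * bump_mass TYPE('a) (Suc (Suc 0))"
      by (intro mult_pos_pos bump_mass_pos) (use pos in simp)
    ultimately show False by linarith
  qed
  have "lap u x = 0" if "x \<in> S" for x
    using L[OF that, of 1] L[OF that, of "-1"] by simp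
  then show ?thesis using S C by (simp add: harm_def)
qed

lemma integrable_indicator_bounded:
  fixes u :: "'a::euclidean_space \<Rightarrow> real"
  assumes "(\<lambda>y. indicator (cball x r) y * u y) \<in> borel_measurable borel" "\<And>y. y \<in> cball x r \<Longrightarrow> \<bar>u y\<bar> \<le> C"
  shows "integrable lborel (\<lambda>y. indicator (cball x r) y * u y)"
proof (rule Bochner_Integration.integrable_bound)
  show "integrable lborel (\<lambda>y. C * indicator (cball x r) y)"
    by (intro integrable_mult_right integrable_indicator_cball)
  show "(\<lambda>y. indicator (cball x r) y * u y) \<in> borel_measurable lborel" using assms(1) by simp
  show "AE y in lborel. norm (indicator (cball x r) y * u y) \<le> norm (C * indicator (cball x r) y)"
    using assms(2) by (auto simp: indicator_def intro!: AE_I2 order_trans[OF _ abs_ge_self])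
qed

text \<open>The mean value property passes to locally bounded pointwise limits by dominated
  convergence, and together with integrability it implies harmonicity. Continuity of the limit is
  part of the conclusion.\<close>

lemma harm_limit:
  fixes u :: "nat \<Rightarrow> 'a::euclidean_space \<Rightarrow> real"
  assumes S: "open S" and u: "\<And>n. harm S (u n)" and lim: "\<And>x. x \<in> S \<Longrightarrow> (\<lambda>n. u n x) \<longlonglongrightarrow> v x"
    and bnd: "\<And>K. compact K \<Longrightarrow> K \<subseteq> S \<Longrightarrow> \<exists>C. \<forall>n. \<forall>x\<in>K. \<bar>u n x\<bar> \<le> C"
  shows "harm S v"
proof (rule mean_property_imp_harm[OF S])
  fix x :: 'a and r :: real assume xr: "cball x r \<subseteq> S"
  obtain C where C: "\<And>n y. y \<in> cball x r \<Longrightarrow> \<bar>u n y\<bar> \<le> C" using bnd[OF compact_cball xr] by blast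
  show "integrable lborel (\<lambda>y. indicator (cball x r) y * v y)"
  proof (rule integrable_indicator_bounded)
    show "(\<lambda>y. indicator (cball x r) y * v y) \<in> borel_measurable borel"
    proof (rule borel_measurable_LIMSEQ_real)
      show "(\<lambda>n. indicator (cball x r) y * u n y) \<longlonglongrightarrow> indicator (cball x r) y * v y" for y
        using lim[of y] xr by (cases "y \<in> cball x r") auto
      show "(\<lambda>y. indicator (cball x r) y * u n y) \<in> borel_measurable borel" for n
        using borel_integrable_compact[OF compact_cball, of x r "u n"] 
          continuous_on_subset[OF harm_imp_continuous[OF u] xr] borel_measurable_integrable by fastforce
    qed
    show "\<bar>v y\<bar> \<le> C" if "y \<in> cball x r" for y
      by (rule LIMSEQ_le_const2[OF tendsto_rabs[OF lim]]) (use that xr C in auto)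
  qed
next
  show "mean_property S v"
    unfolding mean_property_def
  proof (intro allI impI)
    fix m and x :: 'a and r :: real assume r: "0 < r" and xr: "cball x r \<subseteq> S"
    obtain C where C: "\<And>n y. y \<in> cball x r \<Longrightarrow> \<bar>u n y\<bar> \<le> C" using bnd[OF compact_cball xr] by blast
    have inS: "x + r *\<^sub>R y \<in> cball x r" if "norm y \<le> 1" for y
      using that r by (simp add: dist_norm)
    have m: "(\<lambda>y. u n (x + r *\<^sub>R y) * bump (Suc m) y) \<in> borel_measurable lborel" for n
      by (rule borel_measurable_integrable, intro integrable_mult_bump continuous_on_compose2[OF harm_imp_continuous[OF u]] continuous_intros)
        (use inS xr in auto)
    have l: "(\<lambda>n. u n (x + r *\<^sub>R y) * bump (Suc m) y) \<longlonglongrightarrow> v (x + r *\<^sub>R y) * bump (Suc m) y" for y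
      using inS[of y] xr by (cases "norm y < 1") (auto simp: bump_0 intro!: tendsto_intros lim)
    have "(\<lambda>n. \<integral>y. u n (x + r *\<^sub>R y) * bump (Suc m) y \<partial>lborel) \<longlonglongrightarrow> (\<integral>y. v (x + r *\<^sub>R y) * bump (Suc m) y \<partial>lborel)"
    proof (rule integral_dominated_convergence[where w="\<lambda>y. C * bump (Suc m) y"])
      show "(\<lambda>y. v (x + r *\<^sub>R y) * bump (Suc m) y) \<in> borel_measurable lborel"
        by (rule borel_measurable_LIMSEQ_real[OF l m])
      show "integrable lborel (\<lambda>y::'a. C * bump (Suc m) y)" by (intro integrable_mult_right integrable_bump)
      have "norm (u n (x + r *\<^sub>R y) * bump (Suc m) y) \<le> C * bump (Suc m) y" for n y
      proof (cases "norm y < 1")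
        case True
        then show ?thesis using C[OF inS[of y], of n] bump_nonneg[of "Suc m" y] by (simp add: abs_mult mult_right_mono)
      qed (simp add: bump_0)
      then show "AE y in lborel. norm (u n (x + r *\<^sub>R y) * bump (Suc m) y) \<le> C * bump (Suc m) y" for n by simp
    qed (use m l in auto)
    moreover have "(\<integral>y. u n (x + r *\<^sub>R y) * bump (Suc m) y \<partial>lborel) = u n x * bump_mass TYPE('a) (Suc m)" for n
      using harm_imp_mean_property[OF u] r xr unfolding mean_property_def by blast
    moreover have "(\<lambda>n. u n x * bump_mass TYPE('a) (Suc m)) \<longlonglongrightarrow> v x * bump_mass TYPE('a) (Suc m)"
      using r xr by (intro tendsto_intros lim) auto
    ultimately show "(\<integral>y. v (x + r *\<^sub>R y) * bump (Suc m) y \<partial>lborel) = v x * bump_mass TYPE('a) (Suc m)"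
      using LIMSEQ_unique by simp
  qed
qed

section \<open>The maximum principle and the Newton kernel\<close>

text \<open>The first derivative along \<open>b\<close> vanishes at the maximum; were the second one
  positive, the function would increase just beyond \<open>x\<close> in this direction.\<close>

lemma partial_deriv_2_le_0_at_max:
  fixes w :: "'a::euclidean_space \<Rightarrow> real"
  assumes S: "open S" "x \<in> S" and C: "Ck_on 2 S w" and max: "\<And>y. y \<in> S \<Longrightarrow> w y \<le> w x" and b: "b \<in> Basis"
  shows "partial_deriv b (partial_deriv b w) x \<le> 0"
proof (rule ccontr)
  assume "\<not> ?thesis"
  then have pos: "0 < partial_deriv b (partial_deriv b w) x" by simp
  obtain r where r: "0 < r" "ball x r \<subseteq> S" using S open_contains_ball by blast
  have inS: "x + t *\<^sub>R b \<in> S" if "\<bar>t\<bar> < r" for t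
    using r(2) that b by (auto simp: subset_iff dist_norm)
  have d1: "((\<lambda>t. w (x + t *\<^sub>R b)) has_real_derivative partial_deriv b w (x + t *\<^sub>R b)) (at t)" if "\<bar>t\<bar> < r" for t
    by (intro has_real_derivative_line Ck_2_differentiable[OF C inS[OF that] b])
  have d2: "((\<lambda>t. partial_deriv b w (x + t *\<^sub>R b)) has_real_derivative partial_deriv b (partial_deriv b w) (x + 0 *\<^sub>R b)) (at 0)"
    by (intro has_real_derivative_line Ck_2_differentiable[OF C inS b]) (use r in auto)
  have z: "partial_deriv b w (x + 0 *\<^sub>R b) = 0"
    by (rule DERIV_local_max[OF d1[of 0] r(1)]) (use r(1) max[OF inS] in auto)
  obtain e where e: "e > 0" "\<And>h. 0 < h \<Longrightarrow> h < e \<Longrightarrow> partial_deriv b w (x + 0 *\<^sub>R b) < partial_deriv b w (x + (0 + h) *\<^sub>R b)"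
    using DERIV_pos_inc_right[OF d2] pos by auto
  define h where "h = min e r / 2"
  have h: "0 < h" "h < e" "h < r" using e r by (auto simp: h_def)
  have "\<exists>t>0. t < h \<and> w (x + h *\<^sub>R b) - w (x + 0 *\<^sub>R b) = (h - 0) * partial_deriv b w (x + t *\<^sub>R b)"
    by (rule MVT2[OF h(1)]) (use d1 h in auto)
  then obtain t where t: "0 < t" "t < h" "w (x + h *\<^sub>R b) - w x = h * partial_deriv b w (x + t *\<^sub>R b)" by auto
  have "0 < h * partial_deriv b w (x + t *\<^sub>R b)" using e(2)[of t] t h z by simp
  then show False using t(3) max[OF inS[of h]] h by simp
qed

lemma lap_dist_squared:
  fixes c :: "'a::euclidean_space"
  shows "Ck_on k UNIV (\<lambda>x. (x - c) \<bullet> (x - c))" "lap (\<lambda>x. (x - c) \<bullet> (x - c)) x = 2 * real DIM('a)"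
proof -
  show "Ck_on k UNIV (\<lambda>x. (x - c) \<bullet> (x - c))"
    using Ck_on_affine[OF open_UNIV Ck_on_inner_self, of k "- c" 1] by simp
  have 1: "partial_deriv b (\<lambda>x. (x - c) \<bullet> (x - c)) = (\<lambda>x. 2 * ((x - c) \<bullet> b))" for b
  proof
    fix x
    have "((\<lambda>x. (x - c) \<bullet> (x - c)) has_derivative (\<lambda>v. 2 * ((x - c) \<bullet> v))) (at x)"
      by (auto intro!: derivative_eq_intros simp: inner_commute)
    then show "partial_deriv b (\<lambda>x. (x - c) \<bullet> (x - c)) x = 2 * ((x - c) \<bullet> b)" by (rule partial_deriv_eq)
  qed
  have 2: "partial_deriv b (\<lambda>x. 2 * ((x - c) \<bullet> b)) x = 2 * (b \<bullet> b)" for b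
  proof (rule partial_deriv_eq[where f'="\<lambda>v. 2 * (v \<bullet> b)"])
    show "((\<lambda>x. 2 * ((x - c) \<bullet> b)) has_derivative (\<lambda>v. 2 * (v \<bullet> b))) (at x)"
      by (auto intro!: derivative_eq_intros)
  qed
  show "lap (\<lambda>x. (x - c) \<bullet> (x - c)) x = 2 * real DIM('a)"
    unfolding lap_def 1 2 by simp
qed

text \<open>If \<open>u x0 = 2 * e\<close> were positive, the set where \<open>u\<close> is at least
  \<open>e\<close> would be compact, by the conditions at the frontier and at infinity. Adding a
  small multiple of the squared distance to \<open>x0\<close> makes the Laplacian positive at an
  interior maximum, against the second derivative test. The condition at infinity makes the
  principle available on half spaces.\<close>

lemma harm_max_principle:
  fixes u :: "'a::euclidean_space \<Rightarrow> real"
  assumes u: "harm \<Omega> u"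
    and bd: "\<And>q e. q \<in> frontier \<Omega> \<Longrightarrow> 0 < e \<Longrightarrow> eventually (\<lambda>x. u x < e) (at q within \<Omega>)"
    and inf: "\<And>e. 0 < e \<Longrightarrow> eventually (\<lambda>x. u x < e) (inf at_infinity (principal \<Omega>))"
    and x0: "x0 \<in> \<Omega>"
  shows "u x0 \<le> 0"
proof (rule ccontr)
  assume "\<not> ?thesis"
  then have pos: "0 < u x0" by simp
  define e where "e = u x0 / 2"
  have e: "0 < e" "u x0 = 2 * e" using pos by (auto simp: e_def)
  have op: "open \<Omega>" and C: "Ck_on 2 \<Omega> u" using u by (auto simp: harm_def)
  have cont: "continuous_on \<Omega> u" using harm_imp_continuous[OF u] .
  define K where "K = {x \<in> \<Omega>. e \<le> u x}"
  have "\<exists>B. \<forall>x. B \<le> norm x \<longrightarrow> x \<in> \<Omega> \<longrightarrow> u x < e"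
    using inf[OF e(1)] unfolding eventually_inf_principal eventually_at_infinity .
  then obtain B where B: "\<And>x. x \<in> \<Omega> \<Longrightarrow> B \<le> norm x \<Longrightarrow> u x < e" by blast
  have Kb: "bounded K" unfolding bounded_iff K_def using B by (intro exI[of _ B]) (force simp: not_le)
  have Kc: "closed K"
    unfolding closed_limpt
  proof (intro allI impI)
    fix x assume x: "x islimpt K"
    have fr: "frequently (\<lambda>y. y \<in> K) (at x)" using x by (simp add: islimpt_conv_frequently_at)
    show "x \<in> K"
    proof (cases "x \<in> \<Omega>")
      case True
      show ?thesis
      proof (rule ccontr)
        assume "x \<notin> K"
        then have "u x < e" using True by (simp add: K_def)
        moreover have "isCont u x" using cont op True by (simp add: continuous_on_eq_continuous_at)
        ultimately have "eventually (\<lambda>y. u y < e) (at x)" using order_tendstoD(2)[OF isContD] by blast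
        then have "eventually (\<lambda>y. y \<notin> K) (at x)" by eventually_elim (simp add: K_def)
        then show False using fr unfolding frequently_def by blast
      qed
    next
      case False
      have "x islimpt \<Omega>" using x by (rule islimpt_subset) (auto simp: K_def)
      then have "x \<in> frontier \<Omega>" using False op by (simp add: frontier_def interior_open closure_def)
      then have "eventually (\<lambda>y. y \<in> \<Omega> \<longrightarrow> u y < e) (at x)" 
        using bd[OF _ e(1)] unfolding eventually_at_filter by (auto elim!: eventually_mono)
      then have "eventually (\<lambda>y. y \<notin> K) (at x)" by eventually_elim (auto simp: K_def)
      then show ?thesis using fr unfolding frequently_def by blast
    qed
  qed
  have K: "compact K" using Kb Kc by (simp add: compact_eq_bounded_closed)
  have x0K: "x0 \<in> K" using x0 e by (simp add: K_def)
  obtain B' where B': "0 < B'" "\<And>x. x \<in> K \<Longrightarrow> norm (x - x0) \<le> B'"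
  proof -
    have "bounded ((\<lambda>x. x - x0) ` K)" using Kb by (simp add: bounded_translation_minus)
    then show thesis using that unfolding bounded_pos by auto
  qed
  \<comment> \<open>With this factor the perturbation is at most \<open>e / 2\<close> on
    \<open>K\<close>. The maximum of \<open>w\<close> is at least \<open>2 * e\<close>, so
    \<open>e < u x1\<close> and \<open>x1\<close> has a neighbourhood inside
    \<open>K\<close>.\<close>
  define \<eta> where "\<eta> = e / (2 * B' * B')"
  have \<eta>: "0 < \<eta>" using e B' by (simp add: \<eta>_def)
  define q where "q x = (x - x0) \<bullet> (x - x0)" for x
  define w where "w x = u x + \<eta> * q x" for x
  have "continuous_on K w" unfolding w_def q_def
    using cont by (intro continuous_intros) (auto simp: K_def intro: continuous_on_subset)
  then obtain x1 where x1: "x1 \<in> K" "\<And>y. y \<in> K \<Longrightarrow> w y \<le> w x1"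
    using continuous_attains_sup[OF K] x0K by blast
  have "norm (x1 - x0) ^ 2 \<le> B' ^ 2" by (rule power_mono[OF B'(2)[OF x1(1)]]) simp
  then have "q x1 \<le> B' * B'" by (simp only: q_def power2_norm_eq_inner[symmetric] power2_eq_square[of B'])
  then have "\<eta> * q x1 \<le> e / 2" using \<eta> B'(1) e(1) mult_left_mono[of "q x1" "B' * B'" \<eta>] by (simp add: \<eta>_def)
  moreover have "2 * e \<le> w x1" using x1(2)[OF x0K] e(2) by (simp add: w_def q_def)
  ultimately have ux1: "e < u x1" using e(1) by (simp add: w_def)
  have x1O: "x1 \<in> \<Omega>" using x1(1) by (simp add: K_def)
  define S where "S = \<Omega> \<inter> u -` {e<..}"
  have S: "open S" "x1 \<in> S" "S \<subseteq> \<Omega>" "S \<subseteq> K"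
    unfolding S_def using continuous_open_preimage[OF cont op, of "{e<..}"] x1O ux1 by (auto simp: K_def)
  have Cu: "Ck_on 2 S u" using C S(3) by (rule Ck_on_subset)
  have Cq: "Ck_on 2 S (\<lambda>x. \<eta> * q x)" unfolding q_def
    by (intro Ck_on_cmult S Ck_on_subset[OF lap_dist_squared(1)]) auto
  have Cw: "Ck_on 2 S w" unfolding w_def using Ck_on_add[OF S(1) Cu Cq] .
  have "lap w x1 = lap u x1 + \<eta> * lap q x1"
    unfolding w_def using lap_add[OF S(1,2) Cu Cq] lap_cmult[OF open_UNIV _ lap_dist_squared(1), of x1 \<eta> x0]
    by (simp add: q_def[abs_def])
  also have "\<dots> = \<eta> * (2 * real DIM('a))"
    using u x1O lap_dist_squared(2)[of x0 x1] by (simp add: harm_def q_def[abs_def])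
  finally have "0 < lap w x1" using \<eta> by simp
  moreover have "lap w x1 \<le> 0"
    unfolding lap_def using partial_deriv_2_le_0_at_max[OF S(1,2) Cw] x1(2) S(4) by (intro sum_nonpos) auto
  ultimately show False by simp
qed

lemma harm_le_on_bounded:
  fixes u v :: "'a::euclidean_space \<Rightarrow> real"
  assumes "bounded U" "harm U u" "harm U v" "continuous_on (closure U) u" "continuous_on (closure U) v"
    and le: "\<And>q. q \<in> frontier U \<Longrightarrow> u q \<le> v q" and x: "x \<in> closure U"
  shows "u x \<le> v x"
proof (cases "x \<in> U")
  case True
  have "u x - v x \<le> 0"
  proof (rule harm_max_principle[of U "\<lambda>x. u x - v x"])
    show "harm U (\<lambda>x. u x - v x)" by (intro harm_diff assms)
    fix e :: real assume e: "0 < e"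
    obtain B where "\<And>x. x \<in> U \<Longrightarrow> norm x \<le> B" using assms(1) by (auto simp: bounded_iff)
    then show "eventually (\<lambda>x. u x - v x < e) (inf at_infinity (principal U))"
      unfolding eventually_inf_principal eventually_at_infinity by (intro exI[of _ "B + 1"]) force
    fix q assume q: "q \<in> frontier U"
    then have qc: "q \<in> closure U" by (simp add: frontier_def)
    have "((\<lambda>x. u x - v x) \<longlongrightarrow> u q - v q) (at q within closure U)"
      using assms(4,5) qc by (intro tendsto_diff) (auto simp: continuous_on_def)
    then have "((\<lambda>x. u x - v x) \<longlongrightarrow> u q - v q) (at q within U)"
      by (rule tendsto_within_subset) (rule closure_subset)
    then show "eventually (\<lambda>x. u x - v x < e) (at q within U)"
      by (rule order_tendstoD(2)) (use le[OF q] e in simp)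
  qed (rule True)
  then show ?thesis by simp
next
  case False
  then have "x \<in> frontier U" using x assms(2) by (simp add: frontier_def interior_open harm_def)
  then show ?thesis by (rule le)
qed

section \<open>Scaling invariance and the Newton kernel\<close>

lemma harm_affine:
  fixes u :: "'a::euclidean_space \<Rightarrow> real"
  assumes "harm S u"
  shows "harm ((\<lambda>x. c + r *\<^sub>R x) -` S) (\<lambda>x. u (c + r *\<^sub>R x))"
proof -
  let ?T = "(\<lambda>x. c + r *\<^sub>R x) -` S"
  have S: "open S" "Ck_on 2 S u" using assms by (auto simp: harm_def)
  have T: "open ?T" by (intro open_vimage S) (auto intro!: continuous_intros)
  have "lap (\<lambda>x. u (c + r *\<^sub>R x)) x = 0" if x: "x \<in> ?T" for x
  proof -
    have "partial_deriv b (partial_deriv b (\<lambda>x. u (c + r *\<^sub>R x))) x = r * r * partial_deriv b (partial_deriv b u) (c + r *\<^sub>R x)"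
      if b: "b \<in> Basis" for b
    proof -
      have "partial_deriv b (partial_deriv b (\<lambda>x. u (c + r *\<^sub>R x))) x = partial_deriv b (\<lambda>x. r * partial_deriv b u (c + r *\<^sub>R x)) x"
        by (rule partial_deriv_cong[OF T x]) (use Ck_2_differentiable[OF S(2) _ b] in \<open>simp add: partial_deriv_affine\<close>)
      also have "\<dots> = r * partial_deriv b (\<lambda>x. partial_deriv b u (c + r *\<^sub>R x)) x"
        by (intro partial_deriv_cmult differentiable_compose[of "partial_deriv b u" "\<lambda>x. c + r *\<^sub>R x"])
          (use Ck_2_differentiable[OF S(2) _ b] x in \<open>auto intro!: derivative_intros\<close>)
      also have "\<dots> = r * (r * partial_deriv b (partial_deriv b u) (c + r *\<^sub>R x))"
        using Ck_2_differentiable[OF S(2) _ b] x by (simp add: partial_deriv_affine)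
      finally show ?thesis by simp
    qed
    then have "lap (\<lambda>x. u (c + r *\<^sub>R x)) x = r * r * lap u (c + r *\<^sub>R x)"
      by (simp add: lap_def sum_distrib_left)
    then show ?thesis using assms x by (simp add: harm_def)
  qed
  then show ?thesis using T Ck_on_affine[OF S] by (simp add: harm_def)
qed

text \<open>The fundamental solution of the Laplacian up to a constant. As
  \<open>0 powr a = 0\<close>, its value at the origin is 0 and not infinity, so the pole has to be
  treated apart.\<close>

definition newton :: "'a::euclidean_space \<Rightarrow> real" where
  "newton x = norm x powr (2 - real DIM('a))"

lemma Ck_on_powr:
  fixes q :: "'a::euclidean_space \<Rightarrow> real"
  assumes S: "open S" and pos: "\<And>x. x \<in> S \<Longrightarrow> 0 < q x"
  shows "Ck_on k S q \<Longrightarrow> Ck_on k S (\<lambda>x. q x powr a)"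
proof (induction k arbitrary: a)
  case 0
  then show ?case unfolding Ck_on_0 by (intro continuous_on_powr) (auto intro!: continuous_on_const dest!: pos)
next
  case (Suc k)
  let ?D = "\<lambda>y v. a * q y powr (a - 1) * frechet_derivative q (at y) v"
  show ?case
  proof (rule Ck_on_SucI[where f'="?D"])
    fix y assume y: "y \<in> S"
    have 1: "(q has_derivative frechet_derivative q (at y)) (at y)"
      using Suc.prems frechet_derivative_works y by (auto simp: Ck_on_Suc)
    have "((\<lambda>s. s powr a) has_derivative (*) (a * q y powr (a - 1))) (at (q y))"
      using has_real_derivative_powr[OF pos[OF y], of a] by (simp add: has_field_derivative_def)
    from has_derivative_compose[OF 1 this]
    show "((\<lambda>y. q y powr a) has_derivative ?D y) (at y)" .
  next
    fix b :: 'a assume b: "b \<in> Basis"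
    have "Ck_on k S (\<lambda>y. q y powr (a - 1))" "Ck_on k S (partial_deriv b q)"
      using Suc.IH[OF Ck_on_le[OF Suc.prems]] Ck_on_partial_deriv[OF Suc.prems b] by auto
    then show "Ck_on k S (\<lambda>y. ?D y b)"
      unfolding partial_deriv_def[abs_def] by (intro Ck_on_mult Ck_on_const S)
  qed (rule S)
qed

lemma newton_eq_powr: "newton (x::'a::euclidean_space) = (x \<bullet> x) powr ((2 - real DIM('a)) / 2)"
proof (cases "x = 0")
  case False
  have "(x \<bullet> x) powr ((2 - real DIM('a)) / 2) = ((norm x) powr 2) powr ((2 - real DIM('a)) / 2)"
    using False by (simp add: power2_norm_eq_inner[symmetric])
  also have "\<dots> = norm x powr (2 - real DIM('a))" 
    unfolding powr_powr by (rule arg_cong[where f="\<lambda>t. norm x powr t"]) (simp add: field_simps)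
  finally show ?thesis by (simp add: newton_def)
qed (simp add: newton_def)

lemma harm_newton: "harm (- {0}) (newton :: 'a::euclidean_space \<Rightarrow> real)"
proof -
  let ?S = "- {0::'a}" and ?N = "real DIM('a)"
  \<comment> \<open>Half the exponent of the norm, since the kernel is a power of the smooth
    function \<open>x \<bullet> x\<close>; harmonicity amounts to
    \<open>?N + 2 * a - 2 = 0\<close>.\<close>
  define a where "a = (2 - ?N) / 2"
  have n: "newton = (\<lambda>x::'a. (x \<bullet> x) powr a)" by (rule ext) (simp add: newton_eq_powr a_def)
  have S: "open ?S" by auto
  have d: "((\<lambda>x::'a. x \<bullet> x) has_derivative (\<lambda>v. 2 * (x \<bullet> v))) (at x)" for x
    by (auto intro!: derivative_eq_intros simp: inner_commute)
  have dp: "((\<lambda>x::'a. (x \<bullet> x) powr a) has_derivative (\<lambda>v. a * (x \<bullet> x) powr (a - 1) * (2 * (x \<bullet> v)))) (at x)" if "x \<noteq> 0" for x a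
  proof -
    have "((\<lambda>s. s powr a) has_derivative (*) (a * (x \<bullet> x) powr (a - 1))) (at (x \<bullet> x))"
      using has_real_derivative_powr[of "x \<bullet> x" a] that by (simp add: has_field_derivative_def)
    from has_derivative_compose[OF d this] show ?thesis .
  qed
  have p1: "partial_deriv b newton x = 2 * a * (x \<bullet> b) * (x \<bullet> x) powr (a - 1)" if "x \<in> ?S" for b x :: 'a
    using partial_deriv_eq[OF dp[of x a], of b] that unfolding n by simp
  have p2: "partial_deriv b (partial_deriv b newton) x
     = 2 * a * (b \<bullet> b) * (x \<bullet> x) powr (a - 1) + 4 * a * (a - 1) * ((x \<bullet> b) * (x \<bullet> b)) * (x \<bullet> x) powr (a - 2)" if x: "x \<in> ?S" for b x :: 'a
  proof -
    have "partial_deriv b (partial_deriv b newton) x = partial_deriv b (\<lambda>x. 2 * a * (x \<bullet> b) * (x \<bullet> x) powr (a - 1)) x"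
      by (rule partial_deriv_cong[OF S x p1])
    also have "\<dots> = 2 * a * (x \<bullet> b) * ((a - 1) * (x \<bullet> x) powr (a - 1 - 1) * (2 * (x \<bullet> b))) + 2 * a * (b \<bullet> b) * (x \<bullet> x) powr (a - 1)"
    proof (rule partial_deriv_eq[where f'="\<lambda>v. 2 * a * (x \<bullet> b) * ((a - 1) * (x \<bullet> x) powr (a - 1 - 1) * (2 * (x \<bullet> v))) + 2 * a * (v \<bullet> b) * (x \<bullet> x) powr (a - 1)"])
      show "((\<lambda>x. 2 * a * (x \<bullet> b) * (x \<bullet> x) powr (a - 1)) has_derivative 
        (\<lambda>v. 2 * a * (x \<bullet> b) * ((a - 1) * (x \<bullet> x) powr (a - 1 - 1) * (2 * (x \<bullet> v))) + 2 * a * (v \<bullet> b) * (x \<bullet> x) powr (a - 1))) (at x)"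
        by (rule has_derivative_mult[OF _ dp]) (use x in \<open>auto intro!: derivative_eq_intros\<close>)
    qed
    finally show ?thesis by (simp add: algebra_simps)
  qed
  have "lap newton x = 0" if x: "x \<in> ?S" for x :: 'a
  proof -
    have xx: "0 < x \<bullet> x" using x by simp
    have "lap newton x = 2 * a * ?N * (x \<bullet> x) powr (a - 1) + 4 * a * (a - 1) * (\<Sum>b\<in>Basis. (x \<bullet> b) * (x \<bullet> b)) * (x \<bullet> x) powr (a - 2)"
      unfolding lap_def using x by (simp add: p2 sum.distrib sum_distrib_left[symmetric] sum_distrib_right[symmetric])
    also have "(\<Sum>b\<in>Basis. (x \<bullet> b) * (x \<bullet> b)) = x \<bullet> x" by (rule euclidean_inner[symmetric])
    also have "4 * a * (a - 1) * (x \<bullet> x) * (x \<bullet> x) powr (a - 2) = 4 * a * (a - 1) * (x \<bullet> x) powr (a - 1)"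
      using xx powr_mult_base[of "x \<bullet> x" "a - 2"] by simp
    also have "2 * a * ?N * (x \<bullet> x) powr (a - 1) + 4 * a * (a - 1) * (x \<bullet> x) powr (a - 1) = 2 * a * (?N + 2 * a - 2) * (x \<bullet> x) powr (a - 1)"
      by (simp add: algebra_simps)
    also have "?N + 2 * a - 2 = 0" by (simp add: a_def field_simps)
    finally show ?thesis by simp
  qed
  moreover have "Ck_on 2 ?S (newton :: 'a \<Rightarrow> real)"
    unfolding n by (intro Ck_on_powr S Ck_on_subset[OF Ck_on_inner_self]) auto
  ultimately show ?thesis using S by (simp add: harm_def)
qed

lemma harm_newton_at: "harm (- {p}) (\<lambda>x::'a::euclidean_space. newton (x - p))"
proof -
  have "(\<lambda>x. - p + 1 *\<^sub>R x) -` (- {0}) = - {p}" by auto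
  then show ?thesis using harm_affine[OF harm_newton, of "- p" 1] by simp
qed

lemma newton_commute: "newton (x - y) = newton (y - x)"
  by (simp add: newton_def norm_minus_commute)

lemma newton_nonneg: "0 \<le> newton x" by (simp add: newton_def)

lemma newton_scale: "0 < r \<Longrightarrow> newton (r *\<^sub>R x) = r powr (2 - real DIM('a)) * newton (x::'a::euclidean_space)"
  by (simp add: newton_def powr_mult)

lemma newton_strict_antimono:
  fixes x y :: "'a::euclidean_space"
  shows
  "3 \<le> DIM('a) \<Longrightarrow> x \<noteq> 0 \<Longrightarrow> norm x < norm y \<Longrightarrow> newton y < newton (x::'a::euclidean_space)"
  unfolding newton_def by (rule powr_less_mono2_neg) auto

lemma newton_le_powr:
  "2 \<le> DIM('a) \<Longrightarrow> 0 < R \<Longrightarrow> R \<le> norm y \<Longrightarrow> newton (y::'a::euclidean_space) \<le> R powr (2 - real DIM('a))"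
  unfolding newton_def by (rule powr_mono2') auto

lemma continuous_on_newton: "continuous_on (- {p}) (\<lambda>x::'a::euclidean_space. newton (x - p))"
  by (rule harm_imp_continuous[OF harm_newton_at])

lemma newton_gt:
  assumes "3 \<le> DIM('a)" "0 < M"
  shows "\<exists>d>0. \<forall>x::'a::euclidean_space. x \<noteq> 0 \<longrightarrow> norm x < d \<longrightarrow> M < newton x"
proof (intro exI conjI allI impI)
  let ?a = "2 - real DIM('a)"
  \<comment> \<open>The witness is the radius at which the kernel takes the value
    \<open>M\<close>.\<close>
  show "0 < M powr (1 / ?a)" using assms by simp
  fix x :: 'a assume x: "x \<noteq> 0" "norm x < M powr (1 / ?a)"
  have "(M powr (1 / ?a)) powr ?a < norm x powr ?a" by (rule powr_less_mono2_neg) (use assms x in auto)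
  then show "M < newton x" unfolding newton_def powr_powr using assms by simp
qed

section \<open>The Dirichlet problem on a ball\<close>

lemma lap_mult:
  fixes f g :: "'a::euclidean_space \<Rightarrow> real"
  assumes S: "open S" "x \<in> S" and f: "Ck_on 2 S f" and g: "Ck_on 2 S g"
  shows "lap (\<lambda>x. f x * g x) x = f x * lap g x + 2 * (\<Sum>b\<in>Basis. partial_deriv b f x * partial_deriv b g x) + lap f x * g x"
proof -
  have "partial_deriv b (partial_deriv b (\<lambda>x. f x * g x)) x 
    = f x * partial_deriv b (partial_deriv b g) x + 2 * (partial_deriv b f x * partial_deriv b g x) + partial_deriv b (partial_deriv b f) x * g x"
    if b: "b \<in> Basis" for b
  proof -
    note df = Ck_2_differentiable[OF f _ b] and dg = Ck_2_differentiable[OF g _ b]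
    have "partial_deriv b (partial_deriv b (\<lambda>x. f x * g x)) x = partial_deriv b (\<lambda>x. f x * partial_deriv b g x + partial_deriv b f x * g x) x"
      by (rule partial_deriv_cong[OF S]) (use df dg in \<open>simp add: partial_deriv_mult\<close>)
    also have "\<dots> = partial_deriv b (\<lambda>x. f x * partial_deriv b g x) x + partial_deriv b (\<lambda>x. partial_deriv b f x * g x) x"
      by (intro partial_deriv_add differentiable_mult) (use df dg S in auto)
    also have "\<dots> = f x * partial_deriv b (partial_deriv b g) x + 2 * (partial_deriv b f x * partial_deriv b g x) + partial_deriv b (partial_deriv b f) x * g x"
      using df dg S by (simp add: partial_deriv_mult)
    finally show ?thesis .
  qed
  then show ?thesis by (simp add: lap_def sum.distrib sum_distrib_left sum_distrib_right)
qed

section \<open>Polynomials, homogeneity and harmonic polynomials\<close>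

lemma partial_deriv_real_polynomial_function:
  fixes f :: "'a::euclidean_space \<Rightarrow> real"
  assumes "real_polynomial_function f"
  shows "(\<forall>x. f differentiable (at x)) \<and> real_polynomial_function (partial_deriv b f)"
  using assms
proof induction
  case (linear f)
  then have "partial_deriv b f = (\<lambda>x. f b)" by (auto simp: partial_deriv_bounded_linear)
  then show ?case using linear by (auto simp: bounded_linear_imp_differentiable)
next
  case (const c)
  then show ?case by (auto simp: partial_deriv_const)
next
  case (add f g)
  then have "partial_deriv b (\<lambda>x. f x + g x) = (\<lambda>x. partial_deriv b f x + partial_deriv b g x)"
    by (auto simp: partial_deriv_add)
  then show ?case using add by auto
next
  case (mult f g)
  then have "partial_deriv b (\<lambda>x. f x * g x) = (\<lambda>x. f x * partial_deriv b g x + partial_deriv b f x * g x)"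
    by (auto simp: partial_deriv_mult)
  then show ?case using mult by auto
qed

lemma Ck_on_real_polynomial_function:
  fixes f :: "'a::euclidean_space \<Rightarrow> real"
  shows "real_polynomial_function f \<Longrightarrow> Ck_on k UNIV f"
proof (induction k arbitrary: f)
  case 0
  then show ?case using partial_deriv_real_polynomial_function[of f]
    by (simp add: Ck_on_0 differentiable_imp_continuous_on differentiable_on_def differentiable_at_imp_differentiable_on)
next
  case (Suc k)
  then show ?case using partial_deriv_real_polynomial_function[of f]
    by (auto simp: Ck_on_Suc differentiable_imp_continuous_on differentiable_on_def differentiable_at_imp_differentiable_on)
qed

definition euler_op :: "('a::euclidean_space \<Rightarrow> real) \<Rightarrow> 'a \<Rightarrow> real" where
  "euler_op f x = (\<Sum>b\<in>Basis. (x \<bullet> b) * partial_deriv b f x)"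

text \<open>Homogeneity of degree \<open>k\<close> is stated as Euler's differential equation, which
  behaves well under products and derivatives. The degree is real so that the derivative of a
  constant may formally have degree -1.\<close>

definition homogeneous_harmonic :: "real \<Rightarrow> ('a::euclidean_space \<Rightarrow> real) \<Rightarrow> bool" where
  "homogeneous_harmonic k f \<longleftrightarrow> real_polynomial_function f \<and> (\<forall>x. euler_op f x = k * f x) \<and> (\<forall>x. lap f x = 0)"

lemma euler_op_add:
  "f differentiable (at x) \<Longrightarrow> g differentiable (at x) \<Longrightarrow> euler_op (\<lambda>x. f x + g x) x = euler_op f x + euler_op g x"
  by (simp add: euler_op_def partial_deriv_add sum.distrib distrib_left)

lemma euler_op_mult:
  "f differentiable (at x) \<Longrightarrow> g differentiable (at x) \<Longrightarrow> euler_op (\<lambda>x. f x * g x) x = f x * euler_op g x + euler_op f x * g x"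
  by (simp add: euler_op_def partial_deriv_mult sum.distrib distrib_left sum_distrib_left sum_distrib_right mult_ac)

lemma homogeneous_harmonic_cmult:
  assumes "homogeneous_harmonic k f" shows "homogeneous_harmonic k (\<lambda>x. c * f x)"
proof -
  have p: "real_polynomial_function f" using assms by (simp add: homogeneous_harmonic_def)
  have d: "f differentiable (at x)" for x using partial_deriv_real_polynomial_function[OF p] by blast
  have "euler_op (\<lambda>x. c * f x) x = c * euler_op f x" for x
    using d by (simp add: euler_op_def partial_deriv_cmult sum_distrib_left mult_ac)
  moreover have "lap (\<lambda>x. c * f x) x = c * lap f x" for x
    by (rule lap_cmult[OF open_UNIV _ Ck_on_real_polynomial_function[OF p]]) simp
  ultimately show ?thesis using assms p by (auto simp: homogeneous_harmonic_def)
qed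

text \<open>Differentiating Euler's relation in direction \<open>c\<close> produces one extra copy
  of the derivative, which lowers the degree by one; the Laplacian commutes with partial
  derivatives.\<close>

lemma homogeneous_harmonic_partial_deriv:
  fixes f :: "'a::euclidean_space \<Rightarrow> real"
  assumes "homogeneous_harmonic k f" "c \<in> Basis" 
  shows "homogeneous_harmonic (k - 1) (partial_deriv c f)"
proof -
  have p: "real_polynomial_function f" using assms by (simp add: homogeneous_harmonic_def)
  have pc: "real_polynomial_function (partial_deriv b f)" for b using partial_deriv_real_polynomial_function[OF p] by blast
  have pcc: "real_polynomial_function (partial_deriv a (partial_deriv b f))" for a b using partial_deriv_real_polynomial_function[OF pc] by blast
  have d: "f differentiable (at x)" "partial_deriv b f differentiable (at x)" "partial_deriv a (partial_deriv b f) differentiable (at x)" for a b x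
    using partial_deriv_real_polynomial_function[OF p] partial_deriv_real_polynomial_function[OF pc] partial_deriv_real_polynomial_function[OF pcc] by blast+
  have comm: "partial_deriv a (partial_deriv b g) = partial_deriv b (partial_deriv a g)" 
    if "a \<in> Basis" "b \<in> Basis" "real_polynomial_function g" for a b and g :: "'a \<Rightarrow> real"
    by (rule ext, rule partial_deriv_commute[OF Ck_on_real_polynomial_function[OF that(3)] open_UNIV]) (use that in auto)
  have "euler_op (partial_deriv c f) x = (k - 1) * partial_deriv c f x" for x
  proof -
    have di: "(\<lambda>x::'a. x \<bullet> b) differentiable (at x)" for b
      by (auto intro!: derivative_intros)
    have pi: "partial_deriv c (\<lambda>x. x \<bullet> b) x = c \<bullet> b" for b
      by (rule partial_deriv_bounded_linear) (rule bounded_linear_inner_left)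
    have dsum: "partial_deriv c (\<lambda>x. \<Sum>b\<in>B. (x \<bullet> b) * partial_deriv b f x) x = (\<Sum>b\<in>B. (x \<bullet> b) * partial_deriv c (partial_deriv b f) x + (c \<bullet> b) * partial_deriv b f x)
       \<and> (\<lambda>x. \<Sum>b\<in>B. (x \<bullet> b) * partial_deriv b f x) differentiable (at x)"
      if "finite B" for B
      using that
    proof induction
      case (insert b B)
      have "(\<lambda>x. (x \<bullet> b) * partial_deriv b f x) differentiable (at x)" using d di by (intro differentiable_mult) 
      then show ?case using insert d di by (simp add: partial_deriv_add partial_deriv_mult pi)
    qed (simp add: partial_deriv_const)
    have "k * partial_deriv c f x = partial_deriv c (\<lambda>x. k * f x) x" using d by (simp add: partial_deriv_cmult)
    also have "\<dots> = partial_deriv c (euler_op f) x"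
      using assms(1) by (intro arg_cong[where f="\<lambda>g. partial_deriv c g x"]) (auto simp: homogeneous_harmonic_def)
    also have "\<dots> = (\<Sum>b\<in>Basis. (x \<bullet> b) * partial_deriv c (partial_deriv b f) x) + (\<Sum>b\<in>Basis. (c \<bullet> b) * partial_deriv b f x)"
      using dsum[of Basis] by (simp add: euler_op_def[abs_def] sum.distrib)
    also have "(\<Sum>b\<in>Basis. (c \<bullet> b) * partial_deriv b f x) = partial_deriv c f x"
      using assms(2) by (simp add: inner_Basis if_distrib[of "\<lambda>z. z * _"] cong: if_cong)
    also have "(\<Sum>b\<in>Basis. (x \<bullet> b) * partial_deriv c (partial_deriv b f) x) = euler_op (partial_deriv c f) x"
      unfolding euler_op_def using comm[OF assms(2) _ p] by (intro sum.cong) auto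
    finally show ?thesis by (simp add: algebra_simps)
  qed
  moreover have "lap (partial_deriv c f) x = 0" for x
  proof -
    have dsum: "partial_deriv c (\<lambda>x. \<Sum>b\<in>B. partial_deriv b (partial_deriv b f) x) x = (\<Sum>b\<in>B. partial_deriv c (partial_deriv b (partial_deriv b f)) x)
       \<and> (\<lambda>x. \<Sum>b\<in>B. partial_deriv b (partial_deriv b f) x) differentiable (at x)"
      if "finite B" for B
      using that by induction (use d in \<open>auto simp: partial_deriv_add partial_deriv_const\<close>)
    have "partial_deriv b (partial_deriv b (partial_deriv c f)) = partial_deriv c (partial_deriv b (partial_deriv b f))" if b: "b \<in> Basis" for b
      using comm[OF b assms(2) p] comm[OF b assms(2) pc] by simp
    then have "lap (partial_deriv c f) x = partial_deriv c (lap f) x"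
      unfolding lap_def[abs_def] using dsum[of Basis] by simp
    also have "\<dots> = partial_deriv c (\<lambda>_. 0) x"
      using assms(1) by (intro arg_cong[where f="\<lambda>g. partial_deriv c g x"]) (auto simp: homogeneous_harmonic_def)
    finally show ?thesis by (simp add: partial_deriv_const)
  qed
  ultimately show ?thesis using pc by (simp add: homogeneous_harmonic_def)
qed

text \<open>Euler's relation of degree -1 says that \<open>t\<close> times the value of
  \<open>f\<close> at \<open>t *\<^sub>R x\<close> has derivative zero in \<open>t\<close>; it
  vanishes at \<open>t = 0\<close>, hence at \<open>t = 1\<close>.\<close>

lemma homogeneous_harmonic_minus_1:
  fixes f :: "'a::euclidean_space \<Rightarrow> real"
  assumes "homogeneous_harmonic (-1) f" shows "f x = 0"
proof -
  have p: "real_polynomial_function f" using assms by (simp add: homogeneous_harmonic_def)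
  have d: "f differentiable (at x)" for x using partial_deriv_real_polynomial_function[OF p] by blast
  have "((\<lambda>t. t * f (0 + t *\<^sub>R x)) has_real_derivative 0) (at t)" for t
  proof -
    have "partial_deriv x f (t *\<^sub>R x) = (\<Sum>b\<in>Basis. (x \<bullet> b) * partial_deriv b f (t *\<^sub>R x))"
      using partial_deriv_eq[OF has_derivative_partial[OF d[of "t *\<^sub>R x"]], of x] by simp
    then have "t * partial_deriv x f (t *\<^sub>R x) = euler_op f (t *\<^sub>R x)"
      by (simp add: euler_op_def sum_distrib_left mult_ac)
    also have "\<dots> = - f (t *\<^sub>R x)" using assms by (simp add: homogeneous_harmonic_def)
    finally have e: "t * partial_deriv x f (0 + t *\<^sub>R x) + 1 * f (0 + t *\<^sub>R x) = 0" by simp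
    have "((\<lambda>t. t * f (0 + t *\<^sub>R x)) has_real_derivative t * partial_deriv x f (0 + t *\<^sub>R x) + 1 * f (0 + t *\<^sub>R x)) (at t)"
      by (rule DERIV_mult'[OF DERIV_ident has_real_derivative_line[OF d]])
    then show ?thesis unfolding e .
  qed
  then have "1 * f (0 + 1 *\<^sub>R x) = 0 * f (0 + 0 *\<^sub>R x)"
    by (intro DERIV_isconst_all[where f="\<lambda>t. t * f (0 + t *\<^sub>R x)"]) auto
  then show ?thesis by simp
qed

text \<open>Generated from homogeneous pieces so that multiplication by a coordinate can be treated
  one degree at a time, where Euler's relation is available.\<close>

inductive harmonic_poly :: "('a::euclidean_space \<Rightarrow> real) \<Rightarrow> bool" where
  homogeneous: "homogeneous_harmonic (real k) f \<Longrightarrow> harmonic_poly f"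
| add: "harmonic_poly f \<Longrightarrow> harmonic_poly g \<Longrightarrow> harmonic_poly (\<lambda>x. f x + g x)"

lemma homogeneous_harmonic_const: "homogeneous_harmonic 0 (\<lambda>x. c)"
  by (auto simp: homogeneous_harmonic_def euler_op_def lap_def partial_deriv_const)

lemma harmonic_poly_const: "harmonic_poly (\<lambda>x. c)"
  by (rule harmonic_poly.homogeneous[of 0]) (simp add: homogeneous_harmonic_const)

lemma harmonic_poly_cmult: "harmonic_poly f \<Longrightarrow> harmonic_poly (\<lambda>x. c * f x)"
proof (induction rule: harmonic_poly.induct)
  case (homogeneous k f)
  then show ?case using homogeneous_harmonic_cmult harmonic_poly.homogeneous by blast
next
  case (add f g)
  then show ?case using harmonic_poly.add by (simp add: distrib_left)
qed

lemma harmonic_poly_sum: "finite I \<Longrightarrow> (\<And>i. i \<in> I \<Longrightarrow> harmonic_poly (f i)) \<Longrightarrow> harmonic_poly (\<lambda>x. \<Sum>i\<in>I. f i x)"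
  by (induction I rule: finite_induct) (auto intro: harmonic_poly_const harmonic_poly.add)

lemma harm_harmonic_poly: "harmonic_poly f \<Longrightarrow> harm UNIV f"
proof (induction rule: harmonic_poly.induct)
  case (homogeneous k f)
  then show ?case by (simp add: homogeneous_harmonic_def harm_def Ck_on_real_polynomial_function)
qed (rule harm_add)

text \<open>
  If \<open>Q\<close> is harmonic and homogeneous of degree \<open>k\<close>, then so is
  \<open>x\<^sub>b Q - c \<bar>x\<bar>\<^sup>2 \<partial>\<^sub>b Q\<close> of degree \<open>k + 1\<close>, where \<open>c = 1 / (N + 2 k - 2)\<close>; adding \<open>c \<partial>\<^sub>b Q\<close> gives
  a harmonic polynomial that agrees with \<open>x\<^sub>b Q\<close> on the unit sphere.
\<close>

lemma harmonic_poly_mult_coordinate: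
  fixes f :: "'a::euclidean_space \<Rightarrow> real"
  assumes N: "3 \<le> DIM('a)" and b: "b \<in> Basis"
  shows "harmonic_poly f \<Longrightarrow> \<exists>g. harmonic_poly g \<and> (\<forall>x. norm x = 1 \<longrightarrow> g x = (x \<bullet> b) * f x)"
proof (induction rule: harmonic_poly.induct)
  case (homogeneous k f)
  let ?N = "real DIM('a)"
  define R where "R = partial_deriv b f"
  define c where "c = 1 / (?N + 2 * real k - 2)"
  \<comment> \<open>The balance of two Laplacians: that of \<open>(x \<bullet> b) * f x\<close> is
    \<open>2 * R x\<close>, and that of \<open>(x \<bullet> x) * R x\<close> is the bracket times
    \<open>R x\<close>.\<close>
  have c: "c * (2 * ?N + 4 * (real k - 1)) = 2" using N by (simp add: c_def field_simps)
  have R: "homogeneous_harmonic (real k - 1) R" unfolding R_def by (rule homogeneous_harmonic_partial_deriv[OF homogeneous b])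
  have p: "real_polynomial_function f" "real_polynomial_function R" 
    using homogeneous R by (auto simp: homogeneous_harmonic_def)
  have pl: "real_polynomial_function (\<lambda>x::'a. x \<bullet> b)" by (intro real_polynomial_function.intros(1) bounded_linear_inner_left)
  have ps: "real_polynomial_function (\<lambda>x::'a. x \<bullet> x)"
  proof -
    have "real_polynomial_function (\<lambda>x::'a. \<Sum>b\<in>Basis. (x \<bullet> b) * (x \<bullet> b))"
      by (intro real_polynomial_function_sum real_polynomial_function.intros(4) real_polynomial_function.intros(1) bounded_linear_inner_left finite_Basis)
    then show ?thesis by (simp add: euclidean_inner[symmetric])
  qed
  note dd = partial_deriv_real_polynomial_function[THEN conjunct1, rule_format]
  note CC = Ck_on_real_polynomial_function[where k=2]
  define d where "d = - c"
  define g where "g x = (x \<bullet> b) * f x + d * ((x \<bullet> x) * R x)" for x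
  have pg: "real_polynomial_function g" unfolding g_def[abs_def] by (intro real_polynomial_function.intros(2-4) p pl ps)
  have pbl: "partial_deriv a (\<lambda>x. x \<bullet> b) = (\<lambda>x. a \<bullet> b)" for a
    by (rule ext) (rule partial_deriv_bounded_linear, rule bounded_linear_inner_left)
  have pbs: "partial_deriv a (\<lambda>x. x \<bullet> x) = (\<lambda>x. 2 * (x \<bullet> a))" for a :: 'a
  proof
    fix x :: 'a
    have "((\<lambda>x. x \<bullet> x) has_derivative (\<lambda>v. 2 * (x \<bullet> v))) (at x)"
      by (auto intro!: derivative_eq_intros simp: inner_commute)
    then show "partial_deriv a (\<lambda>x. x \<bullet> x) x = 2 * (x \<bullet> a)" by (rule partial_deriv_eq)
  qed
  have el: "euler_op (\<lambda>x. x \<bullet> b) x = x \<bullet> b" for x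
    unfolding euler_op_def pbl using b by (simp add: inner_Basis if_distrib[of "\<lambda>z. _ * z"] cong: if_cong)
  have es: "euler_op (\<lambda>x. x \<bullet> x) x = 2 * (x \<bullet> x)" for x :: 'a
    unfolding euler_op_def pbs by (subst (3) euclidean_inner) (simp add: sum_distrib_left mult_ac)
  have ll: "lap (\<lambda>x. x \<bullet> b) x = 0" for x
    unfolding lap_def pbl by (simp add: partial_deriv_const)
  have ls: "lap (\<lambda>x. x \<bullet> x) x = 2 * ?N" for x :: 'a
    using lap_dist_squared(2)[of 0 x] by simp
  have E: "euler_op f x = real k * f x" "euler_op R x = (real k - 1) * R x" "lap f x = 0" "lap R x = 0" for x
    using homogeneous R by (auto simp: homogeneous_harmonic_def)
  have pp: "real_polynomial_function (\<lambda>x. (x \<bullet> b) * f x)" "real_polynomial_function (\<lambda>x. (x \<bullet> x) * R x)" 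
    "real_polynomial_function (\<lambda>x. d * ((x \<bullet> x) * R x))" 
    by (intro real_polynomial_function.intros(2-4) p pl ps)+
  have "euler_op g x = (real k + 1) * g x" for x
  proof -
    have 1: "euler_op (\<lambda>x. d * ((x \<bullet> x) * R x)) x = d * euler_op (\<lambda>x. (x \<bullet> x) * R x) x"
      unfolding euler_op_def partial_deriv_cmult[OF dd[OF pp(2)]] by (simp add: sum_distrib_left mult_ac)
    show ?thesis unfolding g_def[abs_def] euler_op_add[OF dd[OF pp(1)] dd[OF pp(3)]] 1 euler_op_mult[OF dd[OF pl] dd[OF p(1)]] 
          euler_op_mult[OF dd[OF ps] dd[OF p(2)]] el es E by (simp add: algebra_simps)
  qed
  moreover have "lap g x = 0" for x
  proof -
    have 1: "lap (\<lambda>x. (x \<bullet> b) * f x) x = 2 * R x"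
      using b by (simp add: lap_mult[OF open_UNIV _ CC[OF pl] CC[OF p(1)]] ll E pbl inner_Basis if_distrib[of "\<lambda>z. z * _"] R_def cong: if_cong)
    have "(\<Sum>a\<in>Basis. 2 * (x \<bullet> a) * partial_deriv a R x) = 2 * euler_op R x"
      by (simp add: euler_op_def sum_distrib_left mult_ac)
    then have 2: "lap (\<lambda>x. (x \<bullet> x) * R x) x = (2 * ?N + 4 * (real k - 1)) * R x"
      unfolding lap_mult[OF open_UNIV UNIV_I CC[OF ps] CC[OF p(2)]] ls E pbs by (simp add: algebra_simps)
    have "lap g x = 2 * R x + d * ((2 * ?N + 4 * (real k - 1)) * R x)"
      unfolding g_def[abs_def] lap_add[OF open_UNIV UNIV_I CC[OF pp(1)] CC[OF pp(3)]] lap_cmult[OF open_UNIV UNIV_I CC[OF pp(2)]] 1 2 ..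
    also have "\<dots> = (2 - c * (2 * ?N + 4 * (real k - 1))) * R x" by (simp add: algebra_simps d_def)
    finally show ?thesis unfolding c by simp
  qed
  ultimately have g: "homogeneous_harmonic (real (Suc k)) g" using pg by (simp add: homogeneous_harmonic_def add.commute)
  have "harmonic_poly R"
  proof (cases k)
    case 0
    \<comment> \<open>For \<open>k = 0\<close> the derivative has formal degree -1 and vanishes; in
      all other cases its degree is a natural number.\<close>
    then have "R = (\<lambda>x. 0)" using homogeneous_harmonic_minus_1[of R] R by auto
    then show ?thesis using harmonic_poly_const by simp
  next
    case (Suc j)
    then show ?thesis using R harmonic_poly.homogeneous[of j R] by simp
  qed
  then have "harmonic_poly (\<lambda>x. g x + c * R x)"
    by (intro harmonic_poly.add harmonic_poly_cmult harmonic_poly.homogeneous[OF g])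
  moreover have "g x + c * R x = (x \<bullet> b) * f x" if "norm x = 1" for x
    using that by (simp add: g_def d_def power2_norm_eq_inner[symmetric])
  ultimately show ?case by blast
next
  case (add f g)
  then obtain f' g' where fg: "harmonic_poly f'" "harmonic_poly g'" 
    "\<forall>x. norm x = 1 \<longrightarrow> f' x = (x \<bullet> b) * f x" "\<forall>x. norm x = 1 \<longrightarrow> g' x = (x \<bullet> b) * g x" by blast
  then show ?case by (intro exI[of _ "\<lambda>x. f' x + g' x"]) (auto intro: harmonic_poly.add simp: distrib_left)
qed

text \<open>With \<open>f = 1\<close> this says that every polynomial agrees on the unit sphere with
  a harmonic one. The factor \<open>f\<close> is arbitrary so that a product \<open>p * q\<close> is
  handled by multiplying with \<open>q\<close> and then with \<open>p\<close>.\<close>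

lemma harmonic_poly_mult_polynomial:
  fixes p :: "'a::euclidean_space \<Rightarrow> real"
  assumes N: "3 \<le> DIM('a)" and p: "real_polynomial_function p"
  shows "harmonic_poly f \<Longrightarrow> \<exists>g. harmonic_poly g \<and> (\<forall>x. norm x = 1 \<longrightarrow> g x = p x * f x)"
  using p
proof (induction arbitrary: f rule: real_polynomial_function.induct)
  case (linear p)
  have "\<forall>b\<in>Basis. \<exists>g. harmonic_poly g \<and> (\<forall>x. norm x = 1 \<longrightarrow> g x = (x \<bullet> b) * f x)"
    using harmonic_poly_mult_coordinate[OF N _ linear(2)] by simp
  then obtain g where g: "\<And>b. b \<in> Basis \<Longrightarrow> harmonic_poly (g b)" "\<And>b x. b \<in> Basis \<Longrightarrow> norm x = 1 \<Longrightarrow> g b x = (x \<bullet> b) * f x"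
    by metis
  have px: "p x = (\<Sum>b\<in>Basis. (x \<bullet> b) * p b)" for x
  proof -
    interpret p: bounded_linear p by (rule linear(1))
    have "p x = p (\<Sum>b\<in>Basis. (x \<bullet> b) *\<^sub>R b)" by (simp add: euclidean_representation)
    then show ?thesis by (simp add: p.sum p.scaleR)
  qed
  have "(\<Sum>b\<in>Basis. p b * g b x) = p x * f x" if "norm x = 1" for x
    unfolding px[of x] sum_distrib_right using g(2)[OF _ that] by (intro sum.cong) auto
  then show ?case using g(1) by (intro exI[of _ "\<lambda>x. \<Sum>b\<in>Basis. p b * g b x"]) (auto intro!: harmonic_poly_sum harmonic_poly_cmult)
next
  case (const c)
  show ?case by (intro exI[of _ "\<lambda>x. c * f x"]) (simp add: harmonic_poly_cmult[OF const])
next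
  case (add p q)
  obtain g h where "harmonic_poly g" "harmonic_poly h" "\<forall>x. norm x = 1 \<longrightarrow> g x = p x * f x" "\<forall>x. norm x = 1 \<longrightarrow> h x = q x * f x"
    using add.IH(1)[OF add.prems] add.IH(2)[OF add.prems] by blast
  then show ?case by (intro exI[of _ "\<lambda>x. g x + h x"]) (auto intro: harmonic_poly.add simp: distrib_right)
next
  case (mult p q)
  obtain h where h: "harmonic_poly h" "\<forall>x. norm x = 1 \<longrightarrow> h x = q x * f x" using mult.IH(2)[OF mult.prems] by blast
  obtain g where g: "harmonic_poly g" "\<forall>x. norm x = 1 \<longrightarrow> g x = p x * h x" using mult.IH(1)[OF h(1)] by blast
  have "g x = p x * q x * f x" if "norm x = 1" for x using g(2) h(2) that by simp
  then show ?case using g(1) by blast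
qed

text \<open>Polynomials approximate the boundary data uniformly by Stone-Weierstrass and can be
  replaced by harmonic ones without change on the sphere. The maximum principle carries uniform
  closeness from the sphere to the closed ball, and the limit is harmonic inside.\<close>

lemma dirichlet_unit_ball:
  fixes g :: "'a::euclidean_space \<Rightarrow> real"
  assumes N: "3 \<le> DIM('a)" and g: "continuous_on (sphere 0 1) g"
  shows "\<exists>u. continuous_on (cball 0 1) u \<and> harm (ball 0 1) u \<and> (\<forall>x. norm x = 1 \<longrightarrow> u x = g x)"
proof -
  have "\<exists>f. harmonic_poly f \<and> (\<forall>x. norm x = 1 \<longrightarrow> \<bar>g x - f x\<bar> < inverse (real (Suc n)))" for n
  proof -
    obtain p where p: "real_polynomial_function p" "\<And>x. x \<in> sphere 0 1 \<Longrightarrow> \<bar>g x - p x\<bar> < inverse (real (Suc n))"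
      using Stone_Weierstrass_real_polynomial_function[OF compact_sphere g, of "inverse (real (Suc n))"] by auto
    obtain f where "harmonic_poly f" "\<forall>x. norm x = 1 \<longrightarrow> f x = p x * 1"
      using harmonic_poly_mult_polynomial[OF N p(1) harmonic_poly_const[of 1]] by blast
    then show ?thesis using p(2) by (intro exI[of _ f]) auto
  qed
  then obtain f where f: "\<And>n. harmonic_poly (f n)" "\<And>n x. norm x = 1 \<Longrightarrow> \<bar>g x - f n x\<bar> < inverse (real (Suc n))"
    by metis
  have hf: "harm U (f n)" if "open U" for U n
    using harm_subset[OF harm_harmonic_poly[OF f(1)] that] by simp
  have cf: "continuous_on U (f n)" for U n
    using continuous_on_subset[OF harm_imp_continuous[OF hf[OF open_UNIV]]] by blast
  \<comment> \<open>The added constants are the two approximation errors, so the inequality holds on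
    the sphere and extends inwards by comparison.\<close>
  have le: "f n x \<le> f m x + (inverse (real (Suc n)) + inverse (real (Suc m)))" if "x \<in> cball 0 1" for n m x
  proof (rule harm_le_on_bounded[where U="ball 0 1" and u="f n" and v="\<lambda>x. f m x + (inverse (real (Suc n)) + inverse (real (Suc m)))"])
    show "harm (ball 0 1) (\<lambda>x. f m x + (inverse (real (Suc n)) + inverse (real (Suc m))))"
      by (intro harm_add hf harm_const) auto
    show "continuous_on (closure (ball 0 1)) (\<lambda>x. f m x + (inverse (real (Suc n)) + inverse (real (Suc m))))"
      by (intro continuous_intros cf)
    fix q :: 'a assume "q \<in> frontier (ball 0 1)"
    then have "norm q = 1" by simp
    then show "f n q \<le> f m q + (inverse (real (Suc n)) + inverse (real (Suc m)))"
      using f(2)[of q n] f(2)[of q m] by linarith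
  next
    show "harm (ball 0 1) (f n)" by (rule hf) simp
    show "continuous_on (closure (ball 0 1)) (f n)" by (rule cf)
    show "x \<in> closure (ball 0 1)" using that by simp
  qed simp
  have "uniformly_Cauchy_on (cball 0 1) f"
    unfolding uniformly_Cauchy_on_def
  proof (intro allI impI)
    fix e :: real assume e: "0 < e"
    obtain M where M: "inverse (real (Suc M)) < e / 2" using reals_Archimedean[OF half_gt_zero[OF e]] by blast
    have "dist (f m x) (f n x) < e" if "x \<in> cball 0 1" "M \<le> m" "M \<le> n" for x m n
    proof -
      have "inverse (real (Suc m)) \<le> inverse (real (Suc M))" "inverse (real (Suc n)) \<le> inverse (real (Suc M))"
        using that by (intro le_imp_inverse_le; simp)+
      then show ?thesis using le[OF that(1), of m n] le[OF that(1), of n m] M unfolding dist_real_def by linarith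
    qed
    then show "\<exists>M. \<forall>x\<in>cball 0 1. \<forall>m\<ge>M. \<forall>n\<ge>M. dist (f m x) (f n x) < e" by blast
  qed
  then obtain u where u: "uniform_limit (cball 0 1) f u sequentially"
    using Cauchy_uniformly_convergent unfolding uniformly_convergent_on_def by blast
  have lim: "(\<lambda>n. f n x) \<longlonglongrightarrow> u x" if "x \<in> cball 0 1" for x by (rule tendsto_uniform_limitI[OF u that])
  show ?thesis
  proof (intro exI conjI allI impI)
    show cu: "continuous_on (cball 0 1) u"
      by (rule uniform_limit_theorem[OF always_eventually u]) (auto simp: cf)
    show "harm (ball 0 1) u"
    proof (rule harm_limit[of _ f])
      fix K :: "'a set" assume K: "K \<subseteq> ball 0 1"
      have "bounded (f 0 ` cball 0 1)" by (intro compact_imp_bounded compact_continuous_image cf) auto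
      then obtain C where C: "\<And>x. x \<in> cball 0 1 \<Longrightarrow> \<bar>f 0 x\<bar> \<le> C" by (metis bounded_iff image_eqI real_norm_def)
      have "\<bar>f n x\<bar> \<le> C + 2" if "x \<in> K" for n x
      proof -
        have x: "x \<in> cball 0 1" using that K by auto
        have "inverse (real (Suc n)) \<le> 1" by (simp add: field_simps)
        then show ?thesis using C[OF x] le[OF x, of n 0] le[OF x, of 0 n] by simp
      qed
      then show "\<exists>C. \<forall>n. \<forall>x\<in>K. \<bar>f n x\<bar> \<le> C" by blast
    qed (use hf lim in auto)
    fix x :: 'a assume x: "norm x = 1"
    have "(\<lambda>n. f n x) \<longlonglongrightarrow> g x"
    proof (rule LIM_zero_cancel, rule Lim_null_comparison[OF _ LIMSEQ_inverse_real_of_nat])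
      show "\<forall>\<^sub>F n in sequentially. norm (f n x - g x) \<le> inverse (real (Suc n))"
        using f(2)[OF x] by (intro always_eventually allI) (metis abs_minus_commute less_imp_le real_norm_def)
    qed
    then show "u x = g x" using lim[of x] x LIMSEQ_unique by auto
  qed
qed

lemma dirichlet_ball:
  fixes g :: "'a::euclidean_space \<Rightarrow> real"
  assumes N: "3 \<le> DIM('a)" and r: "0 < r" and g: "continuous_on (sphere a r) g"
  shows "\<exists>u. continuous_on (cball a r) u \<and> harm (ball a r) u \<and> (\<forall>x\<in>sphere a r. u x = g x)"
proof -
  have "continuous_on (sphere 0 1) (\<lambda>x. g (a + r *\<^sub>R x))"
    by (rule continuous_on_compose2[OF g]) (use r in \<open>auto intro!: continuous_intros simp: dist_norm\<close>)
  from dirichlet_unit_ball[OF N this]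
  obtain v where v: "continuous_on (cball 0 1) v" "harm (ball 0 1) v" "\<And>x. norm x = 1 \<Longrightarrow> v x = g (a + r *\<^sub>R x)"
    by blast
  define T where "T x = - (1/r) *\<^sub>R a + (1/r) *\<^sub>R x" for x
  have T: "norm (T x) = dist a x / r" for x
  proof -
    have "T x = (1/r) *\<^sub>R (x - a)" by (simp add: T_def algebra_simps)
    then show ?thesis using r by (simp add: dist_norm norm_minus_commute)
  qed
  have aT: "a + r *\<^sub>R T x = x" for x using r by (simp add: T_def scaleR_diff_right)
  show ?thesis
  proof (intro exI conjI ballI)
    show "continuous_on (cball a r) (\<lambda>x. v (T x))"
      by (rule continuous_on_compose2[OF v(1)]) (use r T in \<open>auto simp: T_def[abs_def] intro!: continuous_intros\<close>)
    have "norm (T x) < 1 \<longleftrightarrow> dist a x < r" for x unfolding T using r by simp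
    then have "T -` ball 0 1 = ball a r" by auto
    then show "harm (ball a r) (\<lambda>x. v (T x))"
      using harm_affine[OF v(2), of "- (1/r) *\<^sub>R a" "1/r"] unfolding T_def by simp
    fix x assume "x \<in> sphere a r"
    then show "v (T x) = g x"
      using v(3)[of "T x"] T[of x] aT[of x] r by simp
  qed
qed

lemma frontier_open: "open S \<Longrightarrow> frontier S = closure S - S"
  by (simp add: frontier_def interior_open)

section \<open>Sweeping out and the regular part of the Green function\<close>

text \<open>Comparison is required on all bounded open sets with closure in the domain, not just on
  balls; stability under modification then reduces to a comparison on the intersection of such a set
  with the ball.\<close>

definition superharm :: "'a::euclidean_space set \<Rightarrow> ('a \<Rightarrow> real) \<Rightarrow> bool" where
  "superharm \<Omega> v \<longleftrightarrow> continuous_on \<Omega> v \<and>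
     (\<forall>U h. open U \<longrightarrow> bounded U \<longrightarrow> closure U \<subseteq> \<Omega> \<longrightarrow> harm U h \<longrightarrow> continuous_on (closure U) h \<longrightarrow>
        (\<forall>q\<in>frontier U. h q \<le> v q) \<longrightarrow> (\<forall>x\<in>U. h x \<le> v x))"

lemma superharmD:
  "superharm \<Omega> v \<Longrightarrow> open U \<Longrightarrow> bounded U \<Longrightarrow> closure U \<subseteq> \<Omega> \<Longrightarrow> harm U h \<Longrightarrow> continuous_on (closure U) h \<Longrightarrow>
        (\<And>q. q \<in> frontier U \<Longrightarrow> h q \<le> v q) \<Longrightarrow> x \<in> U \<Longrightarrow> h x \<le> v x"
  unfolding superharm_def by blast

definition dirichlet_solution :: "'a::euclidean_space \<Rightarrow> real \<Rightarrow> ('a \<Rightarrow> real) \<Rightarrow> 'a \<Rightarrow> real" where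
  "dirichlet_solution a r g = (SOME u. continuous_on (cball a r) u \<and> harm (ball a r) u \<and> (\<forall>x\<in>sphere a r. u x = g x))"

definition poisson_modification :: "'a::euclidean_space \<Rightarrow> real \<Rightarrow> ('a \<Rightarrow> real) \<Rightarrow> 'a \<Rightarrow> real" where
  "poisson_modification a r v x = (if x \<in> ball a r then dirichlet_solution a r v x else v x)"

lemma dirichlet_solution:
  fixes g :: "'a::euclidean_space \<Rightarrow> real"
  assumes "3 \<le> DIM('a)" "0 < r" "continuous_on (sphere a r) g"
  shows "continuous_on (cball a r) (dirichlet_solution a r g)" "harm (ball a r) (dirichlet_solution a r g)"
    "x \<in> sphere a r \<Longrightarrow> dirichlet_solution a r g x = g x"
  using someI_ex[OF dirichlet_ball[OF assms]] unfolding dirichlet_solution_def[symmetric] by blast+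

text \<open>For the last claim, superharmonicity of \<open>v\<close> gives \<open>h \<le> v\<close>
  on \<open>U\<close>. This supplies the boundary inequality on the part of the sphere inside
  \<open>U\<close> for the comparison of \<open>h\<close> with the Dirichlet solution on the
  intersection of \<open>U\<close> with the ball.\<close>

lemma poisson_modification:
  fixes v :: "'a::euclidean_space \<Rightarrow> real"
  assumes N: "3 \<le> DIM('a)" and r: "0 < r" "cball a r \<subseteq> \<Omega>" and v: "continuous_on \<Omega> v"
  shows "continuous_on \<Omega> (poisson_modification a r v)" 
    and "harm (ball a r) (poisson_modification a r v)"
    and "x \<notin> ball a r \<Longrightarrow> poisson_modification a r v x = v x"
    and "x \<in> cball a r \<Longrightarrow> poisson_modification a r v x = dirichlet_solution a r v x"
    and "\<lbrakk>harm \<Omega> s; \<And>x. x \<in> \<Omega> \<Longrightarrow> s x \<le> v x; x \<in> \<Omega>\<rbrakk> \<Longrightarrow> s x \<le> poisson_modification a r v x"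
    and "superharm \<Omega> v \<Longrightarrow> poisson_modification a r v x \<le> v x"
    and "superharm \<Omega> v \<Longrightarrow> superharm \<Omega> (poisson_modification a r v)"
proof -
  let ?w = "poisson_modification a r v" and ?u = "dirichlet_solution a r v"
  have vs: "continuous_on (sphere a r) v" using v r(2) by (meson continuous_on_subset order_trans sphere_cball)
  note u = dirichlet_solution[OF N r(1) vs]
  show out: "?w x = v x" if "x \<notin> ball a r" for x using that by (simp add: poisson_modification_def)
  show inside: "?w x = ?u x" if "x \<in> cball a r" for x using that u(3)[of x] by (auto simp: poisson_modification_def)
  have cin: "continuous_on (cball a r) ?w" by (rule continuous_on_eq[OF u(1)]) (simp add: inside)
  have cout: "continuous_on (\<Omega> - ball a r) ?w"
    by (rule continuous_on_eq[where f=v]) (use v out in \<open>auto intro: continuous_on_subset\<close>)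
  have un: "cball a r \<union> (\<Omega> - ball a r) = \<Omega>" using r(2) by auto
  have "continuous_on (cball a r \<union> (\<Omega> - ball a r)) ?w"
  proof (rule continuous_on_Un_local[OF _ _ cin cout])
    show "closedin (top_of_set (cball a r \<union> (\<Omega> - ball a r))) (cball a r)"
      unfolding un using r(2) by (intro closed_subset) auto
    have "\<Omega> - ball a r = \<Omega> \<inter> - ball a r" by auto
    then show "closedin (top_of_set (cball a r \<union> (\<Omega> - ball a r))) (\<Omega> - ball a r)"
      unfolding un by (simp add: closedin_closed_Int closed_Compl)
  qed
  then show cw: "continuous_on \<Omega> ?w" unfolding un .
  show hw: "harm (ball a r) ?w" by (rule harm_cong[OF u(2)]) (simp add: inside)
  show "s x \<le> ?w x" if s: "harm \<Omega> s" "\<And>x. x \<in> \<Omega> \<Longrightarrow> s x \<le> v x" "x \<in> \<Omega>" for s x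
  proof (cases "x \<in> ball a r")
    case True
    have "s x \<le> ?u x"
    proof (rule harm_le_on_bounded[where U="ball a r" and u=s and v="?u"])
      show "harm (ball a r) s" by (rule harm_subset[OF s(1)]) (use r(2) in auto)
      show "continuous_on (closure (ball a r)) s" using r harm_imp_continuous[OF s(1)] by (auto intro: continuous_on_subset)
      show "continuous_on (closure (ball a r)) ?u" using r u(1) by simp
      show "s q \<le> ?u q" if "q \<in> frontier (ball a r)" for q
        using that r u(3)[of q] s(2)[of q] by auto
      show "x \<in> closure (ball a r)" using True r by auto
    qed (use u(2) in auto)
    then show ?thesis using inside True by simp
  qed (use s out in simp)
  assume sv: "superharm \<Omega> v"
  show le: "?w x \<le> v x" for x
  proof (cases "x \<in> ball a r")
    case True
    have "?u x \<le> v x"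
      by (rule superharmD[OF sv, of "ball a r"]) (use r u True in auto)
    then show ?thesis using inside True by simp
  qed (use out in simp)
  show "superharm \<Omega> ?w"
    unfolding superharm_def
  proof (intro conjI cw allI impI ballI)
    fix U h x assume U: "open U" "bounded U" "closure U \<subseteq> \<Omega>" and h: "harm U h" "continuous_on (closure U) h"
      "\<forall>q\<in>frontier U. h q \<le> ?w q" and x: "x \<in> U"
    have hv: "h y \<le> v y" if "y \<in> U" for y
      by (rule superharmD[OF sv U h(1,2) _ that]) (rule order_trans[OF h(3)[rule_format] le])
    show "h x \<le> ?w x"
    proof (cases "x \<in> ball a r")
      case True
      let ?V = "U \<inter> ball a r"
      have cV: "closure ?V \<subseteq> closure U" "closure ?V \<subseteq> cball a r"
        by (rule closure_mono, simp) (rule closure_minimal, auto)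
      have oV: "open ?V" using U(1) by auto
      have "h x \<le> ?u x"
      proof (rule harm_le_on_bounded[where U="?V" and u=h and v="?u"])
        show "bounded ?V" using U(2) by (simp add: bounded_Int)
        show "harm ?V h" "harm ?V ?u" using harm_subset[OF h(1) oV] harm_subset[OF u(2) oV] by auto
        show "continuous_on (closure ?V) h" "continuous_on (closure ?V) ?u"
          using continuous_on_subset[OF h(2) cV(1)] continuous_on_subset[OF u(1) cV(2)] by auto
        show "x \<in> closure ?V" by (rule subsetD[OF closure_subset]) (use x True in simp)
        fix q assume q: "q \<in> frontier ?V"
        then have qc: "q \<in> closure ?V" "q \<notin> ?V" using frontier_open[OF oV] by auto
        \<comment> \<open>A frontier point of the intersection lies on the frontier of
          \<open>U\<close>, or inside \<open>U\<close> on the sphere.\<close>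
        show "h q \<le> ?u q"
        proof (cases "q \<in> U")
          case False
          then have "q \<in> frontier U" using qc(1) cV(1) frontier_open[OF U(1)] by auto
          then show ?thesis using h(3) inside[of q] subsetD[OF cV(2) qc(1)] by auto
        next
          case q': True
          then have "q \<in> sphere a r" using qc cV(2) by auto
          then show ?thesis using hv[OF q'] u(3)[of q] by simp
        qed
      qed
      then show ?thesis using inside True by simp
    qed (use hv x out in simp)
  qed
qed

text \<open>The greatest harmonic minorant of \<open>f\<close> is the decreasing limit of successive
  modifications over a countable cover by balls. Every ball recurs infinitely often, so on each ball
  the limit is also a limit of functions harmonic there. Harmonic minorants stay below every
  modification, hence below the limit.\<close>

lemma balayage:
  fixes f :: "'a::euclidean_space \<Rightarrow> real"
  assumes N: "3 \<le> DIM('a)" and \<Omega>: "open \<Omega>" "\<Omega> \<noteq> {}" and f: "superharm \<Omega> f" "\<And>x. x \<in> \<Omega> \<Longrightarrow> 0 \<le> f x"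
  shows "\<exists>u. harm \<Omega> u \<and> (\<forall>x\<in>\<Omega>. u x \<le> f x) \<and> (\<forall>s. harm \<Omega> s \<longrightarrow> (\<forall>x\<in>\<Omega>. s x \<le> f x) \<longrightarrow> (\<forall>x\<in>\<Omega>. s x \<le> u x))"
proof -
  define F where "F = {B. \<exists>a r. 0 < r \<and> cball a r \<subseteq> \<Omega> \<and> B = ball a r}"
  have Fo: "\<And>S. S \<in> F \<Longrightarrow> open S" by (auto simp: F_def)
  have UF: "\<Union>F = \<Omega>"
  proof
    show "\<Union>F \<subseteq> \<Omega>" unfolding F_def using ball_subset_cball by blast
    show "\<Omega> \<subseteq> \<Union>F"
    proof
      fix x assume "x \<in> \<Omega>"
      then obtain r where "0 < r" "cball x r \<subseteq> \<Omega>" using \<Omega>(1) open_contains_cball by blast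
      then show "x \<in> \<Union>F" unfolding F_def by (intro UnionI[of "ball x r"]) auto
    qed
  qed
  obtain F' where F': "F' \<subseteq> F" "countable F'" "\<Union>F' = \<Union>F" using Lindelof[OF Fo] by metis
  have F'ne: "F' \<noteq> {}" using F'(3) UF \<Omega>(2) by auto
  have "\<forall>n. \<exists>a r. 0 < r \<and> cball a r \<subseteq> \<Omega> \<and> from_nat_into F' n = ball a r"
    using from_nat_into[OF F'ne] F'(1) unfolding F_def by blast
  then obtain a r where ar: "\<And>n. 0 < r n" "\<And>n. cball (a n) (r n) \<subseteq> \<Omega>" "\<And>n::nat. from_nat_into F' n = ball (a n) (r n)"
    by metis
  have cover: "\<exists>n. x \<in> ball (a n) (r n)" if "x \<in> \<Omega>" for x
    using that F'(3) UF ar(3) by (metis F'(2) UnionE from_nat_into_surj)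
  \<comment> \<open>The first component of \<open>prod_decode n\<close> names the ball used in step
    \<open>n\<close>; each index therefore occurs for infinitely many \<open>n\<close>.\<close>
  define v where "v = rec_nat f (\<lambda>n w. poisson_modification (a (fst (prod_decode n))) (r (fst (prod_decode n))) w)"
  have v0: "v 0 = f" by (simp add: v_def)
  have vS: "v (Suc n) = poisson_modification (a (fst (prod_decode n))) (r (fst (prod_decode n))) (v n)" for n
    by (simp add: v_def)
  have sv: "superharm \<Omega> (v n)" for n
  proof (induction n)
    case (Suc n)
    then have "continuous_on \<Omega> (v n)" by (simp add: superharm_def)
    from poisson_modification(7)[OF N ar(1) ar(2) this Suc] show ?case by (simp add: vS)
  qed (simp add: v0 f)
  have cv: "continuous_on \<Omega> (v n)" for n using sv[of n] by (simp add: superharm_def)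
  have dec: "v (Suc n) x \<le> v n x" for n x
    unfolding vS by (rule poisson_modification(6)[OF N ar(1) ar(2) cv sv])
  have decs: "decseq (\<lambda>n. v n x)" for x using dec by (simp add: decseq_Suc_iff)
  have lower: "s x \<le> v n x" if s: "harm \<Omega> s" "\<And>x. x \<in> \<Omega> \<Longrightarrow> s x \<le> f x" "x \<in> \<Omega>" for s n x
    using s(3)
  proof (induction n arbitrary: x)
    case (Suc n)
    show ?case unfolding vS
      by (rule poisson_modification(5)[OF N ar(1) ar(2) cv s(1) Suc.IH Suc.prems])
  qed (simp add: v0 s(2))
  have v_nonneg: "0 \<le> v n x" if "x \<in> \<Omega>" for n x
    using lower[OF harm_const[OF \<Omega>(1), of 0]] f(2) that by simp
  have v_le: "v n x \<le> f x" for n x using decseqD[OF decs, of 0 n x] by (simp add: v0)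
  define u where "u x = lim (\<lambda>n. v n x)" for x
  have lim: "(\<lambda>n. v n x) \<longlonglongrightarrow> u x" if x: "x \<in> \<Omega>" for x
  proof -
    have "Bseq (\<lambda>n. v n x)"
      by (rule BseqI'[where K="f x"]) (use v_nonneg[OF x] v_le in simp)
    then have "convergent (\<lambda>n. v n x)" using decs Bseq_monoseq_convergent decseq_imp_monoseq by blast
    then show ?thesis unfolding u_def by (simp add: convergent_LIMSEQ_iff)
  qed
  have "harm \<Omega> u"
  proof (rule harm_local[OF _ \<Omega>(1)])
    fix x assume x: "x \<in> \<Omega>"
    obtain i where i: "x \<in> ball (a i) (r i)" using cover[OF x] by blast
    \<comment> \<open>The stages directly after a modification in the ball number \<open>i\<close>,
      where \<open>v\<close> is harmonic in that ball.\<close>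
    define g where "g j = Suc (prod_encode (i, j))" for j
    have g: "filterlim g at_top at_top"
      by (rule filterlim_at_top_mono[OF filterlim_ident])
        (auto simp: g_def intro!: always_eventually le_SucI le_prod_encode_2)
    have "harm (ball (a i) (r i)) u"
    proof (rule harm_limit[where u="\<lambda>j. v (g j)"])
      show "harm (ball (a i) (r i)) (v (g j))" for j
        using poisson_modification(2)[OF N ar(1) ar(2) cv, of i "prod_encode (i, j)"] by (simp add: g_def vS)
      show "(\<lambda>j. v (g j) y) \<longlonglongrightarrow> u y" if "y \<in> ball (a i) (r i)" for y
      proof -
        have "y \<in> \<Omega>" using that ar(2)[of i] by auto
        from filterlim_compose[OF lim[OF this] g] show ?thesis .
      qed
      fix K assume K: "compact K" "K \<subseteq> ball (a i) (r i)"
      then have K\<Omega>: "K \<subseteq> \<Omega>" using ar(2)[of i] ball_subset_cball by blast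
      have "continuous_on K f" using cv[of 0] K\<Omega> by (auto simp: v0 intro: continuous_on_subset)
      then have "bounded (f ` K)" using K(1) by (intro compact_imp_bounded compact_continuous_image)
      then obtain C where C: "\<And>y. y \<in> K \<Longrightarrow> \<bar>f y\<bar> \<le> C" by (metis bounded_iff image_eqI real_norm_def)
      have "\<bar>v (g n) y\<bar> \<le> C" if "y \<in> K" for n y
        using C[OF that] v_nonneg[of y "g n"] v_le[of "g n" y] K\<Omega> that by auto
      then show "\<exists>C. \<forall>n. \<forall>y\<in>K. \<bar>v (g n) y\<bar> \<le> C" by blast
    qed simp
    then show "\<exists>U. x \<in> U \<and> harm U u" using i by blast
  qed
  moreover have "u x \<le> f x" if "x \<in> \<Omega>" for x
    using LIMSEQ_le_const2[OF lim[OF that]] v_le by blast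
  moreover have "s x \<le> u x" if "harm \<Omega> s" "\<forall>x\<in>\<Omega>. s x \<le> f x" "x \<in> \<Omega>" for s x
    using LIMSEQ_le_const[OF lim[OF that(3)]] lower[OF that(1) _ that(3)] that(2) by blast
  ultimately show ?thesis by blast
qed

section \<open>The capped kernel as an obstacle, and the regular part obtained from it\<close>

definition capped_newton :: "'a::euclidean_space \<Rightarrow> real \<Rightarrow> 'a \<Rightarrow> real" where
  "capped_newton p M x = (if x = p then M else min M (newton (x - p)))"

lemma continuous_capped_newton:
  fixes p :: "'a::euclidean_space"
  assumes N: "3 \<le> DIM('a)" and M: "0 < M"
  shows "continuous_on S (capped_newton p M)"
proof -
  have "continuous_on UNIV (capped_newton p M)"
    unfolding continuous_on_eq_continuous_at[OF open_UNIV]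
  proof
    fix x :: 'a
    show "isCont (capped_newton p M) x"
    proof (cases "x = p")
      case False
      have "continuous_on (- {p}) (\<lambda>x. min M (newton (x - p)))"
        by (intro continuous_intros continuous_on_newton)
      then have "continuous_on (- {p}) (capped_newton p M)"
        by (rule continuous_on_eq) (simp add: capped_newton_def)
      then show ?thesis using False by (simp add: continuous_on_eq_continuous_at[OF open_Compl[OF closed_singleton]])
    next
      case True
      obtain d where d: "0 < d" "\<And>y::'a. y \<noteq> 0 \<Longrightarrow> norm y < d \<Longrightarrow> M < newton y" using newton_gt[OF N M] by blast
      have "capped_newton p M y = M" if "y \<in> ball p d" for y
        using d(2)[of "y - p"] that by (auto simp: capped_newton_def dist_norm norm_minus_commute)
      then have "continuous_on (ball p d) (capped_newton p M)"
        by (intro continuous_on_eq[OF continuous_on_const[of _ M]]) simp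
      then show ?thesis using True d(1) by (simp add: continuous_on_eq_continuous_at)
    qed
  qed
  then show ?thesis by (rule continuous_on_subset) simp
qed

text \<open>A harmonic \<open>h\<close> below the capped kernel on the frontier is at most
  \<open>M\<close> throughout. Since the kernel exceeds \<open>M\<close> near the pole, the
  comparison with the kernel itself takes place away from the pole, where it is harmonic.\<close>

lemma superharm_capped_newton:
  fixes p :: "'a::euclidean_space"
  assumes N: "3 \<le> DIM('a)" and M: "0 < M"
  shows "superharm \<Omega> (capped_newton p M)"
  unfolding superharm_def
proof (intro conjI continuous_capped_newton[OF N M] allI impI ballI)
  fix U h x assume U: "open U" "bounded U" "closure U \<subseteq> \<Omega>" and h: "harm U h" "continuous_on (closure U) h"
    "\<forall>q\<in>frontier U. h q \<le> capped_newton p M q" and x: "x \<in> U"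
  have hM: "h y \<le> M" if "y \<in> closure U" for y
    by (rule harm_le_on_bounded[OF U(2) h(1) harm_const[OF U(1)] h(2) continuous_on_const _ that])
      (use h(3) in \<open>fastforce simp: capped_newton_def split: if_splits\<close>)
  obtain d where d: "0 < d" "\<And>y::'a. y \<noteq> 0 \<Longrightarrow> norm y < d \<Longrightarrow> M < newton y" using newton_gt[OF N M] by blast
  have xc: "x \<in> closure U" using x closure_subset by blast
  have "h x \<le> newton (x - p)" if xp: "x \<noteq> p"
  proof (cases "dist p x \<le> d / 2")
    case True
    then have "M < newton (x - p)" using d xp by (auto simp: dist_norm norm_minus_commute)
    then show ?thesis using hM[OF xc] by simp
  next
    case False
    let ?V = "U - cball p (d / 2)"
    have oV: "open ?V" using U(1) by (simp add: open_Diff)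
    have cV: "closure ?V \<subseteq> closure U" "closure ?V \<subseteq> - ball p (d / 2)"
      by (rule closure_mono, simp) (rule closure_minimal, use d(1) in auto)
    have pV: "p \<notin> closure ?V" using cV(2) d(1) by auto
    show ?thesis
    proof (rule harm_le_on_bounded[where U="?V" and u=h and v="\<lambda>x. newton (x - p)"])
      show "bounded ?V" using U(2) by (rule bounded_subset) auto
      show "harm ?V h" by (rule harm_subset[OF h(1) oV]) auto
      show "harm ?V (\<lambda>x. newton (x - p))" 
        by (rule harm_subset[OF harm_newton_at oV]) (use d(1) in auto)
      show "continuous_on (closure ?V) h" using h(2) cV(1) by (rule continuous_on_subset)
      show "continuous_on (closure ?V) (\<lambda>x. newton (x - p))"
        by (rule continuous_on_subset[OF continuous_on_newton]) (use pV in auto)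
      show "x \<in> closure ?V" using x False closure_subset[of ?V] by auto
      fix q assume "q \<in> frontier ?V"
      then have q: "q \<in> closure ?V" "q \<notin> ?V" using frontier_open[OF oV] by auto
      have qp: "q \<noteq> p" using q(1) pV by auto
      show "h q \<le> newton (q - p)"
      proof (cases "q \<in> U")
        case True
        then have "dist p q \<le> d / 2" using q(2) by auto
        then have "M < newton (q - p)" using d qp by (auto simp: dist_norm norm_minus_commute)
        then show ?thesis using hM[of q] q(1) cV(1) by auto
      next
        case False
        then have "q \<in> frontier U" using q(1) cV(1) frontier_open[OF U(1)] by auto
        then show ?thesis using h(3) qp by (auto simp: capped_newton_def)
      qed
    qed
  qed
  then show "h x \<le> capped_newton p M x" using hM[OF xc] by (auto simp: capped_newton_def)
qed

text \<open>The closed ball around \<open>c\<close> through \<open>q\<close> meets the closure of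
  the domain only in \<open>q\<close>; the strict inequality makes the Newton kernel centred at
  \<open>c\<close> yield a barrier at \<open>q\<close>.\<close>

definition exterior_balls :: "'a::euclidean_space set \<Rightarrow> bool" where
  "exterior_balls \<Omega> \<longleftrightarrow> (\<forall>q\<in>frontier \<Omega>. \<exists>c. c \<noteq> q \<and> (\<forall>x\<in>closure \<Omega>. x \<noteq> q \<longrightarrow> dist c q < dist c x))"

text \<open>On a bounded domain this is the Green function minus its singular part: the prescribed
  boundary values cancel those of the kernel.\<close>

definition is_regular_part :: "'a::euclidean_space set \<Rightarrow> 'a \<Rightarrow> ('a \<Rightarrow> real) \<Rightarrow> bool" where
  "is_regular_part \<Omega> p h \<longleftrightarrow> harm \<Omega> h \<and> (\<forall>q\<in>frontier \<Omega>. (h \<longlongrightarrow> - newton (q - p)) (at q within \<Omega>))"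

text \<open>The solution is minus the greatest harmonic minorant \<open>u\<close> of the capped
  kernel. At a frontier point \<open>u\<close> is bounded above by the capped kernel itself; from
  below, the barrier gives harmonic minorants whose limit comes as close to the kernel as
  desired.\<close>

lemma regular_part_exists:
  fixes \<Omega> :: "'a::euclidean_space set"
  assumes N: "3 \<le> DIM('a)" and \<Omega>: "open \<Omega>" "bounded \<Omega>" "exterior_balls \<Omega>" and p: "p \<in> \<Omega>"
  shows "\<exists>h. is_regular_part \<Omega> p h"
proof -
  obtain d where d: "0 < d" "ball p d \<subseteq> \<Omega>" using \<Omega>(1) p open_contains_ball by blast
  \<comment> \<open>The value of the kernel at distance \<open>d\<close> from the pole: outside
    \<open>ball p d\<close>, and so on the frontier, the cap has no effect.\<close>
  define M where "M = d powr (2 - real DIM('a))"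
  have M: "0 < M" using d by (simp add: M_def)
  let ?f = "capped_newton p M"
  have f0: "0 \<le> ?f x" for x using M by (simp add: capped_newton_def newton_nonneg)
  obtain u where u: "harm \<Omega> u" "\<And>x. x \<in> \<Omega> \<Longrightarrow> u x \<le> ?f x" 
    "\<And>s x. harm \<Omega> s \<Longrightarrow> \<forall>x\<in>\<Omega>. s x \<le> ?f x \<Longrightarrow> x \<in> \<Omega> \<Longrightarrow> s x \<le> u x"
  proof -
    have "\<Omega> \<noteq> {}" using p by auto
    from balayage[OF N \<Omega>(1) this superharm_capped_newton[OF N M, of \<Omega> p] f0]
    show thesis using that by metis
  qed
  have "(u \<longlongrightarrow> newton (q - p)) (at q within \<Omega>)" if q: "q \<in> frontier \<Omega>" for q
  proof -
    have q\<Omega>: "q \<notin> \<Omega>" using q \<Omega>(1) by (simp add: frontier_def interior_open)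
    then have qd: "q \<noteq> p" "d \<le> norm (q - p)" using p d(2) by (auto simp: dist_norm norm_minus_commute subset_iff not_less[symmetric])
    have fq: "?f q = newton (q - p)"
      using qd newton_le_powr[OF _ d(1) qd(2)] N by (simp add: capped_newton_def M_def)
    have fc: "(?f \<longlongrightarrow> newton (q - p)) (at q)"
      using continuous_capped_newton[OF N M, of UNIV p] fq by (metis UNIV_I continuous_on_def)
    obtain c where c: "c \<noteq> q" "\<And>x. x \<in> closure \<Omega> \<Longrightarrow> x \<noteq> q \<Longrightarrow> dist c q < dist c x"
      using \<Omega>(3) q unfolding exterior_balls_def by blast
    have c\<Omega>: "c \<notin> closure \<Omega>" using c(2)[of c] c(1) by auto
    \<comment> \<open>The barrier: zero at \<open>q\<close> and positive elsewhere on the closure,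
      because \<open>q\<close> is the unique nearest point to \<open>c\<close>.\<close>
    define b where "b x = newton (q - c) - newton (x - c)" for x
    have hb: "harm \<Omega> b" unfolding b_def
      by (intro harm_diff harm_const \<Omega> harm_subset[OF harm_newton_at]) (use c\<Omega> closure_subset in auto)
    have cb: "continuous_on (closure \<Omega>) b" unfolding b_def
      by (intro continuous_intros continuous_on_subset[OF continuous_on_newton]) (use c\<Omega> in auto)
    have bq: "b q = 0" by (simp add: b_def)
    have bpos: "0 < b x" if "x \<in> closure \<Omega>" "x \<noteq> q" for x
      using newton_strict_antimono[OF N, of "q - c" "x - c"] c(1) c(2)[OF that] by (simp add: b_def dist_norm norm_minus_commute)
    have b0: "0 \<le> b x" if "x \<in> closure \<Omega>" for x using bpos[OF that] bq by fastforce
    have low: "\<forall>\<^sub>F x in at q within \<Omega>. newton (q - p) - e < u x" if e: "0 < e" for e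
    proof -
      have "\<forall>\<^sub>F x in at q. newton (q - p) - e / 2 < ?f x"
        by (rule order_tendstoD(1)[OF fc]) (use e in simp)
      then obtain \<delta> where \<delta>: "0 < \<delta>" "\<And>x. x \<noteq> q \<Longrightarrow> dist x q < \<delta> \<Longrightarrow> newton (q - p) - e / 2 < ?f x"
        unfolding eventually_at by auto
      let ?C = "closure \<Omega> - ball q \<delta>"
      have "compact ?C" using \<Omega>(2) by (intro compact_diff) (auto simp: compact_closure)
      have "\<exists>\<eta>>0. \<forall>x\<in>?C. \<eta> \<le> b x"
      proof (cases "?C = {}")
        case False
        have "continuous_on ?C b" using cb by (rule continuous_on_subset) auto
        then obtain y where y: "y \<in> ?C" "\<And>x. x \<in> ?C \<Longrightarrow> b y \<le> b x"
          using continuous_attains_inf[OF \<open>compact ?C\<close> False] by blast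
        have "0 < b y" using y(1) \<delta>(1) by (intro bpos) auto
        then show ?thesis using y(2) by blast
      qed (auto intro: exI[of _ 1])
      then obtain \<eta> where \<eta>: "0 < \<eta>" "\<And>x. x \<in> ?C \<Longrightarrow> \<eta> \<le> b x" by blast
      \<comment> \<open>So large that \<open>s\<close> is at most 0 outside the ball of radius
        \<open>\<delta>\<close>, where \<open>?f\<close> is only known to be nonnegative.\<close>
      define K where "K = newton (q - p) / \<eta>"
      have K: "0 \<le> K" using \<eta> by (simp add: K_def newton_nonneg)
      define s where "s x = newton (q - p) - e / 2 - K * b x" for x
      have hs: "harm \<Omega> s" unfolding s_def by (intro harm_diff harm_const \<Omega> harm_cmult hb)
      have sf: "s x \<le> ?f x" if x: "x \<in> \<Omega>" for x
      proof (cases "dist x q < \<delta>")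
        case True
        have "0 \<le> K * b x" using K b0 x closure_subset by (intro mult_nonneg_nonneg) auto
        then show ?thesis using \<delta>(2)[OF _ True] x q\<Omega> by (auto simp: s_def) fastforce
      next
        case False
        then have "x \<in> ?C" using x closure_subset by (auto simp: dist_commute)
        then have "K * \<eta> \<le> K * b x" by (intro mult_left_mono \<eta> K)
        then have "s x \<le> 0" using \<eta> e by (simp add: s_def K_def)
        then show ?thesis using f0[of x] by linarith
      qed
      have "(b \<longlongrightarrow> b q) (at q within \<Omega>)"
      proof (rule tendsto_within_subset[OF _ closure_subset])
        show "(b \<longlongrightarrow> b q) (at q within closure \<Omega>)" using cb q by (simp add: continuous_on_def frontier_def)
      qed
      then have "(s \<longlongrightarrow> newton (q - p) - e / 2 - K * b q) (at q within \<Omega>)"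
        unfolding s_def by (intro tendsto_intros)
      then have "\<forall>\<^sub>F x in at q within \<Omega>. newton (q - p) - e < s x"
        by (rule order_tendstoD(1)) (use e bq in simp)
      moreover have "\<forall>\<^sub>F x in at q within \<Omega>. x \<in> \<Omega>" by (simp add: eventually_at_filter)
      ultimately show ?thesis
      proof eventually_elim
        case (elim x)
        then show ?case using u(3)[OF hs _ elim(2)] sf by force
      qed
    qed
    show ?thesis
    proof (rule order_tendstoI)
      fix y assume "y < newton (q - p)"
      then show "\<forall>\<^sub>F x in at q within \<Omega>. y < u x" using low[of "newton (q - p) - y"] by simp
    next
      fix y assume "newton (q - p) < y"
      then have "\<forall>\<^sub>F x in at q. ?f x < y" by (rule order_tendstoD(2)[OF fc])
      then have "\<forall>\<^sub>F x in at q within \<Omega>. x \<in> \<Omega> \<and> ?f x < y"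
        unfolding eventually_at_filter by eventually_elim auto
      then show "\<forall>\<^sub>F x in at q within \<Omega>. u x < y"
        by eventually_elim (use u(2) in force)
    qed
  qed
  then have "is_regular_part \<Omega> p (\<lambda>x. - u x)"
    unfolding is_regular_part_def using harm_uminus[OF u(1)] by (auto intro: tendsto_minus)
  then show ?thesis by blast
qed

section \<open>Comparison by boundary limits and uniqueness of the regular part\<close>

lemma harm_le_boundary_limits:
  fixes u v :: "'a::euclidean_space \<Rightarrow> real"
  assumes "bounded \<Omega>" "harm \<Omega> u" "harm \<Omega> v"
    and lim: "\<And>q. q \<in> frontier \<Omega> \<Longrightarrow> (u \<longlongrightarrow> \<phi> q) (at q within \<Omega>)" "\<And>q. q \<in> frontier \<Omega> \<Longrightarrow> (v \<longlongrightarrow> \<psi> q) (at q within \<Omega>)"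
    and le: "\<And>q. q \<in> frontier \<Omega> \<Longrightarrow> \<phi> q \<le> \<psi> q" and x: "x \<in> \<Omega>"
  shows "u x \<le> v x"
proof -
  have "u x - v x \<le> 0"
  proof (rule harm_max_principle[where u="\<lambda>x. u x - v x"])
    show "harm \<Omega> (\<lambda>x. u x - v x)" by (intro harm_diff assms)
    fix e :: real assume e: "0 < e"
    obtain B where "\<And>x. x \<in> \<Omega> \<Longrightarrow> norm x \<le> B" using assms(1) by (auto simp: bounded_iff)
    then show "eventually (\<lambda>x. u x - v x < e) (inf at_infinity (principal \<Omega>))"
      unfolding eventually_inf_principal eventually_at_infinity by (intro exI[of _ "B + 1"]) force
    fix q assume q: "q \<in> frontier \<Omega>"
    show "eventually (\<lambda>x. u x - v x < e) (at q within \<Omega>)"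
      by (rule order_tendstoD(2)[OF tendsto_diff[OF lim(1)[OF q] lim(2)[OF q]]]) (use le[OF q] e in simp)
  qed (rule x)
  then show ?thesis by simp
qed

lemma is_regular_part_unique:
  assumes "bounded \<Omega>" "is_regular_part \<Omega> p h" "is_regular_part \<Omega> p h'" "x \<in> \<Omega>"
  shows "h x = h' x"
proof (rule antisym)
  show "h x \<le> h' x" 
    by (rule harm_le_boundary_limits[of \<Omega> h h' "\<lambda>q. - newton (q - p)" "\<lambda>q. - newton (q - p)"]) (use assms in \<open>auto simp: is_regular_part_def\<close>)
  show "h' x \<le> h x"
    by (rule harm_le_boundary_limits[of \<Omega> h' h "\<lambda>q. - newton (q - p)" "\<lambda>q. - newton (q - p)"]) (use assms in \<open>auto simp: is_regular_part_def\<close>)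
qed

section \<open>Dependence of the regular part on the pole\<close>

definition regular_part :: "'a::euclidean_space set \<Rightarrow> 'a \<Rightarrow> 'a \<Rightarrow> real" where
  "regular_part \<Omega> p = (SOME h. is_regular_part \<Omega> p h)"

definition green_domain :: "'a::euclidean_space set \<Rightarrow> bool" where
  "green_domain \<Omega> \<longleftrightarrow> open \<Omega> \<and> bounded \<Omega> \<and> exterior_balls \<Omega>"

lemma is_regular_part_regular_part:
  fixes \<Omega> :: "'a::euclidean_space set"
  assumes "3 \<le> DIM('a)" "green_domain \<Omega>" "p \<in> \<Omega>"
  shows "is_regular_part \<Omega> p (regular_part \<Omega> p)"
proof -
  have "\<exists>h. is_regular_part \<Omega> p h" using assms by (intro regular_part_exists) (auto simp: green_domain_def)
  then show ?thesis unfolding regular_part_def by (rule someI_ex)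
qed

lemma frontier_away:
  fixes \<Omega> :: "'a::euclidean_space set"
  assumes "open \<Omega>" "ball p d \<subseteq> \<Omega>" "q \<in> frontier \<Omega>"
  shows "d \<le> norm (q - p)"
proof -
  have "q \<notin> \<Omega>" using assms(1,3) by (simp add: frontier_open)
  then show ?thesis using assms(2) by (auto simp: subset_iff dist_norm norm_minus_commute not_less[symmetric])
qed

text \<open>The boundary data lie between these bounds and 0. The pole enters only through a lower
  bound for its distance to the frontier, so the estimate serves as a dominating constant for
  averages over poles.\<close>

lemma regular_part_bounds:
  fixes \<Omega> :: "'a::euclidean_space set"
  assumes N: "3 \<le> DIM('a)" and \<Omega>: "green_domain \<Omega>" and d: "0 < d" "ball p d \<subseteq> \<Omega>" and z: "z \<in> \<Omega>"
  shows "\<bar>regular_part \<Omega> p z\<bar> \<le> d powr (2 - real DIM('a))"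
proof -
  have p: "p \<in> \<Omega>" using d by auto
  have op: "open \<Omega>" and bd: "bounded \<Omega>" using \<Omega> by (auto simp: green_domain_def)
  have R: "harm \<Omega> (regular_part \<Omega> p)" "\<And>q. q \<in> frontier \<Omega> \<Longrightarrow> (regular_part \<Omega> p \<longlongrightarrow> - newton (q - p)) (at q within \<Omega>)"
    using is_regular_part_regular_part[OF N \<Omega> p] by (auto simp: is_regular_part_def)
  have "regular_part \<Omega> p z \<le> 0"
    by (rule harm_le_boundary_limits[OF bd R(1) harm_const[OF op] R(2) tendsto_const _ z]) (simp_all add: newton_nonneg)
  moreover have "- (d powr (2 - real DIM('a))) \<le> regular_part \<Omega> p z"
  proof (rule harm_le_boundary_limits[OF bd harm_const[OF op] R(1) tendsto_const R(2) _ z])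
    fix q assume "q \<in> frontier \<Omega>"
    then have "newton (q - p) \<le> d powr (2 - real DIM('a))"
      using N d frontier_away[OF op d(2)] by (intro newton_le_powr) auto
    then show "- (d powr (2 - real DIM('a))) \<le> - newton (q - p)" by simp
  qed
  ultimately show ?thesis by simp
qed

lemma regular_part_diff_le:
  fixes \<Omega> :: "'a::euclidean_space set"
  assumes N: "3 \<le> DIM('a)" and \<Omega>: "green_domain \<Omega>" and p: "p \<in> \<Omega>" "p' \<in> \<Omega>"
    and le: "\<And>q. q \<in> frontier \<Omega> \<Longrightarrow> \<bar>newton (q - p) - newton (q - p')\<bar> \<le> e" and z: "z \<in> \<Omega>"
  shows "\<bar>regular_part \<Omega> p z - regular_part \<Omega> p' z\<bar> \<le> e"
proof -
  have *: "regular_part \<Omega> p z \<le> regular_part \<Omega> p' z + e" if p: "p \<in> \<Omega>" "p' \<in> \<Omega>" 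
    and le: "\<And>q. q \<in> frontier \<Omega> \<Longrightarrow> \<bar>newton (q - p) - newton (q - p')\<bar> \<le> e" for p p'
  proof (rule harm_le_boundary_limits[of \<Omega> "regular_part \<Omega> p" "\<lambda>z. regular_part \<Omega> p' z + e" "\<lambda>q. - newton (q - p)" "\<lambda>q. - newton (q - p') + e"])
    show "harm \<Omega> (regular_part \<Omega> p)" "harm \<Omega> (\<lambda>z. regular_part \<Omega> p' z + e)"
      using is_regular_part_regular_part[OF N \<Omega>] p \<Omega> by (auto simp: is_regular_part_def green_domain_def intro!: harm_add harm_const)
    fix q assume q: "q \<in> frontier \<Omega>"
    have t: "(regular_part \<Omega> p \<longlongrightarrow> - newton (q - p)) (at q within \<Omega>)" if "p \<in> \<Omega>" for p
      using is_regular_part_regular_part[OF N \<Omega> that] q by (simp add: is_regular_part_def)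
    show "(regular_part \<Omega> p \<longlongrightarrow> - newton (q - p)) (at q within \<Omega>)" by (rule t[OF p(1)])
    show "((\<lambda>z. regular_part \<Omega> p' z + e) \<longlongrightarrow> - newton (q - p') + e) (at q within \<Omega>)"
      by (rule tendsto_add[OF t[OF p(2)] tendsto_const])
    show "- newton (q - p) \<le> - newton (q - p') + e" using le[OF q] by linarith
  qed (use z \<Omega> in \<open>auto simp: green_domain_def\<close>)
  show ?thesis using *[OF p le] *[OF p(2,1)] le by (simp add: abs_minus_commute abs_le_iff)
qed

lemma newton_uniform_on_frontier:
  fixes \<Omega> :: "'a::euclidean_space set"
  assumes \<Omega>: "open \<Omega>" "bounded \<Omega>" and p: "p0 \<in> \<Omega>" and e: "0 < e"
  shows "\<exists>d>0. ball p0 d \<subseteq> \<Omega> \<and> (\<forall>p\<in>ball p0 d. \<forall>q\<in>frontier \<Omega>. \<bar>newton (q - p) - newton (q - p0)\<bar> \<le> e)"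
proof -
  obtain r where r: "0 < r" "cball p0 r \<subseteq> \<Omega>" using \<Omega>(1) p open_contains_cball by blast
  have fr: "q \<notin> \<Omega>" if "q \<in> frontier \<Omega>" for q using that \<Omega>(1) by (simp add: frontier_open)
  have c: "continuous_on (- {0}) (newton :: 'a \<Rightarrow> real)" using harm_imp_continuous[OF harm_newton] .
  have "continuous_on (frontier \<Omega> \<times> cball p0 r) (\<lambda>w. newton (fst w - snd w))"
    by (rule continuous_on_compose2[OF c]) (use fr r(2) in \<open>auto intro!: continuous_intros\<close>)
  moreover have "compact (frontier \<Omega> \<times> cball p0 r)"
    using \<Omega>(2) by (intro compact_Times compact_frontier_bounded) auto
  ultimately have "uniformly_continuous_on (frontier \<Omega> \<times> cball p0 r) (\<lambda>w. newton (fst w - snd w))"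
    by (rule compact_uniformly_continuous)
  then obtain d where d: "0 < d" "\<And>w w'. w \<in> frontier \<Omega> \<times> cball p0 r \<Longrightarrow> w' \<in> frontier \<Omega> \<times> cball p0 r \<Longrightarrow> dist w' w < d \<Longrightarrow>
      dist (newton (fst w' - snd w')) (newton (fst w - snd w)) < e"
    using e unfolding uniformly_continuous_on_def by metis
  have "\<bar>newton (q - p) - newton (q - p0)\<bar> \<le> e" if "p \<in> ball p0 (min d r)" "q \<in> frontier \<Omega>" for p q
    using d(2)[of "(q, p0)" "(q, p)"] that r(1) by (auto simp: dist_Pair_Pair dist_commute dist_real_def less_imp_le)
  then show ?thesis using d(1) r ball_subset_cball[of p0 r] by (intro exI[of _ "min d r"]) (auto simp: subset_iff)
qed

text \<open>Moving the pole changes the regular part uniformly in \<open>z\<close>, by comparison of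
  the boundary data; together with continuity in \<open>z\<close> for a fixed pole this gives joint
  continuity.\<close>

lemma continuous_on_regular_part:
  fixes \<Omega> :: "'a::euclidean_space set"
  assumes N: "3 \<le> DIM('a)" and \<Omega>: "green_domain \<Omega>"
  shows "continuous_on (\<Omega> \<times> \<Omega>) (\<lambda>w. regular_part \<Omega> (snd w) (fst w))"
  unfolding continuous_on_iff
proof (intro ballI allI impI)
  fix w :: "'a \<times> 'a" and e :: real assume w: "w \<in> \<Omega> \<times> \<Omega>" and e: "0 < e"
  have op: "open \<Omega>" and bd: "bounded \<Omega>" using \<Omega> by (auto simp: green_domain_def)
  have w': "fst w \<in> \<Omega>" "snd w \<in> \<Omega>" using w by auto
  obtain d where d: "0 < d" "ball (snd w) d \<subseteq> \<Omega>" "\<And>p q. p \<in> ball (snd w) d \<Longrightarrow> q \<in> frontier \<Omega> \<Longrightarrow> \<bar>newton (q - p) - newton (q - snd w)\<bar> \<le> e / 2"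
    using newton_uniform_on_frontier[OF op bd w'(2), of "e / 2"] e by auto
  have "continuous_on \<Omega> (regular_part \<Omega> (snd w))"
    using is_regular_part_regular_part[OF N \<Omega> w'(2)] harm_imp_continuous by (auto simp: is_regular_part_def)
  then obtain d' where d': "0 < d'" "\<And>z. z \<in> \<Omega> \<Longrightarrow> dist z (fst w) < d' \<Longrightarrow> dist (regular_part \<Omega> (snd w) z) (regular_part \<Omega> (snd w) (fst w)) < e / 2"
    unfolding continuous_on_iff using w'(1) e half_gt_zero by metis
  have "dist (regular_part \<Omega> (snd v) (fst v)) (regular_part \<Omega> (snd w) (fst w)) < e"
    if v: "v \<in> \<Omega> \<times> \<Omega>" "dist v w < min d d'" for v
  proof -
    have "dist (fst v) (fst w) < d'" "dist (snd w) (snd v) < d"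
      using v(2) dist_fst_le[of v w] dist_snd_le[of v w] by (auto simp: dist_commute)
    moreover have "fst v \<in> \<Omega>" "snd v \<in> \<Omega>" using v(1) by auto
    ultimately have "\<bar>regular_part \<Omega> (snd v) (fst v) - regular_part \<Omega> (snd w) (fst v)\<bar> \<le> e / 2"
      "dist (regular_part \<Omega> (snd w) (fst v)) (regular_part \<Omega> (snd w) (fst w)) < e / 2"
      using w' d(3)[of "snd v"] d'(2)[of "fst v"] 
        regular_part_diff_le[OF N \<Omega>, of "snd v" "snd w" "e / 2" "fst v"] by auto
    then show ?thesis unfolding dist_real_def by linarith
  qed
  then show "\<exists>d>0. \<forall>v\<in>\<Omega> \<times> \<Omega>. dist v w < d \<longrightarrow> dist (regular_part \<Omega> (snd v) (fst v)) (regular_part \<Omega> (snd w) (fst w)) < e"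
    using d(1) d'(1) by (intro exI[of _ "min d d'"]) auto
qed

section \<open>Product weights, Fubini and the averaging over poles\<close>

lemma integrable_bump_product:
  fixes G :: "'a::euclidean_space \<Rightarrow> 'b::euclidean_space \<Rightarrow> real"
  assumes "continuous_on (cball 0 1 \<times> cball 0 1) (\<lambda>w. G (fst w) (snd w))"
  shows "integrable (lborel :: ('a \<times> 'b) measure) (\<lambda>w. G (fst w) (snd w) * (bump (Suc k) (fst w) * bump (Suc m) (snd w)))"
proof -
  have "continuous_on (cball 0 1 \<times> cball 0 1) (\<lambda>w::'a \<times> 'b. G (fst w) (snd w) * (bump (Suc k) (fst w) * bump (Suc m) (snd w)))"
    by (intro continuous_intros assms continuous_on_compose2[OF continuous_on_bump[of UNIV]]) auto
  then have "integrable lborel (\<lambda>w::'a \<times> 'b. indicator (cball 0 1 \<times> cball 0 1) w *\<^sub>R (G (fst w) (snd w) * (bump (Suc k) (fst w) * bump (Suc m) (snd w))))"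
    by (intro borel_integrable_compact compact_Times) auto
  moreover have eq: "indicator (cball 0 1 \<times> cball 0 1) w *\<^sub>R (G (fst w) (snd w) * (bump (Suc k) (fst w) * bump (Suc m) (snd w)))
      = G (fst w) (snd w) * (bump (Suc k) (fst w) * bump (Suc m) (snd w))" for w :: "'a \<times> 'b"
    by (cases "norm (fst w) \<le> 1 \<and> norm (snd w) \<le> 1") (auto simp: mem_Times_iff bump_0)
  ultimately show ?thesis unfolding eq by blast
qed

lemma bump_fubini:
  fixes G :: "'a::euclidean_space \<Rightarrow> 'b::euclidean_space \<Rightarrow> real"
  assumes "continuous_on (cball 0 1 \<times> cball 0 1) (\<lambda>w. G (fst w) (snd w))"
  shows "(\<integral>s. (\<integral>y. G s y * bump (Suc m) y \<partial>lborel) * bump (Suc k) s \<partial>lborel) = (\<integral>y. (\<integral>s. G s y * bump (Suc k) s \<partial>lborel) * bump (Suc m) y \<partial>lborel)"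
    and "(\<integral>s. (\<integral>y. G s y * bump (Suc m) y \<partial>lborel) * bump (Suc k) s \<partial>lborel) = (\<integral>w. G (fst w) (snd w) * (bump (Suc k) (fst w) * bump (Suc m) (snd w)) \<partial>lborel)"
proof -
  let ?f = "\<lambda>s y. G s y * (bump (Suc k) s * bump (Suc m) y)"
  have int: "integrable (lborel \<Otimes>\<^sub>M lborel) (\<lambda>(s, y). ?f s y)"
    unfolding lborel_prod case_prod_unfold by (rule integrable_bump_product[OF assms])
  have 1: "(\<integral>s. (\<integral>y. ?f s y \<partial>lborel) \<partial>lborel) = (\<integral>s. (\<integral>y. G s y * bump (Suc m) y \<partial>lborel) * bump (Suc k) s \<partial>lborel)"
    by (subst (2) mult.commute) (simp add: mult_ac flip: Bochner_Integration.integral_mult_right_zero)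
  have 2: "(\<integral>y. (\<integral>s. ?f s y \<partial>lborel) \<partial>lborel) = (\<integral>y. (\<integral>s. G s y * bump (Suc k) s \<partial>lborel) * bump (Suc m) y \<partial>lborel)"
    by (subst (2) mult.commute) (simp add: mult_ac flip: Bochner_Integration.integral_mult_right_zero)
  show "(\<integral>s. (\<integral>y. G s y * bump (Suc m) y \<partial>lborel) * bump (Suc k) s \<partial>lborel) = (\<integral>y. (\<integral>s. G s y * bump (Suc k) s \<partial>lborel) * bump (Suc m) y \<partial>lborel)"
    using lborel_pair.Fubini_integral[OF int] unfolding 1 2 by simp
  show "(\<integral>s. (\<integral>y. G s y * bump (Suc m) y \<partial>lborel) * bump (Suc k) s \<partial>lborel) = (\<integral>w. G (fst w) (snd w) * (bump (Suc k) (fst w) * bump (Suc m) (snd w)) \<partial>lborel)"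
    using lborel_pair.integral_fst'[OF int] unfolding 1[symmetric] lborel_prod case_prod_unfold by simp
qed

lemma continuous_on_weighted_mean:
  fixes G :: "'a::euclidean_space \<Rightarrow> 'b::euclidean_space \<Rightarrow> real"
  assumes S: "open S" and G: "continuous_on (S \<times> cball 0 1) (\<lambda>w. G (fst w) (snd w))"
  shows "continuous_on S (\<lambda>x. \<integral>y. G x y * bump (Suc m) y \<partial>lborel)"
  unfolding continuous_on_iff
proof (intro ballI allI impI)
  fix x and e :: real assume x: "x \<in> S" and e: "0 < e"
  obtain r where r: "0 < r" "cball x r \<subseteq> S" using S x open_contains_cball by blast
  let ?\<mu> = "bump_mass TYPE('b) (Suc m)"
  have \<mu>: "0 < ?\<mu>" by (rule bump_mass_pos)
  have "uniformly_continuous_on (cball x r \<times> cball 0 1) (\<lambda>w. G (fst w) (snd w))"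
    by (intro compact_uniformly_continuous continuous_on_subset[OF G] compact_Times) (use r in auto)
  then obtain d where d: "0 < d" "\<And>w w'. w \<in> cball x r \<times> cball 0 1 \<Longrightarrow> w' \<in> cball x r \<times> cball 0 1 \<Longrightarrow> dist w' w < d \<Longrightarrow>
      dist (G (fst w') (snd w')) (G (fst w) (snd w)) < e / (2 * ?\<mu>)"
    using e \<mu> unfolding uniformly_continuous_on_def by (metis divide_pos_pos mult_pos_pos zero_less_numeral)
  have "dist (\<integral>y. G x' y * bump (Suc m) y \<partial>lborel) (\<integral>y. G x y * bump (Suc m) y \<partial>lborel) < e"
    if x': "dist x' x < min d r" for x'
  proof -
    have ci: "continuous_on (cball 0 1) (G t)" if "t \<in> cball x r" for t
    proof -
      have "continuous_on (cball 0 1) (\<lambda>y. G (fst (t, y)) (snd (t, y)))"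
        by (rule continuous_on_compose2[OF G]) (use that r(2) in \<open>auto intro!: continuous_intros\<close>)
      then show ?thesis by simp
    qed
    have xc: "x' \<in> cball x r" "x \<in> cball x r" using x' r(1) by (auto simp: dist_commute)
    have i: "integrable lborel (\<lambda>y. G x' y * bump (Suc m) y)" "integrable lborel (\<lambda>y. G x y * bump (Suc m) y)"
      using ci[OF xc(1)] ci[OF xc(2)] by (auto intro!: integrable_mult_bump)
    have "(\<integral>y. G x' y * bump (Suc m) y \<partial>lborel) - (\<integral>y. G x y * bump (Suc m) y \<partial>lborel) = (\<integral>y. bump (Suc m) y * (G x' y - G x y) \<partial>lborel)"
      using i by (subst Bochner_Integration.integral_diff[symmetric]) (auto simp: algebra_simps)
    also have "\<bar>\<dots>\<bar> \<le> (\<integral>y. \<bar>bump (Suc m) y * (G x' y - G x y)\<bar> \<partial>lborel)"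
      using integral_norm_bound[of lborel "\<lambda>y. bump (Suc m) y * (G x' y - G x y)"] by simp
    also have "\<dots> \<le> (\<integral>y. e / (2 * ?\<mu>) * bump (Suc m) (y::'b) \<partial>lborel)"
    proof (rule integral_mono)
      have "integrable lborel (\<lambda>y. bump (Suc m) y * (G x' y - G x y))"
        using Bochner_Integration.integrable_diff[OF i] by (simp add: algebra_simps)
      then show "integrable lborel (\<lambda>y. \<bar>bump (Suc m) y * (G x' y - G x y)\<bar>)" by (rule integrable_abs)
      show "integrable lborel (\<lambda>y::'b. e / (2 * ?\<mu>) * bump (Suc m) y)" by (intro integrable_mult_right integrable_bump)
      fix y :: 'b
      show "\<bar>bump (Suc m) y * (G x' y - G x y)\<bar> \<le> e / (2 * ?\<mu>) * bump (Suc m) y"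
      proof (cases "norm y < 1")
        case True
        have "dist (G x' y) (G x y) < e / (2 * ?\<mu>)"
          using d(2)[of "(x, y)" "(x', y)"] True xc x' by (auto simp: dist_Pair_Pair)
        then have "\<bar>G x' y - G x y\<bar> \<le> e / (2 * ?\<mu>)" by (simp add: dist_real_def)
        from mult_right_mono[OF this bump_nonneg[of "Suc m" y]] show ?thesis
          using bump_nonneg[of "Suc m" y] by (simp add: abs_mult mult.commute)
      qed (simp add: bump_0)
    qed
    also have "\<dots> = e / 2" using \<mu> by (simp add: bump_mass_def)
    finally show ?thesis using e unfolding dist_real_def by linarith
  qed
  then show "\<exists>d>0. \<forall>x'\<in>S. dist x' x < d \<longrightarrow> dist (\<integral>y. G x' y * bump (Suc m) y \<partial>lborel) (\<integral>y. G x y * bump (Suc m) y \<partial>lborel) < e"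
    using d(1) r(1) by (intro exI[of _ "min d r"]) auto
qed

text \<open>
  The boundary data \<open>q \<mapsto> - newton (q - p)\<close> are harmonic in the pole \<open>p\<close>. Averaging the regular parts over
  a ball of poles yields a harmonic function with the averaged boundary data, so uniqueness makes
  the regular part inherit the mean value property in \<open>p\<close>; no symmetry of the Green function is needed.
\<close>

lemma mean_property_regular_part_pole:
  fixes \<Omega> :: "'a::euclidean_space set"
  assumes N: "3 \<le> DIM('a)" and \<Omega>: "green_domain \<Omega>" and z: "z \<in> \<Omega>"
  shows "mean_property \<Omega> (\<lambda>p. regular_part \<Omega> p z)"
  unfolding mean_property_def
proof (intro allI impI)
  fix m p and r :: real assume r: "0 < r" "cball p r \<subseteq> \<Omega>"
  have op: "open \<Omega>" and bd: "bounded \<Omega>" using \<Omega> by (auto simp: green_domain_def)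
  let ?\<mu> = "bump_mass TYPE('a) (Suc m)"
  have \<mu>: "0 < ?\<mu>" by (rule bump_mass_pos)
  \<comment> \<open>The average over poles, not normalised; the goal is that it equals
    \<open>?\<mu>\<close> times the regular part with pole \<open>p\<close>.\<close>
  define w where "w x = (\<integral>y. regular_part \<Omega> (p + r *\<^sub>R y) x * bump (Suc m) y \<partial>lborel)" for x
  have inB: "p + r *\<^sub>R y \<in> cball p r" if "norm y \<le> 1" for y
    using that r(1) by (simp add: dist_norm)
  have in\<Omega>: "p + r *\<^sub>R y \<in> \<Omega>" if "norm y \<le> 1" for y using inB[OF that] r(2) by blast
  have cG: "continuous_on (\<Omega> \<times> cball 0 1) (\<lambda>v. regular_part \<Omega> (p + r *\<^sub>R snd v) (fst v))"
  proof -
    have "continuous_on (\<Omega> \<times> cball 0 1) (\<lambda>v. regular_part \<Omega> (snd (fst v, p + r *\<^sub>R snd v)) (fst (fst v, p + r *\<^sub>R snd v)))"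
      by (rule continuous_on_compose2[OF continuous_on_regular_part[OF N \<Omega>]]) (use in\<Omega> in \<open>auto intro!: continuous_intros\<close>)
    then show ?thesis by simp
  qed
  have cw: "continuous_on \<Omega> w" unfolding w_def by (rule continuous_on_weighted_mean[OF op cG])
  have hw: "harm \<Omega> w"
  \<comment> \<open>Interchanging the two averages reduces the mean value property of
    \<open>w\<close> to that of each regular part in the average.\<close>
  proof (rule mean_property_imp_harm[OF op])
    show "integrable lborel (\<lambda>y. indicator (cball x s) y * w y)" if "cball x s \<subseteq> \<Omega>" for x s
      using borel_integrable_compact[OF compact_cball continuous_on_subset[OF cw that]] by simp
    show "mean_property \<Omega> w"
      unfolding mean_property_def
    proof (intro allI impI)
      fix k x and s :: real assume s: "0 < s" "cball x s \<subseteq> \<Omega>"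
      have ins: "x + s *\<^sub>R y \<in> \<Omega>" if "norm y \<le> 1" for y
      proof -
        have "x + s *\<^sub>R y \<in> cball x s" using that s(1) by (simp add: dist_norm)
        then show ?thesis using s(2) by blast
      qed
      have cc: "continuous_on (cball 0 1 \<times> cball 0 1) (\<lambda>v. regular_part \<Omega> (p + r *\<^sub>R snd v) (x + s *\<^sub>R fst v))"
      proof -
        have "continuous_on (cball 0 1 \<times> cball 0 1) (\<lambda>v. regular_part \<Omega> (snd (x + s *\<^sub>R fst v, p + r *\<^sub>R snd v)) (fst (x + s *\<^sub>R fst v, p + r *\<^sub>R snd v)))"
          by (rule continuous_on_compose2[OF continuous_on_regular_part[OF N \<Omega>]]) (use in\<Omega> ins in \<open>auto intro!: continuous_intros\<close>)
        then show ?thesis by simp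
      qed
      have "(\<integral>t. w (x + s *\<^sub>R t) * bump (Suc k) t \<partial>lborel) = 
        (\<integral>y. (\<integral>t. regular_part \<Omega> (p + r *\<^sub>R y) (x + s *\<^sub>R t) * bump (Suc k) t \<partial>lborel) * bump (Suc m) y \<partial>lborel)"
        unfolding w_def by (rule bump_fubini(1)[OF cc])
      also have "\<dots> = (\<integral>y. (regular_part \<Omega> (p + r *\<^sub>R y) x * bump_mass TYPE('a) (Suc k)) * bump (Suc m) y \<partial>lborel)"
      proof (rule Bochner_Integration.integral_cong[OF refl])
        fix y :: 'a
        show "(\<integral>t. regular_part \<Omega> (p + r *\<^sub>R y) (x + s *\<^sub>R t) * bump (Suc k) t \<partial>lborel) * bump (Suc m) y
           = (regular_part \<Omega> (p + r *\<^sub>R y) x * bump_mass TYPE('a) (Suc k)) * bump (Suc m) y"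
        proof (cases "norm y < 1")
          case True
          then have "harm \<Omega> (regular_part \<Omega> (p + r *\<^sub>R y))"
            using is_regular_part_regular_part[OF N \<Omega> in\<Omega>] by (simp add: is_regular_part_def)
          from harm_imp_mean_property[OF this] show ?thesis using s unfolding mean_property_def by simp
        qed (simp add: bump_0)
      qed
      also have "\<dots> = (\<integral>y. bump_mass TYPE('a) (Suc k) * (regular_part \<Omega> (p + r *\<^sub>R y) x * bump (Suc m) y) \<partial>lborel)"
        by (simp only: mult_ac)
      also have "\<dots> = w x * bump_mass TYPE('a) (Suc k)" by (simp add: w_def)
      finally show "(\<integral>t. w (x + s *\<^sub>R t) * bump (Suc k) t \<partial>lborel) = w x * bump_mass TYPE('a) (Suc k)" .
    qed
  qed
  \<comment> \<open>A larger ball inside the domain puts all poles of the average at distance at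
    least \<open>R - r\<close> from the frontier, whence a common bound.\<close>
  obtain R where R: "r < R" "cball p R \<subseteq> \<Omega>" using cball_enlarge[OF op r(2)] r(1) by auto
  define C where "C = (R - r) powr (2 - real DIM('a))"
  have bC: "\<bar>regular_part \<Omega> (p + r *\<^sub>R y) x\<bar> \<le> C" if "x \<in> \<Omega>" "norm y \<le> 1" for x y
    unfolding C_def
  proof (rule regular_part_bounds[OF N \<Omega> _ _ that(1)])
    show "ball (p + r *\<^sub>R y) (R - r) \<subseteq> \<Omega>"
    proof
      fix t assume t: "t \<in> ball (p + r *\<^sub>R y) (R - r)"
      have "dist p t \<le> dist p (p + r *\<^sub>R y) + dist (p + r *\<^sub>R y) t" by (rule dist_triangle)
      then have "t \<in> cball p R" using t inB[OF that(2)] by auto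
      then show "t \<in> \<Omega>" using R(2) by blast
    qed
  qed (use R in simp)
  have "is_regular_part \<Omega> p (\<lambda>x. (1 / ?\<mu>) * w x)"
    unfolding is_regular_part_def
  proof (intro conjI ballI)
    show "harm \<Omega> (\<lambda>x. (1 / ?\<mu>) * w x)" by (rule harm_cmult[OF hw])
    fix q assume q: "q \<in> frontier \<Omega>"
    have q\<Omega>: "q \<notin> \<Omega>" using q op by (simp add: frontier_open)
    have "(w \<longlongrightarrow> - newton (q - p) * ?\<mu>) (at q within \<Omega>)"
      unfolding tendsto_at_iff_sequentially
    proof (intro allI impI)
      fix X :: "nat \<Rightarrow> 'a" assume X: "\<forall>i. X i \<in> \<Omega> - {q}" "X \<longlonglongrightarrow> q"
      let ?G = "\<lambda>i y. regular_part \<Omega> (p + r *\<^sub>R y) (X i) * bump (Suc m) y"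
      have mG: "?G i \<in> borel_measurable lborel" for i
      proof (rule borel_measurable_integrable, rule integrable_mult_bump)
        have "continuous_on (cball 0 1) (\<lambda>y. regular_part \<Omega> (p + r *\<^sub>R snd (X i, y)) (fst (X i, y)))"
          by (rule continuous_on_compose2[OF cG]) (use X(1) in \<open>auto intro!: continuous_intros\<close>)
        then show "continuous_on (cball 0 1) (\<lambda>y. regular_part \<Omega> (p + r *\<^sub>R y) (X i))" by simp
      qed
      have lG: "(\<lambda>i. ?G i y) \<longlonglongrightarrow> - newton (q - (p + r *\<^sub>R y)) * bump (Suc m) y" for y
      proof (cases "norm y < 1")
        case True
        then have "(regular_part \<Omega> (p + r *\<^sub>R y) \<longlongrightarrow> - newton (q - (p + r *\<^sub>R y))) (at q within \<Omega>)"
          using is_regular_part_regular_part[OF N \<Omega> in\<Omega>] q by (simp add: is_regular_part_def)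
        then have "(\<lambda>i. regular_part \<Omega> (p + r *\<^sub>R y) (X i)) \<longlonglongrightarrow> - newton (q - (p + r *\<^sub>R y))"
          using X unfolding tendsto_at_iff_sequentially o_def by blast
        then show ?thesis by (intro tendsto_intros)
      qed (simp add: bump_0)
      have "(\<lambda>i. \<integral>y. ?G i y \<partial>lborel) \<longlonglongrightarrow> (\<integral>y. - newton (q - (p + r *\<^sub>R y)) * bump (Suc m) y \<partial>lborel)"
      proof (rule integral_dominated_convergence[where w="\<lambda>y. C * bump (Suc m) y"])
        show "(\<lambda>y. - newton (q - (p + r *\<^sub>R y)) * bump (Suc m) y) \<in> borel_measurable lborel"
          by (rule borel_measurable_LIMSEQ_real[OF lG mG])
        show "integrable lborel (\<lambda>y::'a. C * bump (Suc m) y)" by (intro integrable_mult_right integrable_bump)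
        have "norm (?G i y) \<le> C * bump (Suc m) y" for i y
        proof (cases "norm y < 1")
          case True
          have "X i \<in> \<Omega>" using X(1) by blast
          then have "\<bar>regular_part \<Omega> (p + r *\<^sub>R y) (X i)\<bar> \<le> C" using bC True by simp
          from mult_right_mono[OF this bump_nonneg[of "Suc m" y]] show ?thesis
            using bump_nonneg[of "Suc m" y] by (simp add: abs_mult)
        qed (simp add: bump_0)
        then show "AE y in lborel. norm (?G i y) \<le> C * bump (Suc m) y" for i by simp
      qed (use mG lG in auto)
      \<comment> \<open>The frontier point \<open>q\<close> lies outside the ball of poles, so the
        kernel centred at \<open>q\<close> is harmonic there and its mean is its value at the centre
        \<open>p\<close>.\<close>
      moreover have "(\<integral>y. - newton (q - (p + r *\<^sub>R y)) * bump (Suc m) y \<partial>lborel) = - newton (q - p) * ?\<mu>"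
      proof -
        have "mean_property (- {q}) (\<lambda>x. newton (x - q))" by (rule harm_imp_mean_property[OF harm_newton_at])
        moreover have "cball p r \<subseteq> - {q}" using r(2) q\<Omega> by auto
        ultimately have "(\<integral>y. newton (p + r *\<^sub>R y - q) * bump (Suc m) y \<partial>lborel) = newton (p - q) * ?\<mu>"
          using r(1) unfolding mean_property_def by blast
        then show ?thesis by (simp add: newton_commute[of q])
      qed
      ultimately show "(w \<circ> X) \<longlonglongrightarrow> - newton (q - p) * ?\<mu>" unfolding w_def o_def by simp
    qed
    then have "((\<lambda>x. (1 / ?\<mu>) * w x) \<longlongrightarrow> (1 / ?\<mu>) * (- newton (q - p) * ?\<mu>)) (at q within \<Omega>)" by (intro tendsto_intros)
    then show "((\<lambda>x. (1 / ?\<mu>) * w x) \<longlongrightarrow> - newton (q - p)) (at q within \<Omega>)" using \<mu> by simp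
  qed
  moreover have "p \<in> \<Omega>" using r by auto
  ultimately have "(1 / ?\<mu>) * w z = regular_part \<Omega> p z"
    using is_regular_part_unique[OF bd _ is_regular_part_regular_part[OF N \<Omega>] z] by blast
  then show "(\<integral>y. regular_part \<Omega> (p + r *\<^sub>R y) z * bump (Suc m) y \<partial>lborel) = regular_part \<Omega> p z * ?\<mu>"
    using \<mu> by (simp add: w_def field_simps)
qed

section \<open>Derivatives of the diagonal of a separately harmonic function\<close>

text \<open>Differentiating along the diagonal of the product space uses directions
  \<open>(b, b)\<close>, which are not basis vectors; hence the extension to arbitrary directions
  here and in the lemmas that follow.\<close>

lemma Ck_on_partial_deriv_direction:
  fixes f :: "'a::euclidean_space \<Rightarrow> real"
  assumes "Ck_on (Suc k) UNIV f" shows "Ck_on k UNIV (partial_deriv v f)"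
proof -
  have "partial_deriv v f = (\<lambda>x. \<Sum>b\<in>Basis. (v \<bullet> b) * partial_deriv b f x)"
  proof
    fix x
    have "f differentiable (at x)" using assms by (simp add: Ck_on_Suc)
    from partial_deriv_eq[OF has_derivative_partial[OF this], of v]
    show "partial_deriv v f x = (\<Sum>b\<in>Basis. (v \<bullet> b) * partial_deriv b f x)" by simp
  qed
  moreover have "Ck_on k UNIV (\<lambda>x. \<Sum>b\<in>Basis. (v \<bullet> b) * partial_deriv b f x)"
    by (intro Ck_on_sum Ck_on_cmult Ck_on_partial_deriv[OF assms]) auto
  ultimately show ?thesis by simp
qed

lemma Ck_on_partial_derivs_directions:
  fixes f :: "'a::euclidean_space \<Rightarrow> real"
  shows "Ck_on k UNIV f \<Longrightarrow> length vs \<le> k \<Longrightarrow> Ck_on (k - length vs) UNIV (partial_derivs vs f)"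
proof (induction vs)
  case (Cons v vs)
  then have "Ck_on (Suc (k - length (v # vs))) UNIV (partial_derivs vs f)"
    by (simp add: Suc_diff_Suc)
  then show ?case by (simp add: Ck_on_partial_deriv_direction)
qed simp

lemma partial_derivs_cmult:
  fixes f :: "'a::euclidean_space \<Rightarrow> real"
  assumes "Ck_on k UNIV f"
  shows "length vs \<le> k \<Longrightarrow> partial_derivs vs (\<lambda>x. c * f x) = (\<lambda>x. c * partial_derivs vs f x)"
proof (induction vs)
  case (Cons v vs)
  have "Ck_on (Suc 0) UNIV (partial_derivs vs f)"
    using Ck_on_le[OF Ck_on_partial_derivs_directions[OF assms, of vs], of "Suc 0"] Cons.prems by simp
  then have "partial_derivs vs f differentiable (at x)" for x by (rule Ck_on_differentiable) auto
  then have "partial_deriv v (\<lambda>x. c * partial_derivs vs f x) = (\<lambda>x. c * partial_deriv v (partial_derivs vs f) x)"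
    by (auto simp: partial_deriv_cmult)
  then show ?case using Cons by simp
qed simp

lemma partial_deriv_conv_direction:
  fixes h \<kappa> :: "'a::euclidean_space \<Rightarrow> real"
  assumes h: "integrable lborel h" and \<kappa>: "Ck_on (Suc 0) UNIV \<kappa>" "\<And>y. R < norm y \<Longrightarrow> \<kappa> y = 0"
  shows "partial_deriv v (conv h \<kappa>) = conv h (partial_deriv v \<kappa>)"
proof
  fix x
  have d: "\<kappa> differentiable (at x)" for x using \<kappa>(1) by (simp add: Ck_on_Suc)
  have v: "partial_deriv v \<kappa> y = (\<Sum>b\<in>Basis. (v \<bullet> b) * partial_deriv b \<kappa> y)" for y
    using partial_deriv_eq[OF has_derivative_partial[OF d[of y]], of v] by simp
  have z: "partial_deriv b \<kappa> y = 0" if "R < norm y" for b y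
    using partial_derivs_support[of R \<kappa> y "[b]"] that \<kappa>(2) by simp
  have i: "integrable lborel (\<lambda>y. h y * partial_deriv b \<kappa> (x - y))" if "b \<in> Basis" for b
    by (rule integrable_conv[where R=R]) (use h \<kappa>(1) z that in \<open>auto simp: Ck_on_Suc Ck_on_0\<close>)
  have "partial_deriv v (conv h \<kappa>) x = (\<Sum>b\<in>Basis. (v \<bullet> b) * conv h (partial_deriv b \<kappa>) x)"
    by (rule partial_deriv_eq[OF conv_has_derivative[where R=R, OF h \<kappa>(1)]]) (rule \<kappa>(2))
  also have "\<dots> = (\<integral>y. (\<Sum>b\<in>Basis. (v \<bullet> b) * (h y * partial_deriv b \<kappa> (x - y))) \<partial>lborel)"
    unfolding conv_def using i by (subst Bochner_Integration.integral_sum) auto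
  also have "\<dots> = conv h (partial_deriv v \<kappa>) x"
    unfolding conv_def v by (simp add: sum_distrib_left mult_ac)
  finally show "partial_deriv v (conv h \<kappa>) x = conv h (partial_deriv v \<kappa>) x" .
qed

lemma partial_derivs_conv_directions:
  fixes h \<kappa> :: "'a::euclidean_space \<Rightarrow> real"
  assumes h: "integrable lborel h" and \<kappa>: "Ck_on k UNIV \<kappa>" "\<And>y. R < norm y \<Longrightarrow> \<kappa> y = 0"
  shows "length vs \<le> k \<Longrightarrow> partial_derivs vs (conv h \<kappa>) = conv h (partial_derivs vs \<kappa>)"
proof (induction vs)
  case (Cons v vs)
  have "Ck_on (Suc 0) UNIV (partial_derivs vs \<kappa>)"
    using Ck_on_le[OF Ck_on_partial_derivs_directions[OF \<kappa>(1), of vs], of "Suc 0"] Cons.prems by simp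
  moreover have "partial_derivs vs \<kappa> y = 0" if "R < norm y" for y
    using partial_derivs_support[of R \<kappa> y vs] \<kappa>(2) that by simp
  ultimately have "partial_deriv v (conv h (partial_derivs vs \<kappa>)) = conv h (partial_deriv v (partial_derivs vs \<kappa>))"
    by (intro partial_deriv_conv_direction[OF h, where R=R])
  then show ?case using Cons by simp
qed simp

lemma partial_deriv_linear_comp:
  fixes f :: "'b::euclidean_space \<Rightarrow> 'c::real_normed_vector" and L :: "'a::euclidean_space \<Rightarrow> 'b"
  assumes "bounded_linear L" "f differentiable (at (L x))"
  shows "((\<lambda>x. f (L x)) has_derivative (\<lambda>v. partial_deriv (L v) f (L x))) (at x)"
    "partial_deriv v (\<lambda>x. f (L x)) x = partial_deriv (L v) f (L x)"
proof -
  show "((\<lambda>x. f (L x)) has_derivative (\<lambda>v. partial_deriv (L v) f (L x))) (at x)"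
    unfolding partial_deriv_def
    by (rule has_derivative_compose[OF bounded_linear_imp_has_derivative[OF assms(1)]])
      (use assms(2) frechet_derivative_works in blast)
  then show "partial_deriv v (\<lambda>x. f (L x)) x = partial_deriv (L v) f (L x)" by (rule partial_deriv_eq)
qed

lemma Ck_on_linear_comp:
  fixes f :: "'b::euclidean_space \<Rightarrow> real" and L :: "'a::euclidean_space \<Rightarrow> 'b"
  assumes L: "bounded_linear L"
  shows "Ck_on k UNIV f \<Longrightarrow> Ck_on k UNIV (\<lambda>x. f (L x))"
proof (induction k arbitrary: f)
  case 0
  show ?case unfolding Ck_on_0
    by (rule continuous_on_compose2[OF 0[unfolded Ck_on_0] linear_continuous_on[OF L]]) auto
next
  case (Suc k)
  show ?case
  proof (rule Ck_on_SucI)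
    show "((\<lambda>x. f (L x)) has_derivative (\<lambda>v. partial_deriv (L v) f (L x))) (at x)" for x
      by (rule partial_deriv_linear_comp[OF L]) (use Suc.prems in \<open>simp add: Ck_on_Suc\<close>)
    show "Ck_on k UNIV (\<lambda>x. partial_deriv (L b) f (L x))" for b
      by (rule Suc.IH[OF Ck_on_partial_deriv_direction[OF Suc.prems]])
  qed auto
qed

lemma partial_derivs_linear_comp:
  fixes f :: "'b::euclidean_space \<Rightarrow> real" and L :: "'a::euclidean_space \<Rightarrow> 'b"
  assumes L: "bounded_linear L" and f: "Ck_on k UNIV f"
  shows "length vs \<le> k \<Longrightarrow> partial_derivs vs (\<lambda>x. f (L x)) = (\<lambda>x. partial_derivs (map L vs) f (L x))"
proof (induction vs)
  case (Cons v vs)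
  have "Ck_on (Suc 0) UNIV (partial_derivs (map L vs) f)"
    using Ck_on_le[OF Ck_on_partial_derivs_directions[OF f, of "map L vs"], of "Suc 0"] Cons.prems by simp
  then have "partial_derivs (map L vs) f differentiable (at x)" for x by (simp add: Ck_on_Suc)
  then show ?case using Cons by (auto simp: partial_deriv_linear_comp(2)[OF L])
qed simp

section \<open>Reproducing kernels for separately harmonic functions\<close>

definition diag_kernel :: "nat \<Rightarrow> real \<Rightarrow> 'a::euclidean_space \<times> 'a \<Rightarrow> real" where
  "diag_kernel k \<rho> w = bump (Suc k) ((1 / \<rho>) *\<^sub>R fst w) * bump (Suc k) ((1 / \<rho>) *\<^sub>R snd w)"

lemma Ck_on_diag_kernel: "Ck_on k UNIV (diag_kernel k \<rho> :: 'a::euclidean_space \<times> 'a \<Rightarrow> real)"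
  unfolding diag_kernel_def[abs_def]
  by (intro Ck_on_mult Ck_on_linear_comp[OF _ Ck_on_bump] bounded_linear_scaleR_right[THEN bounded_linear_compose] bounded_linear_fst bounded_linear_snd) auto

lemma diag_kernel_support:
  assumes "0 < \<rho>" "2 * \<rho> < norm w" shows "diag_kernel k \<rho> w = 0"
proof -
  have "norm w \<le> norm (fst w) + norm (snd w)" by (metis norm_Pair_le prod.collapse)
  then have "\<rho> \<le> norm (fst w) \<or> \<rho> \<le> norm (snd w)" using assms(2) by linarith
  then show ?thesis using assms(1) by (auto simp: diag_kernel_def bump_0)
qed

text \<open>Harmonic in each variable separately, not in the sense of the iterated Laplacian. The
  formulation by mean values can be imposed on a closed ball, over which the integrals of
  \<open>diag_representation\<close> are taken.\<close>

definition biharmonic_on :: "'a::euclidean_space set \<Rightarrow> ('a \<Rightarrow> 'a \<Rightarrow> real) \<Rightarrow> bool" where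
  "biharmonic_on S H \<longleftrightarrow> continuous_on (S \<times> S) (\<lambda>w. H (fst w) (snd w)) \<and>
     (\<forall>p\<in>S. mean_property S (\<lambda>z. H z p)) \<and> (\<forall>z\<in>S. mean_property S (H z))"

text \<open>The mean value property is used in the first variable with the second fixed at
  \<open>x\<close>, and then in the second variable. Fubini and the substitution by
  \<open>\<rho>\<close> turn the iterated mean into a convolution on the product. For
  \<open>x\<close> in \<open>ball a \<rho>\<close>, the ball of radius \<open>\<rho>\<close> around
  \<open>x\<close> stays inside the ball of radius \<open>2 * \<rho>\<close> around
  \<open>a\<close>.\<close>

lemma diag_representation:
  fixes H :: "'a::euclidean_space \<Rightarrow> 'a \<Rightarrow> real"
  assumes \<rho>: "0 < \<rho>" and H: "biharmonic_on (cball a (2 * \<rho>)) H" and x: "x \<in> ball a \<rho>"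
  shows "H x x = (1 / (\<rho> ^ DIM('a \<times> 'a) * bump_mass TYPE('a) (Suc k) ^ 2)) *
     conv (\<lambda>w. indicator (cball a (2 * \<rho>) \<times> cball a (2 * \<rho>)) w * H (fst w) (snd w)) (diag_kernel k \<rho>) (x, x)"
proof -
  let ?B = "cball a (2 * \<rho>)" and ?\<mu> = "bump_mass TYPE('a) (Suc k)"
  let ?h = "\<lambda>w. indicator (?B \<times> ?B) w * H (fst w) (snd w)"
  have cH: "continuous_on (?B \<times> ?B) (\<lambda>w. H (fst w) (snd w))" using H by (simp add: biharmonic_on_def)
  have int: "integrable lborel ?h"
    using borel_integrable_compact[OF compact_Times[OF compact_cball compact_cball] cH] by simp
  have sub: "cball x \<rho> \<subseteq> ?B"
  proof
    fix t assume "t \<in> cball x \<rho>"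
    then show "t \<in> ?B" using x dist_triangle[of a t x] by simp
  qed
  have inx: "x + \<rho> *\<^sub>R y \<in> ?B" if "norm y \<le> 1" for y
  proof -
    have "x + \<rho> *\<^sub>R y \<in> cball x \<rho>" using that \<rho> by (simp add: dist_norm)
    then show ?thesis using sub by blast
  qed
  have xB: "x \<in> ?B" using inx[of 0] by simp
  have cc: "continuous_on (cball 0 1 \<times> cball 0 1) (\<lambda>v. H (x + \<rho> *\<^sub>R fst v) (x + \<rho> *\<^sub>R snd v))"
  proof -
    have "continuous_on (cball 0 1 \<times> cball 0 1) (\<lambda>v. H (fst (x + \<rho> *\<^sub>R fst v, x + \<rho> *\<^sub>R snd v)) (snd (x + \<rho> *\<^sub>R fst v, x + \<rho> *\<^sub>R snd v)))"
      by (rule continuous_on_compose2[OF cH]) (use inx in \<open>auto intro!: continuous_intros\<close>)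
    then show ?thesis by simp
  qed
  have "H x x * ?\<mu> * ?\<mu> = (\<integral>s. H (x + \<rho> *\<^sub>R s) x * bump (Suc k) s \<partial>lborel) * ?\<mu>"
    using H xB \<rho> sub by (simp add: biharmonic_on_def mean_property_def)
  also have "\<dots> = (\<integral>s. (\<integral>y. H (x + \<rho> *\<^sub>R s) (x + \<rho> *\<^sub>R y) * bump (Suc k) y \<partial>lborel) * bump (Suc k) s \<partial>lborel)"
  proof -
    have eq: "(\<integral>y. H (x + \<rho> *\<^sub>R s) (x + \<rho> *\<^sub>R y) * bump (Suc k) y \<partial>lborel) * bump (Suc k) s = ?\<mu> * (H (x + \<rho> *\<^sub>R s) x * bump (Suc k) s)" for s
    proof (cases "norm s < 1")
      case True
      then have "mean_property ?B (H (x + \<rho> *\<^sub>R s))" using H inx[of s] by (simp add: biharmonic_on_def)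
      then show ?thesis using \<rho> sub by (simp add: mean_property_def)
    qed (simp add: bump_0)
    show ?thesis unfolding eq by (simp only: Bochner_Integration.integral_mult_right_zero mult.commute)
  qed
  also have "\<dots> = (\<integral>w. H (x + \<rho> *\<^sub>R fst w) (x + \<rho> *\<^sub>R snd w) * (bump (Suc k) (fst w) * bump (Suc k) (snd w)) \<partial>lborel)"
    by (rule bump_fubini(2)[OF cc])
  also have "\<dots> = (\<integral>w. ?h ((x, x) + \<rho> *\<^sub>R w) * diag_kernel k \<rho> (\<rho> *\<^sub>R w) \<partial>lborel)"
  proof (rule Bochner_Integration.integral_cong[OF refl])
    fix w :: "'a \<times> 'a"
    obtain s y where w: "w = (s, y)" by (cases w)
    show "H (x + \<rho> *\<^sub>R fst w) (x + \<rho> *\<^sub>R snd w) * (bump (Suc k) (fst w) * bump (Suc k) (snd w)) = ?h ((x, x) + \<rho> *\<^sub>R w) * diag_kernel k \<rho> (\<rho> *\<^sub>R w)"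
    proof (cases "norm s < 1 \<and> norm y < 1")
      case True
      then have "x + \<rho> *\<^sub>R s \<in> ?B" "x + \<rho> *\<^sub>R y \<in> ?B" using inx by auto
      then show ?thesis using \<rho> by (simp add: w diag_kernel_def indicator_def del: mem_cball)
    next
      case False
      then show ?thesis using \<rho> by (auto simp: w diag_kernel_def bump_0)
    qed
  qed
  finally have 1: "H x x * ?\<mu> * ?\<mu> = (\<integral>w. ?h ((x, x) + \<rho> *\<^sub>R w) * diag_kernel k \<rho> (\<rho> *\<^sub>R w) \<partial>lborel)" .
  have dk: "continuous_on UNIV (diag_kernel k \<rho> :: 'a \<times> 'a \<Rightarrow> real)"
    using Ck_on_imp_continuous[OF Ck_on_diag_kernel] .
  have dkm: "diag_kernel k \<rho> (- w) = diag_kernel k \<rho> w" for w :: "'a \<times> 'a"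
    by (simp add: diag_kernel_def bump_minus)
  have "conv ?h (diag_kernel k \<rho>) (x, x) = (\<integral>w. ?h w * diag_kernel k \<rho> (w - (x, x)) \<partial>lborel)"
    unfolding conv_def by (subst dkm[symmetric]) simp
  also have "\<dots> = \<bar>\<rho>\<bar> ^ DIM('a \<times> 'a) * (\<integral>w. ?h ((x, x) + \<rho> *\<^sub>R w) * diag_kernel k \<rho> ((x, x) + \<rho> *\<^sub>R w - (x, x)) \<partial>lborel)"
  proof (rule lborel_integral_affine)
    have [measurable]: "?h \<in> borel_measurable borel" using borel_measurable_integrable[OF int] by simp
    have [measurable]: "(diag_kernel k \<rho> :: 'a \<times> 'a \<Rightarrow> real) \<in> borel_measurable borel" using dk by (rule borel_measurable_continuous_onI)
    show "(\<lambda>w. ?h w * diag_kernel k \<rho> (w - (x, x))) \<in> borel_measurable borel" by measurable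
  qed (use \<rho> in simp)
  also have "\<dots> = \<rho> ^ DIM('a \<times> 'a) * (H x x * ?\<mu> * ?\<mu>)" unfolding 1 using \<rho> by simp
  finally have 2: "conv ?h (diag_kernel k \<rho>) (x, x) = (\<rho> ^ DIM('a \<times> 'a) * ?\<mu> ^ 2) * H x x" by (simp add: power2_eq_square mult_ac)
  have 3: "\<rho> ^ DIM('a \<times> 'a) * ?\<mu> ^ 2 \<noteq> 0" using \<rho> bump_mass_pos[where 'a='a, of k] by simp
  have key: "c = K * h \<Longrightarrow> K \<noteq> 0 \<Longrightarrow> h = (1 / K) * c" for K h c :: real by simp
  show ?thesis by (rule key[OF 2 3])
qed

definition pair_dup :: "'a \<Rightarrow> 'a \<times> 'a" where "pair_dup x = (x, x)"

lemma bounded_linear_pair_dup: "bounded_linear (pair_dup :: 'a::real_normed_vector \<Rightarrow> 'a \<times> 'a)"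
  unfolding pair_dup_def[abs_def] by (intro bounded_linear_Pair bounded_linear_ident)

text \<open>The diagonal restriction is a convolution composed with the linear map
  \<open>pair_dup\<close>, so derivatives along \<open>b\<close> become derivatives of the kernel
  along \<open>(b, b)\<close>, while \<open>H\<close> enters through its values.\<close>

lemma diag_Ck_on:
  fixes H :: "'a::euclidean_space \<Rightarrow> 'a \<Rightarrow> real"
  assumes \<rho>: "0 < \<rho>" and H: "biharmonic_on (cball a (2 * \<rho>)) H"
  shows "Ck_on k (ball a \<rho>) (\<lambda>x. H x x)"
    and "length bs \<le> k \<Longrightarrow> partial_derivs bs (\<lambda>x. H x x) a = 
      (1 / (\<rho> ^ DIM('a \<times> 'a) * bump_mass TYPE('a) (Suc k) ^ 2)) *
        (\<integral>w. (indicator (cball a (2 * \<rho>) \<times> cball a (2 * \<rho>)) w * H (fst w) (snd w)) * partial_derivs (map pair_dup bs) (diag_kernel k \<rho>) ((a, a) - w) \<partial>lborel)"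
proof -
  let ?B = "cball a (2 * \<rho>)"
  let ?h = "\<lambda>w. indicator (?B \<times> ?B) w * H (fst w) (snd w)"
  let ?c = "1 / (\<rho> ^ DIM('a \<times> 'a) * bump_mass TYPE('a) (Suc k) ^ 2)"
  let ?\<Phi> = "\<lambda>w. ?c * conv ?h (diag_kernel k \<rho>) w"
  have cH: "continuous_on (?B \<times> ?B) (\<lambda>w. H (fst w) (snd w))" using H by (simp add: biharmonic_on_def)
  have int: "integrable lborel ?h"
    using borel_integrable_compact[OF compact_Times[OF compact_cball compact_cball] cH] by simp
  have rep: "H x x = ?\<Phi> (pair_dup x)" if "x \<in> ball a \<rho>" for x
    using diag_representation[OF \<rho> H that] by (simp add: pair_dup_def)
  have C: "Ck_on k UNIV (conv ?h (diag_kernel k \<rho>))"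
    by (rule Ck_on_conv[OF int Ck_on_diag_kernel, where R="2 * \<rho>"]) (use \<rho> diag_kernel_support in auto)
  have C\<Phi>: "Ck_on k UNIV ?\<Phi>" by (rule Ck_on_cmult[OF open_UNIV C])
  have "Ck_on k (ball a \<rho>) (\<lambda>x. ?\<Phi> (pair_dup x))"
    by (rule Ck_on_subset[OF Ck_on_linear_comp[OF bounded_linear_pair_dup C\<Phi>]]) simp
  then show "Ck_on k (ball a \<rho>) (\<lambda>x. H x x)" 
    by (rule Ck_on_cong[rotated 2]) (use rep in auto)
  assume bs: "length bs \<le> k"
  have cm: "partial_derivs vs ?\<Phi> = (\<lambda>w. ?c * partial_derivs vs (conv ?h (diag_kernel k \<rho>)) w)" if "length vs \<le> k" for vs
    by (rule partial_derivs_cmult[OF C that])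
  have "partial_derivs bs (\<lambda>x. H x x) a = partial_derivs bs (\<lambda>x. ?\<Phi> (pair_dup x)) a"
    by (rule partial_derivs_cong[of "ball a \<rho>"]) (use rep \<rho> in auto)
  also have "\<dots> = partial_derivs (map pair_dup bs) ?\<Phi> (pair_dup a)"
    using partial_derivs_linear_comp[OF bounded_linear_pair_dup C\<Phi> bs] by (rule fun_cong)
  also have "\<dots> = ?c * partial_derivs (map pair_dup bs) (conv ?h (diag_kernel k \<rho>)) (a, a)"
    using cm[of "map pair_dup bs"] bs by (simp add: pair_dup_def)
  also have "partial_derivs (map pair_dup bs) (conv ?h (diag_kernel k \<rho>)) = conv ?h (partial_derivs (map pair_dup bs) (diag_kernel k \<rho>))"
    by (rule partial_derivs_conv_directions[OF int Ck_on_diag_kernel, where R="2 * \<rho>"]) (use \<rho> bs diag_kernel_support in auto)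
  finally show "partial_derivs bs (\<lambda>x. H x x) a = ?c * (\<integral>w. ?h w * partial_derivs (map pair_dup bs) (diag_kernel k \<rho>) ((a, a) - w) \<partial>lborel)"
    by (simp add: conv_def)
qed

text \<open>By \<open>diag_Ck_on\<close>, each derivative is an integral against one kernel common
  to all members of the sequence and the limit, so uniform closeness of the functions on the ball
  suffices.\<close>

lemma diag_derivs_converge:
  fixes H :: "'a::euclidean_space \<Rightarrow> 'a \<Rightarrow> real" and Hn :: "nat \<Rightarrow> 'a \<Rightarrow> 'a \<Rightarrow> real"
  assumes \<rho>: "0 < \<rho>" and H: "biharmonic_on (cball a (2 * \<rho>)) H" and Hn: "\<And>n. biharmonic_on (cball a (2 * \<rho>)) (Hn n)"
    and lim: "\<And>e. 0 < e \<Longrightarrow> \<forall>\<^sub>F n in sequentially. \<forall>z\<in>cball a (2 * \<rho>). \<forall>p\<in>cball a (2 * \<rho>). \<bar>Hn n z p - H z p\<bar> < e"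
  shows "(\<lambda>n. partial_derivs bs (\<lambda>x. Hn n x x) a) \<longlonglongrightarrow> partial_derivs bs (\<lambda>x. H x x) a"
proof -
  let ?B = "cball a (2 * \<rho>)" and ?k = "length bs"
  let ?c = "1 / (\<rho> ^ DIM('a \<times> 'a) * bump_mass TYPE('a) (Suc ?k) ^ 2)"
  let ?g = "\<lambda>w. partial_derivs (map pair_dup bs) (diag_kernel ?k \<rho>) ((a, a) - w)"
  let ?h = "\<lambda>H w. indicator (?B \<times> ?B) w * H (fst w) (snd w)"
  have g: "continuous_on UNIV (partial_derivs (map pair_dup bs) (diag_kernel ?k \<rho> :: 'a \<times> 'a \<Rightarrow> real))"
    using Ck_on_imp_continuous[OF Ck_on_partial_derivs_directions[OF Ck_on_diag_kernel, of "map pair_dup bs"]] by simp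
  have gs: "partial_derivs (map pair_dup bs) (diag_kernel ?k \<rho>) w = 0" if "2 * \<rho> < norm w" for w :: "'a \<times> 'a"
    by (rule partial_derivs_support[where R="2 * \<rho>"]) (use diag_kernel_support[OF \<rho>] that in auto)
  have h: "integrable lborel (?h H)" if "biharmonic_on ?B H" for H
  proof -
    have "continuous_on (?B \<times> ?B) (\<lambda>w. H (fst w) (snd w))" using that by (simp add: biharmonic_on_def)
    from borel_integrable_compact[OF compact_Times[OF compact_cball compact_cball] this] show ?thesis by simp
  qed
  have "\<exists>C>0. \<forall>w. \<bar>partial_derivs (map pair_dup bs) (diag_kernel ?k \<rho>) (w :: 'a \<times> 'a)\<bar> \<le> C"
    by (rule compact_support_bounded[OF g]) (rule gs)
  then obtain C where C: "0 < C" "\<forall>w. \<bar>partial_derivs (map pair_dup bs) (diag_kernel ?k \<rho>) (w :: 'a \<times> 'a)\<bar> \<le> C"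
    by (elim exE conjE)
  have hi: "integrable lborel (\<lambda>w. ?h H w * ?g w)" if "biharmonic_on ?B H" for H
    by (rule integrable_conv[OF h[OF that] g]) (rule gs)
  have ind: "integrable lborel (indicator (?B \<times> ?B) :: 'a \<times> 'a \<Rightarrow> real)"
    using borel_integrable_compact[OF compact_Times[OF compact_cball compact_cball] continuous_on_const[of _ "1::real"], of a "2 * \<rho>" a "2 * \<rho>"] by simp
  define V :: real where "V = (\<integral>w. indicator (?B \<times> ?B) (w :: 'a \<times> 'a) \<partial>lborel)"
  have V: "0 \<le> V" unfolding V_def by simp
  have "(\<lambda>n. \<integral>w. ?h (Hn n) w * ?g w \<partial>lborel) \<longlonglongrightarrow> (\<integral>w. ?h H w * ?g w \<partial>lborel)"
  proof (rule tendstoI)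
    fix e :: real assume e: "0 < e"
    \<comment> \<open>\<open>C\<close> bounds the kernel and \<open>V\<close> is the volume of the
      region of integration; adding 1 keeps the denominator positive and the final inequality
      strict.\<close>
    define d where "d = e / (C * (V + 1))"
    have d: "0 < d" using e C V by (simp add: d_def)
    show "\<forall>\<^sub>F n in sequentially. dist (\<integral>w. ?h (Hn n) w * ?g w \<partial>lborel) (\<integral>w. ?h H w * ?g w \<partial>lborel) < e"
    proof (rule eventually_mono[OF lim[OF d]])
      fix n assume elim: "\<forall>z\<in>?B. \<forall>p\<in>?B. \<bar>Hn n z p - H z p\<bar> < d"
      define I where "I = (\<integral>w. ?h (Hn n) w * ?g w - ?h H w * ?g w \<partial>lborel)"
      have I: "(\<integral>w. ?h (Hn n) w * ?g w \<partial>lborel) - (\<integral>w. ?h H w * ?g w \<partial>lborel) = I"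
        unfolding I_def by (rule Bochner_Integration.integral_diff[OF hi[OF Hn] hi[OF H], symmetric])
      have "\<bar>I\<bar> \<le> (\<integral>w. \<bar>?h (Hn n) w * ?g w - ?h H w * ?g w\<bar> \<partial>lborel)"
        unfolding I_def using integral_norm_bound[of lborel "\<lambda>w. ?h (Hn n) w * ?g w - ?h H w * ?g w"] by simp
      also have "\<dots> \<le> (\<integral>w. (d * C) * indicator (?B \<times> ?B) (w :: 'a \<times> 'a) \<partial>lborel)"
      proof (rule integral_mono)
        show "integrable lborel (\<lambda>w. \<bar>?h (Hn n) w * ?g w - ?h H w * ?g w\<bar>)"
          using hi[OF Hn] hi[OF H] by (intro integrable_abs Bochner_Integration.integrable_diff)
        show "integrable lborel (\<lambda>w. (d * C) * indicator (?B \<times> ?B) (w :: 'a \<times> 'a))" by (intro integrable_mult_right ind)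
        fix w :: "'a \<times> 'a"
        show "\<bar>?h (Hn n) w * ?g w - ?h H w * ?g w\<bar> \<le> (d * C) * indicator (?B \<times> ?B) w"
        proof (cases "w \<in> ?B \<times> ?B")
          case True
          then have "\<bar>Hn n (fst w) (snd w) - H (fst w) (snd w)\<bar> \<le> d" using elim by (auto simp: mem_Times_iff less_imp_le)
          then have "\<bar>Hn n (fst w) (snd w) - H (fst w) (snd w)\<bar> * \<bar>?g w\<bar> \<le> d * C"
            using C(1) C(2)[rule_format, of "(a, a) - w"] d by (intro mult_mono) auto
          then show ?thesis using True by (simp add: left_diff_distrib[symmetric] abs_mult)
        qed simp
      qed
      also have "\<dots> = d * C * V" by (simp add: V_def)
      also have "\<dots> = e * (V / (V + 1))" using C(1) by (simp add: d_def)
      also have "\<dots> < e" using e V by (simp add: field_simps)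
      finally show "dist (\<integral>w. ?h (Hn n) w * ?g w \<partial>lborel) (\<integral>w. ?h H w * ?g w \<partial>lborel) < e"
        by (simp only: dist_real_def I)
    qed
  qed
  then have "(\<lambda>n. ?c * (\<integral>w. ?h (Hn n) w * ?g w \<partial>lborel)) \<longlonglongrightarrow> ?c * (\<integral>w. ?h H w * ?g w \<partial>lborel)"
    by (rule tendsto_mult_left)
  moreover have "partial_derivs bs (\<lambda>x. H x x) a = ?c * (\<integral>w. ?h H w * ?g w \<partial>lborel)"
    by (rule diag_Ck_on(2)[OF \<rho> H order.refl])
  moreover have "partial_derivs bs (\<lambda>x. Hn n x x) a = ?c * (\<integral>w. ?h (Hn n) w * ?g w \<partial>lborel)" for n
    by (rule diag_Ck_on(2)[OF \<rho> Hn order.refl])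
  ultimately show ?thesis by (simp only:)
qed

section \<open>Green functions and Robin functions\<close>

lemma Basis_vec_complex: "(Basis :: (complex ^ 'n::finite) set) = (\<lambda>(i, u). axis i u) ` (UNIV \<times> {1, \<i>})"
  by (force simp: Basis_vec_def Basis_complex_def)

lemma axis_in_Basis: "axis i 1 \<in> (Basis :: (complex ^ 'n::finite) set)" "axis i \<i> \<in> (Basis :: (complex ^ 'n) set)"
  by (auto simp: Basis_vec_complex)

lemma sum_Basis_vec_complex:
  fixes f :: "complex ^ 'n::finite \<Rightarrow> 'b::comm_monoid_add"
  shows "(\<Sum>b\<in>Basis. f b) = (\<Sum>i\<in>UNIV. f (axis i 1) + f (axis i \<i>))"
proof -
  have inj: "inj_on (\<lambda>(i::'n, u::complex). axis i u) (UNIV \<times> {1, \<i>})"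
    by (auto simp: inj_on_def axis_eq_axis)
  have "(\<Sum>b\<in>Basis. f b) = (\<Sum>(i, u)\<in>UNIV \<times> {1, \<i>}. f (axis i u))"
    unfolding Basis_vec_complex by (subst sum.reindex[OF inj]) (simp add: case_prod_unfold)
  also have "\<dots> = (\<Sum>i\<in>UNIV. \<Sum>u\<in>{1, \<i>}. f (axis i u))" by (rule sum.cartesian_product[symmetric])
  finally show ?thesis by simp
qed

lemma newton_eq_powi:
  fixes z :: "complex ^ 'n::finite"
  assumes "2 \<le> CARD('n)"
  shows "newton z = norm z powi (2 - 2 * int CARD('n))"
proof (cases "z = 0")
  case True
  \<comment> \<open>At the origin both powers are 0 by convention, which for \<open>powi\<close>
    depends on the exponent being nonzero.\<close>
  have "2 - 2 * int CARD('n) \<noteq> 0" using assms by simp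
  then show ?thesis using True by (simp add: newton_def power_int_0_left_if)
next
  case False
  have eq: "2 - real DIM(complex ^ 'n) = real_of_int (2 - 2 * int CARD('n))" by (simp add: mult.commute)
  show ?thesis unfolding newton_def eq by (rule powr_real_of_int') (use False in auto)
qed

lemma partial_deriv_complex_comb:
  fixes u v :: "'a::euclidean_space \<Rightarrow> real"
  assumes "u differentiable (at x)" "v differentiable (at x)"
  shows "partial_deriv b (\<lambda>x. (complex_of_real (u x) + c * complex_of_real (v x)) / 2) x
     = (complex_of_real (partial_deriv b u x) + c * complex_of_real (partial_deriv b v x)) / 2"
proof (rule partial_deriv_eq[where f'="\<lambda>b. (complex_of_real (partial_deriv b u x) + c * complex_of_real (partial_deriv b v x)) / 2"])
  have "(u has_derivative (\<lambda>b. partial_deriv b u x)) (at x)" "(v has_derivative (\<lambda>b. partial_deriv b v x)) (at x)"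
    using assms unfolding partial_deriv_def by (auto simp: frechet_derivative_works)
  then show "((\<lambda>x. (complex_of_real (u x) + c * complex_of_real (v x)) / 2) has_derivative
      (\<lambda>b. (complex_of_real (partial_deriv b u x) + c * complex_of_real (partial_deriv b v x)) / 2)) (at x)"
    by (auto intro!: derivative_eq_intros has_derivative_of_real)
qed

text \<open>The mixed second derivatives cancel by symmetry, so each \<open>dz i (dzbar i f)\<close>
  is a quarter of the Laplacian in the plane of the coordinate \<open>i\<close>; the factor 4
  restores \<open>lap\<close>.\<close>

lemma laplacian_of_real:
  fixes u :: "complex ^ 'n::finite \<Rightarrow> real"
  assumes S: "open S" "z \<in> S" and u: "Ck_on 2 S u"
  shows "laplacian (\<lambda>z. complex_of_real (u z)) z = complex_of_real (lap u z)"
proof -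
  have real: "partial_deriv b (\<lambda>z. complex_of_real (u z)) x = complex_of_real (partial_deriv b u x)" if "x \<in> S" "b \<in> Basis" for b x
    by (rule partial_deriv_bounded_linear_comp[OF bounded_linear_of_real Ck_2_differentiable(1)[OF u that]])
  have e: "dz i (dzbar i (\<lambda>z. complex_of_real (u z))) z 
     = complex_of_real (partial_deriv (axis i 1) (partial_deriv (axis i 1) u) z + partial_deriv (axis i \<i>) (partial_deriv (axis i \<i>) u) z) / 4" for i
  proof -
    let ?g = "\<lambda>x. (complex_of_real (partial_deriv (axis i 1) u x) + \<i> * complex_of_real (partial_deriv (axis i \<i>) u x)) / 2"
    have g: "dzbar i (\<lambda>z. complex_of_real (u z)) x = ?g x" if "x \<in> S" for x
      unfolding dzbar_def using that by (simp add: real axis_in_Basis)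
    have pg: "partial_deriv b (dzbar i (\<lambda>z. complex_of_real (u z))) z
       = (complex_of_real (partial_deriv b (partial_deriv (axis i 1) u) z) + \<i> * complex_of_real (partial_deriv b (partial_deriv (axis i \<i>) u) z)) / 2" for b
    proof -
      have "partial_deriv b (dzbar i (\<lambda>z. complex_of_real (u z))) z = partial_deriv b ?g z"
        by (rule partial_deriv_cong[OF S g])
      also have "\<dots> = (complex_of_real (partial_deriv b (partial_deriv (axis i 1) u) z) + \<i> * complex_of_real (partial_deriv b (partial_deriv (axis i \<i>) u) z)) / 2"
        by (rule partial_deriv_complex_comb) (use Ck_2_differentiable(2)[OF u S(2)] axis_in_Basis in blast)+
      finally show ?thesis .
    qed
    have comm: "partial_deriv (axis i 1) (partial_deriv (axis i \<i>) u) z = partial_deriv (axis i \<i>) (partial_deriv (axis i 1) u) z"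
      by (rule partial_deriv_commute[OF u S]) (rule axis_in_Basis)+
    show ?thesis unfolding dz_def[of i "dzbar i (\<lambda>z. complex_of_real (u z))"] pg comm
      by (simp add: algebra_simps add_divide_distrib diff_divide_distrib)
  qed
  have e4: "4 * dz i (dzbar i (\<lambda>z. complex_of_real (u z))) z 
     = complex_of_real (partial_deriv (axis i 1) (partial_deriv (axis i 1) u) z + partial_deriv (axis i \<i>) (partial_deriv (axis i \<i>) u) z)" for i
    unfolding e by simp
  show ?thesis
    unfolding laplacian_def lap_def sum_Basis_vec_complex sum_distrib_left e4 by simp
qed

lemma harmonic_on_iff_harm: "harmonic_on S u \<longleftrightarrow> harm S u"
proof -
  have "laplacian (\<lambda>z. complex_of_real (u z)) z = 0 \<longleftrightarrow> lap u z = 0" if "open S" "z \<in> S" "Ck_on 2 S u" for z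
    using laplacian_of_real[OF that] by simp
  then show ?thesis unfolding harmonic_on_def harm_def by blast
qed

text \<open>\<open>green_function\<close> is a choice, so the value is computed for an arbitrary
  Green function \<open>G\<close>. Its regular part, extended over the pole, differs from
  \<open>R\<close> by a harmonic function that tends to 0 at the frontier and at infinity; the
  maximum principle for both signs makes the two agree at \<open>p\<close>.\<close>

lemma robin_function_eq:
  fixes \<Omega> :: "(complex ^ 'n::finite) set"
  assumes n: "2 \<le> CARD('n)" and \<Omega>: "open \<Omega>" and p: "p \<in> \<Omega>" and R: "harm \<Omega> R"
    and lim: "\<And>q. q \<in> frontier \<Omega> \<Longrightarrow> (R \<longlongrightarrow> - newton (q - p)) (at q within \<Omega>)"
    and inf: "((\<lambda>z. newton (z - p) + R z) \<longlongrightarrow> 0) (inf at_infinity (principal \<Omega>))"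
  shows "robin_function \<Omega> p = R p"
proof -
  have qp: "q \<noteq> p" if "q \<in> frontier \<Omega>" for q using that p \<Omega> by (auto simp: frontier_open)
  have nlim: "((\<lambda>z. newton (z - p)) \<longlongrightarrow> newton (q - p)) (at q within \<Omega>)" if "q \<in> frontier \<Omega>" for q
  proof -
    have "isCont (\<lambda>z. newton (z - p)) q"
      using continuous_on_newton[of p] qp[OF that] by (simp add: continuous_on_eq_continuous_at[OF open_Compl[OF closed_singleton]])
    then show ?thesis unfolding isCont_def by (rule tendsto_within_subset) simp
  qed
  have oOp: "open (\<Omega> - {p})" using \<Omega> by (rule open_delete)
  have hn: "harm (\<Omega> - {p}) (\<lambda>z. newton (z - p))" by (rule harm_subset[OF harm_newton_at oOp]) auto
  have ex: "is_green_function \<Omega> p (\<lambda>z. newton (z - p) + R z)"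
    unfolding is_green_function_def harmonic_on_iff_harm
  proof (intro conjI ballI inf)
    show "harm (\<Omega> - {p}) (\<lambda>z. newton (z - p) + R z)"
      by (rule harm_add[OF hn harm_subset[OF R oOp]]) auto
    show "((\<lambda>z. newton (z - p) + R z) \<longlongrightarrow> 0) (at q within \<Omega>)" if "q \<in> frontier \<Omega>" for q
      using tendsto_add[OF nlim[OF that] lim[OF that]] by simp
    obtain r where r: "0 < r" "ball p r \<subseteq> \<Omega>" using \<Omega> p open_contains_ball by blast
    show "\<exists>r>0. \<exists>h. ball p r \<subseteq> \<Omega> \<and> harm (ball p r) h \<and>
        (\<forall>z\<in>ball p r - {p}. h z = newton (z - p) + R z - norm (z - p) powi (2 - 2 * int CARD('n)))"
      using r harm_subset[OF R open_ball r(2)] by (intro exI[of _ r] conjI exI[of _ R]) (auto simp: newton_eq_powi[OF n])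
  qed
  define G where "G = green_function \<Omega> p"
  have G: "is_green_function \<Omega> p G"
    unfolding G_def green_function_def by (rule someI[of "is_green_function \<Omega> p", OF ex])
  obtain r h where r: "0 < r" "ball p r \<subseteq> \<Omega>" and h: "harm (ball p r) h" "\<And>z. z \<in> ball p r \<Longrightarrow> z \<noteq> p \<Longrightarrow> h z = G z - newton (z - p)"
    using G unfolding is_green_function_def harmonic_on_iff_harm newton_eq_powi[OF n, symmetric] by (auto simp del: mem_ball)
  \<comment> \<open>The extension of \<open>G\<close> minus the kernel over the pole: harmonic near
    \<open>p\<close> because it equals \<open>h\<close>, and elsewhere as a difference of harmonic
    functions.\<close>
  define H where "H z = (if z = p then h p else G z - newton (z - p))" for z
  have Hh: "H z = h z" if "z \<in> ball p r" for z using h(2)[OF that] by (auto simp: H_def)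
  have hG: "harm (\<Omega> - {p}) G" using G by (simp add: is_green_function_def harmonic_on_iff_harm)
  have HH: "harm \<Omega> H"
  proof (rule harm_local[OF _ \<Omega>])
    fix x assume x: "x \<in> \<Omega>"
    show "\<exists>U. x \<in> U \<and> harm U H"
    proof (cases "x = p")
      case True
      have "harm (ball p r) H" by (rule harm_cong[OF h(1)]) (simp add: Hh)
      then show ?thesis using True r(1) by (intro exI[of _ "ball p r"]) auto
    next
      case False
      have "harm (\<Omega> - {p}) H" by (rule harm_cong[OF harm_diff[OF hG hn]]) (simp add: H_def)
      then show ?thesis using False x by (intro exI[of _ "\<Omega> - {p}"]) auto
    qed
  qed
  have Hlim: "((\<lambda>z. H z - R z) \<longlongrightarrow> 0) (at q within \<Omega>)" if q: "q \<in> frontier \<Omega>" for q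
  proof -
    have "((\<lambda>z. (G z - newton (z - p)) - R z) \<longlongrightarrow> (0 - newton (q - p)) - - newton (q - p)) (at q within \<Omega>)"
      using G q by (intro tendsto_diff nlim[OF q] lim[OF q]) (simp add: is_green_function_def)
    then have l: "((\<lambda>z. (G z - newton (z - p)) - R z) \<longlongrightarrow> 0) (at q within \<Omega>)" by simp
    have "\<forall>\<^sub>F z in at q within \<Omega>. z \<noteq> p"
      using qp[OF q] tendsto_imp_eventually_ne[OF tendsto_ident_at] by blast
    then have "\<forall>\<^sub>F z in at q within \<Omega>. (G z - newton (z - p)) - R z = H z - R z"
      by eventually_elim (simp add: H_def)
    then show ?thesis using l by (rule Lim_transform_eventually[rotated])
  qed
  have Hinf: "((\<lambda>z. H z - R z) \<longlongrightarrow> 0) (inf at_infinity (principal \<Omega>))"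
  proof -
    have "((\<lambda>z. G z - (newton (z - p) + R z)) \<longlongrightarrow> 0 - 0) (inf at_infinity (principal \<Omega>))"
      using G by (intro tendsto_diff inf) (simp add: is_green_function_def)
    then have l: "((\<lambda>z. G z - (newton (z - p) + R z)) \<longlongrightarrow> 0) (inf at_infinity (principal \<Omega>))" by simp
    have "\<forall>\<^sub>F z in inf at_infinity (principal \<Omega>). z \<noteq> p"
      unfolding eventually_inf_principal eventually_at_infinity by (intro exI[of _ "norm p + 1"]) auto
    then have "\<forall>\<^sub>F z in inf at_infinity (principal \<Omega>). G z - (newton (z - p) + R z) = H z - R z"
      by eventually_elim (simp add: H_def)
    then show ?thesis using l by (rule Lim_transform_eventually[rotated])
  qed
  have hd: "harm \<Omega> (\<lambda>z. H z - R z)" by (rule harm_diff[OF HH R])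
  have "H p - R p \<le> 0"
    by (rule harm_max_principle[OF hd _ _ p]) (use order_tendstoD(2)[OF Hlim] order_tendstoD(2)[OF Hinf] in auto)
  moreover have "- (H p - R p) \<le> 0"
  proof (rule harm_max_principle[OF harm_uminus[OF hd] _ _ p])
    fix q and e :: real assume "q \<in> frontier \<Omega>" "0 < e"
    then have "\<forall>\<^sub>F x in at q within \<Omega>. - e < H x - R x" using order_tendstoD(1)[OF Hlim] by simp
    then show "\<forall>\<^sub>F x in at q within \<Omega>. - (H x - R x) < e" by eventually_elim simp
  next
    fix e :: real assume "0 < e"
    then have "\<forall>\<^sub>F x in inf at_infinity (principal \<Omega>). - e < H x - R x" using order_tendstoD(1)[OF Hinf] by simp
    then show "\<forall>\<^sub>F x in inf at_infinity (principal \<Omega>). - (H x - R x) < e" by eventually_elim simp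
  qed
  ultimately have hp: "h p = R p" by (simp add: H_def)
  have "isCont h p"
    using harm_imp_continuous[OF h(1)] r(1) by (simp add: continuous_on_eq_continuous_at)
  then have "(h \<longlongrightarrow> R p) (at p)" by (simp add: isCont_def hp)
  moreover have "\<forall>\<^sub>F z in at p. h z = G z - newton (z - p)"
    unfolding eventually_at using r(1) h(2) by (intro exI[of _ r]) (auto simp: dist_commute)
  ultimately have "((\<lambda>z. G z - newton (z - p)) \<longlongrightarrow> R p) (at p)" by (rule Lim_transform_eventually)
  then have "Lim (at p) (\<lambda>z. G z - newton (z - p)) = R p"
    by (intro tendsto_Lim) auto
  then show ?thesis by (simp add: robin_function_def G_def newton_eq_powi[OF n])
qed

lemma DIM_ge_3: "2 \<le> CARD('n) \<Longrightarrow> 3 \<le> DIM(complex ^ 'n::finite)"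
  by simp

lemma robin_function_regular_part:
  fixes \<Omega> :: "(complex ^ 'n::finite) set"
  assumes n: "2 \<le> CARD('n)" and \<Omega>: "green_domain \<Omega>" and p: "p \<in> \<Omega>"
  shows "robin_function \<Omega> p = regular_part \<Omega> p p"
proof (rule robin_function_eq[OF n _ p, where R="regular_part \<Omega> p"])
  have R: "is_regular_part \<Omega> p (regular_part \<Omega> p)"
    by (rule is_regular_part_regular_part[OF DIM_ge_3[OF n] \<Omega> p])
  show "open \<Omega>" using \<Omega> by (simp add: green_domain_def)
  show "harm \<Omega> (regular_part \<Omega> p)" using R by (simp add: is_regular_part_def)
  show "(regular_part \<Omega> p \<longlongrightarrow> - newton (q - p)) (at q within \<Omega>)" if "q \<in> frontier \<Omega>" for q
    using R that by (simp add: is_regular_part_def)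
  obtain B where B: "\<And>x. x \<in> \<Omega> \<Longrightarrow> norm x \<le> B" using \<Omega> by (auto simp: green_domain_def bounded_iff)
  have "eventually (\<lambda>_. False) (inf at_infinity (principal \<Omega>))"
    unfolding eventually_inf_principal eventually_at_infinity using B by (intro exI[of _ "B + 1"]) force
  then have "inf at_infinity (principal \<Omega>) = bot" by (simp add: trivial_limit_def)
  then show "((\<lambda>z. newton (z - p) + regular_part \<Omega> p z) \<longlongrightarrow> 0) (inf at_infinity (principal \<Omega>))" by simp
qed

section \<open>Half spaces\<close>

text \<open>The mirror image of \<open>p\<close> in the hyperplane
  \<open>g \<bullet> w = 1\<close>.\<close>

definition halfspace_reflection :: "'a::euclidean_space \<Rightarrow> 'a \<Rightarrow> 'a" where
  "halfspace_reflection g p = p + (2 * (1 - g \<bullet> p) / (g \<bullet> g)) *\<^sub>R g"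

lemma inner_halfspace_reflection: "g \<noteq> 0 \<Longrightarrow> g \<bullet> halfspace_reflection g p = 2 - g \<bullet> p"
  by (simp add: halfspace_reflection_def inner_add_right)

text \<open>The added term is symmetric in \<open>z\<close> and \<open>p\<close> and vanishes when
  \<open>z\<close> lies on the hyperplane: the former gives the symmetry of the reflected kernel,
  the latter its boundary values.\<close>

lemma dist_halfspace_reflection:
  assumes g: "g \<noteq> 0"
  shows "(norm (z - halfspace_reflection g p))\<^sup>2 = (norm (z - p))\<^sup>2 + 4 * (1 - g \<bullet> p) * (1 - g \<bullet> z) / (g \<bullet> g)"
proof -
  define s where "s = 2 * (1 - g \<bullet> p) / (g \<bullet> g)"
  have gg: "g \<bullet> g \<noteq> 0" using g by simp
  have s: "s * (g \<bullet> g) = 2 * (1 - g \<bullet> p)" using gg by (simp add: s_def)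
  have "(norm (z - halfspace_reflection g p))\<^sup>2 = ((z - p) - s *\<^sub>R g) \<bullet> ((z - p) - s *\<^sub>R g)"
    unfolding power2_norm_eq_inner halfspace_reflection_def s_def by (simp add: diff_diff_eq)
  also have "\<dots> = (z - p) \<bullet> (z - p) - 2 * s * (g \<bullet> z - g \<bullet> p) + s * (s * (g \<bullet> g))"
    by (simp add: inner_diff_left inner_diff_right inner_commute algebra_simps)
  also have "\<dots> = (z - p) \<bullet> (z - p) + 2 * s * (1 - g \<bullet> z)"
    unfolding s by (simp add: algebra_simps)
  also have "2 * s * (1 - g \<bullet> z) = 4 * (1 - g \<bullet> p) * (1 - g \<bullet> z) / (g \<bullet> g)" by (simp add: s_def)
  finally show ?thesis by (simp add: power2_norm_eq_inner)
qed

lemma norm_halfspace_reflection_sym: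
  assumes "g \<noteq> 0" shows "norm (z - halfspace_reflection g p) = norm (p - halfspace_reflection g z)"
proof -
  have "(norm (z - halfspace_reflection g p))\<^sup>2 = (norm (p - halfspace_reflection g z))\<^sup>2"
    unfolding dist_halfspace_reflection[OF assms] 
    by (simp only: norm_minus_commute[of z p] mult.assoc mult.commute[of "1 - g \<bullet> p" "1 - g \<bullet> z"])
  then show ?thesis by simp
qed

lemma newton_halfspace_reflection_sym:
  "g \<noteq> 0 \<Longrightarrow> newton (z - halfspace_reflection g p) = newton (p - halfspace_reflection g z)"
  unfolding newton_def using norm_halfspace_reflection_sym by metis

lemma newton_halfspace_reflection_boundary:
  "g \<noteq> 0 \<Longrightarrow> g \<bullet> q = 1 \<Longrightarrow> newton (q - halfspace_reflection g p) = newton (q - p)"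
proof -
  assume "g \<noteq> 0" "g \<bullet> q = 1"
  then have "(norm (q - halfspace_reflection g p))\<^sup>2 = (norm (q - p))\<^sup>2"
    using dist_halfspace_reflection[of g q p] by simp
  then have "norm (q - halfspace_reflection g p) = norm (q - p)" by simp
  then show ?thesis by (simp add: newton_def)
qed

lemma newton_tendsto_0_at_infinity:
  assumes "3 \<le> DIM('a)" shows "((\<lambda>z::'a::euclidean_space. newton (z - p)) \<longlongrightarrow> 0) at_infinity"
proof (rule tendstoI)
  fix e :: real assume e: "0 < e"
  let ?a = "2 - real DIM('a)"
  define R where "R = e powr (1 / ?a)"
  have R: "0 < R" using e by (simp add: R_def)
  have Ra: "R powr ?a = e" unfolding R_def powr_powr using assms e by simp
  have "newton (z - p) < e" if "norm p + R + 1 \<le> norm z" for z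
  proof -
    have "norm z \<le> norm (z - p) + norm p" by (metis diff_add_cancel norm_triangle_ineq)
    then have "R < norm (z - p)" using that by simp
    then have "newton (z - p) < R powr ?a"
      unfolding newton_def using R assms by (intro powr_less_mono2_neg) auto
    then show ?thesis by (simp add: Ra)
  qed
  then show "\<forall>\<^sub>F z in at_infinity. dist (newton (z - p)) 0 < e"
    unfolding eventually_at_infinity by (intro exI[of _ "norm p + R + 1"]) (auto simp: newton_nonneg)
qed

text \<open>Method of images: the kernel with the reflected pole is harmonic in the half space and
  agrees with the original kernel on the hyperplane, and both decay at infinity.\<close>

lemma robin_function_halfspace:
  fixes g :: "complex ^ 'n::finite"
  assumes n: "2 \<le> CARD('n)" and g: "g \<noteq> 0" and p: "g \<bullet> p < 1"
  shows "robin_function {w. g \<bullet> w < 1} p = - newton (p - halfspace_reflection g p)"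
proof -
  let ?H = "{w. g \<bullet> w < 1}" and ?p' = "halfspace_reflection g p"
  have p': "1 < g \<bullet> ?p'" using inner_halfspace_reflection[OF g, of p] p by simp
  have fr: "frontier ?H = {w. g \<bullet> w = 1}" using frontier_halfspace_lt[of g 1] g by simp
  have op: "open ?H" by (rule open_halfspace_lt)
  show ?thesis
  proof (rule robin_function_eq[OF n op, where R="\<lambda>z. - newton (z - ?p')"])
    show "p \<in> ?H" using p by simp
    show "harm ?H (\<lambda>z. - newton (z - ?p'))"
      by (rule harm_uminus[OF harm_subset[OF harm_newton_at op]]) (use p' in auto)
    fix q assume "q \<in> frontier ?H"
    then have q: "g \<bullet> q = 1" by (simp add: fr)
    have "q \<noteq> ?p'" using q p' by auto
    then have "isCont (\<lambda>z. newton (z - ?p')) q"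
      using continuous_on_newton[of ?p'] by (simp add: continuous_on_eq_continuous_at[OF open_Compl[OF closed_singleton]])
    then have "((\<lambda>z. newton (z - ?p')) \<longlongrightarrow> newton (q - ?p')) (at q within ?H)"
      unfolding isCont_def by (rule tendsto_within_subset) simp
    then show "((\<lambda>z. - newton (z - ?p')) \<longlongrightarrow> - newton (q - p)) (at q within ?H)"
      using newton_halfspace_reflection_boundary[OF g q, of p] by (metis tendsto_minus)
  next
    have "((\<lambda>z. newton (z - p) + - newton (z - ?p')) \<longlongrightarrow> 0 + - 0) at_infinity"
      by (intro tendsto_add tendsto_minus newton_tendsto_0_at_infinity DIM_ge_3[OF n])
    then have "((\<lambda>z. newton (z - p) + - newton (z - ?p')) \<longlongrightarrow> 0) at_infinity" by simp
    then show "((\<lambda>z. newton (z - p) + - newton (z - ?p')) \<longlongrightarrow> 0) (inf at_infinity (principal ?H))"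
      by (rule filterlim_mono) auto
  qed
qed

section \<open>Domains with a smooth defining function\<close>

lemma mean_value_gradient:
  fixes f :: "'a::euclidean_space \<Rightarrow> real"
  assumes "\<And>x. f differentiable (at x)"
  shows "\<exists>\<tau>>0. \<tau> < 1 \<and> f (x + v) - f x = (\<Sum>b\<in>Basis. (v \<bullet> b) * partial_deriv b f (x + \<tau> *\<^sub>R v))"
proof -
  have "\<exists>\<tau>>0. \<tau> < 1 \<and> f (x + 1 *\<^sub>R v) - f (x + 0 *\<^sub>R v) = (1 - 0) * partial_deriv v f (x + \<tau> *\<^sub>R v)"
    by (rule MVT2) (auto intro: has_real_derivative_line assms)
  moreover have "partial_deriv v f y = (\<Sum>b\<in>Basis. (v \<bullet> b) * partial_deriv b f y)" for y
    using partial_deriv_eq[OF has_derivative_partial[OF assms[of y]], of v] by simp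
  ultimately show ?thesis by auto
qed

lemma sum_inner_le:
  fixes v :: "'a::euclidean_space"
  assumes "\<And>b. b \<in> Basis \<Longrightarrow> \<bar>c b\<bar> \<le> C"
  shows "\<bar>\<Sum>b\<in>Basis. (v \<bullet> b) * c b\<bar> \<le> real DIM('a) * C * norm v"
proof -
  have "\<bar>\<Sum>b\<in>Basis. (v \<bullet> b) * c b\<bar> \<le> (\<Sum>b\<in>(Basis::'a set). norm v * C)"
  proof (rule order_trans[OF sum_abs sum_mono])
    fix b :: 'a assume b: "b \<in> Basis"
    show "\<bar>(v \<bullet> b) * c b\<bar> \<le> norm v * C"
      unfolding abs_mult using Basis_le_norm[OF b, of v] assms[OF b] by (intro mult_mono) auto
  qed
  then show ?thesis by (simp add: mult_ac)
qed

text \<open>With \<open>G\<close> the gradient at \<open>q\<close>, a Taylor estimate bounds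
  \<open>\<psi> (q + v)\<close> from below by \<open>G \<bullet> v - K * |v|^2\<close>. For a point
  of the closure in the ball around \<open>c\<close>, the product \<open>G \<bullet> v\<close> is at
  most \<open>K * |v|^2\<close>, as \<open>\<psi>\<close> is not positive there, whereas a small
  radius forces it to be larger.\<close>

lemma exterior_balls_defining_function:
  fixes \<psi> :: "'a::euclidean_space \<Rightarrow> real"
  assumes C: "Ck_on 2 UNIV \<psi>" and \<Omega>: "\<Omega> = {x. \<psi> x < 0}" and fr: "frontier \<Omega> = {x. \<psi> x = 0}"
    and grad: "\<And>q. q \<in> frontier \<Omega> \<Longrightarrow> \<exists>b\<in>Basis. partial_deriv b \<psi> q \<noteq> 0"
  shows "exterior_balls \<Omega>"
  unfolding exterior_balls_def
proof
  fix q assume q: "q \<in> frontier \<Omega>"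
  have C2: "Ck_on (Suc (Suc 0)) UNIV \<psi>" using C by (simp add: Ck_2_iff)
  have d: "\<psi> differentiable (at x)" "b \<in> Basis \<Longrightarrow> partial_deriv b \<psi> differentiable (at x)" for b x
    using C2 by (auto simp: Ck_on_Suc)
  let ?N = "real DIM('a)"
  have N: "1 \<le> ?N" using DIM_positive[where 'a='a] by linarith
  have "\<forall>w\<in>Basis \<times> Basis. \<exists>L. \<forall>x\<in>cball q 1. \<bar>partial_deriv (fst w) (partial_deriv (snd w) \<psi>) x\<bar> \<le> L"
  proof
    fix w :: "'a \<times> 'a" assume w: "w \<in> Basis \<times> Basis"
    then have "continuous_on UNIV (partial_deriv (fst w) (partial_deriv (snd w) \<psi>))" using C2 by (auto simp: Ck_on_Suc Ck_on_0)
    then have "bounded (partial_deriv (fst w) (partial_deriv (snd w) \<psi>) ` cball q 1)"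
      by (intro compact_imp_bounded compact_continuous_image) (auto intro: continuous_on_subset)
    then show "\<exists>L. \<forall>x\<in>cball q 1. \<bar>partial_deriv (fst w) (partial_deriv (snd w) \<psi>) x\<bar> \<le> L"
      by (metis bounded_iff image_eqI real_norm_def)
  qed
  then obtain L where L: "\<And>w x. w \<in> Basis \<times> Basis \<Longrightarrow> x \<in> cball q 1 \<Longrightarrow> \<bar>partial_deriv (fst w) (partial_deriv (snd w) \<psi>) x\<bar> \<le> L w"
    by metis
  \<comment> \<open>One bound for all second derivatives on the unit ball around \<open>q\<close>;
    the summand 1 ensures \<open>1 \<le> M\<close>.\<close>
  define M where "M = (\<Sum>w\<in>Basis \<times> Basis. \<bar>L w\<bar>) + 1"
  have M: "1 \<le> M" by (simp add: M_def sum_nonneg)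
  have LM: "\<bar>partial_deriv c (partial_deriv b \<psi>) x\<bar> \<le> M" if "c \<in> Basis" "b \<in> Basis" "x \<in> cball q 1" for b c x
  proof -
    have "\<bar>L (c, b)\<bar> \<le> (\<Sum>w\<in>Basis \<times> Basis. \<bar>L w\<bar>)"
      using that by (intro member_le_sum) auto
    then show ?thesis using L[of "(c, b)" x] that by (simp add: M_def)
  qed
  have inb: "q + \<tau> *\<^sub>R v \<in> cball q 1" if "norm v \<le> 1" "0 < \<tau>" "\<tau> < 1" for \<tau> :: real and v
  proof -
    have "norm (\<tau> *\<^sub>R v) \<le> 1 * 1" unfolding norm_scaleR using that by (intro mult_mono) auto
    then show ?thesis by (simp add: dist_norm)
  qed
  have lip: "\<bar>partial_deriv b \<psi> (q + v) - partial_deriv b \<psi> q\<bar> \<le> ?N * M * norm v" if b: "b \<in> Basis" and v: "norm v \<le> 1" for b v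
  proof -
    obtain \<tau> where \<tau>: "0 < \<tau>" "\<tau> < 1" "partial_deriv b \<psi> (q + v) - partial_deriv b \<psi> q = (\<Sum>c\<in>Basis. (v \<bullet> c) * partial_deriv c (partial_deriv b \<psi>) (q + \<tau> *\<^sub>R v))"
      using mean_value_gradient[OF d(2)[OF b], of q v] by metis
    show ?thesis unfolding \<tau>(3) by (rule sum_inner_le) (rule LM[OF _ b inb[OF v \<tau>(1,2)]])
  qed
  define G where "G = (\<Sum>b\<in>Basis. partial_deriv b \<psi> q *\<^sub>R b)"
  have Gb: "G \<bullet> b = partial_deriv b \<psi> q" if "b \<in> Basis" for b unfolding G_def using that by simp
  have G0: "G \<noteq> 0" using grad[OF q] Gb by (metis inner_zero_left)
  have Gv: "(\<Sum>b\<in>Basis. (v \<bullet> b) * partial_deriv b \<psi> q) = G \<bullet> v" for v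
    unfolding G_def inner_sum_left by (intro sum.cong refl) (simp add: inner_commute[of v] mult.commute)
  have lower: "G \<bullet> v - ?N * (?N * M * norm v) * norm v \<le> \<psi> (q + v)" if v: "norm v \<le> 1" for v
  proof -
    obtain \<tau> where \<tau>: "0 < \<tau>" "\<tau> < 1" "\<psi> (q + v) - \<psi> q = (\<Sum>b\<in>Basis. (v \<bullet> b) * partial_deriv b \<psi> (q + \<tau> *\<^sub>R v))"
      using mean_value_gradient[OF d(1), of q v] by metis
    have "\<psi> (q + v) - G \<bullet> v = (\<Sum>b\<in>Basis. (v \<bullet> b) * (partial_deriv b \<psi> (q + \<tau> *\<^sub>R v) - partial_deriv b \<psi> q))"
      using \<tau>(3) q fr Gv[of v] by (simp add: right_diff_distrib sum_subtractf)
    also have "\<bar>\<dots>\<bar> \<le> ?N * (?N * M * norm v) * norm v"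
    proof (rule sum_inner_le)
      fix b :: 'a assume b: "b \<in> Basis"
      have le: "norm (\<tau> *\<^sub>R v) \<le> norm v" using \<tau> by (simp add: mult_left_le_one_le)
      have "\<bar>partial_deriv b \<psi> (q + \<tau> *\<^sub>R v) - partial_deriv b \<psi> q\<bar> \<le> ?N * M * norm (\<tau> *\<^sub>R v)"
        by (rule lip[OF b]) (use le v in linarith)
      also have "\<dots> \<le> ?N * M * norm v" using le M N by (intro mult_left_mono) auto
      finally show "\<bar>partial_deriv b \<psi> (q + \<tau> *\<^sub>R v) - partial_deriv b \<psi> q\<bar> \<le> ?N * M * norm v" .
    qed
    finally show ?thesis by linarith
  qed
  define K where "K = ?N * ?N * M"
  have K: "1 \<le> K" unfolding K_def using N M by (metis mult_mono' mult_1 zero_le_one)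
  \<comment> \<open>The value 1/2 keeps displacements \<open>v\<close> of norm at most 1, where the
    second derivatives are controlled; the other value leaves a factor 2 to spare against the
    curvature bound \<open>K\<close>.\<close>
  define \<rho> where "\<rho> = min (1/2) (norm G / (4 * K))"
  have \<rho>: "0 < \<rho>" "2 * \<rho> \<le> 1" "\<rho> * (4 * K) \<le> norm G" using G0 K by (auto simp: \<rho>_def min_def field_simps)
  define c where "c = q + (\<rho> / norm G) *\<^sub>R G"
  have dc: "dist c q = \<rho>" using \<rho>(1) G0 by (simp add: c_def dist_norm)
  have "dist c q < dist c x" if x: "x \<in> closure \<Omega>" "x \<noteq> q" for x
  proof (rule ccontr)
    assume "\<not> ?thesis"
    then have le: "dist c x \<le> \<rho>" using dc by simp
    define v where "v = x - q"
    have v0: "v \<noteq> 0" using x(2) by (simp add: v_def)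
    \<comment> \<open>Expanding the square shows what membership in the ball means:
      \<open>|v|^2\<close> is at most \<open>2 * \<rho> / norm G\<close> times
      \<open>G \<bullet> v\<close>.\<close>
    have "(norm (v - (\<rho> / norm G) *\<^sub>R G))\<^sup>2 \<le> \<rho>\<^sup>2"
    proof (rule power_mono)
      show "norm (v - (\<rho> / norm G) *\<^sub>R G) \<le> \<rho>" using le by (simp add: c_def v_def dist_norm norm_minus_commute algebra_simps)
    qed simp
    moreover have "(norm (v - (\<rho> / norm G) *\<^sub>R G))\<^sup>2 = (norm v)\<^sup>2 - 2 * (\<rho> / norm G) * (G \<bullet> v) + (norm ((\<rho> / norm G) *\<^sub>R G))\<^sup>2"
      unfolding power2_norm_eq_inner by (simp add: inner_diff_left inner_diff_right inner_commute algebra_simps)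
    moreover have "norm ((\<rho> / norm G) *\<^sub>R G) = \<rho>" using \<rho>(1) G0 by simp
    ultimately have "(norm v)\<^sup>2 \<le> 2 * (\<rho> / norm G) * (G \<bullet> v)" by simp
    then have 1: "norm G * (norm v)\<^sup>2 \<le> 2 * \<rho> * (G \<bullet> v)" using G0 by (simp add: field_simps)
    have "norm v \<le> dist c x + dist c q" unfolding v_def using dist_triangle3[of x q c] by (simp add: dist_norm)
    then have v1: "norm v \<le> 1" using le dc \<rho>(2) by linarith
    have "\<psi> x \<le> 0"
    proof -
      have "x \<in> \<Omega> \<or> x \<in> frontier \<Omega>" using x(1) closure_Un_frontier[of \<Omega>] by blast
      then have "x \<in> {x. \<psi> x < 0} \<or> x \<in> {x. \<psi> x = 0}" using \<Omega> fr by blast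
      then show ?thesis by auto
    qed
    then have "G \<bullet> v \<le> K * (norm v)\<^sup>2" using lower[OF v1] by (simp add: v_def K_def power2_eq_square mult_ac)
    then have "norm G * (norm v)\<^sup>2 \<le> 2 * \<rho> * (K * (norm v)\<^sup>2)"
      using 1 \<rho>(1) mult_left_mono[of "G \<bullet> v" "K * (norm v)\<^sup>2" "2 * \<rho>"] by linarith
    then have "norm G * (norm v)\<^sup>2 \<le> (2 * \<rho> * K) * (norm v)\<^sup>2" by (simp add: mult_ac)
    then have "norm G \<le> 2 * \<rho> * K" using v0 by (simp add: mult_le_cancel_right)
    moreover have "0 < norm G" using G0 by simp
    moreover have "\<rho> * (4 * K) = 2 * (2 * \<rho> * K)" by simp
    ultimately show False using \<rho>(3) by linarith
  qed
  moreover have "c \<noteq> q" using dc \<rho>(1) by auto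
  ultimately show "\<exists>c. c \<noteq> q \<and> (\<forall>x\<in>closure \<Omega>. x \<noteq> q \<longrightarrow> dist c q < dist c x)" by blast
qed

lemma green_domain_smoothly_bounded:
  assumes "smoothly_bounded_domain \<Omega>" "smooth_defining_function \<Omega> \<psi>"
  shows "green_domain \<Omega>"
  unfolding green_domain_def
proof (intro conjI)
  show "open \<Omega>" "bounded \<Omega>" using assms(1) by (auto simp: smoothly_bounded_domain_def is_domain_def)
  show "exterior_balls \<Omega>"
    by (rule exterior_balls_defining_function[of \<psi>]) (use assms(2) in \<open>auto simp: smooth_defining_function_def smooth_on_def\<close>)
qed

section \<open>Blow-up at the boundary\<close>

text \<open>The mean value theorem at \<open>p n\<close> expresses the rescaled function through
  gradients at points within \<open>t n * R\<close> of \<open>p n\<close>, and near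
  \<open>p0\<close> these are eventually uniformly close to \<open>g\<close>. The constant -1 is the
  value \<open>\<psi>n n (p n)\<close> divided by \<open>t n\<close>.\<close>

lemma blow_up_defining_functions:
  fixes \<psi>n :: "nat \<Rightarrow> 'a::euclidean_space \<Rightarrow> real" and g :: 'a
  assumes diff: "\<And>n x. \<psi>n n differentiable (at x)"
    and grad: "\<And>b e. b \<in> Basis \<Longrightarrow> 0 < e \<Longrightarrow> \<exists>r>0. \<forall>\<^sub>F n in sequentially. \<forall>x\<in>cball p0 r. \<bar>partial_deriv b (\<psi>n n) x - g \<bullet> b\<bar> \<le> e"
    and t: "\<And>n. t n = - \<psi>n n (p n)" "\<And>n. 0 < t n" "t \<longlonglongrightarrow> 0" and p: "p \<longlonglongrightarrow> p0" and R: "0 < R" and \<delta>: "0 < \<delta>"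
  shows "\<forall>\<^sub>F n in sequentially. \<forall>y. norm y \<le> R \<longrightarrow> \<bar>\<psi>n n (p n + t n *\<^sub>R y) / t n - (g \<bullet> y - 1)\<bar> \<le> \<delta>"
proof -
  let ?N = "real DIM('a)"
  \<comment> \<open>Chosen so that errors of this size in all components of the gradient add up to
    at most \<open>\<delta>\<close> for vectors of norm at most \<open>R\<close>.\<close>
  define e where "e = \<delta> / (?N * R)"
  have e: "0 < e" using \<delta> R by (simp add: e_def)
  have "\<forall>b\<in>Basis. \<exists>r. 0 < r \<and> (\<forall>\<^sub>F n in sequentially. \<forall>x\<in>cball p0 r. \<bar>partial_deriv b (\<psi>n n) x - g \<bullet> b\<bar> \<le> e)"
    using grad[OF _ e] by blast
  from bchoice[OF this] obtain r where r': "\<forall>b\<in>Basis. 0 < r b \<and>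
      (\<forall>\<^sub>F n in sequentially. \<forall>x\<in>cball p0 (r b). \<bar>partial_deriv b (\<psi>n n) x - g \<bullet> b\<bar> \<le> e)" ..
  have r: "0 < r b" "\<forall>\<^sub>F n in sequentially. \<forall>x\<in>cball p0 (r b). \<bar>partial_deriv b (\<psi>n n) x - g \<bullet> b\<bar> \<le> e"
    if "b \<in> Basis" for b using r' that by auto
  define s where "s = Min (r ` Basis)"
  have s: "0 < s" "\<And>b. b \<in> Basis \<Longrightarrow> s \<le> r b" using r(1) by (auto simp: s_def)
  have "\<forall>\<^sub>F n in sequentially. \<forall>b\<in>Basis. \<forall>x\<in>cball p0 (r b). \<bar>partial_deriv b (\<psi>n n) x - g \<bullet> b\<bar> \<le> e"
    by (rule eventually_ball_finite[OF finite_Basis]) (use r(2) in blast)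
  moreover have "\<forall>\<^sub>F n in sequentially. dist (p n) p0 < s / 2"
    by (rule tendstoD[OF p]) (use s(1) in simp)
  moreover have "\<forall>\<^sub>F n in sequentially. t n < s / (2 * R)"
    by (rule order_tendstoD(2)[OF t(3)]) (use s(1) R in simp)
  ultimately show ?thesis
  proof eventually_elim
    case (elim n)
    show ?case
    proof (intro allI impI)
      fix y :: 'a assume y: "norm y \<le> R"
      let ?v = "t n *\<^sub>R y"
      obtain \<tau> where \<tau>: "0 < \<tau>" "\<tau> < 1" "\<psi>n n (p n + ?v) - \<psi>n n (p n) = (\<Sum>b\<in>Basis. (?v \<bullet> b) * partial_deriv b (\<psi>n n) (p n + \<tau> *\<^sub>R ?v))"
        using mean_value_gradient[of "\<psi>n n" "p n" ?v, OF diff] by blast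
      let ?x = "p n + \<tau> *\<^sub>R ?v"
      have "norm (\<tau> *\<^sub>R ?v) \<le> 1 * (t n * R)"
        unfolding norm_scaleR using \<tau> t(2)[of n] y by (intro mult_mono) auto
      also have "t n * R \<le> s / 2" using elim(3) R by (simp add: field_simps less_imp_le)
      finally have "norm (\<tau> *\<^sub>R ?v) \<le> s / 2" by simp
      moreover have "dist p0 ?x \<le> dist (p n) p0 + norm (\<tau> *\<^sub>R ?v)"
        using dist_triangle[of p0 ?x "p n"] by (simp add: dist_norm norm_minus_commute)
      ultimately have "dist p0 ?x \<le> s" using elim(2) by linarith
      then have b: "\<bar>partial_deriv b (\<psi>n n) ?x - g \<bullet> b\<bar> \<le> e" if "b \<in> Basis" for b
        using elim(1) that s(2)[OF that] by auto
      have gy: "g \<bullet> y = (\<Sum>b\<in>Basis. (y \<bullet> b) * (g \<bullet> b))" by (subst euclidean_inner) (simp add: mult.commute)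
      have "\<psi>n n (p n + ?v) = - t n + t n * (\<Sum>b\<in>Basis. (y \<bullet> b) * partial_deriv b (\<psi>n n) ?x)"
        using \<tau>(3) t(1)[of n] by (simp add: sum_distrib_left mult.assoc)
      then have "\<psi>n n (p n + ?v) / t n - (g \<bullet> y - 1) = (\<Sum>b\<in>Basis. (y \<bullet> b) * partial_deriv b (\<psi>n n) ?x) - g \<bullet> y"
        using t(2)[of n] by (simp add: field_simps)
      also have "\<dots> = (\<Sum>b\<in>Basis. (y \<bullet> b) * (partial_deriv b (\<psi>n n) ?x - g \<bullet> b))"
        unfolding gy by (simp add: right_diff_distrib sum_subtractf)
      also have "\<bar>\<dots>\<bar> \<le> ?N * e * norm y" by (rule sum_inner_le) (rule b)
      also have "\<dots> \<le> ?N * e * R" using y e by (intro mult_left_mono) auto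
      also have "\<dots> = \<delta>" using R by (simp add: e_def)
      finally show "\<bar>\<psi>n n (p n + ?v) / t n - (g \<bullet> y - 1)\<bar> \<le> \<delta>" .
    qed
  qed
qed

section \<open>The kernel and its reflection near the limiting hyperplane\<close>

lemma norm_halfspace_reflection_le:
  fixes g :: "'a::euclidean_space"
  assumes g: "g \<noteq> 0" and p: "\<bar>g \<bullet> p\<bar> \<le> 1/4"
  shows "norm (halfspace_reflection g p) \<le> norm p + 5 / (2 * norm g)"
proof -
  have ng: "0 < norm g" using g by simp
  have "\<bar>1 - g \<bullet> p\<bar> \<le> 5/4" using p by linarith
  then have "2 * \<bar>1 - g \<bullet> p\<bar> / norm g \<le> 2 * (5/4) / norm g" using ng by (intro divide_right_mono) auto
  moreover have "norm ((a / (g \<bullet> g)) *\<^sub>R g) = \<bar>a\<bar> / norm g" for a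
    using ng by (simp add: power2_norm_eq_inner[symmetric] power2_eq_square)
  then have "norm ((2 * (1 - g \<bullet> p) / (g \<bullet> g)) *\<^sub>R g) = 2 * \<bar>1 - g \<bullet> p\<bar> / norm g"
    by (simp only: abs_mult abs_numeral)
  ultimately show ?thesis
    unfolding halfspace_reflection_def using norm_triangle_ineq[of p "(2 * (1 - g \<bullet> p) / (g \<bullet> g)) *\<^sub>R g"] by simp
qed

lemma continuous_on_halfspace_reflection: "continuous_on S (\<lambda>x. halfspace_reflection g x)"
  unfolding halfspace_reflection_def divide_inverse by (intro continuous_intros)

text \<open>The kernel and its reflection agree on the hyperplane, and their difference is uniformly
  continuous on a compact piece of a slab around it; a point \<open>y\<close> near the hyperplane is
  compared with its orthogonal projection.\<close>

lemma newton_almost_boundary: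
  fixes g :: "'a::euclidean_space"
  assumes g: "g \<noteq> 0" and \<rho>: "0 < \<rho>" "\<rho> * norm g \<le> 1/4" and e: "0 < e"
  shows "\<exists>\<delta>>0. \<delta> \<le> 1/4 \<and> (\<forall>y p. norm y \<le> R \<longrightarrow> norm p \<le> \<rho> \<longrightarrow> \<bar>g \<bullet> y - 1\<bar> \<le> \<delta> \<longrightarrow>
     \<bar>newton (y - p) - newton (y - halfspace_reflection g p)\<bar> \<le> e)"
proof -
  have ng: "0 < norm g" using g by simp
  have gp: "\<bar>g \<bullet> p\<bar> \<le> 1/4" if "norm p \<le> \<rho>" for p
  proof -
    have "\<bar>g \<bullet> p\<bar> \<le> norm g * norm p" by (rule Cauchy_Schwarz_ineq2)
    also have "\<dots> \<le> norm g * \<rho>" using that ng by simp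
    finally show ?thesis using \<rho>(2) by (simp add: mult.commute)
  qed
  \<comment> \<open>The slab avoids both poles: \<open>g \<bullet> p\<close> is at most 1/4, and the
    reflected pole has the value \<open>2 - g \<bullet> p\<close>, at least 7/4. The radius
    \<open>R + 1\<close> leaves room for the projection of \<open>y\<close>.\<close>
  define Y where "Y = cball 0 (R + 1) \<inter> ({y. g \<bullet> y \<le> 5/4} \<inter> {y. 3/4 \<le> g \<bullet> y})"
  define F where "F w = newton (fst w - snd w) - newton (fst w - halfspace_reflection g (snd w))" for w
  have cY: "compact Y" unfolding Y_def
    by (intro compact_Int_closed compact_cball closed_Int closed_halfspace_le) (use closed_halfspace_ge[of "3/4" g] in \<open>simp add: inner_commute\<close>)
  have cn: "continuous_on (- {0}) (newton :: 'a \<Rightarrow> real)" using harm_imp_continuous[OF harm_newton] .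
  have ne: "y \<noteq> p" "y \<noteq> halfspace_reflection g p" if "y \<in> Y" "norm p \<le> \<rho>" for y p
    using that gp[OF that(2)] inner_halfspace_reflection[OF g, of p] by (auto simp: Y_def)
  have ne': "y \<notin> Y" "halfspace_reflection g y \<notin> Y" if "norm y \<le> \<rho>" for y using ne that by blast+
  have "continuous_on (Y \<times> cball 0 \<rho>) F" unfolding F_def
    by (intro continuous_on_diff continuous_on_compose2[OF cn] continuous_intros 
        continuous_on_compose2[OF continuous_on_halfspace_reflection[of UNIV]]) (use ne' in auto)
  then have "uniformly_continuous_on (Y \<times> cball 0 \<rho>) F"
    by (intro compact_uniformly_continuous compact_Times cY compact_cball)
  then obtain d where d: "0 < d" "\<And>w w'. w \<in> Y \<times> cball 0 \<rho> \<Longrightarrow> w' \<in> Y \<times> cball 0 \<rho> \<Longrightarrow> dist w' w < d \<Longrightarrow> dist (F w') (F w) < e"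
    using e unfolding uniformly_continuous_on_def by metis
  define \<delta> where "\<delta> = min (1/4) (min (norm g) (d * norm g / 2))"
  have \<delta>: "0 < \<delta>" "\<delta> \<le> 1/4" "\<delta> \<le> norm g" "\<delta> \<le> d * norm g / 2" using ng d(1) by (auto simp: \<delta>_def)
  have "\<bar>newton (y - p) - newton (y - halfspace_reflection g p)\<bar> \<le> e"
    if y: "norm y \<le> R" "\<bar>g \<bullet> y - 1\<bar> \<le> \<delta>" and p: "norm p \<le> \<rho>" for y p
  proof -
    \<comment> \<open>The displacement from \<open>y\<close> to its orthogonal projection on the
      hyperplane.\<close>
    define v where "v = ((1 - g \<bullet> y) / (g \<bullet> g)) *\<^sub>R g"
    have nv: "norm v = \<bar>1 - g \<bullet> y\<bar> / norm g"
      using ng by (simp add: v_def power2_norm_eq_inner[symmetric] power2_eq_square)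
    have "norm v \<le> \<delta> / norm g" unfolding nv using y(2) ng by (intro divide_right_mono) auto
    then have "norm v * norm g \<le> \<delta>" using ng by (simp add: field_simps)
    then have "norm v * norm g \<le> 1 * norm g" "norm v * norm g \<le> (d / 2) * norm g" using \<delta> by auto
    then have v: "norm v \<le> 1" "norm v \<le> d / 2" using ng by (auto simp only: mult_le_cancel_right_pos)
    have g1: "g \<bullet> (y + v) = 1" using g by (simp add: v_def inner_add_right)
    have yY: "y \<in> Y" using y \<delta>(2) by (auto simp: Y_def)
    have "norm (y + v) \<le> R + 1" using norm_triangle_ineq[of y v] y(1) v(1) by linarith
    then have yvY: "y + v \<in> Y" using g1 by (simp add: Y_def)
    have "dist (y, p) (y + v, p) < d" using v(2) d(1) by (simp add: dist_Pair_Pair dist_norm)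
    then have "dist (F (y, p)) (F (y + v, p)) < e" using yY yvY p by (intro d(2)) auto
    moreover have "F (y + v, p) = 0" using newton_halfspace_reflection_boundary[OF g g1, of p] by (simp add: F_def)
    ultimately show ?thesis by (simp add: F_def)
  qed
  then show ?thesis using \<delta>(1,2) by blast
qed

text \<open>The exponent of \<open>t\<close> is the negative of the degree of homogeneity of the
  kernel, so this is the regular part of the domain enlarged by the factor \<open>1 / t\<close>
  about \<open>c\<close>.\<close>

definition rescaled_regular_part :: "'a::euclidean_space set \<Rightarrow> 'a \<Rightarrow> real \<Rightarrow> 'a \<Rightarrow> 'a \<Rightarrow> real" where
  "rescaled_regular_part \<Omega> c t z p = t powr (real DIM('a) - 2) * regular_part \<Omega> (c + t *\<^sub>R p) (c + t *\<^sub>R z)"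

text \<open>
  Both functions are harmonic in \<open>z\<close>, so it suffices to compare them on the boundary: where
  the rescaled boundary is close to the hyperplane, by \<open>newton_almost_boundary\<close>; far away, since both are small.
\<close>

lemma rescaled_regular_part_estimate:
  fixes g :: "'a::euclidean_space"
  assumes N: "3 \<le> DIM('a)" and g: "g \<noteq> 0" and \<rho>: "0 < \<rho>" "\<rho> * norm g \<le> 1/4" and e: "0 < e"
  shows "\<exists>R \<delta>. 0 < R \<and> 0 < \<delta> \<and> (\<forall>\<Omega> \<psi> c t. green_domain \<Omega> \<longrightarrow> \<Omega> = {x. \<psi> x < 0} \<longrightarrow> frontier \<Omega> = {x. \<psi> x = 0} \<longrightarrow> 0 < t \<longrightarrow>
     (\<forall>y. norm y \<le> R \<longrightarrow> \<bar>\<psi> (c + t *\<^sub>R y) / t - (g \<bullet> y - 1)\<bar> \<le> \<delta>) \<longrightarrow>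
     (\<forall>y\<in>cball 0 \<rho>. c + t *\<^sub>R y \<in> \<Omega>) \<and>
     (\<forall>z\<in>cball 0 \<rho>. \<forall>p\<in>cball 0 \<rho>. \<bar>rescaled_regular_part \<Omega> c t z p + newton (z - halfspace_reflection g p)\<bar> \<le> e))"
proof -
  have ng: "0 < norm g" using g by simp
  let ?N = "real DIM('a)"
  have gp: "\<bar>g \<bullet> p\<bar> \<le> 1/4" if "norm p \<le> \<rho>" for p
  proof -
    have "\<bar>g \<bullet> p\<bar> \<le> norm g * norm p" by (rule Cauchy_Schwarz_ineq2)
    also have "\<dots> \<le> norm g * \<rho>" using that ng by simp
    finally show ?thesis using \<rho>(2) by (simp add: mult.commute)
  qed
  \<comment> \<open>A common bound for the norms of all poles \<open>p\<close> in the ball of radius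
    \<open>\<rho>\<close> and of their reflections.\<close>
  define M where "M = \<rho> + 5 / (2 * norm g)"
  have M: "0 < M" "\<rho> \<le> M" using \<rho>(1) ng by (auto simp: M_def intro: add_pos_nonneg)
  have rM: "norm (halfspace_reflection g p) \<le> M" if "norm p \<le> \<rho>" for p
    using norm_halfspace_reflection_le[OF g gp[OF that]] that by (simp add: M_def)
  \<comment> \<open>The distance from the pole at which the kernel equals
    \<open>e / 2\<close>.\<close>
  define d where "d = (e / 2) powr (1 / (2 - ?N))"
  have d: "0 < d" using e by (simp add: d_def)
  have de: "d powr (2 - ?N) = e / 2" unfolding d_def powr_powr using N e by simp
  define R where "R = M + d"
  have R: "0 < R" using M d by (simp add: R_def)
  obtain \<delta> where \<delta>: "0 < \<delta>" "\<delta> \<le> 1/4" "\<And>y p. norm y \<le> R \<Longrightarrow> norm p \<le> \<rho> \<Longrightarrow> \<bar>g \<bullet> y - 1\<bar> \<le> \<delta> \<Longrightarrow>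
     \<bar>newton (y - p) - newton (y - halfspace_reflection g p)\<bar> \<le> e"
    using newton_almost_boundary[OF g \<rho> e, of R] by metis
  have far: "newton (y - x) \<le> e / 2" if "R < norm y" "norm x \<le> M" for x y :: 'a
  proof -
    have "d \<le> norm (y - x)" using norm_triangle_ineq2[of y x] that by (simp add: R_def)
    then show ?thesis using newton_le_powr[of d "y - x"] d N by (simp add: de)
  qed
  have bd: "\<bar>newton (y - p) - newton (y - halfspace_reflection g p)\<bar> \<le> e"
    if p: "norm p \<le> \<rho>" and y: "norm y \<le> R \<Longrightarrow> \<bar>g \<bullet> y - 1\<bar> \<le> \<delta>" for y p
  proof (cases "norm y \<le> R")
    case True
    then show ?thesis using \<delta>(3)[OF True p y] by simp
  next
    case False
    then have "newton (y - p) \<le> e / 2" "newton (y - halfspace_reflection g p) \<le> e / 2"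
      using far[of y p] far[of y "halfspace_reflection g p"] rM[OF p] p M(2) by auto
    then show ?thesis using newton_nonneg[of "y - p"] newton_nonneg[of "y - halfspace_reflection g p"] by linarith
  qed
  show ?thesis
  proof (rule exI[of _ R], rule exI[of _ \<delta>], intro conjI R \<delta>(1) allI impI)
    fix \<Omega> :: "'a set" and \<psi> :: "'a \<Rightarrow> real" and c t
    assume \<Omega>: "green_domain \<Omega>" "\<Omega> = {x. \<psi> x < 0}" "frontier \<Omega> = {x. \<psi> x = 0}" and t: "0 < t"
      and bu: "\<forall>y. norm y \<le> R \<longrightarrow> \<bar>\<psi> (c + t *\<^sub>R y) / t - (g \<bullet> y - 1)\<bar> \<le> \<delta>"
    have inside: "c + t *\<^sub>R y \<in> \<Omega>" if y: "norm y \<le> \<rho>" for y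
    proof -
      have "norm y \<le> R" using y M(2) d by (simp add: R_def)
      then have "\<bar>\<psi> (c + t *\<^sub>R y) / t - (g \<bullet> y - 1)\<bar> \<le> \<delta>" using bu by simp
      then have "\<psi> (c + t *\<^sub>R y) / t < 0" using gp[OF y] \<delta>(2) by linarith
      then show ?thesis using t \<Omega>(2) by (simp add: divide_less_0_iff)
    qed
    then show "\<forall>y\<in>cball 0 \<rho>. c + t *\<^sub>R y \<in> \<Omega>" by simp
    \<comment> \<open>The reflected pole lies outside the closure of the domain, so the reflected
      kernel is harmonic inside and continuous up to the frontier.\<close>
    have outside: "c + t *\<^sub>R halfspace_reflection g p \<notin> \<Omega>" "c + t *\<^sub>R halfspace_reflection g p \<notin> frontier \<Omega>" if p: "norm p \<le> \<rho>" for p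
    proof -
      have "norm (halfspace_reflection g p) \<le> R" using rM[OF p] d by (simp add: R_def)
      then have "\<bar>\<psi> (c + t *\<^sub>R halfspace_reflection g p) / t - (g \<bullet> halfspace_reflection g p - 1)\<bar> \<le> \<delta>" using bu by simp
      then have "0 < \<psi> (c + t *\<^sub>R halfspace_reflection g p) / t"
        using gp[OF p] \<delta>(2) unfolding inner_halfspace_reflection[OF g] by linarith
      then have "0 < \<psi> (c + t *\<^sub>R halfspace_reflection g p)" using t by (simp add: zero_less_divide_iff)
      then show "c + t *\<^sub>R halfspace_reflection g p \<notin> \<Omega>" "c + t *\<^sub>R halfspace_reflection g p \<notin> frontier \<Omega>"
        unfolding \<Omega>(3) using \<Omega>(2) by auto
    qed
    have op: "open \<Omega>" and bO: "bounded \<Omega>" using \<Omega>(1) by (auto simp: green_domain_def)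
    show "\<forall>z\<in>cball 0 \<rho>. \<forall>p\<in>cball 0 \<rho>. \<bar>rescaled_regular_part \<Omega> c t z p + newton (z - halfspace_reflection g p)\<bar> \<le> e"
    proof (intro ballI)
      fix z p :: 'a assume "z \<in> cball 0 \<rho>" "p \<in> cball 0 \<rho>"
      then have z: "norm z \<le> \<rho>" and p: "norm p \<le> \<rho>" by auto
      let ?P = "c + t *\<^sub>R p" and ?P' = "c + t *\<^sub>R halfspace_reflection g p" and ?k = "t powr (?N - 2)"
      have ir: "is_regular_part \<Omega> ?P (regular_part \<Omega> ?P)" by (rule is_regular_part_regular_part[OF N \<Omega>(1) inside[OF p]])
      have sc: "?k * newton (x - (c + t *\<^sub>R w)) = newton ((1/t) *\<^sub>R (x - c) - w)" for x w :: 'a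
      proof -
        have "x - (c + t *\<^sub>R w) = t *\<^sub>R ((1/t) *\<^sub>R (x - c) - w)" using t by (simp add: algebra_simps)
        moreover have "?k * t powr (2 - ?N) = 1" using t by (simp add: powr_add[symmetric])
        ultimately show ?thesis using newton_scale[OF t, of "(1/t) *\<^sub>R (x - c) - w"] by (simp add: mult.assoc[symmetric])
      qed
      have hu: "harm \<Omega> (\<lambda>x. ?k * regular_part \<Omega> ?P x)" using ir by (auto simp: is_regular_part_def intro: harm_cmult)
      have hv: "harm \<Omega> (\<lambda>x. - (?k * newton (x - ?P')))"
        by (intro harm_uminus harm_cmult harm_subset[OF harm_newton_at op]) (use outside[OF p] in auto)
      have lu: "((\<lambda>x. ?k * regular_part \<Omega> ?P x) \<longlongrightarrow> - newton ((1/t) *\<^sub>R (q - c) - p)) (at q within \<Omega>)" if q: "q \<in> frontier \<Omega>" for q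
      proof -
        have "((\<lambda>x. ?k * regular_part \<Omega> ?P x) \<longlongrightarrow> ?k * - newton (q - ?P)) (at q within \<Omega>)"
          using ir q by (intro tendsto_intros) (auto simp: is_regular_part_def)
        then show ?thesis using sc[of q p] by simp
      qed
      have lv: "((\<lambda>x. - (?k * newton (x - ?P'))) \<longlongrightarrow> - newton ((1/t) *\<^sub>R (q - c) - halfspace_reflection g p)) (at q within \<Omega>)" if q: "q \<in> frontier \<Omega>" for q
      proof -
        have "q \<noteq> ?P'" using outside(2)[OF p] q by auto
        then have "isCont (\<lambda>x. newton (x - ?P')) q"
          using continuous_on_newton[of ?P'] by (simp add: continuous_on_eq_continuous_at[OF open_Compl[OF closed_singleton]])
        then have "((\<lambda>x. newton (x - ?P')) \<longlongrightarrow> newton (q - ?P')) (at q within \<Omega>)"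
          unfolding isCont_def by (rule tendsto_within_subset) simp
        then have "((\<lambda>x. - (?k * newton (x - ?P'))) \<longlongrightarrow> - (?k * newton (q - ?P'))) (at q within \<Omega>)" by (intro tendsto_intros)
        then show ?thesis unfolding sc .
      qed
      have close: "\<bar>newton ((1/t) *\<^sub>R (q - c) - p) - newton ((1/t) *\<^sub>R (q - c) - halfspace_reflection g p)\<bar> \<le> e" if q: "q \<in> frontier \<Omega>" for q
      proof (rule bd[OF p])
        assume "norm ((1/t) *\<^sub>R (q - c)) \<le> R"
        then have "\<bar>\<psi> (c + t *\<^sub>R ((1/t) *\<^sub>R (q - c))) / t - (g \<bullet> ((1/t) *\<^sub>R (q - c)) - 1)\<bar> \<le> \<delta>" using bu by blast
        moreover have "c + t *\<^sub>R ((1/t) *\<^sub>R (q - c)) = q" using t by simp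
        moreover have "\<psi> q = 0" using q \<Omega>(3) by simp
        ultimately show "\<bar>g \<bullet> ((1/t) *\<^sub>R (q - c)) - 1\<bar> \<le> \<delta>" by simp
      qed
      let ?x = "c + t *\<^sub>R z"
      have x: "?x \<in> \<Omega>" by (rule inside[OF z])
      have "?k * regular_part \<Omega> ?P ?x \<le> - (?k * newton (?x - ?P')) + e"
      proof (rule harm_le_boundary_limits[OF bO hu _ lu _ _ x])
        show "harm \<Omega> (\<lambda>x. - (?k * newton (x - ?P')) + e)" by (intro harm_add hv harm_const op)
        show "((\<lambda>x. - (?k * newton (x - ?P')) + e) \<longlongrightarrow> - newton ((1/t) *\<^sub>R (q - c) - halfspace_reflection g p) + e) (at q within \<Omega>)" 
          if "q \<in> frontier \<Omega>" for q by (intro tendsto_add lv[OF that] tendsto_const)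
        show "- newton ((1/t) *\<^sub>R (q - c) - p) \<le> - newton ((1/t) *\<^sub>R (q - c) - halfspace_reflection g p) + e" if "q \<in> frontier \<Omega>" for q
          using close[OF that] by linarith
      qed
      moreover have "- (?k * newton (?x - ?P')) \<le> ?k * regular_part \<Omega> ?P ?x + e"
      proof (rule harm_le_boundary_limits[OF bO hv _ lv _ _ x])
        show "harm \<Omega> (\<lambda>x. ?k * regular_part \<Omega> ?P x + e)" by (intro harm_add hu harm_const op)
        show "((\<lambda>x. ?k * regular_part \<Omega> ?P x + e) \<longlongrightarrow> - newton ((1/t) *\<^sub>R (q - c) - p) + e) (at q within \<Omega>)" 
          if "q \<in> frontier \<Omega>" for q by (intro tendsto_add lu[OF that] tendsto_const)
        show "- newton ((1/t) *\<^sub>R (q - c) - halfspace_reflection g p) \<le> - newton ((1/t) *\<^sub>R (q - c) - p) + e" if "q \<in> frontier \<Omega>" for q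
          using close[OF that] by linarith
      qed
      moreover have "?k * newton (?x - ?P') = newton (z - halfspace_reflection g p)"
        unfolding sc using t by simp
      ultimately show "\<bar>rescaled_regular_part \<Omega> c t z p + newton (z - halfspace_reflection g p)\<bar> \<le> e"
        unfolding rescaled_regular_part_def by linarith
    qed
  qed
qed

section \<open>Separate harmonicity of the rescaled and of the limiting functions\<close>

lemma mean_property_affine:
  fixes u :: "'a::euclidean_space \<Rightarrow> real"
  assumes u: "mean_property S u" and t: "0 < t" and sub: "\<And>x. x \<in> T \<Longrightarrow> c + t *\<^sub>R x \<in> S"
  shows "mean_property T (\<lambda>x. k * u (c + t *\<^sub>R x))"
  unfolding mean_property_def
proof (intro allI impI)
  fix m and x :: 'a and r :: real assume r: "0 < r" "cball x r \<subseteq> T"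
  have "cball (c + t *\<^sub>R x) (t * r) \<subseteq> S"
  proof
    fix w assume w: "w \<in> cball (c + t *\<^sub>R x) (t * r)"
    define y where "y = (1/t) *\<^sub>R (w - c)"
    have wy: "w = c + t *\<^sub>R y" using t by (simp add: y_def)
    have "c + t *\<^sub>R x - w = t *\<^sub>R (x - y)" by (simp add: wy algebra_simps)
    then have "t * norm (x - y) \<le> t * r" using w t by (simp add: dist_norm)
    then have "y \<in> cball x r" using t by (simp add: dist_norm)
    then show "w \<in> S" using sub r(2) unfolding wy by blast
  qed
  then have "(\<integral>y. u (c + t *\<^sub>R x + (t * r) *\<^sub>R y) * bump (Suc m) y \<partial>lborel) = u (c + t *\<^sub>R x) * bump_mass TYPE('a) (Suc m)"
    using u t r(1) unfolding mean_property_def by simp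
  moreover have "(\<integral>y. k * u (c + t *\<^sub>R (x + r *\<^sub>R y)) * bump (Suc m) y \<partial>lborel) = k * (\<integral>y. u (c + t *\<^sub>R x + (t * r) *\<^sub>R y) * bump (Suc m) y \<partial>lborel)"
    by (simp add: mult.assoc scaleR_add_right add.assoc)
  ultimately show "(\<integral>y. k * u (c + t *\<^sub>R (x + r *\<^sub>R y)) * bump (Suc m) y \<partial>lborel) = k * u (c + t *\<^sub>R x) * bump_mass TYPE('a) (Suc m)"
    by simp
qed

lemma mean_property_subset: "mean_property S u \<Longrightarrow> T \<subseteq> S \<Longrightarrow> mean_property T u"
  unfolding mean_property_def by (meson order_trans)

lemma biharmonic_rescaled_regular_part:
  fixes \<Omega> :: "'a::euclidean_space set"
  assumes N: "3 \<le> DIM('a)" and \<Omega>: "green_domain \<Omega>" and t: "0 < t" and sub: "\<And>x. x \<in> T \<Longrightarrow> c + t *\<^sub>R x \<in> \<Omega>"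
  shows "biharmonic_on T (rescaled_regular_part \<Omega> c t)"
  unfolding biharmonic_on_def rescaled_regular_part_def
proof (intro conjI ballI)
  have "continuous_on (T \<times> T) (\<lambda>w. regular_part \<Omega> (snd (c + t *\<^sub>R fst w, c + t *\<^sub>R snd w)) (fst (c + t *\<^sub>R fst w, c + t *\<^sub>R snd w)))"
    by (rule continuous_on_compose2[OF continuous_on_regular_part[OF N \<Omega>]]) (use sub in \<open>auto intro!: continuous_intros\<close>)
  then show "continuous_on (T \<times> T) (\<lambda>w. t powr (real DIM('a) - 2) * regular_part \<Omega> (c + t *\<^sub>R snd w) (c + t *\<^sub>R fst w))"
    by (intro continuous_on_mult continuous_on_const) simp
next
  fix p assume "p \<in> T"
  then have "is_regular_part \<Omega> (c + t *\<^sub>R p) (regular_part \<Omega> (c + t *\<^sub>R p))"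
    by (intro is_regular_part_regular_part[OF N \<Omega>] sub)
  then have "mean_property \<Omega> (regular_part \<Omega> (c + t *\<^sub>R p))" by (auto simp: is_regular_part_def intro: harm_imp_mean_property)
  then show "mean_property T (\<lambda>z. t powr (real DIM('a) - 2) * regular_part \<Omega> (c + t *\<^sub>R p) (c + t *\<^sub>R z))"
    using t sub by (rule mean_property_affine)
next
  fix z assume "z \<in> T"
  then have "mean_property \<Omega> (\<lambda>p. regular_part \<Omega> p (c + t *\<^sub>R z))"
    by (intro mean_property_regular_part_pole[OF N \<Omega>] sub)
  from mean_property_affine[OF this t sub]
  show "mean_property T (\<lambda>p. t powr (real DIM('a) - 2) * regular_part \<Omega> (c + t *\<^sub>R p) (c + t *\<^sub>R z))" .
qed

text \<open>The symmetry of the reflected kernel reduces the mean value property in the pole to that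
  in \<open>z\<close>.\<close>

lemma biharmonic_halfspace:
  fixes g :: "'a::euclidean_space"
  assumes g: "g \<noteq> 0" and T: "\<And>x. x \<in> T \<Longrightarrow> g \<bullet> x < 1"
  shows "biharmonic_on T (\<lambda>z p. - newton (z - halfspace_reflection g p))"
  unfolding biharmonic_on_def
proof (intro conjI ballI)
  have ne: "z \<noteq> halfspace_reflection g p" if "z \<in> T" "p \<in> T" for z p
    using T[OF that(1)] T[OF that(2)] inner_halfspace_reflection[OF g, of p] by auto
  have cn: "continuous_on (- {0}) (newton :: 'a \<Rightarrow> real)" using harm_imp_continuous[OF harm_newton] .
  have ne': "halfspace_reflection g p \<notin> T" if "p \<in> T" for p using ne that by blast
  show "continuous_on (T \<times> T) (\<lambda>w. - newton (fst w - halfspace_reflection g (snd w)))"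
    by (intro continuous_on_minus continuous_on_compose2[OF cn] continuous_intros
        continuous_on_compose2[OF continuous_on_halfspace_reflection[of UNIV]]) (use ne' in auto)
  have mp: "mean_property T (\<lambda>z. - newton (z - halfspace_reflection g p))" if "p \<in> T" for p
  proof (rule mean_property_subset[OF harm_imp_mean_property[OF harm_uminus[OF harm_newton_at]]])
    show "T \<subseteq> - {halfspace_reflection g p}" using ne[OF _ that] by blast
  qed
  show "mean_property T (\<lambda>z. - newton (z - halfspace_reflection g p))" if "p \<in> T" for p by (rule mp[OF that])
  show "mean_property T (\<lambda>p. - newton (z - halfspace_reflection g p))" if "z \<in> T" for z
    using mp[OF that] by (subst newton_halfspace_reflection_sym[OF g])
qed

section \<open>Wirtinger derivatives of smooth functions\<close>

text \<open>The induction runs over a whole family, so that \<open>P\<close> can relate several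
  functions under simultaneous differentiation; the counter records the order reached.\<close>

lemma wirtinger_family_induct:
  fixes P :: "nat \<Rightarrow> ('j \<Rightarrow> (complex, 'n::{finite,linorder}) vec \<Rightarrow> complex) \<Rightarrow> bool"
  assumes base: "P 0 F"
    and z: "\<And>k F i. P k F \<Longrightarrow> P (Suc k) (\<lambda>j. dz i (F j))"
    and zb: "\<And>k F i. P k F \<Longrightarrow> P (Suc k) (\<lambda>j. dzbar i (F j))"
  shows "P (multi_order A + multi_order B) (\<lambda>j. wirtinger_deriv A B (F j))"
proof -
  have pow: "P (m + k) (\<lambda>j. (D ^^ m) (F j))" if "P k F" "\<And>k F. P k F \<Longrightarrow> P (Suc k) (\<lambda>j. D (F j))" for D m k F
    by (induction m) (use that in auto)
  have fold: "P (sum_list (map A xs) + k) (\<lambda>j. foldr (\<lambda>i. D i ^^ A i) xs (F j))"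
    if "P k F" "\<And>i k F. P k F \<Longrightarrow> P (Suc k) (\<lambda>j. D i (F j))" for D xs k F and A :: "'n \<Rightarrow> nat"
  proof (induction xs)
    case (Cons x xs)
    from pow[where m="A x" and D="D x", OF Cons that(2)] show ?case by (simp add: o_def add.assoc)
  qed (use that in simp)
  have sl: "sum_list (map A (sorted_list_of_set UNIV)) = multi_order A" for A :: "'n \<Rightarrow> nat"
    by (simp add: multi_order_def sum_list_distinct_conv_sum_set)
  have "P (sum_list (map A (sorted_list_of_set UNIV)) + (sum_list (map B (sorted_list_of_set UNIV)) + 0)) 
     (\<lambda>j. foldr (\<lambda>i. dz i ^^ A i) (sorted_list_of_set UNIV) (foldr (\<lambda>i. dzbar i ^^ B i) (sorted_list_of_set UNIV) (F j)))"
    by (intro fold z zb base)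
  then show ?thesis by (simp add: sl wirtinger_deriv_def)
qed

text \<open>A common form of both Wirtinger operators, so that each induction over derivatives has a
  single step.\<close>

definition dcomb :: "complex \<Rightarrow> complex \<Rightarrow> 'a::euclidean_space \<Rightarrow> 'a \<Rightarrow> ('a \<Rightarrow> complex) \<Rightarrow> 'a \<Rightarrow> complex" where
  "dcomb \<alpha> \<beta> b c f z = \<alpha> * partial_deriv b f z + \<beta> * partial_deriv c f z"

lemma dz_dcomb: "dz i = dcomb (1/2) (- \<i>/2) (axis i 1) (axis i \<i>)"
  by (intro ext) (simp add: dz_def dcomb_def field_simps)

lemma dzbar_dcomb: "dzbar i = dcomb (1/2) (\<i>/2) (axis i 1) (axis i \<i>)"
  by (intro ext) (simp add: dzbar_def dcomb_def field_simps)

lemma smooth_on_partial_deriv: "smooth_on S f \<Longrightarrow> b \<in> Basis \<Longrightarrow> smooth_on S (partial_deriv b f)"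
  unfolding smooth_on_def using Ck_on_partial_deriv by blast

lemma smooth_on_differentiable: "smooth_on S f \<Longrightarrow> x \<in> S \<Longrightarrow> f differentiable (at x)"
  unfolding smooth_on_def by (metis Ck_on_differentiable order_refl)

lemma smooth_on_comb:
  fixes f g :: "'a::euclidean_space \<Rightarrow> complex"
  assumes "open S" "smooth_on S f" "smooth_on S g"
  shows "smooth_on S (\<lambda>z. \<alpha> * f z + \<beta> * g z)"
  unfolding smooth_on_def
  by (intro allI Ck_on_add[OF assms(1)] Ck_on_bounded_linear_comp[OF bounded_linear_mult_right assms(1)])
    (use assms in \<open>auto simp: smooth_on_def\<close>)

lemma smooth_on_dcomb:
  assumes "open S" "smooth_on S f" "b \<in> Basis" "c \<in> Basis"
  shows "smooth_on S (dcomb \<alpha> \<beta> b c f)"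
  unfolding dcomb_def[abs_def] by (intro smooth_on_comb smooth_on_partial_deriv assms)

lemma smooth_on_partial_derivs: "smooth_on S f \<Longrightarrow> set bs \<subseteq> Basis \<Longrightarrow> smooth_on S (partial_derivs bs f)"
  by (induction bs) (auto intro: smooth_on_partial_deriv)

lemma partial_deriv_comb:
  fixes f g :: "'a::euclidean_space \<Rightarrow> complex"
  assumes "f differentiable (at x)" "g differentiable (at x)"
  shows "partial_deriv b (\<lambda>z. \<alpha> * f z + \<beta> * g z) x = \<alpha> * partial_deriv b f x + \<beta> * partial_deriv b g x"
proof -
  have "((\<lambda>z. \<alpha> * f z + \<beta> * g z) has_derivative (\<lambda>v. \<alpha> * frechet_derivative f (at x) v + \<beta> * frechet_derivative g (at x) v)) (at x)"
    using assms by (intro has_derivative_add has_derivative_mult_right) (simp_all add: frechet_derivative_works[symmetric])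
  then show ?thesis by (simp add: partial_deriv_def frechet_derivative_at[symmetric])
qed

lemma partial_derivs_comb:
  fixes f g :: "'a::euclidean_space \<Rightarrow> complex"
  assumes S: "open S" and f: "smooth_on S f" and g: "smooth_on S g"
  shows "set bs \<subseteq> Basis \<Longrightarrow> x \<in> S \<Longrightarrow> partial_derivs bs (\<lambda>z. \<alpha> * f z + \<beta> * g z) x = \<alpha> * partial_derivs bs f x + \<beta> * partial_derivs bs g x"
proof (induction bs arbitrary: x)
  case (Cons b bs)
  have "partial_deriv b (partial_derivs bs (\<lambda>z. \<alpha> * f z + \<beta> * g z)) x = partial_deriv b (\<lambda>x. \<alpha> * partial_derivs bs f x + \<beta> * partial_derivs bs g x) x"
    by (rule partial_deriv_cong[OF S Cons.prems(2)]) (use Cons in auto)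
  also have "\<dots> = \<alpha> * partial_deriv b (partial_derivs bs f) x + \<beta> * partial_deriv b (partial_derivs bs g) x"
    using Cons.prems by (intro partial_deriv_comb smooth_on_differentiable[OF smooth_on_partial_derivs[OF f]] smooth_on_differentiable[OF smooth_on_partial_derivs[OF g]]) auto
  finally show ?case by simp
qed simp

lemma partial_derivs_dcomb:
  assumes "open S" "smooth_on S f" "b \<in> Basis" "c \<in> Basis" "set bs \<subseteq> Basis" "x \<in> S"
  shows "partial_derivs bs (dcomb \<alpha> \<beta> b c f) x = \<alpha> * partial_derivs (bs @ [b]) f x + \<beta> * partial_derivs (bs @ [c]) f x"
  unfolding dcomb_def[abs_def] partial_derivs_snoc
  by (rule partial_derivs_comb[OF assms(1) smooth_on_partial_deriv smooth_on_partial_deriv]) (use assms in auto)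

text \<open>The family consists of the sequence and, at the index \<open>None\<close>, its limit.
  The invariant speaks of all real partial derivatives at \<open>a\<close>, since convergence of
  values alone is not inherited by derivatives.\<close>

lemma wirtinger_deriv_converges:
  fixes f :: "nat \<Rightarrow> (complex, 'n::{finite,linorder}) vec \<Rightarrow> complex"
  assumes S: "open S" "a \<in> S" and f: "\<And>n. smooth_on S (f n)" "smooth_on S h"
    and lim: "\<And>bs. set bs \<subseteq> Basis \<Longrightarrow> (\<lambda>n. partial_derivs bs (f n) a) \<longlonglongrightarrow> partial_derivs bs h a"
  shows "(\<lambda>n. wirtinger_deriv A B (f n) a) \<longlonglongrightarrow> wirtinger_deriv A B h a"
proof -
  define P :: "nat \<Rightarrow> (nat option \<Rightarrow> (complex, 'n) vec \<Rightarrow> complex) \<Rightarrow> bool" where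
    "P k F \<longleftrightarrow> (\<forall>j. smooth_on S (F j)) \<and> (\<forall>bs. set bs \<subseteq> Basis \<longrightarrow> (\<lambda>n. partial_derivs bs (F (Some n)) a) \<longlonglongrightarrow> partial_derivs bs (F None) a)" for k F
  have step: "P (Suc k) (\<lambda>j. dcomb \<alpha> \<beta> b c (F j))" if P: "P k F" and bc: "b \<in> Basis" "c \<in> Basis" for k F \<alpha> \<beta> b c
    unfolding P_def
  proof (intro conjI allI impI)
    show "smooth_on S (dcomb \<alpha> \<beta> b c (F j))" for j using P bc S by (intro smooth_on_dcomb) (auto simp: P_def)
    fix bs :: "((complex, 'n) vec) list" assume bs: "set bs \<subseteq> Basis"
    have e: "partial_derivs bs (dcomb \<alpha> \<beta> b c (F j)) a = \<alpha> * partial_derivs (bs @ [b]) (F j) a + \<beta> * partial_derivs (bs @ [c]) (F j) a" for j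
      using P bc S bs by (intro partial_derivs_dcomb) (auto simp: P_def)
    have "(\<lambda>n. partial_derivs (bs @ [b]) (F (Some n)) a) \<longlonglongrightarrow> partial_derivs (bs @ [b]) (F None) a"
      "(\<lambda>n. partial_derivs (bs @ [c]) (F (Some n)) a) \<longlonglongrightarrow> partial_derivs (bs @ [c]) (F None) a"
      using P bs bc by (auto simp: P_def simp del: partial_derivs_simps)
    then show "(\<lambda>n. partial_derivs bs (dcomb \<alpha> \<beta> b c (F (Some n))) a) \<longlonglongrightarrow> partial_derivs bs (dcomb \<alpha> \<beta> b c (F None)) a"
      unfolding e by (intro tendsto_intros)
  qed
  define F where "F j = (case j of None \<Rightarrow> h | Some n \<Rightarrow> f n)" for j
  have "P (multi_order A + multi_order B) (\<lambda>j. wirtinger_deriv A B (F j))"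
  proof (rule wirtinger_family_induct)
    show "P 0 F" unfolding P_def F_def using f lim by (auto split: option.split)
  qed (auto simp: dz_dcomb dzbar_dcomb intro!: step axis_in_Basis)
  then have "(\<lambda>n. partial_derivs [] (wirtinger_deriv A B (F (Some n))) a) \<longlonglongrightarrow> partial_derivs [] (wirtinger_deriv A B (F None)) a"
    unfolding P_def by (metis empty_set empty_subsetI)
  then show ?thesis by (simp add: F_def)
qed

text \<open>The family consists of \<open>f\<close> and \<open>g\<close>. By the chain rule each
  derivative of \<open>g\<close> picks up one factor \<open>r\<close>, so the counter of the
  induction becomes the exponent.\<close>

lemma wirtinger_deriv_affine:
  fixes f g :: "(complex, 'n::{finite,linorder}) vec \<Rightarrow> complex"
  assumes S: "open S" and f: "smooth_on S f" 
    and g: "\<And>x. c + r *\<^sub>R x \<in> S \<Longrightarrow> g x = \<kappa> * f (c + r *\<^sub>R x)" and x: "c + r *\<^sub>R x \<in> S"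
  shows "wirtinger_deriv A B g x = \<kappa> * complex_of_real r ^ (multi_order A + multi_order B) * wirtinger_deriv A B f (c + r *\<^sub>R x)"
proof -
  define T where "T = (\<lambda>x. c + r *\<^sub>R x) -` S"
  have T: "open T" unfolding T_def by (intro open_vimage S) (auto intro!: continuous_intros)
  define P :: "nat \<Rightarrow> (bool \<Rightarrow> (complex, 'n) vec \<Rightarrow> complex) \<Rightarrow> bool" where
    "P k F \<longleftrightarrow> smooth_on S (F True) \<and> (\<forall>x\<in>T. F False x = \<kappa> * complex_of_real r ^ k * F True (c + r *\<^sub>R x))" for k F
  have step: "P (Suc k) (\<lambda>j. dcomb \<alpha> \<beta> a b (F j))" if P: "P k F" and ab: "a \<in> Basis" "b \<in> Basis" for k F \<alpha> \<beta> a b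
    unfolding P_def
  proof (intro conjI ballI)
    have sm: "smooth_on S (F True)" using P by (simp add: P_def)
    show "smooth_on S (dcomb \<alpha> \<beta> a b (F True))" using sm ab S by (intro smooth_on_dcomb)
    fix x assume x: "x \<in> T"
    then have d: "F True differentiable (at (c + r *\<^sub>R x))" using smooth_on_differentiable[OF sm] by (simp add: T_def)
    have pd: "partial_deriv v (F False) x = \<kappa> * complex_of_real r ^ Suc k * partial_deriv v (F True) (c + r *\<^sub>R x)" for v
    proof -
      have "partial_deriv v (F False) x = partial_deriv v (\<lambda>x. (\<kappa> * complex_of_real r ^ k) * F True (c + r *\<^sub>R x)) x"
        by (rule partial_deriv_cong[OF T x]) (use P in \<open>auto simp: P_def\<close>)
      also have "\<dots> = (\<kappa> * complex_of_real r ^ k) * partial_deriv v (\<lambda>x. F True (c + r *\<^sub>R x)) x"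
        by (rule partial_deriv_bounded_linear_comp[OF bounded_linear_mult_right])
          (rule differentiable_compose[of "F True" "\<lambda>x. c + r *\<^sub>R x"], use d in \<open>auto intro!: derivative_intros\<close>)
      also have "partial_deriv v (\<lambda>x. F True (c + r *\<^sub>R x)) x = complex_of_real r * partial_deriv v (F True) (c + r *\<^sub>R x)"
        using partial_deriv_affine[OF d] by (simp add: scaleR_conv_of_real)
      finally show ?thesis by (simp add: mult_ac)
    qed
    show "dcomb \<alpha> \<beta> a b (F False) x = \<kappa> * complex_of_real r ^ Suc k * dcomb \<alpha> \<beta> a b (F True) (c + r *\<^sub>R x)"
      unfolding dcomb_def pd by (simp add: algebra_simps)
  qed
  define F where "F j = (if j then f else g)" for j
  have "P (multi_order A + multi_order B) (\<lambda>j. wirtinger_deriv A B (F j))"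
  proof (rule wirtinger_family_induct)
    show "P 0 F" unfolding P_def F_def T_def using f g by auto
  qed (auto simp: dz_dcomb dzbar_dcomb intro!: step axis_in_Basis)
  then show ?thesis using x unfolding P_def T_def F_def by simp
qed

section \<open>From real to complex values, and the half space in real terms\<close>

lemma smooth_on_of_real:
  fixes u :: "'a::euclidean_space \<Rightarrow> real"
  assumes "open S" "smooth_on S u"
  shows "smooth_on S (\<lambda>x. complex_of_real (u x))"
    and "set bs \<subseteq> Basis \<Longrightarrow> x \<in> S \<Longrightarrow> partial_derivs bs (\<lambda>x. complex_of_real (u x)) x = complex_of_real (partial_derivs bs u x)"
proof -
  show "smooth_on S (\<lambda>x. complex_of_real (u x))"
    unfolding smooth_on_def 
    by (intro allI Ck_on_bounded_linear_comp[OF bounded_linear_of_real assms(1)]) (use assms(2) in \<open>simp add: smooth_on_def\<close>)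
  show "partial_derivs bs (\<lambda>x. complex_of_real (u x)) x = complex_of_real (partial_derivs bs u x)" if "set bs \<subseteq> Basis" "x \<in> S"
    using that
  proof (induction bs arbitrary: x)
    case (Cons b bs)
    have "partial_deriv b (partial_derivs bs (\<lambda>x. complex_of_real (u x))) x = partial_deriv b (\<lambda>x. complex_of_real (partial_derivs bs u x)) x"
      by (rule partial_deriv_cong[OF assms(1) Cons.prems(2)]) (use Cons in auto)
    also have "\<dots> = complex_of_real (partial_deriv b (partial_derivs bs u) x)"
      using Cons.prems by (intro partial_deriv_bounded_linear_comp[OF bounded_linear_of_real] smooth_on_differentiable[OF smooth_on_partial_derivs[OF assms(2)]]) auto
    finally show ?case by simp
  qed simp
qed

text \<open>Since \<open>\<psi>\<close> is real, twice the real part of \<open>dz i\<close> times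
  \<open>w $ i\<close> is the Euclidean product of the real gradient and \<open>w\<close> in the
  plane of the coordinate \<open>i\<close>.\<close>

lemma half_space_at_eq:
  fixes \<psi> :: "complex ^ 'n::finite \<Rightarrow> real"
  assumes "\<psi> differentiable (at p)"
  shows "half_space_at \<psi> p = {w. (\<Sum>b\<in>Basis. partial_deriv b \<psi> p *\<^sub>R b) \<bullet> w < 1}"
proof -
  have pd: "partial_deriv b (\<lambda>z. complex_of_real (\<psi> z)) p = complex_of_real (partial_deriv b \<psi> p)" for b
    by (rule partial_deriv_bounded_linear_comp[OF bounded_linear_of_real assms])
  have ax: "axis i u \<bullet> w = u \<bullet> (w $ i)" for i u and w :: "complex ^ 'n"
    by (simp add: inner_axis')
  have "2 * Re (\<Sum>i\<in>UNIV. dz i (\<lambda>z. complex_of_real (\<psi> z)) p * w $ i) = (\<Sum>b\<in>Basis. partial_deriv b \<psi> p *\<^sub>R b) \<bullet> w" for w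
  proof -
    have "2 * Re (dz i (\<lambda>z. complex_of_real (\<psi> z)) p * w $ i) = partial_deriv (axis i 1) \<psi> p * Re (w $ i) + partial_deriv (axis i \<i>) \<psi> p * Im (w $ i)" for i
      unfolding dz_def pd by simp
    then show ?thesis
      by (simp add: sum_distrib_left inner_sum_left inner_add_left sum_Basis_vec_complex ax inner_complex_def)
  qed
  then show ?thesis by (simp add: half_space_at_def)
qed

section \<open>Uniform limits near the boundary point, and the scaling limit\<close>

lemma tendsto_uniform_limit_moving_point:
  fixes f :: "nat \<Rightarrow> 'a::euclidean_space \<Rightarrow> real"
  assumes u: "uniform_limit (cball p0 1) f g sequentially" and p: "p \<longlonglongrightarrow> p0" and g: "isCont g p0"
  shows "(\<lambda>n. f n (p n)) \<longlonglongrightarrow> g p0"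
proof (rule tendstoI)
  fix e :: real assume e: "0 < e"
  have "\<forall>\<^sub>F n in sequentially. \<forall>x\<in>cball p0 1. dist (f n x) (g x) < e / 2"
    using u half_gt_zero[OF e] unfolding uniform_limit_iff by blast
  moreover have "\<forall>\<^sub>F n in sequentially. dist (p n) p0 < 1" by (rule tendstoD[OF p]) simp
  moreover have "\<forall>\<^sub>F n in sequentially. dist (g (p n)) (g p0) < e / 2"
    by (rule tendstoD[OF isCont_tendsto_compose[OF g p]]) (use e in simp)
  ultimately show "\<forall>\<^sub>F n in sequentially. dist (f n (p n)) (g p0) < e"
  proof eventually_elim
    case (elim n)
    have "dist (f n (p n)) (g (p n)) < e / 2" using elim(1,2) by (simp add: dist_commute)
    then show ?case using elim(3) dist_triangle[of "f n (p n)" "g p0" "g (p n)"] by linarith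
  qed
qed

lemma uniform_limit_near_point:
  fixes f :: "nat \<Rightarrow> 'a::euclidean_space \<Rightarrow> real"
  assumes u: "uniform_limit (cball p0 1) f g sequentially" and g: "isCont g p0" and e: "0 < e"
  shows "\<exists>r>0. \<forall>\<^sub>F n in sequentially. \<forall>x\<in>cball p0 r. \<bar>f n x - g p0\<bar> \<le> e"
proof -
  have "\<forall>\<^sub>F x in at p0. dist (g x) (g p0) < e / 2" using g e unfolding isCont_def by (intro tendstoD) auto
  then obtain d where d: "0 < d" "\<And>x. x \<noteq> p0 \<Longrightarrow> dist x p0 < d \<Longrightarrow> dist (g x) (g p0) < e / 2"
    unfolding eventually_at by auto
  define r where "r = min 1 (d / 2)"
  have r: "0 < r" "r \<le> 1" "r < d" using d(1) by (auto simp: r_def)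
  have "\<forall>\<^sub>F n in sequentially. \<forall>x\<in>cball p0 1. dist (f n x) (g x) < e / 2"
    using u half_gt_zero[OF e] unfolding uniform_limit_iff by blast
  then have "\<forall>\<^sub>F n in sequentially. \<forall>x\<in>cball p0 r. \<bar>f n x - g p0\<bar> \<le> e"
  proof eventually_elim
    case (elim n)
    show ?case
    proof
      fix x assume x: "x \<in> cball p0 r"
      have "dist (f n x) (g x) < e / 2" using elim x r(2) by simp
      moreover have "dist (g x) (g p0) < e / 2"
        using d(2)[of x] x r(3) e by (cases "x = p0") (auto simp: dist_commute)
      ultimately show "\<bar>f n x - g p0\<bar> \<le> e" unfolding dist_real_def by linarith
    qed
  qed
  then show ?thesis using r(1) by blast
qed

theorem theorem1p2:
  fixes D :: "(complex ^ 'n::{finite,linorder}) set"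
    and \<psi> :: "(complex, 'n) vec \<Rightarrow> real"
    and D\<nu> :: "nat \<Rightarrow> (complex, 'n) vec set"
    and \<psi>\<nu> :: "nat \<Rightarrow> (complex, 'n) vec \<Rightarrow> real"
    and p :: "nat \<Rightarrow> (complex, 'n) vec"
    and p0 :: "(complex, 'n) vec"
    and A B :: "'n \<Rightarrow> nat"
  assumes "CARD('n) \<ge> 2"
    and "smoothly_bounded_domain D"
    and "smooth_defining_function D \<psi>"
    and "\<And>\<nu>. smoothly_bounded_domain (D\<nu> \<nu>)"
    and "\<And>\<nu>. smooth_defining_function (D\<nu> \<nu>) (\<psi>\<nu> \<nu>)"
    and "converges_smoothly \<psi>\<nu> \<psi>"
    and "\<And>\<nu>. p \<nu> \<in> D\<nu> \<nu>"
    and "p \<longlonglongrightarrow> p0"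
    and "p0 \<in> frontier D"
  shows "(\<lambda>\<nu>. (- 1) ^ (multi_order A + multi_order B)
           * wirtinger_deriv A B (\<lambda>z. complex_of_real (robin_function (D\<nu> \<nu>) z)) (p \<nu>)
           * complex_of_real (\<psi>\<nu> \<nu> (p \<nu>))
               ^ (2 * CARD('n) - 2 + multi_order A + multi_order B))
         \<longlonglongrightarrow> wirtinger_deriv A B
               (\<lambda>w. complex_of_real (robin_function (half_space_at \<psi> p0) w)) 0"
proof -
  let ?N = "real DIM((complex, 'n) vec)"
  have N: "3 \<le> DIM((complex, 'n) vec)" by (rule DIM_ge_3[OF assms(1)])
  have C\<psi>: "Ck_on k UNIV \<psi>" and C\<psi>\<nu>: "Ck_on k UNIV (\<psi>\<nu> \<nu>)" for k \<nu>
    using assms(3) assms(5)[of \<nu>] by (auto simp: smooth_defining_function_def smooth_on_def)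
  have dset: "D\<nu> \<nu> = {x. \<psi>\<nu> \<nu> x < 0}" "frontier (D\<nu> \<nu>) = {x. \<psi>\<nu> \<nu> x = 0}" for \<nu>
    using assms(5)[of \<nu>] by (auto simp: smooth_defining_function_def)
  have gd: "green_domain (D\<nu> \<nu>)" for \<nu> by (rule green_domain_smoothly_bounded[OF assms(4,5)])
  have ul: "uniform_limit (cball p0 1) (\<lambda>\<nu>. partial_derivs bs (\<psi>\<nu> \<nu>)) (partial_derivs bs \<psi>) sequentially" if "set bs \<subseteq> Basis" for bs
    by (rule assms(6)[unfolded converges_smoothly_def, rule_format, OF compact_cball that])
  have cont\<psi>: "isCont (partial_derivs bs \<psi>) x" if "set bs \<subseteq> Basis" for bs x
    using C\<psi>[of "length bs"] that unfolding Ck_on_def by (simp add: continuous_on_eq_continuous_at)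
  define g where "g = (\<Sum>b\<in>Basis. partial_deriv b \<psi> p0 *\<^sub>R b)"
  have gb: "g \<bullet> b = partial_deriv b \<psi> p0" if "b \<in> Basis" for b unfolding g_def using that by simp
  have "\<exists>b\<in>Basis. partial_deriv b \<psi> p0 \<noteq> 0" using assms(3,9) by (simp add: smooth_defining_function_def)
  then have g: "g \<noteq> 0" using gb by (metis inner_zero_left)
  have H: "half_space_at \<psi> p0 = {w. g \<bullet> w < 1}"
    unfolding g_def by (rule half_space_at_eq[OF Ck_on_differentiable[OF C\<psi>[of 1]]]) auto
  define t where "t \<nu> = - \<psi>\<nu> \<nu> (p \<nu>)" for \<nu>
  have t0: "0 < t \<nu>" for \<nu> using assms(7)[of \<nu>] dset(1)[of \<nu>] by (simp add: t_def)
  have "(\<lambda>\<nu>. \<psi>\<nu> \<nu> (p \<nu>)) \<longlonglongrightarrow> \<psi> p0"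
    by (rule tendsto_uniform_limit_moving_point[OF _ assms(8)]) (use ul[of "[]"] cont\<psi>[of "[]"] in auto)
  moreover have "\<psi> p0 = 0"
  proof -
    have "frontier D = {x. \<psi> x = 0}" using assms(3) unfolding smooth_defining_function_def by blast
    then show ?thesis using assms(9) by blast
  qed
  ultimately have "(\<lambda>\<nu>. - \<psi>\<nu> \<nu> (p \<nu>)) \<longlonglongrightarrow> - 0" by (intro tendsto_minus) simp
  then have tl: "t \<longlonglongrightarrow> 0" by (simp add: t_def[abs_def])
  have grad: "\<exists>r>0. \<forall>\<^sub>F \<nu> in sequentially. \<forall>x\<in>cball p0 r. \<bar>partial_deriv b (\<psi>\<nu> \<nu>) x - g \<bullet> b\<bar> \<le> e" if "b \<in> Basis" "0 < e" for b e
    unfolding gb[OF that(1)] by (rule uniform_limit_near_point[OF _ _ that(2)]) (use ul[of "[b]"] cont\<psi>[of "[b]"] that in auto)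
  have blow: "\<forall>\<^sub>F \<nu> in sequentially. \<forall>y. norm y \<le> R \<longrightarrow> \<bar>\<psi>\<nu> \<nu> (p \<nu> + t \<nu> *\<^sub>R y) / t \<nu> - (g \<bullet> y - 1)\<bar> \<le> \<delta>"
    if "0 < R" "0 < \<delta>" for R \<delta>
    by (rule blow_up_defining_functions[OF _ grad t_def t0 tl assms(8) that]) (use Ck_on_differentiable[OF C\<psi>\<nu>[of 1]] in auto)
  \<comment> \<open>With this choice \<open>|g \<bullet> y|\<close> is at most 1/4 on the ball of
    radius \<open>2 * \<rho>\<close>, which keeps the ball inside the half space and meets the
    condition of \<open>rescaled_regular_part_estimate\<close>.\<close>
  define \<rho> where "\<rho> = 1 / (8 * norm g)"
  have \<rho>: "0 < \<rho>" "0 < 2 * \<rho>" "(2 * \<rho>) * norm g \<le> 1/4" using g by (auto simp: \<rho>_def)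
  let ?B = "cball (0 :: (complex, 'n) vec) (2 * \<rho>)"
  have gB: "g \<bullet> y < 1" if "y \<in> ?B" for y
  proof -
    have "g \<bullet> y \<le> norm g * norm y" by (rule norm_cauchy_schwarz)
    also have "\<dots> \<le> norm g * (2 * \<rho>)" using that by (intro mult_left_mono) auto
    also have "\<dots> = (2 * \<rho>) * norm g" by (rule mult.commute)
    also have "\<dots> < 1" using \<rho>(3) by linarith
    finally show ?thesis .
  qed
  define H0 where "H0 z w = - newton (z - halfspace_reflection g w)" for z w
  define good where "good \<nu> \<longleftrightarrow> (\<forall>y\<in>?B. p \<nu> + t \<nu> *\<^sub>R y \<in> D\<nu> \<nu>)" for \<nu>
  \<comment> \<open>Where the rescaled ball is not contained in the domain, the limit function is
    substituted, so that separate harmonicity holds for every index; by \<open>est\<close> this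
    default is eventually not taken.\<close>
  define H\<nu> where "H\<nu> \<nu> = (if good \<nu> then rescaled_regular_part (D\<nu> \<nu>) (p \<nu>) (t \<nu>) else H0)" for \<nu>
  have est: "\<forall>\<^sub>F \<nu> in sequentially. good \<nu> \<and> (\<forall>z\<in>?B. \<forall>w\<in>?B. \<bar>rescaled_regular_part (D\<nu> \<nu>) (p \<nu>) (t \<nu>) z w - H0 z w\<bar> \<le> e)" if e: "0 < e" for e
  proof -
    obtain R \<delta> where R: "0 < R" "0 < \<delta>" and est: "\<And>\<Omega> \<psi> c t. green_domain \<Omega> \<Longrightarrow> \<Omega> = {x. \<psi> x < 0} \<Longrightarrow> frontier \<Omega> = {x. \<psi> x = 0} \<Longrightarrow> 0 < t \<Longrightarrow>
       (\<forall>y. norm y \<le> R \<longrightarrow> \<bar>\<psi> (c + t *\<^sub>R y) / t - (g \<bullet> y - 1)\<bar> \<le> \<delta>) \<Longrightarrow>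
       (\<forall>y\<in>?B. c + t *\<^sub>R y \<in> \<Omega>) \<and>
       (\<forall>z\<in>?B. \<forall>w\<in>?B. \<bar>rescaled_regular_part \<Omega> c t z w + newton (z - halfspace_reflection g w)\<bar> \<le> e)"
      using rescaled_regular_part_estimate[OF N g \<rho>(2,3) e] by metis
    show ?thesis using blow[OF R]
    proof eventually_elim
      case (elim \<nu>)
      show ?case using est[OF gd dset t0 elim] by (simp add: good_def H0_def)
    qed
  qed
  have bh0: "biharmonic_on ?B H0" unfolding H0_def by (rule biharmonic_halfspace[OF g gB])
  have bh: "biharmonic_on ?B (H\<nu> \<nu>)" for \<nu>
  proof (cases "good \<nu>")
    case True
    then have "biharmonic_on ?B (rescaled_regular_part (D\<nu> \<nu>) (p \<nu>) (t \<nu>))"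
      by (intro biharmonic_rescaled_regular_part[OF N gd t0]) (auto simp: good_def)
    then show ?thesis using True by (simp add: H\<nu>_def)
  qed (simp add: H\<nu>_def bh0)
  have Hlim: "\<forall>\<^sub>F \<nu> in sequentially. \<forall>z\<in>?B. \<forall>w\<in>?B. \<bar>H\<nu> \<nu> z w - H0 z w\<bar> < e" if "0 < e" for e
    using est[OF half_gt_zero[OF that]]
  proof eventually_elim
    case (elim \<nu>)
    then show ?case using that unfolding H\<nu>_def by fastforce
  qed
  let ?L = "\<lambda>\<nu> x. H\<nu> \<nu> x x" and ?K = "\<lambda>x. H0 x x" and ?S = "ball (0 :: (complex, 'n) vec) \<rho>"
  have sm: "smooth_on ?S (?L \<nu>)" "smooth_on ?S ?K" for \<nu>
    unfolding smooth_on_def using diag_Ck_on(1)[OF \<rho>(1) bh] diag_Ck_on(1)[OF \<rho>(1) bh0] by blast+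
  have 0: "0 \<in> ?S" using \<rho>(1) by simp
  have main: "(\<lambda>\<nu>. wirtinger_deriv A B (\<lambda>x. complex_of_real (?L \<nu> x)) 0) \<longlonglongrightarrow> wirtinger_deriv A B (\<lambda>x. complex_of_real (?K x)) 0"
  proof (rule wirtinger_deriv_converges[OF open_ball 0])
    show "smooth_on ?S (\<lambda>x. complex_of_real (?L \<nu> x))" "smooth_on ?S (\<lambda>x. complex_of_real (?K x))" for \<nu>
      by (intro smooth_on_of_real(1) sm open_ball)+
    fix bs :: "(complex, 'n) vec list" assume bs: "set bs \<subseteq> Basis"
    have "(\<lambda>\<nu>. partial_derivs bs (?L \<nu>) 0) \<longlonglongrightarrow> partial_derivs bs ?K 0"
      by (rule diag_derivs_converge[OF \<rho>(1) bh0 bh Hlim])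
    then show "(\<lambda>\<nu>. partial_derivs bs (\<lambda>x. complex_of_real (?L \<nu> x)) 0) \<longlonglongrightarrow> partial_derivs bs (\<lambda>x. complex_of_real (?K x)) 0"
      unfolding smooth_on_of_real(2)[OF open_ball sm(1) bs 0] smooth_on_of_real(2)[OF open_ball sm(2) bs 0] by (rule tendsto_of_real)
  qed
  \<comment> \<open>The two functions agree only near \<open>0\<close>. The affine rule with the
    identity map is used for its locality: it compares derivatives on an open set.\<close>
  have limit: "wirtinger_deriv A B (\<lambda>w. complex_of_real (robin_function (half_space_at \<psi> p0) w)) 0 = wirtinger_deriv A B (\<lambda>x. complex_of_real (?K x)) 0"
  proof -
    have "complex_of_real (robin_function (half_space_at \<psi> p0) x) = 1 * complex_of_real (?K (0 + 1 *\<^sub>R x))" if "0 + 1 *\<^sub>R x \<in> ?S" for x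
    proof -
      have "x \<in> ?B" using that \<rho>(1) by simp
      from robin_function_halfspace[OF assms(1) g gB[OF this]] show ?thesis by (simp add: H H0_def)
    qed
    from wirtinger_deriv_affine[OF open_ball smooth_on_of_real(1)[OF open_ball sm(2)] this, of 0 A B] show ?thesis
      using \<rho>(1) by simp
  qed
  let ?m = "multi_order A + multi_order B"
  have scaled: "(- 1) ^ ?m * wirtinger_deriv A B (\<lambda>z. complex_of_real (robin_function (D\<nu> \<nu>) z)) (p \<nu>)
           * complex_of_real (\<psi>\<nu> \<nu> (p \<nu>)) ^ (2 * CARD('n) - 2 + multi_order A + multi_order B)
      = wirtinger_deriv A B (\<lambda>x. complex_of_real (?L \<nu> x)) 0" if good: "good \<nu>" for \<nu>
  proof -
    \<comment> \<open>The chain rule is applied to the inverse of the blow-up, from the domain to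
      the rescaled ball, so each derivative contributes a factor \<open>1 / ?t\<close>.\<close>
    let ?t = "t \<nu>" let ?c = "- (1 / ?t) *\<^sub>R p \<nu>"
    note t = t0[of \<nu>]
    have rb: "complex_of_real (robin_function (D\<nu> \<nu>) x) = complex_of_real (?t powr (2 - ?N)) * complex_of_real (?L \<nu> (?c + (1 / ?t) *\<^sub>R x))"
      if x: "?c + (1 / ?t) *\<^sub>R x \<in> ?S" for x
    proof -
      define y where "y = ?c + (1 / ?t) *\<^sub>R x"
      have xy: "p \<nu> + ?t *\<^sub>R y = x" unfolding y_def using t by (simp add: scaleR_diff_right)
      have "ball (0 :: (complex, 'n) vec) \<rho> \<subseteq> ?B" using \<rho>(1) by auto
      then have "y \<in> ?B" using x unfolding y_def by blast
      then have xD: "x \<in> D\<nu> \<nu>" using good xy unfolding good_def by metis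
      have "?L \<nu> y = ?t powr (?N - 2) * regular_part (D\<nu> \<nu>) x x"
        unfolding H\<nu>_def rescaled_regular_part_def using good by (simp add: xy)
      moreover have "?t powr (2 - ?N) * ?t powr (?N - 2) = 1" using t by (simp add: powr_add[symmetric])
      ultimately have "regular_part (D\<nu> \<nu>) x x = ?t powr (2 - ?N) * ?L \<nu> y" by (simp add: mult.assoc[symmetric])
      then show ?thesis unfolding y_def[symmetric] using robin_function_regular_part[OF assms(1) gd xD] by simp
    qed
    have c0: "?c + (1 / ?t) *\<^sub>R p \<nu> = 0" by simp
    have W: "wirtinger_deriv A B (\<lambda>z. complex_of_real (robin_function (D\<nu> \<nu>) z)) (p \<nu>)
       = complex_of_real (?t powr (2 - ?N)) * complex_of_real (1 / ?t) ^ ?m * wirtinger_deriv A B (\<lambda>x. complex_of_real (?L \<nu> x)) 0"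
    proof -
      have "?c + (1 / ?t) *\<^sub>R p \<nu> \<in> ?S" unfolding c0 by (rule 0)
      from wirtinger_deriv_affine[where g="\<lambda>z. complex_of_real (robin_function (D\<nu> \<nu>) z)", 
          OF open_ball smooth_on_of_real(1)[OF open_ball sm(1)] rb this]
      show ?thesis unfolding c0 .
    qed
    \<comment> \<open>Since \<open>M\<close> is even, the sign of the base \<open>- ?t\<close>
      contributes \<open>(- 1) ^ ?m\<close> alone, which cancels the sign in front; the powers of
      \<open>?t\<close> cancel against those from the scaling.\<close>
    define M where "M = 2 * CARD('n) - 2"
    have evM: "even M" by (simp add: M_def)
    have NM: "2 - ?N = - real M" using assms(1) by (simp add: M_def of_nat_diff mult.commute)
    have tp: "?t powr (2 - ?N) = 1 / ?t ^ M" unfolding NM using t by (simp add: powr_minus powr_realpow field_simps)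
    have "(- 1 :: real) ^ ?m * (?t powr (2 - ?N) * (1 / ?t) ^ ?m) * (- ?t) ^ (M + ?m) = 1"
    proof -
      have "(- ?t) ^ (M + ?m) = (- 1) ^ ?m * ?t ^ (M + ?m)"
        using evM power_mult_distrib[of "-1" ?t "M + ?m"] by (simp add: power_add)
      moreover have "(- 1 :: real) ^ ?m * (- 1) ^ ?m = 1" by (simp flip: power_mult_distrib)
      moreover have "(1 / ?t ^ M * (1 / ?t) ^ ?m) * ?t ^ (M + ?m) = 1" using t by (simp add: power_add power_one_over)
      moreover have "s * a * (s * b) = (s * s) * (a * b)" for s a b :: real by simp
      ultimately show ?thesis unfolding tp by (simp only: mult_1)
    qed
    then have "complex_of_real ((- 1) ^ ?m * (?t powr (2 - ?N) * (1 / ?t) ^ ?m) * (- ?t) ^ (M + ?m)) = 1" by (simp only: of_real_1)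
    then have one: "(- 1) ^ ?m * (complex_of_real (?t powr (2 - ?N)) * complex_of_real (1 / ?t) ^ ?m) * complex_of_real (- ?t) ^ (M + ?m) = 1"
      by (simp only: of_real_mult of_real_power of_real_minus of_real_1)
    have "\<psi>\<nu> \<nu> (p \<nu>) = - ?t" by (simp add: t_def)
    then have "(- 1) ^ ?m * wirtinger_deriv A B (\<lambda>z. complex_of_real (robin_function (D\<nu> \<nu>) z)) (p \<nu>)
           * complex_of_real (\<psi>\<nu> \<nu> (p \<nu>)) ^ (2 * CARD('n) - 2 + multi_order A + multi_order B)
       = ((- 1) ^ ?m * (complex_of_real (?t powr (2 - ?N)) * complex_of_real (1 / ?t) ^ ?m) * complex_of_real (- ?t) ^ (M + ?m)) 
          * wirtinger_deriv A B (\<lambda>x. complex_of_real (?L \<nu> x)) 0"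
      unfolding W M_def by (simp only: mult_ac add.assoc)
    then show ?thesis unfolding one by simp
  qed
  have "\<forall>\<^sub>F \<nu> in sequentially. good \<nu>" using est[OF zero_less_one] by eventually_elim simp
  then have "\<forall>\<^sub>F \<nu> in sequentially. wirtinger_deriv A B (\<lambda>x. complex_of_real (?L \<nu> x)) 0 
     = (- 1) ^ ?m * wirtinger_deriv A B (\<lambda>z. complex_of_real (robin_function (D\<nu> \<nu>) z)) (p \<nu>)
           * complex_of_real (\<psi>\<nu> \<nu> (p \<nu>)) ^ (2 * CARD('n) - 2 + multi_order A + multi_order B)"
    by eventually_elim (rule scaled[symmetric])
  with main show ?thesis unfolding limit by (rule Lim_transform_eventually)
qed

end
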